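(* Let $n\in(0,2)$ and $0<r_1<r_2$. For any measurable function $R:\mathbb{R}^+\to[r_1,r_2]$, $$\overline{\Sigma}\big(\mathcal{L}^{(R)}\big)\le\sup_{\mathfrak{c}\in(0,\infty)}\overline{\Sigma}\big(\mathcal{L}_{\mathfrak{c}}\big).$$ Moreover, the supremum is attained as a maximum at a value $\mathfrak{c}>0$ with the following property: the unique radial inflection point over $(0,\infty)$ of the eigenfunction $\phi_{\mathfrak{c}}$ of $\mathcal{L}_{\mathfrak{c}}$ corresponding to the eigenvalue $\overline{\Sigma}(\mathcal{L}_{\mathfrak{c}})$ occurs at the value $\mathfrak{c}$.
   Context: Convention: $\mathbb{R}^+=(0,\infty)$. $\Delta_n:=\frac{n-1}{x}\frac{d}{dx}+\frac{d^2}{dx^2}$. For a Borel measurable $R:\mathbb{R}^+\to[r_1,r_2]$ let $w(x):=\frac{x^{n-1}}{R(x)}e^{\int_0^x\frac{v}{R(v)}dv}$, let $L^2(\mathbb{R}^+,w(x)dx)$ be the weighted Hilbert space with norm $\|\cdot\|_{2,R}$, and let $$\mathbf{D}=\Big\{f\in L^2(\mathbb{R}^+,w(x)dx)\ \Big|\ \|\Delta_nf\|_{2,R}<\infty\ \text{ and }\ \lim_{x\searrow0}x^{n-1}\tfrac{df}{dx}(x)=0\Big\}$$ (where $f$ and $f'$ are locally absolutely continuous on $(0,\infty)$). The operator $\mathcal{L}^{(R)}:=x\frac{d}{dx}+R(x)\Delta_n$ with domain $\mathbf{D}$ is self-adjoint in $L^2(\mathbb{R}^+,w(x)dx)$ with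 compact resolvent and strictly negative eigenvalues; $\overline{\Sigma}(\mathcal{L}^{(R)})$ denotes the maximum element of its spectrum. For $\mathfrak{c}>0$, $\ell_{\mathfrak{c}}(x):=r_1$ for $x\le\mathfrak{c}$ and $\ell_{\mathfrak{c}}(x):=r_2$ for $x>\mathfrak{c}$, and $\mathcal{L}_{\mathfrak{c}}:=\mathcal{L}^{(\ell_{\mathfrak{c}})}$ (with the weight and domain corresponding to $R=\ell_{\mathfrak{c}}$). A radial inflection point of $f:\mathbb{R}^+\to\mathbb{R}$ is a point at which $\Delta_nf$ changes sign. The eigenvalue $\overline{\Sigma}(\mathcal{L}^{(R)})$ is non-degenerate, and its eigenfunction can be chosen strictly positive; it has exactly one radial inflection point in $(0,\infty)$. *)

theory Defs
  imports "HOL-Analysis.Analysis"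
begin

text \<open>Functions on the half-line \<open>(0,\<infinity>)\<close> are represented by total functions on the reals; only their
  values at positive arguments matter. Elements of \<open>L\<^sup>2\<close> are represented by functions, and equality in
  \<open>L\<^sup>2\<close> is almost everywhere equality.\<close>

definition L2_space :: "'a measure \<Rightarrow> ('a \<Rightarrow> real) set" where
  "L2_space M = {f \<in> borel_measurable M. integrable M (\<lambda>x. (f x)\<^sup>2)}"

definition L2_norm :: "'a measure \<Rightarrow> ('a \<Rightarrow> real) \<Rightarrow> real" where
  "L2_norm M f = sqrt (\<integral>x. (f x)\<^sup>2 \<partial>M)"

text \<open>\<open>s\<close> is in the resolvent set of the (unbounded) operator \<open>T\<close> on \<open>L\<^sup>2(M)\<close> with domain \<open>D\<close> if
  \<open>s - T\<close> is injective and surjective from \<open>D\<close> to \<open>L\<^sup>2(M)\<close> with bounded inverse. The space is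
  real, so the spectrum consists of real numbers; for a self-adjoint operator it agrees with the
  spectrum of the complexification.\<close>

definition resolvent_set ::
    "'a measure \<Rightarrow> ('a \<Rightarrow> real) set \<Rightarrow> (('a \<Rightarrow> real) \<Rightarrow> ('a \<Rightarrow> real)) \<Rightarrow> real set" where
  "resolvent_set M D T =
    {s. (\<forall>f\<in>D. \<forall>h\<in>D. (AE x in M. s * f x - T f x = s * h x - T h x) \<longrightarrow> (AE x in M. f x = h x)) \<and>
        (\<forall>g\<in>L2_space M. \<exists>f\<in>D. AE x in M. s * f x - T f x = g x) \<and>
        (\<exists>C. \<forall>f\<in>D. L2_norm M f \<le> C * L2_norm M (\<lambda>x. s * f x - T f x))}"

definition spectrum ::
    "'a measure \<Rightarrow> ('a \<Rightarrow> real) set \<Rightarrow> (('a \<Rightarrow> real) \<Rightarrow> ('a \<Rightarrow> real)) \<Rightarrow> real set" where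
  "spectrum M D T = - resolvent_set M D T"

text \<open>The usual \<open>\<epsilon>\<close>-\<open>\<delta>\<close> definition; \<open>d\<close> ranges over the finite families of non-overlapping compact
  subintervals of \<open>S\<close>, and \<open>Inf k\<close>, \<open>Sup k\<close> are the endpoints of the interval \<open>k\<close>.\<close>

definition abs_continuous_on :: "real set \<Rightarrow> (real \<Rightarrow> real) \<Rightarrow> bool" where
  "abs_continuous_on S f \<longleftrightarrow>
    (\<forall>\<epsilon>>0. \<exists>\<delta>>0. \<forall>d t. d division_of t \<and> t \<subseteq> S \<and> (\<Sum>k\<in>d. Sup k - Inf k) < \<delta> \<longrightarrow>
       (\<Sum>k\<in>d. \<bar>f (Sup k) - f (Inf k)\<bar>) < \<epsilon>)"

definition locally_abs_continuous :: "(real \<Rightarrow> real) \<Rightarrow> bool" where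
  "locally_abs_continuous f \<longleftrightarrow> (\<forall>a b. 0 < a \<and> a \<le> b \<longrightarrow> abs_continuous_on {a..b} f)"

text \<open>For \<open>f'\<close> locally absolutely continuous, \<open>f''\<close> exists almost everywhere; on the exceptional null
  set \<^const>\<open>deriv\<close> takes a meaningless value. Accordingly all notions built on \<open>radial_Laplacian\<close>
  below are insensitive to null sets.\<close>

definition radial_Laplacian :: "real \<Rightarrow> (real \<Rightarrow> real) \<Rightarrow> real \<Rightarrow> real" where
  "radial_Laplacian n f x = (n - 1) / x * deriv f x + deriv (deriv f) x"

definition weight :: "real \<Rightarrow> (real \<Rightarrow> real) \<Rightarrow> real \<Rightarrow> real" where
  "weight n R x = x powr (n - 1) / R x * exp (LBINT v=0..x. v / R v)"

definition weighted_measure :: "real \<Rightarrow> (real \<Rightarrow> real) \<Rightarrow> real measure" where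
  "weighted_measure n R = density (lebesgue_on {0<..}) (\<lambda>x. ennreal (weight n R x))"

definition op_domain :: "real \<Rightarrow> (real \<Rightarrow> real) \<Rightarrow> (real \<Rightarrow> real) set" where
  "op_domain n R =
    {f \<in> L2_space (weighted_measure n R).
       locally_abs_continuous f \<and>
       (\<forall>x>0. f differentiable (at x)) \<and> locally_abs_continuous (deriv f) \<and>
       radial_Laplacian n f \<in> L2_space (weighted_measure n R) \<and>
       ((\<lambda>x. x powr (n - 1) * deriv f x) \<longlongrightarrow> 0) (at_right 0)}"

definition L_op :: "real \<Rightarrow> (real \<Rightarrow> real) \<Rightarrow> (real \<Rightarrow> real) \<Rightarrow> real \<Rightarrow> real" where
  "L_op n R f x = x * deriv f x + R x * radial_Laplacian n f x"

definition max_spectrum :: "real \<Rightarrow> (real \<Rightarrow> real) \<Rightarrow> real" where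
  "max_spectrum n R =
    (GREATEST s. s \<in> spectrum (weighted_measure n R) (op_domain n R) (L_op n R))"

definition is_eigenfunction :: "real \<Rightarrow> (real \<Rightarrow> real) \<Rightarrow> real \<Rightarrow> (real \<Rightarrow> real) \<Rightarrow> bool" where
  "is_eigenfunction n R s f \<longleftrightarrow>
    f \<in> op_domain n R \<and> \<not> (AE x in weighted_measure n R. f x = 0) \<and>
    (AE x in weighted_measure n R. L_op n R f x = s * f x)"

definition step_fun :: "real \<Rightarrow> real \<Rightarrow> real \<Rightarrow> real \<Rightarrow> real" where
  "step_fun r\<^sub>1 r\<^sub>2 c x = (if x \<le> c then r\<^sub>1 else r\<^sub>2)"

text \<open>Strictly negative on one side and strictly positive on the other; almost everywhere, because
  the functions of interest are only defined up to null sets.\<close>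

definition changes_sign_at :: "(real \<Rightarrow> real) \<Rightarrow> real \<Rightarrow> bool" where
  "changes_sign_at h p \<longleftrightarrow>
    (\<exists>\<epsilon>>0. (AE x in lebesgue. (p - \<epsilon> < x \<and> x < p \<longrightarrow> h x < 0) \<and> (p < x \<and> x < p + \<epsilon> \<longrightarrow> h x > 0)) \<or>
           (AE x in lebesgue. (p - \<epsilon> < x \<and> x < p \<longrightarrow> h x > 0) \<and> (p < x \<and> x < p + \<epsilon> \<longrightarrow> h x < 0)))"

definition radial_inflection_points :: "real \<Rightarrow> (real \<Rightarrow> real) \<Rightarrow> real set" where
  "radial_inflection_points n f = {p. 0 < p \<and> changes_sign_at (radial_Laplacian n f) p}"

end

(*
  Write the operator in divergence form, L f = (P f')' / w with w = P / R.  The solution y_s of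
  L y = s y with y(0) = 1 and zero flux at 0 is a power series in s that depends continuously on
  R.  The top of the spectrum is -mu for the largest mu such that y_(-mu) has no zero: this ground
  state is square integrable, for s > -mu the function y_s is not, and Picone's identity
  with the ground state bounds the inverse of s - L by 1 / (s + mu).

  For a ground state phi put F = x phi' + mu phi, which is -R times the radial Laplacian.  Since
  (e^E F)' = (2 - n + mu) e^E phi' < 0 (here n < 2 enters), F changes sign exactly once, at some
  p.  The step function at p switches where F does, so it can only raise the top of the spectrum;
  comparing Wronskians, equality forces the two ground states to coincide.  Finally, take steps
  c_k along which the eigenvalues approach their supremum.  A subsequence of the step functions
  converges pointwise to some R whose ground state attains the supremum, and the comparison for
  this R yields the optimal step together with the position of its inflection point; the limit
  R need not be a step function with c in (0, infinity) itself.
*)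

theory Submission
  imports Defs
begin

section \<open>Absolutely continuous functions on the line\<close>

text \<open>\<open>R\<close> is merely measurable, so solutions have second derivatives only almost
  everywhere and the operator domain is phrased with absolute continuity. Hence the fundamental
  theorem for absolutely continuous functions and their differentiability almost everywhere come at
  the outset, and later calculus runs through pairs \<open>ac_deriv f g\<close>. The obstacle to
  limits in \<open>R\<close> is loss of mass at infinity. The estimates used for limits therefore
  depend on \<open>R\<close> only through \<open>r1\<close>, \<open>r2\<close> and \<open>n\<close>:
  pointwise convergence of the coefficients then suffices for dominated convergence, and an energy
  identity bounds the mass of a positive solution up to its first zero, wherever that zero lies.
  This makes \<open>ground\<close> a condition that survives limits; it serves both for the
  existence of a ground state and for the extremal \<open>R\<close>. The comparison is decided at
  infinity: a positive Wronskian would drive the quotient of the two ground states below 0, because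
  finite mass of one of them makes the integral of 1 / (P y^2) diverge.\<close>

lemma division_interval_cases:
  assumes "d division_of t" "k \<in> d"
  obtains u v :: real where "k = {u..v}" "u \<le> v" "Inf k = u" "Sup k = v" "k \<subseteq> t"
proof -
  obtain u v where "k = cbox u v" using division_ofD(4)[OF assms] by blast
  moreover have "k \<noteq> {}" "k \<subseteq> t" using division_ofD(2,3)[OF assms] by auto
  ultimately show ?thesis using that[of u v] by auto
qed

lemma abs_continuous_onE:
  assumes "abs_continuous_on S f" "0 < e"
  obtains \<delta> where "\<delta> > 0" "\<And>d t. d division_of t \<Longrightarrow> t \<subseteq> S \<Longrightarrow>
    (\<Sum>k\<in>d. Sup k - Inf k) < \<delta> \<Longrightarrow> (\<Sum>k\<in>d. \<bar>f (Sup k) - f (Inf k)\<bar>) < e"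
  using assms unfolding abs_continuous_on_def by meson

text \<open>The increments of \<open>h\<close> over a division are summed termwise against those of
  \<open>f\<close> and \<open>g\<close>. Lipschitz functions, sums, products, compositions and
  changes outside the half-line all reduce to this one comparison.\<close>

lemma abs_continuous_on_dominated:
  assumes f: "abs_continuous_on S f" and g: "abs_continuous_on S g" and "0 \<le> C"
    and dom: "\<And>u v. u \<in> S \<Longrightarrow> v \<in> S \<Longrightarrow> \<bar>h v - h u\<bar> \<le> C * (\<bar>f v - f u\<bar> + \<bar>g v - g u\<bar>)"
  shows "abs_continuous_on S h"
  unfolding abs_continuous_on_def
proof (intro allI impI)
  fix e :: real assume "0 < e"
  \<comment> \<open>Dividing by \<open>C + 1\<close> rather than by \<open>C\<close> covers
    \<open>C = 0\<close> and makes the final estimate strict.\<close>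
  define e' where "e' = e / (2 * (C + 1))"
  have "0 < e'" using \<open>0 < e\<close> \<open>0 \<le> C\<close> by (simp add: e'_def)
  obtain d1 where d1: "d1 > 0" "\<And>d t. d division_of t \<Longrightarrow> t \<subseteq> S \<Longrightarrow> (\<Sum>k\<in>d. Sup k - Inf k) < d1
      \<Longrightarrow> (\<Sum>k\<in>d. \<bar>f (Sup k) - f (Inf k)\<bar>) < e'"
    using abs_continuous_onE[OF f \<open>0 < e'\<close>] by blast
  obtain d2 where d2: "d2 > 0" "\<And>d t. d division_of t \<Longrightarrow> t \<subseteq> S \<Longrightarrow> (\<Sum>k\<in>d. Sup k - Inf k) < d2
      \<Longrightarrow> (\<Sum>k\<in>d. \<bar>g (Sup k) - g (Inf k)\<bar>) < e'"
    using abs_continuous_onE[OF g \<open>0 < e'\<close>] by blast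
  show "\<exists>\<delta>>0. \<forall>d t. d division_of t \<and> t \<subseteq> S \<and> (\<Sum>k\<in>d. Sup k - Inf k) < \<delta> \<longrightarrow>
       (\<Sum>k\<in>d. \<bar>h (Sup k) - h (Inf k)\<bar>) < e"
  proof (intro exI[of _ "min d1 d2"] conjI allI impI)
    fix d t assume *: "d division_of t \<and> t \<subseteq> S \<and> (\<Sum>k\<in>d. Sup k - Inf k) < min d1 d2"
    have "(\<Sum>k\<in>d. \<bar>h (Sup k) - h (Inf k)\<bar>)
        \<le> (\<Sum>k\<in>d. C * (\<bar>f (Sup k) - f (Inf k)\<bar> + \<bar>g (Sup k) - g (Inf k)\<bar>))"
    proof (rule sum_mono)
      fix k assume "k \<in> d"
      with * obtain u v where "k = {u..v}" "u \<le> v" "Inf k = u" "Sup k = v" "k \<subseteq> t"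
        using division_interval_cases by metis
      then show "\<bar>h (Sup k) - h (Inf k)\<bar>
          \<le> C * (\<bar>f (Sup k) - f (Inf k)\<bar> + \<bar>g (Sup k) - g (Inf k)\<bar>)"
        using * by (intro dom) auto
    qed
    also have "\<dots> = C * ((\<Sum>k\<in>d. \<bar>f (Sup k) - f (Inf k)\<bar>) + (\<Sum>k\<in>d. \<bar>g (Sup k) - g (Inf k)\<bar>))"
      by (simp add: sum.distrib flip: sum_distrib_left)
    also have "\<dots> \<le> C * (e' + e')"
      using * d1(2)[of d t] d2(2)[of d t] \<open>0 \<le> C\<close> by (intro mult_left_mono add_mono) auto
    also have "\<dots> < (C + 1) * (e' + e')" using \<open>0 < e'\<close> by simp
    also have "\<dots> = e" using \<open>0 \<le> C\<close> unfolding e'_def by (simp add: divide_simps)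
    finally show "(\<Sum>k\<in>d. \<bar>h (Sup k) - h (Inf k)\<bar>) < e" .
  qed (use d1 d2 in auto)
qed

lemma abs_continuous_on_lipschitz:
  assumes "\<And>u v. u \<in> S \<Longrightarrow> v \<in> S \<Longrightarrow> \<bar>h v - h u\<bar> \<le> C * \<bar>v - u\<bar>"
  shows "abs_continuous_on S h"
proof (rule abs_continuous_on_dominated[where f = "\<lambda>x. x" and g = "\<lambda>x. x" and C = "\<bar>C\<bar>"])
  have "abs_continuous_on S (\<lambda>x. x)"
    unfolding abs_continuous_on_def
  proof (intro allI impI exI conjI)
    fix e :: real and d :: "real set set" and t
    assume "0 < e" "d division_of t \<and> t \<subseteq> S \<and> (\<Sum>k\<in>d. Sup k - Inf k) < e"
    moreover have "(\<Sum>k\<in>d. \<bar>Sup k - Inf k\<bar>) = (\<Sum>k\<in>d. Sup k - Inf k)" if "d division_of t"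
      by (rule sum.cong) (use that in \<open>auto elim!: division_interval_cases\<close>)
    ultimately show "(\<Sum>k\<in>d. \<bar>Sup k - Inf k\<bar>) < e" by auto
  qed auto
  then show "abs_continuous_on S (\<lambda>x. x)" "abs_continuous_on S (\<lambda>x. x)" by auto
  show "\<bar>h v - h u\<bar> \<le> \<bar>C\<bar> * (\<bar>v - u\<bar> + \<bar>v - u\<bar>)" if "u \<in> S" "v \<in> S" for u v
  proof -
    have "\<bar>h v - h u\<bar> \<le> C * \<bar>v - u\<bar>" using assms that by blast
    also have "\<dots> \<le> \<bar>C\<bar> * (\<bar>v - u\<bar> + \<bar>v - u\<bar>)" by (intro mult_mono) auto
    finally show ?thesis .
  qed
qed auto

lemma abs_continuous_on_subset:
  "abs_continuous_on S f \<Longrightarrow> T \<subseteq> S \<Longrightarrow> abs_continuous_on T f"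
  unfolding abs_continuous_on_def by (meson order_trans)

lemma abs_continuous_on_pair:
  assumes "abs_continuous_on {a..b} f" "0 < e"
  obtains \<delta> where "\<delta> > 0"
    "\<And>u v. a \<le> u \<Longrightarrow> u \<le> v \<Longrightarrow> v \<le> b \<Longrightarrow> v - u < \<delta> \<Longrightarrow> \<bar>f v - f u\<bar> < e"
proof -
  obtain \<delta> where d: "\<delta> > 0" "\<And>d t. d division_of t \<Longrightarrow> t \<subseteq> {a..b} \<Longrightarrow> (\<Sum>k\<in>d. Sup k - Inf k) < \<delta>
      \<Longrightarrow> (\<Sum>k\<in>d. \<bar>f (Sup k) - f (Inf k)\<bar>) < e"
    using abs_continuous_onE[OF assms] by blast
  show ?thesis
  proof (rule that[OF d(1)])
    fix u v assume *: "a \<le> u" "u \<le> v" "v \<le> b" "v - u < \<delta>"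
    have "{cbox u v} division_of cbox u v" using * by (intro division_of_self) auto
    from d(2)[OF this] show "\<bar>f v - f u\<bar> < e" using * by auto
  qed
qed

lemma abs_continuous_on_imp_continuous_on:
  assumes "abs_continuous_on {a..b} f"
  shows "continuous_on {a..b} f"
  unfolding continuous_on_iff
proof (intro ballI allI impI)
  fix x e :: real assume x: "x \<in> {a..b}" "0 < e"
  obtain \<delta> where d: "\<delta> > 0"
    "\<And>u v. a \<le> u \<Longrightarrow> u \<le> v \<Longrightarrow> v \<le> b \<Longrightarrow> v - u < \<delta> \<Longrightarrow> \<bar>f v - f u\<bar> < e"
    using abs_continuous_on_pair[OF assms x(2)] by blast
  show "\<exists>d>0. \<forall>x'\<in>{a..b}. dist x' x < d \<longrightarrow> dist (f x') (f x) < e"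
  proof (intro exI[of _ \<delta>] conjI ballI impI)
    fix y assume y: "y \<in> {a..b}" "dist y x < \<delta>"
    show "dist (f y) (f x) < e"
    proof (cases "x \<le> y")
      case True then show ?thesis using d(2)[of x y] x y by (auto simp: dist_real_def)
    next
      case False then show ?thesis using d(2)[of y x] x y by (auto simp: dist_real_def)
    qed
  qed (use d in auto)
qed

lemma abs_continuous_on_mult:
  assumes f: "abs_continuous_on {a..b} f" and g: "abs_continuous_on {a..b} g"
  shows "abs_continuous_on {a..b} (\<lambda>x. f x * g x)"
proof -
  have bdd: "\<exists>B\<ge>0. \<forall>x\<in>{a..b}. \<bar>h x\<bar> \<le> B" if "abs_continuous_on {a..b} h" for h :: "real \<Rightarrow> real"
  proof -
    have "bounded (h ` {a..b})"
      using abs_continuous_on_imp_continuous_on[OF that] compact_continuous_image compact_imp_bounded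
      by blast
    then obtain B where "\<forall>x\<in>{a..b}. \<bar>h x\<bar> \<le> B" by (auto simp: bounded_iff)
    then show ?thesis by (intro exI[of _ "\<bar>B\<bar>"]) force
  qed
  obtain B1 where B1: "0 \<le> B1" "\<And>x. x \<in> {a..b} \<Longrightarrow> \<bar>f x\<bar> \<le> B1" using bdd[OF f] by blast
  obtain B2 where B2: "0 \<le> B2" "\<And>x. x \<in> {a..b} \<Longrightarrow> \<bar>g x\<bar> \<le> B2" using bdd[OF g] by blast
  show ?thesis
  proof (rule abs_continuous_on_dominated[OF f g, of "B1 + B2"])
    fix u v assume uv: "u \<in> {a..b}" "v \<in> {a..b}"
    have "f v * g v - f u * g u = (f v - f u) * g v + f u * (g v - g u)" by (simp add: algebra_simps)
    also have "\<bar>\<dots>\<bar> \<le> \<bar>f v - f u\<bar> * \<bar>g v\<bar> + \<bar>f u\<bar> * \<bar>g v - g u\<bar>"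
      by (metis abs_mult abs_triangle_ineq)
    also have "\<dots> \<le> \<bar>f v - f u\<bar> * (B1 + B2) + (B1 + B2) * \<bar>g v - g u\<bar>"
      using B1(1) B2(1) B1(2)[OF uv(1)] B2(2)[OF uv(2)] by (intro add_mono mult_mono) auto
    finally show "\<bar>f v * g v - f u * g u\<bar> \<le> (B1 + B2) * (\<bar>f v - f u\<bar> + \<bar>g v - g u\<bar>)"
      by (simp add: algebra_simps)
  qed (use B1 B2 in auto)
qed

section \<open>The fundamental theorem of calculus for absolutely continuous functions\<close>

lemma division_length:
  assumes "d division_of t"
  shows "(\<Sum>k\<in>d. Sup k - Inf k) = measure lebesgue (t :: real set)"
proof -
  have "(\<Sum>k\<in>d. Sup k - Inf k) = (\<Sum>k\<in>d. measure lebesgue k)"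
  proof (rule sum.cong[OF refl])
    fix k assume "k \<in> d"
    from division_interval_cases[OF assms this] obtain u v
      where k: "k = {u..v}" "u \<le> v" "Inf k = u" "Sup k = v" by blast
    have "measure lebesgue k = v - u" unfolding k(1) using k(2) by simp
    then show "Sup k - Inf k = measure lebesgue k" using k(3,4) by simp
  qed
  then show ?thesis using content_division[OF assms] by simp
qed

text \<open>Tagging every interval with its left endpoint turns the division into a tagged division,
  over which increments are known to add up.\<close>

lemma division_telescope:
  fixes f :: "real \<Rightarrow> real"
  assumes "q division_of {a..b}" "a \<le> b"
  shows "(\<Sum>k\<in>q. f (Sup k) - f (Inf k)) = f b - f a"
proof -
  let ?p = "(\<lambda>k. (Inf k, k)) ` q"
  have "?p tagged_division_of {a..b}"
  proof (rule tagged_division_ofI)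
    show "finite ?p" using assms by auto
    have "{K. \<exists>x. (x, K) \<in> ?p} = q" by auto
    then show "\<Union>{K. \<exists>x. (x, K) \<in> ?p} = {a..b}" using division_ofD(6)[OF assms(1)] by simp
    fix x K assume "(x, K) \<in> ?p"
    then have K: "K \<in> q" "x = Inf K" by auto
    then show "x \<in> K" "K \<subseteq> {a..b}" "\<exists>a b. K = cbox a b"
      using assms(1) by (auto elim!: division_interval_cases simp: box_real)
    fix x2 K2 assume "(x2, K2) \<in> ?p" "(x, K) \<noteq> (x2, K2)"
    then show "interior K \<inter> interior K2 = {}" using K division_ofD(5)[OF assms(1)] by auto
  qed
  from additive_tagged_division_1[OF assms(2) this, of f]
  show ?thesis by (subst (asm) sum.reindex) (auto simp: inj_on_def)
qed

lemma lmeasurable_outer_open: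
  fixes S :: "real set"
  assumes "S \<in> lmeasurable" "0 < e"
  obtains T where "open T" "S \<subseteq> T" "T \<in> lmeasurable" "measure lebesgue T < measure lebesgue S + e"
proof -
  obtain T where T: "open T" "S \<subseteq> T" "T - S \<in> lmeasurable" "emeasure lebesgue (T - S) < ennreal e"
    using sets_lebesgue_outer_open[of S e] assms by blast
  have eq: "T = S \<union> (T - S)" using T(2) by auto
  have m: "measure lebesgue (T - S) < e"
    using T(4) emeasure_eq_measure2[OF T(3)] by (simp add: ennreal_less_iff)
  show ?thesis
  proof (rule that[OF T(1,2)])
    show "T \<in> lmeasurable" by (subst eq) (rule fmeasurable.Un[OF assms(1) T(3)])
    have "measure lebesgue T = measure lebesgue (S \<union> (T - S))" using eq by simp
    also have "\<dots> \<le> measure lebesgue S + measure lebesgue (T - S)"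
      using assms(1) T(3) by (intro measure_Un_le) (auto dest: fmeasurableD)
    finally show "measure lebesgue T < measure lebesgue S + e" using m by simp
  qed
qed

text \<open>The gauge integral is computed from its definition. Off \<open>N\<close> the Riemann
  terms are close to the increments of \<open>f\<close> by differentiability. Intervals tagged in
  \<open>N\<close> are kept inside an open set of measure less than \<delta>, where absolute
  continuity makes the increments of \<open>f\<close> small in total; their Riemann terms vanish
  because \<open>g0\<close> is 0 on \<open>N\<close>.\<close>

theorem abs_continuous_FTC:
  assumes ac: "abs_continuous_on {a..b} f" and "a \<le> b" and N: "negligible N"
    and der: "\<And>x. x \<in> {a..b} - N \<Longrightarrow> (f has_real_derivative g x) (at x within {a..b})"
  shows "(g has_integral (f b - f a)) {a..b}"
proof -
  define g0 where "g0 x = (if x \<in> N then 0 else g x)" for x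
  have "(g0 has_integral (f b - f a)) {a..b}"
    unfolding has_integral_real
  proof (intro allI impI)
    fix e :: real assume "0 < e"
    define e1 where "e1 = e / (2 * (b - a + 1))"
    have e1: "0 < e1" using \<open>0 < e\<close> \<open>a \<le> b\<close> by (simp add: e1_def)
    obtain \<delta> where d: "\<delta> > 0" "\<And>d t. d division_of t \<Longrightarrow> t \<subseteq> {a..b} \<Longrightarrow>
        (\<Sum>k\<in>d. Sup k - Inf k) < \<delta> \<Longrightarrow> (\<Sum>k\<in>d. \<bar>f (Sup k) - f (Inf k)\<bar>) < e / 2"
      using abs_continuous_onE[OF ac half_gt_zero[OF \<open>0 < e\<close>]] by blast
    have N2: "N \<in> sets lebesgue" "N \<in> lmeasurable" "measure lebesgue N = 0"
      using N by (auto simp: negligible_imp_measurable negligible_imp_measure0 negligible_imp_sets)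
    obtain G where G: "open G" "N \<subseteq> G" "G \<in> lmeasurable" "measure lebesgue G < measure lebesgue N + \<delta>"
      using lmeasurable_outer_open[OF N2(2) d(1)] by blast
    have mG: "measure lebesgue G < \<delta>" using G N2 by simp
    \<comment> \<open>Radius of the gauge: at a point of \<open>N\<close> it confines the interval
      to \<open>G\<close>, elsewhere it is a radius of differentiability with error
      \<open>e1\<close>.\<close>
    have "\<exists>r>0. (x \<in> N \<longrightarrow> ball x r \<subseteq> G) \<and> (x \<in> {a..b} - N \<longrightarrow>
        (\<forall>y\<in>{a..b}. \<bar>y - x\<bar> < r \<longrightarrow> \<bar>f y - f x - (y - x) * g x\<bar> \<le> e1 * \<bar>y - x\<bar>))" for x
    proof (cases "x \<in> N")
      case True
      then show ?thesis using G(1,2) open_contains_ball by blast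
    next
      case False
      show ?thesis
      proof (cases "x \<in> {a..b}")
        case True
        then have "(f has_real_derivative g x) (at x within {a..b})" using der False by auto
        then have "\<exists>r>0. \<forall>y\<in>{a..b}. norm (y - x) < r \<longrightarrow> norm (f y - f x - g x * (y - x)) \<le> e1 * norm (y - x)"
          using e1 unfolding has_field_derivative_def has_derivative_within_alt by blast
        then show ?thesis using False True by (simp add: mult.commute[of "g x"])
      qed (use False in \<open>auto intro: exI[of _ 1]\<close>)
    qed
    then obtain r where r: "\<forall>x. r x > 0 \<and> (x \<in> N \<longrightarrow> ball x (r x) \<subseteq> G) \<and> (x \<in> {a..b} - N \<longrightarrow>
        (\<forall>y\<in>{a..b}. \<bar>y - x\<bar> < r x \<longrightarrow> \<bar>f y - f x - (y - x) * g x\<bar> \<le> e1 * \<bar>y - x\<bar>))"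
      using choice[of "\<lambda>x r. r > 0 \<and> (x \<in> N \<longrightarrow> ball x r \<subseteq> G) \<and> (x \<in> {a..b} - N \<longrightarrow>
        (\<forall>y\<in>{a..b}. \<bar>y - x\<bar> < r \<longrightarrow> \<bar>f y - f x - (y - x) * g x\<bar> \<le> e1 * \<bar>y - x\<bar>))"] by blast
    have r0: "r x > 0" for x using spec[OF r, of x] by simp
    have rN: "ball x (r x) \<subseteq> G" if "x \<in> N" for x using spec[OF r, of x] that by simp
    have rd: "\<bar>f y - f x - (y - x) * g x\<bar> \<le> e1 * \<bar>y - x\<bar>"
      if "x \<in> {a..b}" "x \<notin> N" "y \<in> {a..b}" "\<bar>y - x\<bar> < r x" for x y using spec[OF r, of x] that by simp
    show "\<exists>\<gamma>. gauge \<gamma> \<and> (\<forall>\<D>. \<D> tagged_division_of {a..b} \<and> \<gamma> fine \<D> \<longrightarrow>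
        norm ((\<Sum>(x, k)\<in>\<D>. measure lborel k *\<^sub>R g0 x) - (f b - f a)) < e)"
    proof (intro exI[of _ "\<lambda>x. ball x (r x)"] conjI allI impI)
      show "gauge (\<lambda>x. ball x (r x))" using r0 by (simp add: gauge_ball_dependent)
      fix p assume "p tagged_division_of {a..b} \<and> (\<lambda>x. ball x (r x)) fine p"
      then have p: "p tagged_division_of {a..b}" "(\<lambda>x. ball x (r x)) fine p" by auto
      have fin: "finite p" using p by auto
      have pc: "\<exists>u v. K = {u..v} \<and> u \<le> v \<and> x \<in> {u..v} \<and> {u..v} \<subseteq> {a..b} \<and> {u..v} \<subseteq> ball x (r x)"
        if xK: "(x, K) \<in> p" for x K
      proof -
        obtain u v where K: "K = cbox u v" using tagged_division_ofD(4)[OF p(1) xK] by blast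
        moreover have "x \<in> K" "K \<subseteq> {a..b}" using tagged_division_ofD(2,3)[OF p(1) xK] by auto
        moreover have "K \<subseteq> ball x (r x)" using p(2) xK unfolding fine_def by blast
        ultimately have "K = {u..v} \<and> u \<le> v \<and> x \<in> {u..v} \<and> {u..v} \<subseteq> {a..b} \<and> {u..v} \<subseteq> ball x (r x)"
          by auto
        then show ?thesis by blast
      qed
      define q where "q = {(x, K) \<in> p. x \<in> N}"
      have qp: "q \<subseteq> p" "finite q" using fin by (auto simp: q_def intro: finite_subset)
      have tq: "q tagged_partial_division_of {a..b}"
        by (rule tagged_partial_division_subset[OF _ qp(1)]) (use p(1) in \<open>simp add: tagged_division_of_def\<close>)
      have dq: "(snd ` q) division_of \<Union>(snd ` q)"
        by (rule partial_division_of_tagged_division[OF tq])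
      \<comment> \<open>Distinct tagged pairs have disjoint interiors, so they carry the same
        interval only if it is a single point. The condition \<open>h u u = 0\<close> makes such
        repetitions harmless when the sum passes from pairs to intervals.\<close>
      have sumq: "(\<Sum>(x, K)\<in>q. h (Sup K) (Inf K)) = (\<Sum>K\<in>snd ` q. h (Sup K) (Inf K))"
        if "\<And>u. h u u = (0::real)" for h
      proof -
        have "(\<Sum>K\<in>snd ` q. h (Sup K) (Inf K)) = (\<Sum>z\<in>q. h (Sup (snd z)) (Inf (snd z)))"
        proof (rule sum.reindex_nontrivial[OF qp(2), unfolded o_def])
          fix z1 z2 assume *: "z1 \<in> q" "z2 \<in> q" "z1 \<noteq> z2" "snd z1 = snd z2"
          obtain x1 K1 x2 K2 where z: "z1 = (x1, K1)" "z2 = (x2, K2)" by (cases z1; cases z2)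
          have "interior K1 \<inter> interior K2 = {}"
            using tq * z unfolding tagged_partial_division_of_def by blast
          then have "interior K1 = {}" using * z by simp
          moreover obtain u v where uv: "K1 = {u..v}" "u \<le> v"
            using pc[of x1 K1] * z qp by blast
          ultimately have "u = v" by (simp add: interior_atLeastAtMost_real)
          then show "h (Sup (snd z1)) (Inf (snd z1)) = 0" using that z uv by simp
        qed
        then show ?thesis by (simp add: case_prod_unfold)
      qed
      have small: "(\<Sum>(x, K)\<in>q. \<bar>f (Sup K) - f (Inf K)\<bar>) < e / 2"
      proof -
        have sub: "\<Union>(snd ` q) \<subseteq> {a..b} \<inter> G"
        proof
          fix z assume "z \<in> \<Union>(snd ` q)"
          then obtain x K where "(x, K) \<in> q" "z \<in> K" by auto
          moreover then have "x \<in> N" "(x, K) \<in> p" by (auto simp: q_def)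
          ultimately show "z \<in> {a..b} \<inter> G" using pc[of x K] rN[of x] by blast
        qed
        have "(\<Sum>K\<in>snd ` q. Sup K - Inf K) = measure lebesgue (\<Union>(snd ` q))"
          by (rule division_length[OF dq])
        also have "\<dots> \<le> measure lebesgue G"
          using sub G(3) dq by (intro measure_mono_fmeasurable) (auto intro!: lmeasurable_division fmeasurableD)
        finally have "(\<Sum>K\<in>snd ` q. Sup K - Inf K) < \<delta>" using mG by simp
        from d(2)[OF dq _ this] sub show ?thesis
          using sumq[of "\<lambda>s i. \<bar>f s - f i\<bar>"] by simp
      qed
      have telf: "f b - f a = (\<Sum>(x,K)\<in>p. f (Sup K) - f (Inf K))"
        using additive_tagged_division_1[OF \<open>a \<le> b\<close> p(1), of f] by simp
      have telx: "b - a = (\<Sum>(x,K)\<in>p. Sup K - Inf K)"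
        using additive_tagged_division_1[OF \<open>a \<le> b\<close> p(1), of "\<lambda>x. x"] by simp
      have "\<bar>(\<Sum>(x, K)\<in>p. measure lborel K *\<^sub>R g0 x) - (f b - f a)\<bar>
          = \<bar>\<Sum>(x, K)\<in>p. measure lborel K * g0 x - (f (Sup K) - f (Inf K))\<bar>"
        by (simp add: telf case_prod_unfold sum_subtractf)
      also have "\<dots> \<le> (\<Sum>(x, K)\<in>p. \<bar>measure lborel K * g0 x - (f (Sup K) - f (Inf K))\<bar>)"
        by (simp add: case_prod_unfold sum_abs)
      also have "\<dots> \<le> (\<Sum>(x, K)\<in>p. e1 * (Sup K - Inf K)
          + (if x \<in> N then \<bar>f (Sup K) - f (Inf K)\<bar> else 0))"
      proof (rule sum_mono, clarify)
        fix x K assume xK: "(x, K) \<in> p"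
        obtain u v where K: "K = {u..v}" "u \<le> v" "x \<in> {u..v}"
          "{u..v} \<subseteq> {a..b}" "{u..v} \<subseteq> ball x (r x)" using pc[OF xK] by blast
        show "\<bar>measure lborel K * g0 x - (f (Sup K) - f (Inf K))\<bar>
            \<le> e1 * (Sup K - Inf K) + (if x \<in> N then \<bar>f (Sup K) - f (Inf K)\<bar> else 0)"
        proof (cases "x \<in> N")
          case True
          have "0 \<le> e1 * (v - u)" using K e1 by simp
          then show ?thesis using True K by (simp add: g0_def)
        next
          case False
          have uvm: "u \<in> {u..v}" "v \<in> {u..v}" using K by auto
          have B: "\<bar>f y - f x - (y - x) * g x\<bar> \<le> e1 * \<bar>y - x\<bar>" if "y \<in> {u..v}" for y
            using rd[of x y] False K that by (auto simp: dist_real_def subset_iff)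
          have "measure lborel K * g0 x - (f (Sup K) - f (Inf K))
              = (f u - f x - (u - x) * g x) - (f v - f x - (v - x) * g x)"
            using K False by (simp add: g0_def algebra_simps)
          also have "\<bar>\<dots>\<bar> \<le> e1 * \<bar>u - x\<bar> + e1 * \<bar>v - x\<bar>"
            using B[OF uvm(1)] B[OF uvm(2)] by linarith
          also have "\<dots> = e1 * (v - u)" using K by (simp add: algebra_simps)
          finally show ?thesis using False K by simp
        qed
      qed
      also have "\<dots> = e1 * (b - a) + (\<Sum>(x, K)\<in>q. \<bar>f (Sup K) - f (Inf K)\<bar>)"
      proof -
        have "(\<Sum>(x, K)\<in>p. if x \<in> N then \<bar>f (Sup K) - f (Inf K)\<bar> else 0)
            = (\<Sum>(x, K)\<in>q. \<bar>f (Sup K) - f (Inf K)\<bar>)"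
          by (rule sum.mono_neutral_cong_right) (use fin in \<open>auto simp: q_def split: if_splits\<close>)
        then show ?thesis
          by (simp add: telx sum_distrib_left case_prod_unfold sum.distrib)
      qed
      also have "\<dots> < e"
      proof -
        have "e1 * (b - a) \<le> e1 * (b - a + 1)" using e1 by simp
        also have "\<dots> = e / 2" using \<open>a \<le> b\<close> by (simp add: e1_def divide_simps)
        finally show ?thesis using small by simp
      qed
      finally show "norm ((\<Sum>(x, k)\<in>p. measure lborel k *\<^sub>R g0 x) - (f b - f a)) < e" by simp
    qed
  qed
  then show ?thesis
    by (rule has_integral_spike[OF N, rotated]) (auto simp: g0_def)
qed

section \<open>Differentiability almost everywhere by Vitali coverings\<close>

lemma vitali_finite_subfamily:
  fixes E :: "real set"
  assumes cov: "\<And>x e. x \<in> E \<Longrightarrow> 0 < e \<Longrightarrow> \<exists>u v. u < v \<and> x \<in> {u..v} \<and> v - u < e \<and> Q {u..v}"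
    and big: "\<And>T. E \<subseteq> T \<Longrightarrow> T \<in> lmeasurable \<Longrightarrow> M < measure lebesgue T"
  obtains d where "d division_of \<Union>d" "pairwise disjnt d"
    "\<And>k. k \<in> d \<Longrightarrow> Q k \<and> (\<exists>u v. u < v \<and> k = {u..v})" "M < (\<Sum>k\<in>d. Sup k - Inf k)"
proof -
  define K where "K = {(u, v). u < v \<and> Q {u..v}}"
  define c where "c = (\<lambda>(u, v). (u + v) / 2 :: real)"
  define r where "r = (\<lambda>(u, v). (v - u) / 2 :: real)"
  have cb: "cball (c (u, v)) (r (u, v)) = {u..v}" for u v
    by (auto simp: c_def r_def cball_def dist_real_def abs_le_iff field_simps)
  have r0: "0 < r i" if "i \<in> K" for i using that by (auto simp: K_def r_def)
  have cov': "\<exists>i. i \<in> K \<and> x \<in> cball (c i) (r i) \<and> r i < e" if "x \<in> E" "0 < e" for x e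
  proof -
    from cov[OF that] obtain u v where uv: "u < v" "x \<in> {u..v}" "v - u < e" "Q {u..v}" by blast
    have "(u, v) \<in> K" using uv by (simp add: K_def)
    moreover have "r (u, v) < e" using uv by (simp add: r_def)
    moreover have "x \<in> cball (c (u, v)) (r (u, v))" unfolding cb by (rule uv(2))
    ultimately show ?thesis by blast
  qed
  obtain C where C: "countable C" "C \<subseteq> K"
      "pairwise (\<lambda>i j. disjnt (cball (c i) (r i)) (cball (c j) (r j))) C"
      "negligible (E - (\<Union>i\<in>C. cball (c i) (r i)))"
    using Vitali_covering_theorem_cballs[of K r E c, OF r0 cov'] by blast
  define S where "S = (\<lambda>i. cball (c i) (r i))"
  have fam: "(S ` D) division_of \<Union>(S ` D) \<and> pairwise disjnt (S ` D)
      \<and> (\<forall>k\<in>S ` D. Q k \<and> (\<exists>u v. u < v \<and> k = {u..v}))" if "finite D" "D \<subseteq> C" for D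
  proof (intro conjI ballI)
    have iv: "\<exists>u v. u < v \<and> S i = {u..v} \<and> Q (S i)" if "i \<in> C" for i
    proof -
      obtain u v where "i = (u, v)" by (cases i)
      then show ?thesis using that C(2) by (auto simp: K_def S_def cb)
    qed
    show pw: "pairwise disjnt (S ` D)"
      unfolding pairwise_def
    proof (intro ballI impI)
      fix k1 k2 assume k: "k1 \<in> S ` D" "k2 \<in> S ` D" "k1 \<noteq> k2"
      then obtain i j where "i \<in> D" "j \<in> D" "k1 = S i" "k2 = S j" by blast
      moreover from this have "i \<noteq> j" "i \<in> C" "j \<in> C" using k(3) \<open>D \<subseteq> C\<close> by auto
      ultimately show "disjnt k1 k2" using pairwiseD[OF C(3)] by (simp add: S_def)
    qed
    show "(S ` D) division_of \<Union>(S ` D)"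
    proof (rule division_ofI)
      show "finite (S ` D)" using that by simp
      fix k assume k: "k \<in> S ` D"
      with \<open>D \<subseteq> C\<close> obtain i where i: "i \<in> C" "k = S i" by blast
      obtain u v where uv: "u < v" "S i = {u..v}" using iv[OF i(1)] by blast
      show "k \<noteq> {}" "\<exists>a b. k = cbox a b" "k \<subseteq> \<Union>(S ` D)" using uv i k by auto
      fix k2 assume "k2 \<in> S ` D" "k \<noteq> k2"
      then have "disjnt k k2" using pairwiseD[OF pw k] by blast
      then show "interior k \<inter> interior k2 = {}"
        using interior_subset[of k] interior_subset[of k2] by (auto simp: disjnt_def)
    qed simp
    show "Q k" if "k \<in> S ` D" for k using iv \<open>D \<subseteq> C\<close> that by blast
    show "\<exists>u v. u < v \<and> k = {u..v}" if "k \<in> S ` D" for k using iv \<open>D \<subseteq> C\<close> that by blast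
  qed
  \<comment> \<open>\<open>E\<close> need not be measurable, so \<open>big\<close> speaks of its
    measurable supersets. If all finite subfamilies had total length at most \<open>M\<close>, so
    would the countable Vitali family, whose union covers \<open>E\<close> up to a null set.\<close>
  have "\<exists>D. finite D \<and> D \<subseteq> C \<and> M < measure lebesgue (\<Union>(S ` D))"
  proof (rule ccontr)
    assume "\<not> ?thesis"
    then have le: "measure lebesgue (\<Union>(S ` D)) \<le> M" if "D \<subseteq> C" "finite D" for D
      using that by (meson not_less)
    have lm: "\<And>i. i \<in> C \<Longrightarrow> S i \<in> lmeasurable" by (simp add: S_def)
    have 1: "\<Union>(S ` C) \<in> lmeasurable" and 2: "measure lebesgue (\<Union>(S ` C)) \<le> M"
      using fmeasurable_UN_bound[OF C(1), of S lebesgue M, OF lm le]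
        measure_UN_bound[OF C(1), of S lebesgue M, OF lm le] by auto
    have N: "E - \<Union>(S ` C) \<in> null_sets lebesgue"
      using C(4) by (simp add: S_def negligible_iff_null_sets)
    have "\<Union>(S ` C) \<union> (E - \<Union>(S ` C)) \<in> lmeasurable"
      using 1 C(4) by (intro fmeasurable.Un) (auto simp: S_def negligible_imp_measurable)
    from big[OF _ this] have "M < measure lebesgue (\<Union>(S ` C) \<union> (E - \<Union>(S ` C)))" by blast
    also have "\<dots> = measure lebesgue (\<Union>(S ` C))"
      by (rule measure_Un_null_set[OF fmeasurableD[OF 1] N])
    finally show False using 2 by simp
  qed
  then obtain D where D: "finite D" "D \<subseteq> C" "M < measure lebesgue (\<Union>(S ` D))" by blast
  show ?thesis
    using that[of "S ` D"] fam[OF D(1,2)] D(3) division_length[of "S ` D" "\<Union>(S ` D)"] by simp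
qed

text \<open>Let \<open>m\<close> be the outer measure of \<open>E\<close>. Disjoint intervals of
  slope at least \<eta> cover almost all of \<open>E\<close> and lie in an open set hardly larger
  than \<open>E\<close>; inside them, disjoint intervals of slope at most -\<eta> again cover almost
  all of \<open>E\<close>. So \<open>G\<close> gains about \<eta> m over the first family and loses
  about as much over the second, while the gaps between the two are so short that absolute
  continuity allows them a change of less than \<eta> m / 2.\<close>

lemma negligible_oscillating_slopes:
  assumes ac: "abs_continuous_on {a..b} G" and E: "E \<subseteq> {a<..<b}" and "0 < \<eta>"
    and up: "\<And>x e. x \<in> E \<Longrightarrow> 0 < e \<Longrightarrow>
      \<exists>u v. u < v \<and> x \<in> {u..v} \<and> v - u < e \<and> \<eta> * (v - u) \<le> G v - G u"
    and down: "\<And>x e. x \<in> E \<Longrightarrow> 0 < e \<Longrightarrow>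
      \<exists>u v. u < v \<and> x \<in> {u..v} \<and> v - u < e \<and> G v - G u \<le> - \<eta> * (v - u)"
  shows "negligible E"
proof (rule ccontr)
  assume nn: "\<not> negligible E"
  define A where "A = measure lebesgue ` {T. E \<subseteq> T \<and> T \<in> lmeasurable}"
  define m where "m = Inf A"
  have Abd: "bdd_below A" by (rule bdd_belowI[of _ 0]) (auto simp: A_def)
  have Ane: "A \<noteq> {}" using E unfolding A_def by (auto intro!: exI[of _ "{a<..<b}"])
  have mle: "m \<le> measure lebesgue T" if "E \<subseteq> T" "T \<in> lmeasurable" for T
    unfolding m_def using that by (intro cInf_lower Abd) (auto simp: A_def)
  have m0: "0 < m"
  proof (rule ccontr)
    assume "\<not> 0 < m"
    have "\<exists>T. E \<subseteq> T \<and> T \<in> lmeasurable \<and> measure lebesgue T < e" if "0 < e" for e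
    proof -
      have "Inf A < e" using \<open>\<not> 0 < m\<close> that by (simp add: m_def)
      then obtain y where "y \<in> A" "y < e" using cInf_lessD[OF Ane] by blast
      then show ?thesis by (auto simp: A_def)
    qed
    then show False using nn negligible_outer[of E] by blast
  qed
  have "0 < \<eta> * m / 2" using m0 \<open>0 < \<eta>\<close> by simp
  then obtain \<delta> where \<delta>: "\<delta> > 0" "\<And>d t. d division_of t \<Longrightarrow> t \<subseteq> {a..b} \<Longrightarrow>
    (\<Sum>k\<in>d. Sup k - Inf k) < \<delta> \<Longrightarrow> (\<Sum>k\<in>d. \<bar>G (Sup k) - G (Inf k)\<bar>) < \<eta> * m / 2"
    using abs_continuous_onE[OF ac] by blast
  \<comment> \<open>The gaps will have total length below (m + 2 e) - (m - 4 e) = 6 e, which is less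
    than \<delta>; the concluding contradiction needs 5 e < 3 m / 2.\<close>
  define e where "e = min (\<delta> / 8) (m / 16)"
  have e: "0 < e" "8 * e \<le> \<delta>" "16 * e \<le> m" using \<delta>(1) m0 by (auto simp: e_def)
  have "Inf A < m + e" using e by (simp add: m_def)
  then obtain T0 where T0: "E \<subseteq> T0" "T0 \<in> lmeasurable" "measure lebesgue T0 < m + e"
    using cInf_lessD[OF Ane, of "m + e"] by (auto simp: A_def)
  obtain U0 where U0: "open U0" "T0 \<subseteq> U0" "U0 \<in> lmeasurable" "measure lebesgue U0 < measure lebesgue T0 + e"
    using lmeasurable_outer_open[OF T0(2) e(1)] by blast
  define U where "U = U0 \<inter> {a<..<b}"
  have U: "open U" "E \<subseteq> U" "U \<in> lmeasurable" "U \<subseteq> {a<..<b}" "measure lebesgue U < m + 2 * e"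
  proof -
    show "open U" "E \<subseteq> U" "U \<subseteq> {a<..<b}" using U0 T0 E by (auto simp: U_def)
    show "U \<in> lmeasurable" unfolding U_def using U0 by (intro fmeasurable.Int) auto
    have "measure lebesgue U \<le> measure lebesgue U0"
      using U0 \<open>U \<in> lmeasurable\<close> by (intro measure_mono_fmeasurable) (auto simp: U_def fmeasurableD)
    then show "measure lebesgue U < m + 2 * e" using U0 T0 by simp
  qed
  have inside: "\<exists>r>0. \<forall>u v. x \<in> {u..v} \<and> v - u < r \<longrightarrow> {u..v} \<subseteq> V" if "open V" "x \<in> V" for x and V :: "real set"
  proof -
    from openE[OF that] obtain r where r: "r > 0" "ball x r \<subseteq> V" by blast
    have "{u..v} \<subseteq> V" if "x \<in> {u..v}" "v - u < r" for u v
    proof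
      fix y assume "y \<in> {u..v}"
      then have "y \<in> ball x r" using that by (auto simp: dist_real_def)
      then show "y \<in> V" using r by blast
    qed
    then show ?thesis using r(1) by blast
  qed
  define Q1 where "Q1 k \<longleftrightarrow> k \<subseteq> U \<and> \<eta> * (Sup k - Inf k) \<le> G (Sup k) - G (Inf k)" for k
  have cov1: "\<exists>u v. u < v \<and> x \<in> {u..v} \<and> v - u < s \<and> Q1 {u..v}" if "x \<in> E" "0 < s" for x s
  proof -
    from inside[OF U(1) subsetD[OF U(2) that(1)]]
    obtain r where r: "r > 0" "\<forall>u v. x \<in> {u..v} \<and> v - u < r \<longrightarrow> {u..v} \<subseteq> U"
      by (elim exE conjE)
    have "0 < min r s" using r that by simp
    from up[OF that(1) this] obtain u v where uv: "u < v" "x \<in> {u..v}" "v - u < min r s"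
      "\<eta> * (v - u) \<le> G v - G u" by blast
    then have "Q1 {u..v}" using r(2)[rule_format, of u v] by (simp add: Q1_def)
    then show ?thesis using uv by (intro exI[of _ u] exI[of _ v]) simp
  qed
  have big1: "m - e < measure lebesgue T" if "E \<subseteq> T" "T \<in> lmeasurable" for T
    using mle[OF that] e by simp
  obtain d1 where d1: "d1 division_of \<Union>d1" "pairwise disjnt d1"
    "\<And>k. k \<in> d1 \<Longrightarrow> Q1 k \<and> (\<exists>u v. u < v \<and> k = {u..v})" "m - e < (\<Sum>k\<in>d1. Sup k - Inf k)"
    using vitali_finite_subfamily[of E Q1 "m - e", OF cov1 big1] by blast
  have fin1: "finite d1" using d1(1) by auto
  define W where "W = (\<Union>k\<in>d1. interior k)"
  have W: "open W" "W \<subseteq> U" using d1(3) interior_subset by (auto simp: W_def Q1_def)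
  have L1: "(\<Sum>k\<in>d1. Sup k - Inf k) = measure lebesgue (\<Union>d1)" by (rule division_length[OF d1(1)])
  have d1U: "\<Union>d1 \<subseteq> U" using d1(3) by (auto simp: Q1_def)
  have lm1: "\<Union>d1 \<in> lmeasurable" using lmeasurable_division[OF d1(1)] .
  have L1U: "measure lebesgue (\<Union>d1) \<le> measure lebesgue U"
    using d1U lm1 U(3) by (intro measure_mono_fmeasurable) (auto simp: fmeasurableD)
  have nW: "negligible (\<Union>d1 - W)"
  proof -
    have "\<Union>d1 - W \<subseteq> (\<Union>k\<in>d1. {Inf k, Sup k})"
    proof
      fix x assume x: "x \<in> \<Union>d1 - W"
      then obtain k where k: "k \<in> d1" "x \<in> k" "x \<notin> interior k" by (auto simp: W_def)
      obtain u v where uv: "u < v" "k = {u..v}" using d1(3)[OF k(1)] by blast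
      then have "x = u \<or> x = v" using k by (auto simp: interior_atLeastAtMost_real)
      then have "x \<in> {Inf k, Sup k}" using uv by auto
      then show "x \<in> (\<Union>k\<in>d1. {Inf k, Sup k})" using k(1) by blast
    qed
    moreover have "finite (\<Union>k\<in>d1. {Inf k, Sup k})" using fin1 by simp
    ultimately show ?thesis using negligible_finite negligible_subset by blast
  qed
  \<comment> \<open>Each falling interval has to lie inside a single rising one, so that the
    increments of \<open>G\<close> telescope over every rising interval separately.\<close>
  define Q2 where "Q2 k \<longleftrightarrow> (\<exists>K\<in>d1. k \<subseteq> K) \<and> G (Sup k) - G (Inf k) \<le> - \<eta> * (Sup k - Inf k)" for k
  have cov2: "\<exists>u v. u < v \<and> x \<in> {u..v} \<and> v - u < s \<and> Q2 {u..v}" if "x \<in> E \<inter> W" "0 < s" for x s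
  proof -
    from that obtain K where K: "K \<in> d1" "x \<in> interior K" by (auto simp: W_def)
    from inside[OF open_interior K(2)]
    obtain r where r: "r > 0" "\<forall>u v. x \<in> {u..v} \<and> v - u < r \<longrightarrow> {u..v} \<subseteq> interior K"
      by (elim exE conjE)
    have "0 < min r s" using r that by simp
    from down[OF _ this, of x] that obtain u v where uv: "u < v" "x \<in> {u..v}" "v - u < min r s"
      "G v - G u \<le> - \<eta> * (v - u)" by blast
    have "{u..v} \<subseteq> interior K" using r(2)[rule_format, of u v] uv by simp
    then have "{u..v} \<subseteq> K" using interior_subset order_trans by blast
    then have "Q2 {u..v}" using K(1) uv by (auto simp: Q2_def)
    then show ?thesis using uv by (intro exI[of _ u] exI[of _ v]) simp
  qed
  \<comment> \<open>Passing from \<open>E\<close> to its part in the interiors discards at most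
    \<open>U\<close> minus the rising intervals, of measure below 3 \<open>e\<close>, and the
    finitely many endpoints.\<close>
  have big2: "m - 4 * e < measure lebesgue T" if T: "E \<inter> W \<subseteq> T" "T \<in> lmeasurable" for T
  proof -
    let ?D = "U - \<Union>d1" and ?N = "\<Union>d1 - W"
    have lD: "?D \<in> lmeasurable" using U(3) lm1 by (intro fmeasurable_Diff fmeasurableD)
    have lN: "?N \<in> lmeasurable" "measure lebesgue ?N = 0"
      using nW by (auto simp: negligible_imp_measurable negligible_imp_measure0)
    have "m \<le> measure lebesgue ((T \<union> ?D) \<union> ?N)"
    proof (rule mle)
      show "E \<subseteq> (T \<union> ?D) \<union> ?N" using T(1) U(2) by blast
      show "(T \<union> ?D) \<union> ?N \<in> lmeasurable" using T(2) lD lN by (intro fmeasurable.Un)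
    qed
    also have "\<dots> \<le> measure lebesgue T + measure lebesgue ?D + measure lebesgue ?N"
      using measure_Un_le[of "T \<union> ?D" lebesgue ?N] measure_Un_le[of T lebesgue ?D] T(2) lD lN
      by (simp add: fmeasurableD fmeasurable.Un)
    also have "measure lebesgue ?D = measure lebesgue U - measure lebesgue (\<Union>d1)"
      by (rule measurable_measure_Diff[OF U(3) fmeasurableD[OF lm1] d1U])
    finally show ?thesis using lN(2) L1 d1(4) U(5) e(1) by linarith
  qed
  obtain d2 where d2: "d2 division_of \<Union>d2" "pairwise disjnt d2"
    "\<And>k. k \<in> d2 \<Longrightarrow> Q2 k \<and> (\<exists>u v. u < v \<and> k = {u..v})" "m - 4 * e < (\<Sum>k\<in>d2. Sup k - Inf k)"
    using vitali_finite_subfamily[of "E \<inter> W" Q2 "m - 4 * e", OF cov2 big2] by blast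
  have fin2: "finite d2" using d2(1) by auto
  define p where "p K = {k \<in> d2. k \<subseteq> K}" for K
  have ex: "\<exists>q. p K \<subseteq> q \<and> q division_of K" if "K \<in> d1" for K
  proof -
    obtain u v where uv: "u < v" "K = {u..v}" using d1(3)[OF \<open>K \<in> d1\<close>] by blast
    have "p K division_of \<Union>(p K)" by (rule division_of_subset[OF d2(1)]) (auto simp: p_def)
    moreover have "\<Union>(p K) \<subseteq> cbox u v" using uv by (auto simp: p_def)
    ultimately show ?thesis
      using partial_division_extend_interval[of "p K" u v] uv(2) by (metis box_real(2))
  qed
  define q where "q K = (SOME q. p K \<subseteq> q \<and> q division_of K)" for K
  have q: "p K \<subseteq> q K" "q K division_of K" if "K \<in> d1" for K
    using someI_ex[OF ex[OF that]] by (auto simp: q_def)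
  \<comment> \<open>Every rising interval is divided into the falling intervals inside it and
    further pieces; \<open>gap\<close> collects those pieces.\<close>
  define gap where "gap = (\<Union>K\<in>d1. q K - p K)"
  have qne: "k \<noteq> {}" "k \<subseteq> K" if "k \<in> q K" "K \<in> d1" for k K
    using division_ofD(2,3)[OF q(2)[OF that(2)] that(1)] by auto
  have disj1: "K1 = K2" if "K1 \<in> d1" "K2 \<in> d1" "k1 \<in> q K1" "k2 \<in> q K2" "k1 \<inter> k2 \<noteq> {}" for K1 K2 k1 k2
  proof (rule ccontr)
    assume "K1 \<noteq> K2"
    then have "K1 \<inter> K2 = {}" using pairwiseD[OF d1(2) that(1,2)] by (simp add: disjnt_def)
    then show False using qne(2)[OF that(3,1)] qne(2)[OF that(4,2)] that(5) by auto
  qed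
  have sums: "(\<Sum>K\<in>d1. f (Sup K) - f (Inf K)) = (\<Sum>k\<in>d2. f (Sup k) - f (Inf k))
      + (\<Sum>k\<in>gap. f (Sup k) - f (Inf k))" for f :: "real \<Rightarrow> real"
  proof -
    let ?h = "\<lambda>k. f (Sup k) - f (Inf k)"
    have "(\<Sum>K\<in>d1. ?h K) = (\<Sum>K\<in>d1. \<Sum>k\<in>q K. ?h k)"
    proof (rule sum.cong[OF refl])
      fix K assume K: "K \<in> d1"
      obtain u v where uv: "u < v" "K = {u..v}" using d1(3)[OF K] by blast
      have "(\<Sum>k\<in>q K. ?h k) = f v - f u"
        by (rule division_telescope) (use q(2)[OF K] uv in auto)
      then show "?h K = (\<Sum>k\<in>q K. ?h k)" using uv by simp
    qed
    also have "\<dots> = (\<Sum>K\<in>d1. (\<Sum>k\<in>p K. ?h k) + (\<Sum>k\<in>q K - p K. ?h k))"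
    proof (rule sum.cong[OF refl])
      fix K assume K: "K \<in> d1"
      have "finite (q K)" using q(2)[OF K] by auto
      from sum.subset_diff[OF q(1)[OF K] this, of ?h]
      show "(\<Sum>k\<in>q K. ?h k) = (\<Sum>k\<in>p K. ?h k) + (\<Sum>k\<in>q K - p K. ?h k)" by simp
    qed
    also have "\<dots> = (\<Sum>K\<in>d1. \<Sum>k\<in>p K. ?h k) + (\<Sum>K\<in>d1. \<Sum>k\<in>q K - p K. ?h k)"
      by (rule sum.distrib)
    also have "(\<Sum>K\<in>d1. \<Sum>k\<in>p K. ?h k) = (\<Sum>k\<in>(\<Union>K\<in>d1. p K). ?h k)"
    proof (rule sum.UNION_disjoint[symmetric, OF fin1])
      show "\<forall>i\<in>d1. finite (p i)" using fin2 by (simp add: p_def)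
      show "\<forall>i\<in>d1. \<forall>j\<in>d1. i \<noteq> j \<longrightarrow> p i \<inter> p j = {}"
      proof (intro ballI impI, rule ccontr)
        fix i j assume ij: "i \<in> d1" "j \<in> d1" "i \<noteq> j" "p i \<inter> p j \<noteq> {}"
        then obtain k where "k \<in> p i" "k \<in> p j" by auto
        then have k: "k \<in> q i" "k \<in> q j" using q(1) ij(1,2) by auto
        show False using disj1[OF ij(1,2) k] qne(1)[OF k(1) ij(1)] ij(3) by simp
      qed
    qed
    also have "(\<Union>K\<in>d1. p K) = d2" using d2(3) by (auto simp: p_def Q2_def)
    also have "(\<Sum>K\<in>d1. \<Sum>k\<in>q K - p K. ?h k) = (\<Sum>k\<in>gap. ?h k)"
      unfolding gap_def
    proof (rule sum.UNION_disjoint[symmetric, OF fin1])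
      show "\<forall>i\<in>d1. finite (q i - p i)" using q(2) by auto
      show "\<forall>i\<in>d1. \<forall>j\<in>d1. i \<noteq> j \<longrightarrow> (q i - p i) \<inter> (q j - p j) = {}"
      proof (intro ballI impI, rule ccontr)
        fix i j assume ij: "i \<in> d1" "j \<in> d1" "i \<noteq> j" "(q i - p i) \<inter> (q j - p j) \<noteq> {}"
        then obtain k where k: "k \<in> q i" "k \<in> q j" by auto
        show False using disj1[OF ij(1,2) k] qne(1)[OF k(1) ij(1)] ij(3) by simp
      qed
    qed
    finally show ?thesis .
  qed
  have dgap: "gap division_of \<Union>gap"
  proof (rule division_ofI)
    show "finite gap" using fin1 q(2) by (auto simp: gap_def)
    fix k assume "k \<in> gap"
    then obtain K where K: "K \<in> d1" "k \<in> q K" by (auto simp: gap_def)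
    show "k \<subseteq> \<Union>gap" using \<open>k \<in> gap\<close> by blast
    show "k \<noteq> {}" using qne[OF K(2,1)] by simp
    show "\<exists>a b. k = cbox a b" using division_ofD(4)[OF q(2)[OF K(1)] K(2)] .
    fix k2 assume "k2 \<in> gap" "k \<noteq> k2"
    then obtain K2 where K2: "K2 \<in> d1" "k2 \<in> q K2" by (auto simp: gap_def)
    show "interior k \<inter> interior k2 = {}"
    proof (cases "K = K2")
      case True
      then show ?thesis using division_ofD(5)[OF q(2)[OF K(1)] K(2)] K2 \<open>k \<noteq> k2\<close> by blast
    next
      case False
      then have "k \<inter> k2 = {}" using disj1[OF K(1) K2(1) K(2) K2(2)] by blast
      then show ?thesis using interior_subset[of k] interior_subset[of k2] by auto
    qed
  qed simp
  have gsub: "\<Union>gap \<subseteq> {a..b}"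
  proof -
    have "\<Union>gap \<subseteq> \<Union>d1" using qne(2) by (auto simp: gap_def)
    also have "\<dots> \<subseteq> {a..b}" using d1U U(4) by fastforce
    finally show ?thesis .
  qed
  have "(\<Sum>k\<in>gap. Sup k - Inf k) < \<delta>"
    using sums[of "\<lambda>x. x"] L1 L1U U(5) d2(4) e by linarith
  from \<delta>(2)[OF dgap gsub this]
  have "\<bar>\<Sum>k\<in>gap. G (Sup k) - G (Inf k)\<bar> < \<eta> * m / 2"
    using sum_abs[of "\<lambda>k. G (Sup k) - G (Inf k)" gap] by linarith
  moreover have "\<eta> * (\<Sum>k\<in>d1. Sup k - Inf k) \<le> (\<Sum>k\<in>d1. G (Sup k) - G (Inf k))"
    unfolding sum_distrib_left by (rule sum_mono) (use d1(3) in \<open>auto simp: Q1_def\<close>)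
  moreover have "(\<Sum>k\<in>d2. G (Sup k) - G (Inf k)) \<le> - \<eta> * (\<Sum>k\<in>d2. Sup k - Inf k)"
    unfolding sum_distrib_left by (rule sum_mono) (use d2(3) in \<open>auto simp: Q2_def\<close>)
  moreover have "\<eta> * (m - e) \<le> \<eta> * (\<Sum>k\<in>d1. Sup k - Inf k)"
    using d1(4) \<open>0 < \<eta>\<close> by (intro mult_left_mono) auto
  moreover have "\<eta> * (m - 4 * e) \<le> \<eta> * (\<Sum>k\<in>d2. Sup k - Inf k)"
    using d2(4) \<open>0 < \<eta>\<close> by (intro mult_left_mono) auto
  ultimately have "\<eta> * (m - e) + \<eta> * (m - 4 * e) < \<eta> * m / 2"
    using sums[of G] by linarith
  then have "\<eta> * (3 * m / 2 - 5 * e) < 0" by (simp add: algebra_simps)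
  then show False using \<open>0 < \<eta>\<close> e m0 by (simp add: mult_less_0_iff)
qed

text \<open>If all measurable supersets of \<open>E\<close> had measure at least \<open>e\<close>,
  disjoint intervals of slope at least \<open>K\<close> and total length above \<open>e / 2\<close>
  would carry a variation above \<open>K * (e / 2) = \<bar>B\<bar> + 1\<close>, more than the bound
  \<open>B\<close> permits.\<close>

lemma negligible_infinite_slopes:
  fixes f :: "real \<Rightarrow> real"
  assumes bd: "\<And>d t. d division_of t \<Longrightarrow> t \<subseteq> {a..b} \<Longrightarrow> (\<Sum>k\<in>d. \<bar>f (Sup k) - f (Inf k)\<bar>) \<le> B"
    and E: "E \<subseteq> {a<..<b}"
    and steep: "\<And>x e K. x \<in> E \<Longrightarrow> 0 < e \<Longrightarrow>
      \<exists>u v. u < v \<and> x \<in> {u..v} \<and> v - u < e \<and> K * (v - u) \<le> \<bar>f v - f u\<bar>"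
  shows "negligible E"
  unfolding negligible_outer
proof (intro allI impI)
  fix e :: real assume e: "0 < e"
  show "\<exists>T. E \<subseteq> T \<and> T \<in> lmeasurable \<and> measure lebesgue T < e"
  proof (rule ccontr)
    assume "\<not> ?thesis"
    then have ge: "e \<le> measure lebesgue T" if "E \<subseteq> T" "T \<in> lmeasurable" for T
      using that by (auto simp: not_less)
    have big: "e / 2 < measure lebesgue T" if "E \<subseteq> T" "T \<in> lmeasurable" for T
      using ge[OF that] e by linarith
    define K where "K = 2 * (\<bar>B\<bar> + 1) / e"
    have K: "0 < K" using e by (simp add: K_def)
    define Q where "Q k \<longleftrightarrow> k \<subseteq> {a..b} \<and> K * (Sup k - Inf k) \<le> \<bar>f (Sup k) - f (Inf k)\<bar>" for k
    have cov: "\<exists>u v. u < v \<and> x \<in> {u..v} \<and> v - u < s \<and> Q {u..v}" if "x \<in> E" "0 < s" for x s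
    proof -
      define r where "r = min s (min (x - a) (b - x))"
      have "0 < r" using that E by (auto simp: r_def)
      from steep[OF that(1) this, of K] obtain u v where uv: "u < v" "x \<in> {u..v}" "v - u < r"
        "K * (v - u) \<le> \<bar>f v - f u\<bar>" by blast
      then have "Q {u..v}" by (auto simp: Q_def r_def)
      then show ?thesis using uv by (intro exI[of _ u] exI[of _ v]) (simp add: r_def)
    qed
    obtain d where d: "d division_of \<Union>d" "pairwise disjnt d"
      "\<And>k. k \<in> d \<Longrightarrow> Q k \<and> (\<exists>u v. u < v \<and> k = {u..v})" "e / 2 < (\<Sum>k\<in>d. Sup k - Inf k)"
      using vitali_finite_subfamily[of E Q "e / 2", OF cov big] by blast
    have "\<Union>d \<subseteq> {a..b}" using d(3) by (auto simp: Q_def)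
    from bd[OF d(1) this] have "(\<Sum>k\<in>d. \<bar>f (Sup k) - f (Inf k)\<bar>) \<le> B" .
    moreover have "K * (\<Sum>k\<in>d. Sup k - Inf k) \<le> (\<Sum>k\<in>d. \<bar>f (Sup k) - f (Inf k)\<bar>)"
      unfolding sum_distrib_left by (rule sum_mono) (use d(3) in \<open>auto simp: Q_def\<close>)
    moreover have "K * (e / 2) < K * (\<Sum>k\<in>d. Sup k - Inf k)"
      using d(4) K by (intro mult_strict_left_mono)
    moreover have "K * (e / 2) = \<bar>B\<bar> + 1" using e by (simp add: K_def)
    ultimately show False by linarith
  qed
qed

text \<open>Unless two rational levels are both visited frequently, the supremum of the levels that
  \<sigma> eventually exceeds is a limit. Rational levels keep the later union over all pairs
  countable.\<close>

lemma bounded_no_limit_oscillates: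
  fixes \<sigma> :: "'a \<Rightarrow> real"
  assumes "F \<noteq> bot" and bd: "eventually (\<lambda>y. \<bar>\<sigma> y\<bar> < K) F" and nl: "\<nexists>D. (\<sigma> \<longlongrightarrow> D) F"
  obtains p q where "p < q" "p \<in> \<rat>" "q \<in> \<rat>" "frequently (\<lambda>y. \<sigma> y \<le> p) F" "frequently (\<lambda>y. q \<le> \<sigma> y) F"
proof (rule ccontr)
  note osc = that
  assume "\<not> thesis"
  then have alt: "eventually (\<lambda>y. p < \<sigma> y) F \<or> eventually (\<lambda>y. \<sigma> y < q) F"
    if "p < q" "p \<in> \<rat>" "q \<in> \<rat>" for p q
    using osc[OF that] \<open>\<not> thesis\<close> by (auto simp: frequently_def not_le)
  define A where "A = {p. eventually (\<lambda>y. p < \<sigma> y) F}"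
  define D where "D = Sup A"
  have A1: "- K \<in> A" unfolding A_def using bd by (auto elim!: eventually_mono)
  have A2: "p \<le> K" if "p \<in> A" for p
  proof (rule ccontr)
    assume "\<not> p \<le> K"
    have "eventually (\<lambda>y. False) F"
      using that[unfolded A_def, simplified] bd by eventually_elim (use \<open>\<not> p \<le> K\<close> in auto)
    then show False using \<open>F \<noteq> bot\<close> by simp
  qed
  have bda: "bdd_above A" by (rule bdd_aboveI[of _ K]) (rule A2)
  have "(\<sigma> \<longlongrightarrow> D) F"
  proof (rule order_tendstoI)
    fix l assume "l < D"
    then obtain p where "p \<in> A" "l < p" using less_cSupE[of l A] A1 unfolding D_def by blast
    then show "eventually (\<lambda>y. l < \<sigma> y) F" by (auto simp: A_def elim!: eventually_mono)
  next
    fix r assume "D < r"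
    obtain q where q: "q \<in> \<rat>" "D < q" "q < r" using Rats_dense_in_real[OF \<open>D < r\<close>] by blast
    obtain p where p: "p \<in> \<rat>" "D < p" "p < q" using Rats_dense_in_real[OF q(2)] by blast
    have "p \<notin> A" using cSup_upper[OF _ bda, of p] p(2) by (auto simp: D_def)
    then have "eventually (\<lambda>y. \<sigma> y < q) F" using alt[OF p(3,1) q(1)] by (simp add: A_def)
    then show "eventually (\<lambda>y. \<sigma> y < r) F" using q(3) by (auto elim!: eventually_mono)
  qed
  then show False using nl by blast
qed

text \<open>The difference quotient is symmetric in its two points, so the interval may lie on
  either side of \<open>x\<close>, which is one of its endpoints.\<close>

lemma slope_interval:
  fixes f :: "real \<Rightarrow> real"
  assumes "frequently (\<lambda>y. P ((f y - f x) / (y - x))) (at x)" "0 < e"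
  obtains u v where "u < v" "x \<in> {u..v}" "v - u < e" "P ((f v - f u) / (v - u))"
proof -
  have "eventually (\<lambda>y. dist y x < e \<and> y \<noteq> x) (at x)"
    using \<open>0 < e\<close> by (auto simp: eventually_at)
  from frequently_eventually_frequently[OF assms(1) this]
  have "frequently (\<lambda>y. P ((f y - f x) / (y - x)) \<and> dist y x < e \<and> y \<noteq> x) (at x)" .
  then obtain y where y: "P ((f y - f x) / (y - x))" "dist y x < e" "y \<noteq> x"
    using frequently_ex by blast
  show ?thesis
  proof (cases "x < y")
    case True
    then show ?thesis using that[of x y] y by (simp add: dist_real_def)
  next
    case False
    have "(f x - f y) / (x - y) = (f y - f x) / (y - x)" using y(3) by (simp add: divide_simps) (simp add: algebra_simps)
    then show ?thesis using that[of y x] y False by (simp add: dist_real_def)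
  qed
qed

text \<open>At a point without derivative the difference quotients are either unbounded near the
  point or oscillate across a rational gap \<open>p < q\<close>. Subtracting the linear function of
  slope \<open>(p + q) / 2\<close> turns the second case into slopes at least
  \<open>(q - p) / 2\<close> and at most its negative.\<close>

lemma nondifferentiable_negligible_bounded_variation:
  assumes ac: "abs_continuous_on {a..b} f"
    and bd: "\<And>d t. d division_of t \<Longrightarrow> t \<subseteq> {a..b} \<Longrightarrow> (\<Sum>k\<in>d. \<bar>f (Sup k) - f (Inf k)\<bar>) \<le> B"
  shows "negligible {x \<in> {a<..<b}. \<nexists>D. (f has_real_derivative D) (at x)}"
proof -
  define \<sigma> where "\<sigma> x y = (f y - f x) / (y - x)" for x y
  define Einf where "Einf = {x \<in> {a<..<b}. \<forall>K. frequently (\<lambda>y. K \<le> \<bar>\<sigma> x y\<bar>) (at x)}"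
  define Eosc where "Eosc p q = {x \<in> {a<..<b}. frequently (\<lambda>y. \<sigma> x y \<le> p) (at x)
      \<and> frequently (\<lambda>y. q \<le> \<sigma> x y) (at x)}" for p q
  have n1: "negligible Einf"
  proof (rule negligible_infinite_slopes[OF bd])
    fix x e K :: real assume "x \<in> Einf" "0 < e"
    then have "frequently (\<lambda>y. K \<le> \<bar>(f y - f x) / (y - x)\<bar>) (at x)" by (auto simp: Einf_def \<sigma>_def)
    from slope_interval[where P = "\<lambda>s. K \<le> \<bar>s\<bar>", OF this \<open>0 < e\<close>] obtain u v where
      uv: "u < v" "x \<in> {u..v}" "v - u < e" "K \<le> \<bar>(f v - f u) / (v - u)\<bar>" by blast
    then have "K * (v - u) \<le> \<bar>f v - f u\<bar>" by (simp add: field_simps)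
    then show "\<exists>u v. u < v \<and> x \<in> {u..v} \<and> v - u < e \<and> K * (v - u) \<le> \<bar>f v - f u\<bar>" using uv by blast
  qed (auto simp: Einf_def)
  have n2: "negligible (Eosc p q)" if "p < q" for p q
  proof -
    define G where "G x = f x - (p + q) / 2 * x" for x
    have acG: "abs_continuous_on {a..b} G"
    proof (rule abs_continuous_on_dominated[OF ac, where C = 1])
      show "abs_continuous_on {a..b} (\<lambda>x. (p + q) / 2 * x)"
        by (rule abs_continuous_on_lipschitz[of _ _ "\<bar>(p + q) / 2\<bar>"])
          (metis abs_mult order_refl right_diff_distrib)
    qed (auto simp: G_def)
    show ?thesis
    proof (rule negligible_oscillating_slopes[OF acG, of _ "(q - p) / 2"])
      show "0 < (q - p) / 2" using that by simp
      fix x e :: real assume x: "x \<in> Eosc p q" "0 < e"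
      have "frequently (\<lambda>y. q \<le> (f y - f x) / (y - x)) (at x)" using x(1) by (auto simp: Eosc_def \<sigma>_def)
      from slope_interval[where P = "\<lambda>s. q \<le> s", OF this x(2)] obtain u v where
        uv: "u < v" "x \<in> {u..v}" "v - u < e" "q \<le> (f v - f u) / (v - u)" by blast
      then have "q * (v - u) \<le> f v - f u" by (simp add: field_simps)
      then have "(q - p) / 2 * (v - u) \<le> G v - G u" by (simp add: G_def field_simps)
      then show "\<exists>u v. u < v \<and> x \<in> {u..v} \<and> v - u < e \<and> (q - p) / 2 * (v - u) \<le> G v - G u" using uv by blast
    next
      fix x e :: real assume x: "x \<in> Eosc p q" "0 < e"
      have "frequently (\<lambda>y. (f y - f x) / (y - x) \<le> p) (at x)" using x(1) by (auto simp: Eosc_def \<sigma>_def)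
      from slope_interval[where P = "\<lambda>s. s \<le> p", OF this x(2)] obtain u v where
        uv: "u < v" "x \<in> {u..v}" "v - u < e" "(f v - f u) / (v - u) \<le> p" by blast
      then have "f v - f u \<le> p * (v - u)" by (simp add: field_simps)
      then have "G v - G u \<le> - ((q - p) / 2) * (v - u)" by (simp add: G_def field_simps)
      then show "\<exists>u v. u < v \<and> x \<in> {u..v} \<and> v - u < e \<and> G v - G u \<le> - ((q - p) / 2) * (v - u)" using uv by blast
    qed (auto simp: Eosc_def)
  qed
  define \<F> where "\<F> = insert Einf ((\<lambda>(p, q). Eosc p q) ` {(p, q). p \<in> \<rat> \<and> q \<in> \<rat> \<and> p < q})"
  have "countable ((\<rat> :: real set) \<times> (\<rat> :: real set))" using countable_rat by blast
  then have "countable {(p :: real, q). p \<in> \<rat> \<and> q \<in> \<rat> \<and> p < q}"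
    by (rule countable_subset[rotated]) auto
  then have "negligible (\<Union>\<F>)"
    using n1 n2 by (intro negligible_countable_Union) (auto simp: \<F>_def)
  moreover have "{x \<in> {a<..<b}. \<nexists>D. (f has_real_derivative D) (at x)} \<subseteq> \<Union>\<F>"
  proof
    fix x assume "x \<in> {x \<in> {a<..<b}. \<nexists>D. (f has_real_derivative D) (at x)}"
    then have x: "x \<in> {a<..<b}" "\<nexists>D. (f has_real_derivative D) (at x)" by auto
    have nl: "\<nexists>D. (\<sigma> x \<longlongrightarrow> D) (at x)"
      using x(2) unfolding has_field_derivative_iff \<sigma>_def[abs_def] .
    show "x \<in> \<Union>\<F>"
    proof (cases "\<exists>K. eventually (\<lambda>y. \<bar>\<sigma> x y\<bar> < K) (at x)")
      case False
      then have "x \<in> Einf" using x(1) by (auto simp: Einf_def frequently_def not_le)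
      then show ?thesis by (auto simp: \<F>_def)
    next
      case True
      then obtain K where "eventually (\<lambda>y. \<bar>\<sigma> x y\<bar> < K) (at x)" by blast
      from bounded_no_limit_oscillates[OF _ this nl] obtain p q where "p < q" "p \<in> \<rat>" "q \<in> \<rat>"
        "frequently (\<lambda>y. \<sigma> x y \<le> p) (at x)" "frequently (\<lambda>y. q \<le> \<sigma> x y) (at x)"
        by (metis trivial_limit_at)
      then have "x \<in> Eosc p q" "Eosc p q \<in> \<F>" using x(1) by (auto simp: Eosc_def \<F>_def)
      then show ?thesis by blast
    qed
  qed
  ultimately show ?thesis using negligible_subset by blast
qed

text \<open>Negligibility is local, and on an interval shorter than the \<delta> that belongs to
  \<epsilon> = 1 the variation over every division is at most 1.\<close>

theorem abs_continuous_differentiable: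
  assumes ac: "abs_continuous_on {a..b} f"
  shows "negligible {x \<in> {a<..<b}. \<nexists>D. (f has_real_derivative D) (at x)}" (is "negligible ?S")
proof (subst locally_negligible_alt, rule ballI)
  fix x assume x: "x \<in> ?S"
  obtain \<delta> where \<delta>: "\<delta> > 0" "\<And>d t. d division_of t \<Longrightarrow> t \<subseteq> {a..b} \<Longrightarrow>
      (\<Sum>k\<in>d. Sup k - Inf k) < \<delta> \<Longrightarrow> (\<Sum>k\<in>d. \<bar>f (Sup k) - f (Inf k)\<bar>) < 1"
    using abs_continuous_onE[OF ac zero_less_one] by blast
  define u where "u = max a (x - \<delta> / 3)"
  define v where "v = min b (x + \<delta> / 3)"
  have uv: "a \<le> u" "u < x" "x < v" "v \<le> b" "v - u < \<delta>" using x \<delta>(1) by (auto simp: u_def v_def)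
  have "negligible {x \<in> {u<..<v}. \<nexists>D. (f has_real_derivative D) (at x)}"
  proof (rule nondifferentiable_negligible_bounded_variation[where B = 1])
    show "abs_continuous_on {u..v} f" using ac uv by (rule_tac abs_continuous_on_subset) auto
    fix d t assume dt: "d division_of t" "t \<subseteq> {u..v}"
    have "(\<Sum>k\<in>d. Sup k - Inf k) = measure lebesgue t" by (rule division_length[OF dt(1)])
    also have "\<dots> \<le> measure lebesgue {u..v}"
      using dt lmeasurable_division[OF dt(1)] by (intro measure_mono_fmeasurable) (auto simp: fmeasurableD)
    also have "\<dots> < \<delta>" using uv by simp
    finally show "(\<Sum>k\<in>d. \<bar>f (Sup k) - f (Inf k)\<bar>) \<le> 1"
      using \<delta>(2)[OF dt(1)] dt(2) uv by fastforce
  qed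
  moreover have "?S \<inter> {u<..<v} = {x \<in> {u<..<v}. \<nexists>D. (f has_real_derivative D) (at x)}"
    using uv by auto
  moreover have "openin (top_of_set ?S) (?S \<inter> {u<..<v})" by (auto intro: openin_open_Int)
  moreover have "x \<in> ?S \<inter> {u<..<v}" using x uv by auto
  ultimately show "\<exists>U. openin (top_of_set ?S) U \<and> x \<in> U \<and> negligible U"
    by (intro exI[of _ "?S \<inter> {u<..<v}"] conjI) simp_all
qed

section \<open>Indefinite integrals\<close>

lemma abs_continuous_on_indefinite_integral:
  fixes g :: "real \<Rightarrow> real"
  assumes g: "g absolutely_integrable_on {a..b}"
  shows "abs_continuous_on {a..b} (\<lambda>x. integral {a..x} g)"
  unfolding abs_continuous_on_def
proof (intro allI impI)
  fix e :: real assume e: "0 < e"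
  \<comment> \<open>Truncation at height \<open>j\<close>: for large \<open>j\<close> the cut-off
    remainder has integral below \<open>e / 2\<close>, and the bounded part contributes at most
    \<open>j\<close> times the length of the division.\<close>
  let ?h = "\<lambda>j x. min \<bar>g x\<bar> (real j)"
  have ga: "(\<lambda>x. \<bar>g x\<bar>) absolutely_integrable_on {a..b}"
    using absolutely_integrable_norm[OF g] by (simp add: o_def)
  have gi: "(\<lambda>x. \<bar>g x\<bar>) integrable_on {a..b}" using ga by (simp add: absolutely_integrable_on_def)
  have hi: "?h j integrable_on {a..b}" for j
    using absolutely_integrable_min_1[OF ga absolutely_integrable_on_const[of "{a..b}" "real j"]]
    by (simp add: absolutely_integrable_on_def)
  have "(\<lambda>j. integral {a..b} (?h j)) \<longlonglongrightarrow> integral {a..b} (\<lambda>x. \<bar>g x\<bar>)"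
  proof (rule dominated_convergence(2)[OF hi gi])
    fix x
    have "eventually (\<lambda>j. min \<bar>g x\<bar> (real j) = \<bar>g x\<bar>) sequentially"
      using eventually_ge_at_top[of "nat \<lceil>\<bar>g x\<bar>\<rceil>"] by eventually_elim (simp add: min_def; linarith)
    then show "(\<lambda>j. min \<bar>g x\<bar> (real j)) \<longlonglongrightarrow> \<bar>g x\<bar>" by (rule tendsto_eventually)
  qed auto
  then have "eventually (\<lambda>j. integral {a..b} (\<lambda>x. \<bar>g x\<bar>) - e / 2 < integral {a..b} (?h j)) sequentially"
    using e by (intro order_tendstoD) auto
  then obtain j where j: "integral {a..b} (\<lambda>x. \<bar>g x\<bar>) - e / 2 < integral {a..b} (?h j)"
    using eventually_happens'[OF sequentially_bot] by blast
  define \<delta> where "\<delta> = e / (2 * (real j + 1))"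
  have \<delta>: "0 < \<delta>" using e by (simp add: \<delta>_def)
  show "\<exists>\<delta>>0. \<forall>d t. d division_of t \<and> t \<subseteq> {a..b} \<and> (\<Sum>k\<in>d. Sup k - Inf k) < \<delta> \<longrightarrow>
      (\<Sum>k\<in>d. \<bar>integral {a..Sup k} g - integral {a..Inf k} g\<bar>) < e"
  proof (intro exI[of _ \<delta>] conjI allI impI \<delta>)
    fix d t assume "d division_of t \<and> t \<subseteq> {a..b} \<and> (\<Sum>k\<in>d. Sup k - Inf k) < \<delta>"
    then have d: "d division_of t" "t \<subseteq> {a..b}" "(\<Sum>k\<in>d. Sup k - Inf k) < \<delta>" by auto
    let ?r = "\<lambda>x. \<bar>g x\<bar> - ?h j x"
    have ri: "?r integrable_on {a..b}" by (rule integrable_diff[OF gi hi])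
    have rt: "?r integrable_on t"
      using has_integral_combine_division_topdown[OF ri d(1,2)] by blast
    have "(\<Sum>k\<in>d. \<bar>integral {a..Sup k} g - integral {a..Inf k} g\<bar>)
        \<le> (\<Sum>k\<in>d. integral k ?r + real j * (Sup k - Inf k))"
    proof (rule sum_mono)
      fix k assume k: "k \<in> d"
      obtain u v where uv: "k = {u..v}" "u \<le> v" "Inf k = u" "Sup k = v" "k \<subseteq> t"
        by (rule division_interval_cases[OF d(1) k])
      have ab: "a \<le> u" "v \<le> b" "{u..v} \<subseteq> {a..b}" proof -
        have "{u..v} \<subseteq> {a..b}" using uv(1,5) d(2) by blast
        moreover have "u \<in> {u..v}" "v \<in> {u..v}" using uv(2) by auto
        ultimately show "a \<le> u" "v \<le> b" "{u..v} \<subseteq> {a..b}" by auto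
      qed
      have gk: "g absolutely_integrable_on {u..v}"
        using absolutely_integrable_on_subinterval[OF g ab(3)] .
      have gab: "g integrable_on {a..v}"
        using absolutely_integrable_on_subinterval[OF g, of a v] ab by (auto simp: absolutely_integrable_on_def)
      have "integral {a..v} g = integral {a..u} g + integral {u..v} g"
        using Henstock_Kurzweil_Integration.integral_combine[OF ab(1) uv(2) gab] by simp
      then have "\<bar>integral {a..v} g - integral {a..u} g\<bar> = \<bar>integral {u..v} g\<bar>" by simp
      also have "\<dots> \<le> integral {u..v} (\<lambda>x. \<bar>g x\<bar>)"
        using integral_norm_bound_integral[of g "{u..v}" "\<lambda>x. \<bar>g x\<bar>"] gk
        by (simp add: absolutely_integrable_on_def)
      also have "\<dots> \<le> integral {u..v} (\<lambda>x. ?r x + real j)"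
      proof (rule integral_le)
        show "(\<lambda>x. \<bar>g x\<bar>) integrable_on {u..v}" using integrable_on_subinterval[OF gi ab(3)] .
        show "(\<lambda>x. ?r x + real j) integrable_on {u..v}"
          by (intro integrable_add integrable_on_subinterval[OF ri ab(3)]) auto
      qed auto
      also have "\<dots> = integral {u..v} ?r + real j * (v - u)"
        using integrable_on_subinterval[OF ri ab(3)] uv(2) by (subst integral_add) auto
      finally show "\<bar>integral {a..Sup k} g - integral {a..Inf k} g\<bar> \<le> integral k ?r + real j * (Sup k - Inf k)"
        unfolding uv(3,4) unfolding uv(1) .
    qed
    also have "\<dots> = integral t ?r + real j * (\<Sum>k\<in>d. Sup k - Inf k)"
      using integral_combine_division_topdown[OF rt d(1)] by (simp add: sum.distrib sum_distrib_left)
    also have "integral t ?r \<le> integral {a..b} ?r"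
      by (rule integral_subset_le[OF d(2) rt ri]) auto
    also have "integral {a..b} ?r = integral {a..b} (\<lambda>x. \<bar>g x\<bar>) - integral {a..b} (?h j)"
      by (rule integral_diff[OF gi hi])
    also have "\<dots> + real j * (\<Sum>k\<in>d. Sup k - Inf k) < e / 2 + (real j + 1) * \<delta>"
    proof (rule add_strict_mono)
      have "real j * (\<Sum>k\<in>d. Sup k - Inf k) \<le> real j * \<delta>" using d(3) by (intro mult_left_mono) auto
      also have "\<dots> < (real j + 1) * \<delta>" using \<delta> by simp
      finally show "real j * (\<Sum>k\<in>d. Sup k - Inf k) < (real j + 1) * \<delta>" .
    qed (use j in simp)
    also have "\<dots> = e" by (simp add: \<delta>_def divide_simps) (simp add: algebra_simps)
    finally show "(\<Sum>k\<in>d. \<bar>integral {a..Sup k} g - integral {a..Inf k} g\<bar>) < e" by simp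
  qed
qed

text \<open>The averages of \<open>g\<close> over \<open>{x..x + h}\<close> converge to
  \<open>g x\<close> almost everywhere, which identifies the right-hand derivative. The two-sided
  derivative exists almost everywhere by absolute continuity and must agree with it.\<close>

lemma indefinite_integral_derivative_ae:
  fixes g :: "real \<Rightarrow> real"
  assumes g: "g absolutely_integrable_on {a..b}"
  obtains N where "negligible N"
    "\<And>x. x \<in> {a<..<b} - N \<Longrightarrow> ((\<lambda>x. integral {a..x} g) has_real_derivative g x) (at x)"
proof -
  let ?G = "\<lambda>x. integral {a..x} g"
  define g0 where "g0 x = (if x \<in> {a..b} then g x else 0)" for x
  have gi: "g integrable_on {a..b}" using g by (simp add: absolutely_integrable_on_def)
  have "g0 integrable_on UNIV" unfolding g0_def using gi by (simp only: integrable_restrict_UNIV)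
  then have "g0 integrable_on cbox u v" for u v :: real by (rule integrable_on_subcbox) auto
  then obtain N where N: "negligible N" "\<And>x e. x \<notin> N \<Longrightarrow> 0 < e \<Longrightarrow> \<exists>d>0. \<forall>h. 0 < h \<and> h < d \<longrightarrow>
      norm (integral (cbox x (x + h *\<^sub>R One)) g0 /\<^sub>R h ^ DIM(real) - g0 x) < e"
    using integrable_ccontinuous_explicit[of g0] by blast
  define M where "M = N \<union> {x \<in> {a<..<b}. \<nexists>D. (?G has_real_derivative D) (at x)}"
  show ?thesis
  proof (rule that[of M])
    show "negligible M" unfolding M_def
      using N(1) abs_continuous_differentiable[OF abs_continuous_on_indefinite_integral[OF g]] by auto
    fix x assume x: "x \<in> {a<..<b} - M"
    then obtain D where D: "(?G has_real_derivative D) (at x)" by (auto simp: M_def)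
    have "((\<lambda>y. (?G y - ?G x) / (y - x)) \<longlongrightarrow> D) (at x)"
      using D by (simp add: has_field_derivative_iff)
    then have lim1: "((\<lambda>y. (?G y - ?G x) / (y - x)) \<longlongrightarrow> D) (at_right x)"
      by (rule filterlim_mono) (auto simp: at_within_le_at)
    have lim2: "((\<lambda>y. (?G y - ?G x) / (y - x)) \<longlongrightarrow> g x) (at_right x)"
    proof (rule tendstoI)
      fix e :: real assume "0 < e"
      obtain d where d: "d > 0" "\<And>h. 0 < h \<Longrightarrow> h < d \<Longrightarrow>
          norm (integral (cbox x (x + h *\<^sub>R One)) g0 /\<^sub>R h ^ DIM(real) - g0 x) < e"
        using N(2)[of x e] x \<open>0 < e\<close> by (auto simp: M_def)
      have "eventually (\<lambda>y. y \<in> {x<..<min b (x + d)}) (at_right x)"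
        using x d(1) by (intro eventually_at_right_real) auto
      then show "eventually (\<lambda>y. dist ((?G y - ?G x) / (y - x)) (g x) < e) (at_right x)"
      proof eventually_elim
        case (elim y)
        have "g integrable_on {a..y}" using integrable_on_subinterval[OF gi, of a y] elim by auto
        then have "?G y = ?G x + integral {x..y} g"
          using Henstock_Kurzweil_Integration.integral_combine[where a = a and c = x and b = y and f = g] x elim by auto
        moreover have "integral {x..y} g0 = integral {x..y} g"
          by (rule integral_cong) (use x elim in \<open>auto simp: g0_def\<close>)
        moreover have "g0 x = g x" using x by (auto simp: g0_def)
        moreover have "norm (integral {x..y} g0 / (y - x) - g0 x) < e"
          using d(2)[of "y - x"] elim by (simp add: divide_inverse mult.commute)
        ultimately show ?case by (simp add: dist_norm)
      qed
    qed
    have "D = g x" by (rule tendsto_unique[OF _ lim1 lim2]) simp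
    then show "(?G has_real_derivative g x) (at x)" using D by simp
  qed
qed

section \<open>Locally absolutely continuous functions on the half-line\<close>

text \<open>Pairs a function with an explicit version of its almost everywhere derivative. Sum,
  product and chain rules then act on formulas, and \<open>deriv\<close>, meaningless on the
  exceptional set, enters only through the operator domain.\<close>

definition ac_deriv :: "(real \<Rightarrow> real) \<Rightarrow> (real \<Rightarrow> real) \<Rightarrow> bool" where
  "ac_deriv f g \<longleftrightarrow> locally_abs_continuous f \<and>
    (AE x in lebesgue. 0 < x \<longrightarrow> (f has_real_derivative g x) (at x))"

lemma continuous_on_interval_bounded:
  fixes f :: "real \<Rightarrow> real"
  assumes "continuous_on {a..b} f"
  obtains B where "0 \<le> B" "\<And>x. x \<in> {a..b} \<Longrightarrow> \<bar>f x\<bar> \<le> B"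
proof -
  have "bounded (f ` {a..b})" using assms by (intro compact_imp_bounded compact_continuous_image) auto
  then obtain B where B: "0 < B" "\<forall>x\<in>f ` {a..b}. norm x \<le> B" unfolding bounded_pos by blast
  show ?thesis using that[of B] B by simp
qed

lemma AE_lebesgue_iff_negligible: "(AE x in lebesgue. Q x) \<longleftrightarrow> negligible {x :: real. \<not> Q x}"
  by (simp add: eventually_ae_filter_negligible) (meson negligible_subset order_refl)

lemma has_integral_spike_AE:
  fixes f g :: "real \<Rightarrow> real"
  assumes "AE x in lebesgue. x \<in> S \<longrightarrow> g x = f x" "(f has_integral I) S"
  shows "(g has_integral I) S"
  using assms(1) by (intro has_integral_spike[OF _ _ assms(2)])
    (auto simp: AE_lebesgue_iff_negligible)

lemma has_integral_le_AE:
  fixes f g :: "real \<Rightarrow> real"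
  assumes "(f has_integral I) S" "(g has_integral J) S" "AE x in lebesgue. x \<in> S \<longrightarrow> f x \<le> g x"
  shows "I \<le> J"
proof -
  have "((\<lambda>x. max (f x) (g x)) has_integral J) S"
    by (rule has_integral_spike_AE[OF _ assms(2)]) (use assms(3) in \<open>auto elim!: eventually_mono\<close>)
  then show ?thesis by (rule has_integral_le[OF assms(1)]) auto
qed

lemma ac_deriv_has_integral:
  assumes "ac_deriv f g" "0 < a" "a \<le> b"
  shows "(g has_integral (f b - f a)) {a..b}"
proof (rule abs_continuous_FTC)
  show "abs_continuous_on {a..b} f" using assms by (auto simp: ac_deriv_def locally_abs_continuous_def)
  show "negligible {x. \<not> (0 < x \<longrightarrow> (f has_real_derivative g x) (at x))}"
    using assms(1) by (simp add: ac_deriv_def AE_lebesgue_iff_negligible)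
  show "(f has_real_derivative g x) (at x within {a..b})"
    if "x \<in> {a..b} - {x. \<not> (0 < x \<longrightarrow> (f has_real_derivative g x) (at x))}" for x
    using that assms(2) by (auto intro: has_field_derivative_at_within)
qed (use assms in auto)

lemma ac_deriv_continuous_on: "ac_deriv f g \<Longrightarrow> continuous_on {0<..} f"
proof (rule continuous_at_imp_continuous_on, rule ballI)
  fix x :: real assume f: "ac_deriv f g" and x: "x \<in> {0<..}"
  have "continuous_on {x/2..2*x} f"
    using f x by (intro abs_continuous_on_imp_continuous_on) (auto simp: ac_deriv_def locally_abs_continuous_def)
  then show "isCont f x" using x by (intro continuous_on_interior) (auto simp: interior_atLeastAtMost_real)
qed

lemma ac_deriv_abs_continuous_on:
  "ac_deriv f g \<Longrightarrow> 0 < a \<Longrightarrow> a \<le> b \<Longrightarrow> abs_continuous_on {a..b} f"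
  by (simp add: ac_deriv_def locally_abs_continuous_def)

lemma ac_deriv_AE: "ac_deriv f g \<Longrightarrow> AE x in lebesgue. 0 < x \<longrightarrow> (f has_real_derivative g x) (at x)"
  by (simp add: ac_deriv_def)

text \<open>A continuous derivative is bounded on compact intervals, so \<open>f\<close> is
  Lipschitz there.\<close>

lemma ac_deriv_C1:
  assumes "\<And>x. 0 < x \<Longrightarrow> (f has_real_derivative g x) (at x)" "continuous_on {0<..} g"
  shows "ac_deriv f g"
  unfolding ac_deriv_def locally_abs_continuous_def
proof (intro conjI allI impI)
  fix a b :: real assume ab: "0 < a \<and> a \<le> b"
  have "continuous_on {a..b} g" using ab by (intro continuous_on_subset[OF assms(2)]) auto
  then obtain B where B: "\<And>x. x \<in> {a..b} \<Longrightarrow> \<bar>g x\<bar> \<le> B"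
    using continuous_on_interval_bounded by blast
  show "abs_continuous_on {a..b} f"
  proof (rule abs_continuous_on_lipschitz)
    show "\<bar>f v - f u\<bar> \<le> B * \<bar>v - u\<bar>" if "u \<in> {a..b}" "v \<in> {a..b}" for u v
    proof -
      have "norm (f v - f u) \<le> B * norm (v - u)"
      proof (rule field_differentiable_bound[of "{a..b}" f g])
        show "(f has_field_derivative g z) (at z within {a..b})" if "z \<in> {a..b}" for z
          using assms(1)[of z] ab that by (auto intro: has_field_derivative_at_within)
      qed (use B that in auto)
      then show ?thesis by simp
    qed
  qed
qed (use assms in auto)

lemma ac_deriv_mult:
  assumes f: "ac_deriv f f'" and g: "ac_deriv g g'"
  shows "ac_deriv (\<lambda>x. f x * g x) (\<lambda>x. f' x * g x + f x * g' x)"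
  unfolding ac_deriv_def locally_abs_continuous_def
proof (intro conjI allI impI)
  show "abs_continuous_on {a..b} (\<lambda>x. f x * g x)" if "0 < a \<and> a \<le> b" for a b
    using that by (intro abs_continuous_on_mult ac_deriv_abs_continuous_on[OF f] ac_deriv_abs_continuous_on[OF g]) auto
  show "AE x in lebesgue. 0 < x \<longrightarrow> ((\<lambda>x. f x * g x) has_real_derivative f' x * g x + f x * g' x) (at x)"
    using ac_deriv_AE[OF f] ac_deriv_AE[OF g]
    by eventually_elim (auto intro!: derivative_eq_intros)
qed

lemma ac_deriv_add:
  assumes f: "ac_deriv f f'" and g: "ac_deriv g g'"
  shows "ac_deriv (\<lambda>x. f x + g x) (\<lambda>x. f' x + g' x)"
  unfolding ac_deriv_def locally_abs_continuous_def
proof (intro conjI allI impI)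
  show "abs_continuous_on {a..b} (\<lambda>x. f x + g x)" if "0 < a \<and> a \<le> b" for a b
  proof (rule abs_continuous_on_dominated)
    show "abs_continuous_on {a..b} f" "abs_continuous_on {a..b} g"
      using that ac_deriv_abs_continuous_on[OF f] ac_deriv_abs_continuous_on[OF g] by auto
    show "\<bar>(f v + g v) - (f u + g u)\<bar> \<le> 1 * (\<bar>f v - f u\<bar> + \<bar>g v - g u\<bar>)" for u v
      by simp
  qed simp
  show "AE x in lebesgue. 0 < x \<longrightarrow> ((\<lambda>x. f x + g x) has_real_derivative f' x + g' x) (at x)"
    using ac_deriv_AE[OF f] ac_deriv_AE[OF g]
    by eventually_elim (auto intro!: derivative_eq_intros)
qed

lemma ac_deriv_const: "ac_deriv (\<lambda>x. c) (\<lambda>x. 0)"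
  by (rule ac_deriv_C1) (auto intro: continuous_intros)

lemma ac_deriv_cmult: "ac_deriv f f' \<Longrightarrow> ac_deriv (\<lambda>x. c * f x) (\<lambda>x. c * f' x)"
  using ac_deriv_mult[OF ac_deriv_const, of f f' c] by simp

lemma ac_deriv_diff:
  "ac_deriv f f' \<Longrightarrow> ac_deriv g g' \<Longrightarrow> ac_deriv (\<lambda>x. f x - g x) (\<lambda>x. f' x - g' x)"
  using ac_deriv_add[OF _ ac_deriv_cmult[of g g' "-1"]] by simp

text \<open>Values at nonpositive arguments are free and the derivative may change on a null set.
  This is how raw expressions from the product rule are replaced by simplified ones
  throughout.\<close>

lemma ac_deriv_cong:
  assumes f: "ac_deriv f f'" and "\<And>x. 0 < x \<Longrightarrow> g x = f x"
    and "AE x in lebesgue. 0 < x \<longrightarrow> g' x = f' x"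
  shows "ac_deriv g g'"
  unfolding ac_deriv_def locally_abs_continuous_def
proof (intro conjI allI impI)
  fix a b :: real assume ab: "0 < a \<and> a \<le> b"
  have "abs_continuous_on {a..b} f" using ac_deriv_abs_continuous_on[OF f] ab by blast
  then show "abs_continuous_on {a..b} g"
    by (rule abs_continuous_on_dominated[where g = f and C = 1]) (use assms(2) ab \<open>abs_continuous_on {a..b} f\<close> in auto)
next
  show "AE x in lebesgue. 0 < x \<longrightarrow> (g has_real_derivative g' x) (at x)"
    using ac_deriv_AE[OF f] assms(3)
  proof eventually_elim
    case (elim x)
    show ?case
    proof
      assume "0 < x"
      then have "(f has_real_derivative g' x) (at x)" using elim by simp
      then show "(g has_real_derivative g' x) (at x)"
        by (rule has_field_derivative_transform_within_open[of _ _ _ "{0<..}"])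
          (use \<open>0 < x\<close> assms(2) in \<open>simp_all\<close>)
    qed
  qed
qed

lemma ac_deriv_compose:
  assumes f: "ac_deriv f f'" and h: "\<And>y. (h has_real_derivative h' y) (at y)" and ch: "continuous_on UNIV h'"
  shows "ac_deriv (\<lambda>x. h (f x)) (\<lambda>x. h' (f x) * f' x)"
  unfolding ac_deriv_def locally_abs_continuous_def
proof (intro conjI allI impI)
  fix a b :: real assume ab: "0 < a \<and> a \<le> b"
  have af: "abs_continuous_on {a..b} f" using ac_deriv_abs_continuous_on[OF f] ab by blast
  obtain M where M: "\<And>x. x \<in> {a..b} \<Longrightarrow> \<bar>f x\<bar> \<le> M"
    using continuous_on_interval_bounded[OF abs_continuous_on_imp_continuous_on[OF af]] by blast
  obtain B where B: "\<And>x. x \<in> {-M..M} \<Longrightarrow> \<bar>h' x\<bar> \<le> B"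
    using continuous_on_interval_bounded[OF continuous_on_subset[OF ch, of "{-M..M}"]] by blast
  show "abs_continuous_on {a..b} (\<lambda>x. h (f x))"
  proof (rule abs_continuous_on_dominated[OF af af, of "\<bar>B\<bar>"])
    fix u v assume uv: "u \<in> {a..b}" "v \<in> {a..b}"
    have "norm (h (f v) - h (f u)) \<le> \<bar>B\<bar> * norm (f v - f u)"
    proof (rule field_differentiable_bound[of "{-M..M}" h h'])
      show "(h has_field_derivative h' z) (at z within {- M..M})" for z
        by (rule has_field_derivative_at_within[OF h])
      show "norm (h' z) \<le> \<bar>B\<bar>" if "z \<in> {-M..M}" for z using B[OF that] by simp
      show "f v \<in> {-M..M}" "f u \<in> {-M..M}" using M[OF uv(1)] M[OF uv(2)] by (auto simp: abs_le_iff)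
    qed auto
    also have "\<dots> \<le> \<bar>B\<bar> * (\<bar>f v - f u\<bar> + \<bar>f v - f u\<bar>)" by (intro mult_left_mono) auto
    finally show "\<bar>h (f v) - h (f u)\<bar> \<le> \<bar>B\<bar> * (\<bar>f v - f u\<bar> + \<bar>f v - f u\<bar>)" by simp
  qed auto
next
  show "AE x in lebesgue. 0 < x \<longrightarrow> ((\<lambda>x. h (f x)) has_real_derivative h' (f x) * f' x) (at x)"
    using ac_deriv_AE[OF f] by eventually_elim (use h in \<open>auto intro: DERIV_chain2\<close>)
qed

lemma ac_deriv_exp: "ac_deriv f f' \<Longrightarrow> ac_deriv (\<lambda>x. exp (f x)) (\<lambda>x. exp (f x) * f' x)"
  by (rule ac_deriv_compose[where h = exp and h' = exp]) (auto intro: continuous_intros DERIV_exp)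

lemma ac_deriv_powr: "ac_deriv (\<lambda>x. x powr c) (\<lambda>x. c * x powr (c - 1))"
  by (rule ac_deriv_C1) (auto intro!: derivative_eq_intros continuous_intros)

lemma AE_lebesgue_if_AE_intervals:
  assumes "\<And>a b :: real. 0 < a \<Longrightarrow> a < b \<Longrightarrow> AE x in lebesgue. x \<in> {a<..<b} \<longrightarrow> Q x"
  shows "AE x in lebesgue. 0 < x \<longrightarrow> Q x"
proof -
  have "AE x in lebesgue. \<forall>k::nat. x \<in> {inverse (real k + 2)<..<real k + 2} \<longrightarrow> Q x"
    unfolding AE_all_countable
  proof
    fix k :: nat
    have "inverse (real k + 2) < 1" by (simp add: inverse_eq_divide)
    then show "AE x in lebesgue. x \<in> {inverse (real k + 2)<..<real k + 2} \<longrightarrow> Q x"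
      by (intro assms) auto
  qed
  then show ?thesis
  proof eventually_elim
    case (elim x)
    show ?case
    proof
      assume "0 < x"
      define k where "k = nat \<lceil>max x (inverse x)\<rceil>"
      have k: "x < real k + 2" "inverse x < real k + 2" unfolding k_def by linarith+
      have "inverse (real k + 2) < inverse (inverse x)" using k(2) \<open>0 < x\<close> by (intro less_imp_inverse_less) auto
      then show "Q x" using elim k(1) by auto
    qed
  qed
qed

lemma locally_abs_continuous_ac_deriv:
  assumes "locally_abs_continuous f"
  shows "ac_deriv f (deriv f)"
  unfolding ac_deriv_def
proof (intro conjI assms AE_lebesgue_if_AE_intervals)
  fix a b :: real assume ab: "0 < a" "a < b"
  then have "abs_continuous_on {a..b} f" using assms by (auto simp: locally_abs_continuous_def)
  from abs_continuous_differentiable[OF this]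
  have "AE x in lebesgue. x \<notin> {x \<in> {a<..<b}. \<nexists>D. (f has_real_derivative D) (at x)}"
    unfolding AE_lebesgue_iff_negligible not_not Collect_mem_eq .
  then show "AE x in lebesgue. x \<in> {a<..<b} \<longrightarrow> (f has_real_derivative deriv f x) (at x)"
    by eventually_elim (auto simp: DERIV_imp_deriv)
qed

text \<open>Stated through increments between positive points, because 0 cannot serve as a base
  point in general. Each compact interval is treated with its own left endpoint as base.\<close>

lemma ac_deriv_indefinite_integral:
  assumes ai: "\<And>a b. 0 < a \<Longrightarrow> a \<le> b \<Longrightarrow> g absolutely_integrable_on {a..b}"
    and eq: "\<And>a b. 0 < a \<Longrightarrow> a \<le> b \<Longrightarrow> f b - f a = integral {a..b} g"
  shows "ac_deriv f g"
  unfolding ac_deriv_def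
proof (intro conjI AE_lebesgue_if_AE_intervals)
  show "locally_abs_continuous f"
    unfolding locally_abs_continuous_def
  proof (intro allI impI)
    fix a b :: real assume ab: "0 < a \<and> a \<le> b"
    let ?G = "\<lambda>x. integral {a..x} g"
    have G: "abs_continuous_on {a..b} ?G"
      by (rule abs_continuous_on_indefinite_integral) (use ai ab in auto)
    have fG: "f x = f a + ?G x" if "x \<in> {a..b}" for x using eq[of a x] ab that by simp
    show "abs_continuous_on {a..b} f"
    proof (rule abs_continuous_on_dominated[OF G G, where C = 1])
      show "\<bar>f v - f u\<bar> \<le> 1 * (\<bar>?G v - ?G u\<bar> + \<bar>?G v - ?G u\<bar>)" if "u \<in> {a..b}" "v \<in> {a..b}" for u v
        unfolding fG[OF that(1)] fG[OF that(2)] by simp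
    qed simp
  qed
  fix a b :: real assume ab: "0 < a" "a < b"
  obtain N where N: "negligible N"
    "\<And>x. x \<in> {a<..<b} - N \<Longrightarrow> ((\<lambda>x. integral {a..x} g) has_real_derivative g x) (at x)"
    using indefinite_integral_derivative_ae[OF ai[of a b]] ab by auto
  have "AE x in lebesgue. x \<notin> N" using N(1) by (simp add: AE_lebesgue_iff_negligible)
  then show "AE x in lebesgue. x \<in> {a<..<b} \<longrightarrow> (f has_real_derivative g x) (at x)"
  proof eventually_elim
    case (elim x)
    show ?case
    proof
      assume x: "x \<in> {a<..<b}"
      have "((\<lambda>x. f a + integral {a..x} g) has_real_derivative g x) (at x)"
        using N(2)[of x] x elim by (auto intro!: derivative_eq_intros)
      then show "(f has_real_derivative g x) (at x)"
      proof (rule has_field_derivative_transform_within_open[of _ _ _ "{a<..<b}"])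
        show "f a + integral {a..y} g = f y" if "y \<in> {a<..<b}" for y
          using eq[of a y] ab that by simp
      qed (use x in auto)
    qed
  qed
qed

lemma ac_deriv_mono:
  assumes "ac_deriv f g" "AE x in lebesgue. 0 < x \<longrightarrow> 0 \<le> g x" "0 < a" "a \<le> b"
  shows "f a \<le> f b"
proof -
  have "0 \<le> f b - f a"
    by (rule has_integral_le_AE[OF has_integral_0 ac_deriv_has_integral[OF assms(1,3,4)]])
      (use assms(2,3) in \<open>auto elim!: eventually_mono\<close>)
  then show ?thesis by simp
qed

text \<open>Measurability is given on the open half-line and the bound may fail at \<open>a\<close>,
  which can be 0. Removing the single point \<open>a\<close> changes neither integrability nor the
  integral.\<close>

lemma absolutely_integrable_dominated:
  fixes f h :: "real \<Rightarrow> real"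
  assumes f: "f \<in> borel_measurable (lebesgue_on {0<..})" and "0 \<le> a" and h: "h integrable_on {a..b}"
    and le: "\<And>x. a < x \<Longrightarrow> x \<le> b \<Longrightarrow> \<bar>f x\<bar> \<le> h x"
  shows "f absolutely_integrable_on {a..b}"
proof -
  have s: "{a<..b} \<subseteq> {a..b}" "{a..b} - {a<..b} \<subseteq> {a}" by auto
  have neg: "negligible ({a..b} - {a<..b})" by (rule negligible_subset[of "{a}"]) auto
  have "({a..b} - {a<..b}) \<union> ({a<..b} - {a..b}) = {a..b} - {a<..b}" by auto
  then have "h integrable_on {a<..b}"
    using h integrable_spike_set_eq[of "{a..b}" "{a<..b}" h] neg by simp
  moreover have "f \<in> borel_measurable (lebesgue_on {a<..b})"
    by (rule measurable_restrict_mono[OF f]) (use \<open>0 \<le> a\<close> in auto)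
  ultimately have "f absolutely_integrable_on {a<..b}"
    by (intro measurable_bounded_by_integrable_imp_absolutely_integrable) (auto simp: le)
  then show ?thesis
    by (rule absolutely_integrable_spike_set) (auto intro: negligible_subset[of "{a}"])
qed

section \<open>The operator in divergence form\<close>

lemma continuous_measurable: "continuous_on {0<..} g \<Longrightarrow> g \<in> borel_measurable (lebesgue_on {0<..})"
  for g :: "real \<Rightarrow> real"
  by (rule continuous_imp_measurable_on_sets_lebesgue) auto

locale radial =
  fixes n r1 r2 :: real and R :: "real \<Rightarrow> real"
  assumes n_pos: "0 < n" and n_less: "n < 2" and r1_pos: "0 < r1"
    and R_borel: "R \<in> borel_measurable (restrict_space borel {0<..})"
    and R_lower: "\<And>x. 0 < x \<Longrightarrow> r1 \<le> R x" and R_upper: "\<And>x. 0 < x \<Longrightarrow> R x \<le> r2"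
begin

lemma R_pos: "0 < x \<Longrightarrow> 0 < R x"
  using R_lower[of x] r1_pos by linarith

lemma r2_pos: "0 < r2"
  using R_lower[of 1] R_upper[of 1] r1_pos by linarith

lemma R_measurable: "R \<in> borel_measurable (lebesgue_on {0<..})"
proof -
  have "(\<lambda>x. indicator {0<..} x *\<^sub>R R x) \<in> borel_measurable borel"
    using R_borel by (subst (asm) borel_measurable_restrict_space_iff) auto
  then have "(\<lambda>x. indicator {0<..} x *\<^sub>R R x) \<in> borel_measurable lebesgue"
    by (auto intro: measurable_completion)
  then have "(\<lambda>x. indicator {0<..} x *\<^sub>R R x) \<in> borel_measurable (lebesgue_on {0<..})"
    by (rule measurable_restrict_space1)
  then show ?thesis by (subst measurable_lebesgue_cong[of _ _ "\<lambda>x. indicator {0<..} x *\<^sub>R R x"]) auto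
qed

section \<open>The drift exponent and the two densities\<close>

definition E :: "real \<Rightarrow> real" where "E x = (LBINT v=0..x. v / R v)"

definition P :: "real \<Rightarrow> real" where "P x = x powr (n - 1) * exp (E x)"

abbreviation w :: "real \<Rightarrow> real" where "w \<equiv> weight n R"

lemma drift_bounds: "0 < v \<Longrightarrow> v / r2 \<le> v / R v" "0 < v \<Longrightarrow> v / R v \<le> v / r1"
  using R_lower[of v] R_upper[of v] R_pos[of v] r1_pos r2_pos by (auto intro!: divide_left_mono mult_pos_pos)

lemma drift_integrable: "0 \<le> a \<Longrightarrow> (\<lambda>v. v / R v) absolutely_integrable_on {a..b}"
proof (rule absolutely_integrable_dominated[where h = "\<lambda>v. v / r1"])
  show "(\<lambda>v. v / R v) \<in> borel_measurable (lebesgue_on {0<..})"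
    by (intro borel_measurable_divide R_measurable continuous_measurable continuous_intros)
  show "(\<lambda>v. v / r1) integrable_on {a..b}" by (intro integrable_continuous_interval continuous_intros) (use r1_pos in auto)
  show "\<bar>v / R v\<bar> \<le> v / r1" if "0 \<le> a" "a < v" for v using drift_bounds(2)[of v] R_pos[of v] that by simp
qed auto

lemma drift_integrable_on: "0 \<le> a \<Longrightarrow> (\<lambda>v. v / R v) integrable_on {a..b}"
  using drift_integrable[of a b] by (simp add: absolutely_integrable_on_def)

text \<open>The interval integral in the definition is taken over \<open>lborel\<close>, whereas
  \<open>drift_integrable\<close> speaks of Lebesgue measure. Borel measurability of
  \<open>R\<close> carries integrability from the completion back to \<open>lborel\<close>.\<close>

lemma E_eq: "0 \<le> x \<Longrightarrow> E x = integral {0..x} (\<lambda>v. v / R v)"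
proof -
  assume x: "0 \<le> x"
  have Rb: "(\<lambda>x. indicator {0<..} x *\<^sub>R R x) \<in> borel_measurable borel"
    using R_borel by (subst (asm) borel_measurable_restrict_space_iff) auto
  have "(\<lambda>v. indicator {0..x} v *\<^sub>R (v / R v))
      = (\<lambda>v. indicator {0..x} v * (v / (indicator {0<..} v *\<^sub>R R v)))"
    by (auto simp: indicator_def fun_eq_iff)
  also have "\<dots> \<in> borel_measurable borel" using Rb by measurable
  finally have "(\<lambda>v. indicator {0..x} v *\<^sub>R (v / R v)) \<in> borel_measurable lborel" by simp
  from integrable_completion[OF this]
  have "set_integrable lborel {0..x} (\<lambda>v. v / R v)"
    using drift_integrable[of 0 x] unfolding set_integrable_def by simp
  from interval_integral_eq_integral[OF x this] show ?thesis by (simp add: E_def zero_ereal_def)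
qed

lemma E_0 [simp]: "E 0 = 0"
  by (simp add: E_eq)

lemma E_diff: "0 \<le> a \<Longrightarrow> a \<le> b \<Longrightarrow> E b - E a = integral {a..b} (\<lambda>v. v / R v)"
  using Henstock_Kurzweil_Integration.integral_combine[of 0 a b "\<lambda>v. v / R v"] drift_integrable_on[of 0 b]
  by (simp add: E_eq)

lemma integral_id: "a \<le> b \<Longrightarrow> 0 < c \<Longrightarrow> integral {a..b} (\<lambda>v. v / c) = (b\<^sup>2 - a\<^sup>2) / (2 * c)" for c :: real
proof -
  assume "a \<le> b" "0 < c"
  then have "((\<lambda>v. v / c) has_integral (b\<^sup>2 / (2 * c) - a\<^sup>2 / (2 * c))) {a..b}"
    by (intro fundamental_theorem_of_calculus)
      (auto intro!: derivative_eq_intros simp flip: has_real_derivative_iff_has_vector_derivative)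
  from integral_unique[OF this] show ?thesis unfolding diff_divide_distrib .
qed

text \<open>Together with \<open>E_upper\<close> this places the growth of \<open>P\<close> between
  Gaussian factors of rates \<open>1 / (2 * r2)\<close> and \<open>1 / (2 * r1)\<close>.\<close>

lemma E_lower:
  assumes "0 \<le> a" "a \<le> b"
  shows "(b\<^sup>2 - a\<^sup>2) / (2 * r2) \<le> E b - E a"
proof -
  have "integral {a..b} (\<lambda>v. v / r2) \<le> integral {a..b} (\<lambda>v. v / R v)"
  proof (rule integral_le[OF _ drift_integrable_on[OF assms(1)]])
    show "v / r2 \<le> v / R v" if "v \<in> {a..b}" for v
      using drift_bounds(1)[of v] that assms by (cases "v = 0") auto
  qed (use r2_pos in \<open>auto intro!: integrable_continuous_interval continuous_intros\<close>)
  then show ?thesis using assms by (simp add: E_diff integral_id r2_pos)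
qed

lemma E_upper:
  assumes "0 \<le> a" "a \<le> b"
  shows "E b - E a \<le> (b\<^sup>2 - a\<^sup>2) / (2 * r1)"
proof -
  have "integral {a..b} (\<lambda>v. v / R v) \<le> integral {a..b} (\<lambda>v. v / r1)"
  proof (rule integral_le[OF drift_integrable_on[OF assms(1)]])
    show "v / R v \<le> v / r1" if "v \<in> {a..b}" for v
      using drift_bounds(2)[of v] that assms by (cases "v = 0") auto
  qed (use r1_pos in \<open>auto intro!: integrable_continuous_interval continuous_intros\<close>)
  then show ?thesis using assms by (simp add: E_diff integral_id r1_pos)
qed

lemma E_mono: "0 \<le> a \<Longrightarrow> a \<le> b \<Longrightarrow> E a \<le> E b"
  using order_trans[OF divide_nonneg_pos E_lower[of a b]] r2_pos power_mono[of a b 2] by simp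

lemma E_nonneg: "0 \<le> x \<Longrightarrow> 0 \<le> E x"
  using E_mono[of 0 x] by simp

lemma ac_deriv_E: "ac_deriv E (\<lambda>x. x / R x)"
  by (rule ac_deriv_indefinite_integral) (auto intro: drift_integrable E_diff)

lemma ac_deriv_exp_E: "ac_deriv (\<lambda>x. exp (c * E x)) (\<lambda>x. exp (c * E x) * (c * (x / R x)))"
  by (rule ac_deriv_exp[OF ac_deriv_cmult[OF ac_deriv_E]])

lemma ac_deriv_powr_exp_E:
  "ac_deriv (\<lambda>x. x powr a * exp (c * E x)) (\<lambda>x. x powr a * exp (c * E x) * (a / x + c * x / R x))"
proof (rule ac_deriv_cong[OF ac_deriv_mult[OF ac_deriv_powr ac_deriv_exp_E]])
  show "AE x in lebesgue. 0 < x \<longrightarrow> x powr a * exp (c * E x) * (a / x + c * x / R x)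
      = a * x powr (a - 1) * exp (c * E x) + x powr a * (exp (c * E x) * (c * (x / R x)))"
    by (auto simp: algebra_simps powr_diff)
qed auto

lemma P_0 [simp]: "P 0 = 0"
  by (simp add: P_def)

lemma P_pos: "0 < x \<Longrightarrow> 0 < P x"
  by (simp add: P_def)

lemma weight_eq: "w x = P x / R x"
  by (simp add: weight_def P_def E_def)

lemma w_pos: "0 < x \<Longrightarrow> 0 < w x"
  by (simp add: weight_eq P_pos R_pos)

lemma w_0 [simp]: "w 0 = 0"
  by (simp add: weight_eq)

lemma ac_deriv_P: "ac_deriv P (\<lambda>x. P x * ((n - 1) / x + x / R x))"
  using ac_deriv_powr_exp_E[of "n - 1" 1] by (simp add: P_def[abs_def])

lemma P_continuous: "continuous_on {0<..} P"
  by (rule ac_deriv_continuous_on[OF ac_deriv_P])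

lemma P_measurable: "P \<in> borel_measurable (lebesgue_on {0<..})"
  by (rule continuous_measurable[OF P_continuous])

lemma w_measurable: "w \<in> borel_measurable (lebesgue_on {0<..})"
  unfolding weight_eq[abs_def] by (intro borel_measurable_divide R_measurable P_measurable)

lemma P_le: "0 < s \<Longrightarrow> s \<le> x \<Longrightarrow> P s \<le> s powr (n - 1) * exp (E x)"
  unfolding P_def using E_mono[of s x] by (intro mult_left_mono) auto

lemma w_le: "0 < s \<Longrightarrow> s \<le> x \<Longrightarrow> w s \<le> s powr (n - 1) * exp (E x) / r1"
proof -
  assume s: "0 < s" "s \<le> x"
  have "w s \<le> P s / r1" unfolding weight_eq
    using R_lower[OF s(1)] R_pos[OF s(1)] P_pos[OF s(1)] r1_pos by (intro divide_left_mono) auto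
  also have "\<dots> \<le> s powr (n - 1) * exp (E x) / r1"
    using P_le[OF s] r1_pos by (intro divide_right_mono) auto
  finally show ?thesis .
qed

lemma has_integral_powr_n: "0 \<le> x \<Longrightarrow> ((\<lambda>s. s powr (n - 1)) has_integral (x powr n / n)) {0..x}"
  using has_integral_powr_from_0[of "n - 1" x] n_pos by simp

text \<open>Near 0 the weight is at most a multiple of \<open>s powr (n - 1)\<close>, which is
  integrable because n > 0.\<close>

lemma wg_integrable:
  assumes g: "g \<in> borel_measurable (lebesgue_on {0<..})" and "0 \<le> a"
    and bd: "\<And>s. 0 < s \<Longrightarrow> s \<le> x \<Longrightarrow> \<bar>g s\<bar> \<le> C"
  shows "(\<lambda>s. w s * g s) absolutely_integrable_on {a..x}"
proof (cases "0 \<le> x")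
  case True
  have int: "(\<lambda>s. C * exp (E x) / r1 * s powr (n - 1)) integrable_on {0..x}"
    using has_integral_mult_right[OF has_integral_powr_n[OF True]] by blast
  show ?thesis
  proof (rule absolutely_integrable_dominated[OF _ \<open>0 \<le> a\<close>])
    show "(\<lambda>s. w s * g s) \<in> borel_measurable (lebesgue_on {0<..})"
      by (intro borel_measurable_times w_measurable g)
    show "(\<lambda>s. C * exp (E x) / r1 * s powr (n - 1)) integrable_on {a..x}"
      by (rule integrable_on_subinterval[OF int]) (use \<open>0 \<le> a\<close> in auto)
    fix s assume "a < s" "s \<le> x"
    then have s: "0 < s" "s \<le> x" using \<open>0 \<le> a\<close> by auto
    have "\<bar>w s * g s\<bar> \<le> (s powr (n - 1) * exp (E x) / r1) * C"
      unfolding abs_mult using w_le[OF s] w_pos[OF s(1)] bd[OF s] by (intro mult_mono) auto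
    then show "\<bar>w s * g s\<bar> \<le> C * exp (E x) / r1 * s powr (n - 1)" by (simp add: algebra_simps)
  qed
next
  case False
  then show ?thesis using \<open>0 \<le> a\<close> by (simp add: set_integrable_def)
qed

lemma wg_integrable_on:
  assumes "g \<in> borel_measurable (lebesgue_on {0<..})" "0 \<le> a"
    and "\<And>s. 0 < s \<Longrightarrow> s \<le> x \<Longrightarrow> \<bar>g s\<bar> \<le> C"
  shows "(\<lambda>s. w s * g s) integrable_on {a..x}"
  using wg_integrable[OF assms] by (simp add: absolutely_integrable_on_def)

lemma integral_wg_bound:
  assumes g: "g \<in> borel_measurable (lebesgue_on {0<..})" and x: "0 \<le> x"
    and bd: "\<And>s. 0 < s \<Longrightarrow> s \<le> x \<Longrightarrow> \<bar>g s\<bar> \<le> C"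
  shows "\<bar>integral {0..x} (\<lambda>s. w s * g s)\<bar> \<le> C * exp (E x) / r1 * (x powr n / n)"
proof -
  have hi: "((\<lambda>s. C * exp (E x) / r1 * s powr (n - 1)) has_integral (C * exp (E x) / r1 * (x powr n / n))) {0..x}"
    by (intro has_integral_mult_right has_integral_powr_n[OF x])
  have "norm (integral {0..x} (\<lambda>s. w s * g s)) \<le> integral {0..x} (\<lambda>s. C * exp (E x) / r1 * s powr (n - 1))"
  proof (rule integral_norm_bound_integral)
    show "(\<lambda>s. w s * g s) integrable_on {0..x}" by (rule wg_integrable_on[OF g _ bd]) auto
    show "(\<lambda>s. C * exp (E x) / r1 * s powr (n - 1)) integrable_on {0..x}" using hi by blast
    fix s assume "s \<in> {0..x}"
    show "norm (w s * g s) \<le> C * exp (E x) / r1 * s powr (n - 1)"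
    proof (cases "s = 0")
      case False
      then have s: "0 < s" "s \<le> x" using \<open>s \<in> {0..x}\<close> by auto
      have "\<bar>w s * g s\<bar> \<le> (s powr (n - 1) * exp (E x) / r1) * C"
        unfolding abs_mult using w_le[OF s] w_pos[OF s(1)] bd[OF s] by (intro mult_mono) auto
      then show ?thesis by (simp add: algebra_simps)
    qed simp
  qed
  then show ?thesis using integral_unique[OF hi] by simp
qed

text \<open>\<open>M g\<close> is the derivative of the solution u of L u = g with zero flux at 0,
  and \<open>T g\<close> is that solution normalised by u(0) = 0.\<close>

definition M :: "(real \<Rightarrow> real) \<Rightarrow> real \<Rightarrow> real" where
  "M g x = integral {0..x} (\<lambda>s. w s * g s) / P x"

definition T :: "(real \<Rightarrow> real) \<Rightarrow> real \<Rightarrow> real" where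
  "T g x = integral {0..x} (M g)"

lemma M_0 [simp]: "M g 0 = 0"
  by (simp add: M_def)

text \<open>Since \<open>E\<close> is increasing, the exponential factors of numerator and
  denominator cancel. What remains depends on \<open>R\<close> only through
  \<open>r1\<close>.\<close>

lemma M_bound:
  assumes g: "g \<in> borel_measurable (lebesgue_on {0<..})" and x: "0 < x"
    and bd: "\<And>s. 0 < s \<Longrightarrow> s \<le> x \<Longrightarrow> \<bar>g s\<bar> \<le> C"
  shows "\<bar>M g x\<bar> \<le> C * x / (n * r1)"
proof -
  have "\<bar>M g x\<bar> = \<bar>integral {0..x} (\<lambda>s. w s * g s)\<bar> / P x" using P_pos[OF x] by (simp add: M_def)
  also have "\<dots> \<le> (C * exp (E x) / r1 * (x powr n / n)) / P x"
    using integral_wg_bound[OF g _ bd] P_pos[OF x] x by (intro divide_right_mono) auto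
  also have "\<dots> = C * x / (n * r1)"
    using x by (simp add: P_def powr_diff field_simps)
  finally show ?thesis .
qed

lemma continuous_on_Icc_bound:
  fixes g :: "real \<Rightarrow> real"
  assumes "continuous_on {0..} g"
  obtains C where "0 \<le> C" "\<And>s. 0 \<le> s \<Longrightarrow> s \<le> x \<Longrightarrow> \<bar>g s\<bar> \<le> C"
proof -
  have "continuous_on {0..x} g" by (rule continuous_on_subset[OF assms]) auto
  then obtain C where C: "0 \<le> C" "\<And>s. s \<in> {0..x} \<Longrightarrow> \<bar>g s\<bar> \<le> C"
    by (rule continuous_on_interval_bounded) blast
  show ?thesis
  proof (rule that[OF C(1)])
    show "\<bar>g s\<bar> \<le> C" if "0 \<le> s" "s \<le> x" for s using C(2)[of s] that by simp
  qed
qed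

lemma continuous_measurable_0: "continuous_on {0..} g \<Longrightarrow> g \<in> borel_measurable (lebesgue_on {0<..})"
  for g :: "real \<Rightarrow> real"
  by (intro continuous_measurable) (auto elim: continuous_on_subset)

text \<open>At 0 the definition divides by \<open>P 0 = 0\<close> and yields 0; the bound linear in
  the argument shows that this is also the limit.\<close>

lemma M_continuous:
  assumes g: "continuous_on {0..} g"
  shows "continuous_on {0..} (M g)"
proof -
  note gm = continuous_measurable_0[OF g]
  have c1: "continuous_on {0<..} (M g)"
  proof (rule continuous_at_imp_continuous_on, rule ballI)
    fix x :: real assume x: "x \<in> {0<..}"
    obtain C where C: "\<And>s. 0 \<le> s \<Longrightarrow> s \<le> 2 * x \<Longrightarrow> \<bar>g s\<bar> \<le> C"
      using continuous_on_Icc_bound[OF g] by blast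
    have "(\<lambda>s. w s * g s) integrable_on {0..2*x}" by (rule wg_integrable_on[OF gm _ C]) auto
    from indefinite_integral_continuous_1[OF this]
    have "isCont (\<lambda>t. integral {0..t} (\<lambda>s. w s * g s)) x"
      by (rule continuous_on_interior) (use x in \<open>auto simp: interior_atLeastAtMost_real\<close>)
    moreover have "isCont P x" using P_continuous x by (simp add: continuous_on_eq_continuous_at)
    moreover have "P x \<noteq> 0" using P_pos[of x] x by simp
    ultimately show "isCont (M g) x" unfolding M_def[abs_def] by (rule isCont_divide)
  qed
  show ?thesis
    unfolding continuous_on_eq_continuous_within
  proof
    fix x :: real assume "x \<in> {0..}"
    show "continuous (at x within {0..}) (M g)"
    proof (cases "x = 0")
      case False
      then have "isCont (M g) x" using c1 \<open>x \<in> {0..}\<close> by (simp add: continuous_on_eq_continuous_at)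
      then show ?thesis by (rule continuous_at_imp_continuous_at_within)
    next
      case True
      obtain C where C: "0 \<le> C" "\<And>s. 0 \<le> s \<Longrightarrow> s \<le> 1 \<Longrightarrow> \<bar>g s\<bar> \<le> C"
        using continuous_on_Icc_bound[OF g] by blast
      have "((\<lambda>t. C * t / (n * r1)) \<longlongrightarrow> C * 0 / (n * r1)) (at 0 within {0..})"
        by (intro tendsto_intros) (use n_pos r1_pos in auto)
      moreover have "eventually (\<lambda>t. norm (M g t) \<le> C * t / (n * r1)) (at 0 within {0..})"
        unfolding eventually_at
      proof (intro exI[of _ 1] conjI ballI impI)
        fix t :: real assume "t \<in> {0..}" "t \<noteq> 0 \<and> dist t 0 < 1"
        then have t: "0 < t" "t < 1" by (auto simp: dist_real_def)
        show "norm (M g t) \<le> C * t / (n * r1)"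
          using M_bound[OF gm t(1), of C] C(2) t by simp
      qed simp
      ultimately have "(M g \<longlongrightarrow> 0) (at 0 within {0..})"
        by (intro Lim_null_comparison[of "M g" "\<lambda>t. C * t / (n * r1)"]) auto
      then show ?thesis using True by (simp add: continuous_within)
    qed
  qed
qed

lemma T_0 [simp]: "T g 0 = 0"
  by (simp add: T_def)

lemma T_deriv_within:
  assumes g: "continuous_on {0..} g" and "0 \<le> x" "x \<le> X"
  shows "(T g has_real_derivative M g x) (at x within {0..X})"
  unfolding T_def[abs_def]
  by (rule integral_has_real_derivative) (use assms M_continuous[OF g] in \<open>auto elim: continuous_on_subset\<close>)

lemma T_deriv:
  assumes g: "continuous_on {0..} g" and "0 < x"
  shows "(T g has_real_derivative M g x) (at x)"
proof -
  have "(T g has_real_derivative M g x) (at x within {0..2*x})"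
    by (rule T_deriv_within[OF g]) (use assms in auto)
  moreover have "at x within {0..2*x} = at x"
    by (rule at_within_interior) (use assms(2) in \<open>simp add: interior_atLeastAtMost_real\<close>)
  ultimately show ?thesis by simp
qed

lemma T_continuous:
  assumes g: "continuous_on {0..} g"
  shows "continuous_on {0..} (T g)"
  unfolding continuous_on_eq_continuous_within
proof
  fix x :: real assume x: "x \<in> {0..}"
  have "continuous (at x within {0..x+1}) (T g)"
    using T_deriv_within[OF g, of x "x + 1"] x by (auto intro: DERIV_continuous)
  moreover have "at x within {0..x+1} = at x within {0..}"
    by (rule at_within_nhd[of _ "{..<x+1}"]) auto
  ultimately show "continuous (at x within {0..}) (T g)" by (simp add: continuous_within)
qed

text \<open>Each application of \<open>T\<close> gains two powers of the argument and a factor of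
  order 1 / k, so iterates of \<open>T\<close> are bounded by the terms of an exponential
  series.\<close>

lemma T_bound:
  assumes g: "continuous_on {0..} g" and x: "0 \<le> x" and "0 \<le> C"
    and bd: "\<And>t. 0 \<le> t \<Longrightarrow> t \<le> x \<Longrightarrow> \<bar>g t\<bar> \<le> C * t ^ (2 * k)"
  shows "\<bar>T g x\<bar> \<le> C * x ^ (2 * k + 2) / (n * r1 * (2 * k + 2))"
proof -
  define K where "K = C / (n * r1)"
  have K: "0 \<le> K" using \<open>0 \<le> C\<close> n_pos r1_pos by (simp add: K_def)
  have hi: "((\<lambda>t. K * t ^ (2 * k + 1)) has_integral
      (K * x ^ (2 * k + 2) / (2 * k + 2) - K * 0 ^ (2 * k + 2) / (2 * k + 2))) {0..x}"
  proof (rule fundamental_theorem_of_calculus[OF x])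
    fix t :: real
    have "((\<lambda>t. K * t ^ (2 * k + 2) / (2 * k + 2)) has_real_derivative K * t ^ (2 * k + 1)) (at t within {0..x})"
    proof -
      have "((\<lambda>t. t ^ (2 * k + 2)) has_real_derivative real (2 * k + 2) * t ^ (2 * k + 1)) (at t within {0..x})"
        using has_field_derivative_at_within[OF DERIV_pow[of "2 * k + 2" t]] by simp
      from DERIV_cmult[OF this, of "K / (2 * k + 2)"]
      have "((\<lambda>t. K / (2 * k + 2) * t ^ (2 * k + 2)) has_real_derivative
          K / (2 * k + 2) * (real (2 * k + 2) * t ^ (2 * k + 1))) (at t within {0..x})" .
      moreover have "K / (2 * k + 2) * (real (2 * k + 2) * t ^ (2 * k + 1)) = K * t ^ (2 * k + 1)"
        by (simp del: power_Suc)
      ultimately show ?thesis by (simp add: mult.commute del: power_Suc)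
    qed
    then show "((\<lambda>t. K * t ^ (2 * k + 2) / (2 * k + 2)) has_vector_derivative K * t ^ (2 * k + 1)) (at t within {0..x})"
      by (simp add: has_real_derivative_iff_has_vector_derivative)
  qed
  have "norm (integral {0..x} (M g)) \<le> integral {0..x} (\<lambda>t. K * t ^ (2 * k + 1))"
  proof (rule integral_norm_bound_integral)
    show "M g integrable_on {0..x}"
      by (intro integrable_continuous_interval continuous_on_subset[OF M_continuous[OF g]]) auto
    show "(\<lambda>t. K * t ^ (2 * k + 1)) integrable_on {0..x}" using hi by blast
    fix t assume t: "t \<in> {0..x}"
    show "norm (M g t) \<le> K * t ^ (2 * k + 1)"
    proof (cases "t = 0")
      case False
      have "\<bar>M g t\<bar> \<le> (C * t ^ (2 * k)) * t / (n * r1)"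
      proof (rule M_bound[OF continuous_measurable_0[OF g]])
        fix s assume s: "0 < s" "s \<le> t"
        have "\<bar>g s\<bar> \<le> C * s ^ (2 * k)" using bd[of s] s t by simp
        also have "\<dots> \<le> C * t ^ (2 * k)" using s \<open>0 \<le> C\<close> by (intro mult_left_mono power_mono) auto
        finally show "\<bar>g s\<bar> \<le> C * t ^ (2 * k)" .
      qed (use t False in auto)
      then show ?thesis by (simp add: K_def algebra_simps)
    qed (use K in simp)
  qed
  then show ?thesis using integral_unique[OF hi] by (simp add: T_def K_def field_simps)
qed

lemma wg_integrable_cont:
  assumes "continuous_on {0..} g" "0 \<le> a"
  shows "(\<lambda>s. w s * g s) absolutely_integrable_on {a..x}" "(\<lambda>s. w s * g s) integrable_on {a..x}"
proof -
  obtain C where C: "\<And>s. 0 \<le> s \<Longrightarrow> s \<le> x \<Longrightarrow> \<bar>g s\<bar> \<le> C"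
    using continuous_on_Icc_bound[OF assms(1)] by blast
  show "(\<lambda>s. w s * g s) absolutely_integrable_on {a..x}"
    by (rule wg_integrable[OF continuous_measurable_0[OF assms(1)] assms(2) C]) auto
  then show "(\<lambda>s. w s * g s) integrable_on {a..x}" by (simp add: absolutely_integrable_on_def)
qed

lemma M_linear:
  assumes "continuous_on {0..} g" "continuous_on {0..} h"
  shows "M (\<lambda>x. a * g x + b * h x) x = a * M g x + b * M h x"
proof -
  have "integral {0..x} (\<lambda>s. w s * (a * g s + b * h s))
      = integral {0..x} (\<lambda>s. a * (w s * g s) + b * (w s * h s))"
    by (simp add: algebra_simps)
  also have "\<dots> = a * integral {0..x} (\<lambda>s. w s * g s) + b * integral {0..x} (\<lambda>s. w s * h s)"
    using wg_integrable_cont(2)[OF assms(1), of 0 x] wg_integrable_cont(2)[OF assms(2), of 0 x]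
    by (subst integral_add) (auto intro: integrable_on_mult_right)
  finally show ?thesis by (simp add: M_def add_divide_distrib)
qed

lemma T_linear:
  assumes "continuous_on {0..} g" "continuous_on {0..} h"
  shows "T (\<lambda>x. a * g x + b * h x) x = a * T g x + b * T h x"
proof -
  have "M (\<lambda>x. a * g x + b * h x) = (\<lambda>x. a * M g x + b * M h x)" using M_linear[OF assms] by blast
  moreover have "M g integrable_on {0..x}" "M h integrable_on {0..x}"
    using M_continuous[OF assms(1)] M_continuous[OF assms(2)]
    by (auto intro!: integrable_continuous_interval intro: continuous_on_subset)
  ultimately show ?thesis by (simp add: T_def integral_add integrable_on_mult_right)
qed

text \<open>Feeding the fixed point equation repeatedly into \<open>T_bound\<close> bounds
  \<open>g\<close> by C (c x^2)^k / k! for every \<open>k\<close>. The factorial wins for all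
  \<open>s\<close> and \<open>x\<close>, however large.\<close>

lemma T_fixed_point_zero:
  assumes g: "continuous_on {0..} g" and fp: "\<And>x. 0 \<le> x \<Longrightarrow> g x = s * T g x" and "0 \<le> x"
  shows "g x = 0"
proof -
  obtain C where C: "0 \<le> C" "\<And>t. 0 \<le> t \<Longrightarrow> t \<le> x \<Longrightarrow> \<bar>g t\<bar> \<le> C"
    using continuous_on_Icc_bound[OF g] by blast
  define c where "c = \<bar>s\<bar> / (2 * n * r1)"
  have c: "0 \<le> c" using n_pos r1_pos by (simp add: c_def)
  have B: "\<bar>g t\<bar> \<le> C * c ^ k / fact k * t ^ (2 * k)" if "0 \<le> t" "t \<le> x" for k t
    using that
  proof (induction k arbitrary: t)
    case 0
    then show ?case using C(2)[of t] by simp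
  next
    case (Suc k)
    have "\<bar>T g t\<bar> \<le> (C * c ^ k / fact k) * t ^ (2 * k + 2) / (n * r1 * (2 * k + 2))"
      by (rule T_bound[OF g Suc.prems(1)]) (use Suc C c in auto)
    then have "\<bar>g t\<bar> \<le> \<bar>s\<bar> * ((C * c ^ k / fact k) * t ^ (2 * k + 2) / (n * r1 * (2 * k + 2)))"
      unfolding fp[OF Suc.prems(1)] abs_mult by (intro mult_left_mono) auto
    also have "\<dots> = C * c ^ Suc k / fact (Suc k) * t ^ (2 * Suc k)"
      using n_pos r1_pos by (simp add: c_def divide_simps)
    finally show ?case .
  qed
  have "(\<lambda>k. (c * x\<^sup>2) ^ k / fact k) \<longlonglongrightarrow> 0"
    using summable_LIMSEQ_zero[OF summable_exp[of "c * x\<^sup>2"]] by (simp add: divide_inverse mult.commute)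
  from tendsto_mult_right[OF this, of C]
  have "(\<lambda>k. C * c ^ k / fact k * x ^ (2 * k)) \<longlonglongrightarrow> 0"
    by (simp add: power_mult_distrib mult_ac flip: power_mult)
  then have "\<bar>g x\<bar> \<le> 0" by (rule Lim_bounded2[OF _, rule_format]) (use B \<open>0 \<le> x\<close> in auto)
  then show ?thesis by simp
qed

end

section \<open>Fundamental solutions\<close>

context radial
begin

primrec A :: "nat \<Rightarrow> real \<Rightarrow> real" where
  "A 0 = (\<lambda>x. 1)"
| "A (Suc k) = T (A k)"

text \<open>The Neumann series of \<open>y = 1 + s T y\<close>, the integrated form of the eigenvalue equation with
  \<open>y(0) = 1\<close> and zero flux at \<open>0\<close>.\<close>

definition y :: "real \<Rightarrow> real \<Rightarrow> real" where
  "y s x = (\<Sum>k. s ^ k * A k x)"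

definition dy :: "real \<Rightarrow> real \<Rightarrow> real" where
  "dy s x = s * M (y s) x"

lemma A_continuous: "continuous_on {0..} (A k)"
  by (induction k) (auto intro: T_continuous continuous_intros)

lemma A_bound: "0 \<le> x \<Longrightarrow> \<bar>A k x\<bar> \<le> (1 / (2 * n * r1)) ^ k / fact k * x ^ (2 * k)"
proof (induction k arbitrary: x)
  case (Suc k)
  let ?c = "1 / (2 * n * r1)"
  have c: "0 \<le> ?c" using n_pos r1_pos by simp
  have "\<bar>T (A k) x\<bar> \<le> (?c ^ k / fact k) * x ^ (2 * k + 2) / (n * r1 * (2 * k + 2))"
    by (rule T_bound[OF A_continuous Suc.prems]) (use Suc.IH c in auto)
  also have "\<dots> = ?c ^ Suc k / fact (Suc k) * x ^ (2 * Suc k)"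
    using n_pos r1_pos by (simp add: divide_simps)
  finally show ?case by simp
qed simp

lemma term_bound:
  assumes "0 \<le> x" "\<bar>s\<bar> \<le> S"
  shows "\<bar>s ^ k * A k x\<bar> \<le> (S * x\<^sup>2 / (2 * n * r1)) ^ k / fact k"
proof -
  have "\<bar>s ^ k * A k x\<bar> \<le> S ^ k * ((1 / (2 * n * r1)) ^ k / fact k * x ^ (2 * k))"
    unfolding abs_mult power_abs using assms A_bound[OF assms(1)]
    by (intro mult_mono power_mono) (auto intro: order_trans[OF abs_ge_zero])
  also have "\<dots> = (S * x\<^sup>2 / (2 * n * r1)) ^ k / fact k"
    by (simp add: power_mult_distrib power_divide mult_ac flip: power_mult)
  finally show ?thesis .
qed

lemma exp_summable: "summable (\<lambda>k. (c :: real) ^ k / fact k)"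
  using summable_exp[of c] by (simp add: divide_inverse mult.commute)

lemma y_bound:
  assumes "0 \<le> x" "\<bar>s\<bar> \<le> S"
  shows "\<bar>y s x\<bar> \<le> exp (S * x\<^sup>2 / (2 * n * r1))"
proof -
  let ?c = "S * x\<^sup>2 / (2 * n * r1)"
  have "norm (\<Sum>k. s ^ k * A k x) \<le> (\<Sum>k. ?c ^ k / fact k)"
    by (rule norm_suminf_le[OF _ exp_summable]) (use term_bound[OF assms] in simp)
  also have "(\<Sum>k. ?c ^ k / fact k) = exp ?c"
    unfolding exp_def real_scaleR_def divide_real_def by (intro suminf_cong mult.commute)
  finally show ?thesis unfolding y_def real_norm_def .
qed

definition S :: "real \<Rightarrow> nat \<Rightarrow> real \<Rightarrow> real" where
  "S s N x = (\<Sum>k<N. s ^ k * A k x)"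

lemma S_continuous: "continuous_on {0..} (S s N)"
  unfolding S_def[abs_def] by (intro continuous_intros A_continuous)

lemma S_uniform_limit: "uniform_limit {0..X} (S s) (y s) sequentially"
proof -
  have "uniform_limit {0..X} (\<lambda>N x. \<Sum>k<N. s ^ k * A k x) (\<lambda>x. \<Sum>k. s ^ k * A k x) sequentially"
  proof (rule Weierstrass_m_test[OF _ exp_summable[of "\<bar>s\<bar> * X\<^sup>2 / (2 * n * r1)"]])
    fix k x assume x: "x \<in> {0..X}"
    have "norm (s ^ k * A k x) \<le> (\<bar>s\<bar> * x\<^sup>2 / (2 * n * r1)) ^ k / fact k"
      using term_bound[of x s "\<bar>s\<bar>" k] x by simp
    also have "\<dots> \<le> (\<bar>s\<bar> * X\<^sup>2 / (2 * n * r1)) ^ k / fact k"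
      using x n_pos r1_pos by (intro divide_right_mono power_mono mult_left_mono) auto
    finally show "norm (s ^ k * A k x) \<le> (\<bar>s\<bar> * X\<^sup>2 / (2 * n * r1)) ^ k / fact k" .
  qed
  then show ?thesis unfolding S_def[abs_def] y_def[abs_def] .
qed

lemma y_continuous: "continuous_on {0..} (y s)"
proof -
  have c: "continuous_on {0..X} (y s)" for X
    by (rule uniform_limit_theorem[OF _ S_uniform_limit])
      (auto intro!: always_eventually continuous_on_subset[OF S_continuous])
  show ?thesis
    unfolding continuous_on_eq_continuous_within
  proof
    fix x :: real assume x: "x \<in> {0..}"
    have "continuous (at x within {0..x+1}) (y s)"
      using c[of "x + 1"] x by (simp add: continuous_on_eq_continuous_within)
    moreover have "at x within {0..x+1} = at x within {0..}"
      by (rule at_within_nhd[of _ "{..<x+1}"]) auto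
    ultimately show "continuous (at x within {0..}) (y s)" by (simp add: continuous_within)
  qed
qed

lemma S_Suc: "0 \<le> x \<Longrightarrow> S s (Suc N) x = 1 + s * T (S s N) x"
proof (induction N)
  case 0
  have "S s 0 = (\<lambda>x. 0)" "M (\<lambda>x. 0) = (\<lambda>x. 0)" by (simp_all add: M_def[abs_def] S_def fun_eq_iff)
  then show ?case by (simp add: T_def) (simp add: S_def)
next
  case (Suc N)
  have step: "S s (Suc N) x = S s N x + s ^ N * A N x" for N x by (simp add: S_def)
  then have "S s (Suc N) = (\<lambda>x. 1 * S s N x + s ^ N * A N x)" by (simp add: fun_eq_iff)
  then have "T (S s (Suc N)) x = T (S s N) x + s ^ N * A (Suc N) x"
    using T_linear[OF S_continuous[of s N] A_continuous[of N], of 1 "s ^ N" x] by simp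
  then show ?case using Suc step[of "Suc N" x] by (simp add: algebra_simps)
qed

text \<open>The partial sums satisfy the shifted recursion \<open>S_Suc\<close>, and their uniform
  convergence on \<open>{0..x}\<close> passes through \<open>T\<close> by \<open>T_bound\<close>
  with \<open>k = 0\<close>.\<close>

lemma y_eq:
  assumes "0 \<le> x"
  shows "y s x = 1 + s * T (y s) x"
proof -
  have lim1: "(\<lambda>N. S s N t) \<longlonglongrightarrow> y s t" if "0 \<le> t" for t
    using tendsto_uniform_limitI[OF S_uniform_limit[of s t], of t] that by simp
  have "(\<lambda>N. T (S s N) x) \<longlonglongrightarrow> T (y s) x"
  proof (rule tendstoI)
    fix e :: real assume e: "0 < e"
    define d where "d = e / (x ^ 2 / (n * r1 * 2) + 1)"
    have q: "0 \<le> x ^ 2 / (n * r1 * 2)" using n_pos r1_pos by simp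
    then have d: "0 < d" using e by (auto simp: d_def intro!: divide_pos_pos)
    have "eventually (\<lambda>N. \<forall>t\<in>{0..x}. dist (S s N t) (y s t) < d) sequentially"
      using S_uniform_limit[of s x] d by (simp add: uniform_limit_iff)
    then show "eventually (\<lambda>N. dist (T (S s N) x) (T (y s) x) < e) sequentially"
    proof eventually_elim
      case (elim N)
      have c: "continuous_on {0..} (\<lambda>t. 1 * S s N t + (-1) * y s t)"
        by (intro continuous_intros S_continuous y_continuous)
      have "\<bar>1 * S s N t + (-1) * y s t\<bar> \<le> d * t ^ (2 * 0)" if "0 \<le> t" "t \<le> x" for t
        using elim that by (auto simp: dist_real_def dest!: bspec[of _ _ t])
      from T_bound[OF c assms _ this] d
      have "\<bar>T (\<lambda>t. 1 * S s N t + (-1) * y s t) x\<bar> \<le> d * (x ^ 2 / (n * r1 * 2))"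
        by (simp add: power2_eq_square)
      also have "T (\<lambda>t. 1 * S s N t + (-1) * y s t) x = T (S s N) x - T (y s) x"
        using T_linear[OF S_continuous[of s N] y_continuous[of s], of 1 "-1" x] by simp
      finally have "\<bar>T (S s N) x - T (y s) x\<bar> \<le> d * (x ^ 2 / (n * r1 * 2))" .
      also have "\<dots> < d * (x ^ 2 / (n * r1 * 2) + 1)" using d by (simp add: distrib_left)
      also have "\<dots> = e" using q by (simp add: d_def)
      finally show ?case by (simp add: dist_real_def)
    qed
  qed
  then have "(\<lambda>N. 1 + s * T (S s N) x) \<longlonglongrightarrow> 1 + s * T (y s) x" by (intro tendsto_intros)
  moreover have "(\<lambda>N. 1 + s * T (S s N) x) \<longlonglongrightarrow> y s x"
    using LIMSEQ_Suc[OF lim1[OF assms]] S_Suc[OF assms] by simp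
  ultimately show ?thesis by (rule LIMSEQ_unique[symmetric])
qed

lemma y_0 [simp]: "y s 0 = 1"
  using y_eq[of 0 s] by simp

lemma y_deriv:
  assumes "0 < x"
  shows "(y s has_real_derivative dy s x) (at x)"
proof -
  have "((\<lambda>x. 1 + s * T (y s) x) has_real_derivative s * M (y s) x) (at x)"
    by (auto intro!: derivative_eq_intros T_deriv[OF y_continuous assms])
  then show ?thesis
    unfolding dy_def
    by (rule has_field_derivative_transform_within_open[of _ _ _ "{0<..}"])
      (use assms y_eq[of _ s] in \<open>auto\<close>)
qed

lemma dy_continuous: "continuous_on {0..} (dy s)"
  unfolding dy_def[abs_def] by (intro continuous_intros M_continuous y_continuous)

lemma ac_deriv_y: "ac_deriv (y s) (dy s)"
  by (rule ac_deriv_C1[OF y_deriv continuous_on_subset[OF dy_continuous]]) auto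

lemma P_dy: "0 \<le> x \<Longrightarrow> P x * dy s x = s * integral {0..x} (\<lambda>t. w t * y s t)"
  using P_pos[of x] by (cases "x = 0") (auto simp: dy_def M_def)

lemma integral_wg_diff:
  assumes g: "(\<lambda>t. w t * g t) integrable_on {0..b}" and "0 \<le> a" "a \<le> b"
  shows "integral {0..b} (\<lambda>t. w t * g t) - integral {0..a} (\<lambda>t. w t * g t) = integral {a..b} (\<lambda>t. w t * g t)"
  using Henstock_Kurzweil_Integration.integral_combine[OF assms(2,3) g] by simp

text \<open>This is the eigenvalue equation in divergence form.\<close>

lemma ac_deriv_P_dy: "ac_deriv (\<lambda>x. P x * dy s x) (\<lambda>x. s * (w x * y s x))"
proof (rule ac_deriv_cong)
  show "ac_deriv (\<lambda>x. s * integral {0..x} (\<lambda>t. w t * y s t)) (\<lambda>x. s * (w x * y s x))"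
    by (intro ac_deriv_cmult ac_deriv_indefinite_integral wg_integrable_cont y_continuous
        integral_wg_diff) auto
qed (auto simp: P_dy)

lemma dy_bound:
  assumes "0 < x" "x \<le> X" "\<bar>s\<bar> \<le> B"
  shows "\<bar>dy s x\<bar> \<le> B * exp (B * X\<^sup>2 / (2 * n * r1)) * X / (n * r1)"
proof -
  have "0 \<le> B" using assms(3) by linarith
  have "\<bar>M (y s) x\<bar> \<le> exp (B * X\<^sup>2 / (2 * n * r1)) * x / (n * r1)"
  proof (rule M_bound[OF continuous_measurable_0[OF y_continuous] assms(1)])
    fix t assume t: "0 < t" "t \<le> x"
    have "\<bar>y s t\<bar> \<le> exp (B * t\<^sup>2 / (2 * n * r1))" by (rule y_bound) (use t assms in auto)
    also have "\<dots> \<le> exp (B * X\<^sup>2 / (2 * n * r1))"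
      using t assms \<open>0 \<le> B\<close> n_pos r1_pos
      by (subst exp_le_cancel_iff) (intro divide_right_mono mult_left_mono power_mono, auto)
    finally show "\<bar>y s t\<bar> \<le> exp (B * X\<^sup>2 / (2 * n * r1))" .
  qed
  also have "\<dots> \<le> exp (B * X\<^sup>2 / (2 * n * r1)) * X / (n * r1)"
    using assms n_pos r1_pos by (intro divide_right_mono mult_left_mono) auto
  finally have "\<bar>s\<bar> * \<bar>M (y s) x\<bar> \<le> B * (exp (B * X\<^sup>2 / (2 * n * r1)) * X / (n * r1))"
    using assms \<open>0 \<le> B\<close> by (intro mult_mono) auto
  then show ?thesis by (simp add: dy_def abs_mult mult.assoc)
qed

text \<open>The constant does not involve \<open>R\<close> beyond \<open>r1\<close>, so solutions
  for different coefficients are equicontinuous. This lets the argument move when the coefficient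
  converges.\<close>

lemma y_lipschitz:
  assumes "0 \<le> u" "u \<le> X" "0 \<le> v" "v \<le> X" "\<bar>s\<bar> \<le> B"
  shows "\<bar>y s v - y s u\<bar> \<le> B * exp (B * X\<^sup>2 / (2 * n * r1)) * X / (n * r1) * \<bar>v - u\<bar>"
proof -
  define L where "L = B * exp (B * X\<^sup>2 / (2 * n * r1)) * X / (n * r1)"
  have main: "\<bar>y s v - y s u\<bar> \<le> L * \<bar>v - u\<bar>" if "0 \<le> u" "u < v" "v \<le> X" for u v
  proof -
    have "continuous_on {u..v} (y s)" by (rule continuous_on_subset[OF y_continuous]) (use that in auto)
    moreover have "(y s has_derivative (\<lambda>h. dy s z * h)) (at z)" if "u < z" "z < v" for z
      using y_deriv[of z s] that \<open>0 \<le> u\<close> by (simp add: has_field_derivative_def)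
    ultimately obtain z where z: "u < z" "z < v" "y s v - y s u = dy s z * (v - u)"
      using mvt[OF \<open>u < v\<close>, of "y s" "\<lambda>z h. dy s z * h"] by blast
    have "\<bar>dy s z\<bar> \<le> L" unfolding L_def by (rule dy_bound) (use z that assms in auto)
    then show ?thesis using z that by (simp add: abs_mult mult.commute mult_left_mono)
  qed
  have "\<bar>y s v - y s u\<bar> \<le> L * \<bar>v - u\<bar>"
    using main[of u v] main[of v u] assms by (cases u v rule: linorder_cases) (auto simp: abs_minus_commute)
  then show ?thesis by (simp add: L_def)
qed

end

text \<open>The coefficient enters only through integrals whose majorants are built from
  \<open>n\<close>, \<open>r1\<close> and a bound for the argument, so pointwise convergence of
  \<open>Rs k\<close> passes through each of them by dominated convergence. The iterates
  \<open>A\<close> follow by induction.\<close>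

lemma radial_tendsto:
  fixes Rs :: "nat \<Rightarrow> real \<Rightarrow> real"
  assumes rk: "\<And>k. radial n r1 r2 (Rs k)" and r: "radial n r1 r2 R"
    and lim: "\<And>x. 0 < x \<Longrightarrow> (\<lambda>k. Rs k x) \<longlonglongrightarrow> R x"
  shows radial_E_tendsto: "0 \<le> x \<Longrightarrow> (\<lambda>k. radial.E (Rs k) x) \<longlonglongrightarrow> radial.E R x"
    and radial_P_tendsto: "0 \<le> x \<Longrightarrow> (\<lambda>k. radial.P n (Rs k) x) \<longlonglongrightarrow> radial.P n R x"
    and radial_A_tendsto: "0 \<le> x \<Longrightarrow> (\<lambda>k. radial.A n (Rs k) j x) \<longlonglongrightarrow> radial.A n R j x"
proof -
  interpret r: radial n r1 r2 R by (rule r)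
  interpret rk: radial n r1 r2 "Rs k" for k by (rule rk)
  show E: "(\<lambda>k. rk.E k x) \<longlonglongrightarrow> r.E x" if "0 \<le> x" for x
  proof -
    have "(\<lambda>k. integral {0..x} (\<lambda>v. v / Rs k v)) \<longlonglongrightarrow> integral {0..x} (\<lambda>v. v / R v)"
    proof (rule dominated_convergence(2)[where h = "\<lambda>v. v / r1"])
      show "(\<lambda>v. v / Rs k v) integrable_on {0..x}" for k by (rule rk.drift_integrable_on) simp
      show "(\<lambda>v. v / r1) integrable_on {0..x}"
        by (intro integrable_continuous_interval continuous_intros) (use r.r1_pos in auto)
      show "norm (v / Rs k v) \<le> v / r1" if "v \<in> {0..x}" for k v
        using rk.drift_bounds(2)[of v k] rk.R_pos[of v k] that by (cases "v = 0") auto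
      show "(\<lambda>k. v / Rs k v) \<longlonglongrightarrow> v / R v" if "v \<in> {0..x}" for v
      proof (cases "v = 0")
        case False
        then show ?thesis using lim[of v] r.R_pos[of v] that by (intro tendsto_intros) auto
      qed simp
    qed
    then show ?thesis using that by (simp add: rk.E_eq r.E_eq)
  qed
  show P: "(\<lambda>k. rk.P k x) \<longlonglongrightarrow> r.P x" if "0 \<le> x" for x
    unfolding rk.P_def r.P_def by (intro tendsto_intros E that)
  have w: "(\<lambda>k. weight n (Rs k) x) \<longlonglongrightarrow> weight n R x" if "0 \<le> x" for x
  proof (cases "x = 0")
    case False
    then show ?thesis
      unfolding rk.weight_eq r.weight_eq using lim[of x] r.R_pos[of x] that by (intro tendsto_intros P) auto
  qed simp
  have M: "(\<lambda>k. rk.M k (g k) x) \<longlonglongrightarrow> r.M h x"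
    if g: "\<And>k. continuous_on {0..} (g k)" and x: "0 \<le> x"
      and bd: "\<And>k t. 0 \<le> t \<Longrightarrow> t \<le> x \<Longrightarrow> \<bar>g k t\<bar> \<le> C" and gl: "\<And>t. 0 \<le> t \<Longrightarrow> t \<le> x \<Longrightarrow> (\<lambda>k. g k t) \<longlonglongrightarrow> h t"
    for g h x C
  proof (cases "x = 0")
    case False
    then have x0: "0 < x" using x by simp
    have "0 \<le> C" using bd[of 0 0] x by linarith
    have "(\<lambda>k. integral {0..x} (\<lambda>t. weight n (Rs k) t * g k t)) \<longlonglongrightarrow> integral {0..x} (\<lambda>t. weight n R t * h t)"
    proof (rule dominated_convergence(2)[where h = "\<lambda>t. C * exp (x\<^sup>2 / (2 * r1)) / r1 * t powr (n - 1)"])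
      show "(\<lambda>t. weight n (Rs k) t * g k t) integrable_on {0..x}" for k
        by (rule rk.wg_integrable_cont[OF g]) simp
      show "(\<lambda>t. C * exp (x\<^sup>2 / (2 * r1)) / r1 * t powr (n - 1)) integrable_on {0..x}"
        using has_integral_mult_right[OF r.has_integral_powr_n[OF x]] by blast
      show "norm (weight n (Rs k) t * g k t) \<le> C * exp (x\<^sup>2 / (2 * r1)) / r1 * t powr (n - 1)"
        if "t \<in> {0..x}" for k t
      proof (cases "t = 0")
        case False
        then have t: "0 < t" "t \<le> x" using that by auto
        have "weight n (Rs k) t \<le> t powr (n - 1) * exp (rk.E k x) / r1" by (rule rk.w_le[OF t])
        also have "\<dots> \<le> t powr (n - 1) * exp (x\<^sup>2 / (2 * r1)) / r1"
          using rk.E_upper[of 0 x k] x r.r1_pos by (intro divide_right_mono mult_left_mono) auto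
        finally have "\<bar>weight n (Rs k) t * g k t\<bar> \<le> (t powr (n - 1) * exp (x\<^sup>2 / (2 * r1)) / r1) * C"
          unfolding abs_mult using rk.w_pos[OF t(1), of k] bd[of t k] t by (intro mult_mono) auto
        then show ?thesis by (simp add: algebra_simps)
      qed simp
      show "(\<lambda>k. weight n (Rs k) t * g k t) \<longlonglongrightarrow> weight n R t * h t" if "t \<in> {0..x}" for t
        using that by (intro tendsto_mult w gl) auto
    qed
    then show ?thesis
      unfolding rk.M_def r.M_def using r.P_pos[OF x0] P[OF x] by (intro tendsto_divide) auto
  qed simp
  have T: "(\<lambda>k. rk.T k (g k) x) \<longlonglongrightarrow> r.T h x"
    if g: "\<And>k. continuous_on {0..} (g k)" and x: "0 \<le> x"
      and bd: "\<And>k t. 0 \<le> t \<Longrightarrow> t \<le> x \<Longrightarrow> \<bar>g k t\<bar> \<le> C" and gl: "\<And>t. 0 \<le> t \<Longrightarrow> t \<le> x \<Longrightarrow> (\<lambda>k. g k t) \<longlonglongrightarrow> h t"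
    for g h x C
    unfolding rk.T_def r.T_def
  proof (rule dominated_convergence(2)[where h = "\<lambda>t. C * x / (n * r1)"])
    have "0 \<le> C" using bd[of 0 0] x by linarith
    show "rk.M k (g k) integrable_on {0..x}" for k
      by (intro integrable_continuous_interval continuous_on_subset[OF rk.M_continuous[OF g]]) auto
    show "norm (rk.M k (g k) t) \<le> C * x / (n * r1)" if "t \<in> {0..x}" for k t
    proof (cases "t = 0")
      case False
      have "\<bar>rk.M k (g k) t\<bar> \<le> C * t / (n * r1)"
        by (rule rk.M_bound[OF rk.continuous_measurable_0]) (use g bd that False in auto)
      also have "\<dots> \<le> C * x / (n * r1)"
        using that \<open>0 \<le> C\<close> r.n_pos r.r1_pos by (intro divide_right_mono mult_left_mono) auto
      finally show ?thesis by simp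
    qed (use \<open>0 \<le> C\<close> x r.n_pos r.r1_pos in simp)
    show "(\<lambda>k. rk.M k (g k) t) \<longlonglongrightarrow> r.M h t" if "t \<in> {0..x}" for t
      by (rule M[OF g, where C = C]) (use bd gl that in auto)
  qed auto
  show "(\<lambda>k. rk.A k j x) \<longlonglongrightarrow> r.A j x" if "0 \<le> x" for x
    using that
  proof (induction j arbitrary: x)
    case (Suc j)
    have "(\<lambda>k. rk.T k (rk.A k j) x) \<longlonglongrightarrow> r.T (r.A j) x"
    proof (rule T[OF rk.A_continuous Suc.prems, where C = "(1 / (2 * n * r1)) ^ j / fact j * x ^ (2 * j)"])
      show "\<bar>rk.A k j t\<bar> \<le> (1 / (2 * n * r1)) ^ j / fact j * x ^ (2 * j)" if "0 \<le> t" "t \<le> x" for k t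
      proof -
        have "\<bar>rk.A k j t\<bar> \<le> (1 / (2 * n * r1)) ^ j / fact j * t ^ (2 * j)" by (rule rk.A_bound[OF that(1)])
        also have "\<dots> \<le> (1 / (2 * n * r1)) ^ j / fact j * x ^ (2 * j)"
          using that r.n_pos r.r1_pos by (intro mult_left_mono power_mono) auto
        finally show ?thesis .
      qed
    qed (use Suc.IH in auto)
    then show ?case by simp
  qed simp
qed

text \<open>At the fixed point \<open>x\<close> the series converges termwise under an exponential
  majorant uniform in \<open>k\<close>, which is Tannery's theorem. The common Lipschitz constant
  then replaces \<open>x\<close> by the moving points \<open>xs k\<close>.\<close>

lemma radial_y_tendsto:
  fixes Rs :: "nat \<Rightarrow> real \<Rightarrow> real"
  assumes rk: "\<And>k. radial n r1 r2 (Rs k)" and r: "radial n r1 r2 R"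
    and lim: "\<And>x. 0 < x \<Longrightarrow> (\<lambda>k. Rs k x) \<longlonglongrightarrow> R x"
    and s: "ss \<longlonglongrightarrow> s" and xs: "xs \<longlonglongrightarrow> x" "\<And>k. 0 \<le> xs k"
  shows "(\<lambda>k. radial.y n (Rs k) (ss k) (xs k)) \<longlonglongrightarrow> radial.y n R s x"
proof -
  interpret r: radial n r1 r2 R by (rule r)
  interpret rk: radial n r1 r2 "Rs k" for k by (rule rk)
  have x: "0 \<le> x" using xs by (intro LIMSEQ_le_const) auto
  obtain B where B: "\<And>k. \<bar>ss k\<bar> \<le> B"
    using convergent_imp_Bseq[OF convergentI[OF s]] by (auto simp: Bseq_def)
  obtain X where X: "\<And>k. \<bar>xs k\<bar> \<le> X"
    using convergent_imp_Bseq[OF convergentI[OF xs(1)]] by (auto simp: Bseq_def)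
  have X': "xs k \<le> X" for k using X[of k] by simp
  have xX: "x \<le> X" by (rule LIMSEQ_le_const2[OF xs(1)]) (use X' in auto)
  let ?c = "B * x\<^sup>2 / (2 * n * r1)"
  have "eventually (\<lambda>k. summable (\<lambda>j. norm (ss k ^ j * rk.A k j x))) sequentially \<and>
      summable (\<lambda>j. norm (s ^ j * r.A j x)) \<and>
      (\<lambda>k. \<Sum>j. ss k ^ j * rk.A k j x) \<longlonglongrightarrow> (\<Sum>j. s ^ j * r.A j x)"
  proof (rule tannerys_theorem[where M = "\<lambda>j. ?c ^ j / fact j"])
    show "(\<lambda>k. ss k ^ j * rk.A k j x) \<longlonglongrightarrow> s ^ j * r.A j x" for j
      by (intro tendsto_intros s radial_A_tendsto[OF rk r lim x])
    show "eventually (\<lambda>(j, k). norm (ss k ^ j * rk.A k j x) \<le> ?c ^ j / fact j) (sequentially \<times>\<^sub>F sequentially)"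
      using rk.term_bound[OF x B] by (intro always_eventually) auto
    show "summable (\<lambda>j. ?c ^ j / fact j)" by (rule r.exp_summable)
  qed simp
  then have ylim: "(\<lambda>k. rk.y k (ss k) x) \<longlonglongrightarrow> r.y s x" by (simp add: rk.y_def r.y_def)
  define L where "L = B * exp (B * X\<^sup>2 / (2 * n * r1)) * X / (n * r1)"
  have "(\<lambda>k. rk.y k (ss k) (xs k) - rk.y k (ss k) x) \<longlonglongrightarrow> 0"
  proof (rule Lim_null_comparison[where g = "\<lambda>k. L * \<bar>xs k - x\<bar>"])
    show "eventually (\<lambda>k. norm (rk.y k (ss k) (xs k) - rk.y k (ss k) x) \<le> L * \<bar>xs k - x\<bar>) sequentially"
      using rk.y_lipschitz[OF x xX xs(2) X' B] by (simp add: L_def)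
    have "(\<lambda>k. L * \<bar>xs k - x\<bar>) \<longlonglongrightarrow> L * \<bar>x - x\<bar>" by (intro tendsto_intros xs)
    then show "(\<lambda>k. L * \<bar>xs k - x\<bar>) \<longlonglongrightarrow> 0" by simp
  qed
  from tendsto_add[OF this ylim] show ?thesis by simp
qed

section \<open>Positive solutions and ground states\<close>

text \<open>\<open>K\<close> is the point beyond which the energy \<open>x\<^sup>n e\<^sup>E y\<^sup>2 + 2 r\<^sub>2 P y' y\<close> of a positive decreasing
  solution grows at least as fast as \<open>\<integral> P y\<^sup>2\<close>; since it vanishes at a zero of \<open>y\<close>, the mass is
  controlled by the part below \<open>K\<close>.\<close>

definition mass_bound :: "real \<Rightarrow> real \<Rightarrow> real \<Rightarrow> real \<Rightarrow> real" where
  "mass_bound n r1 r2 m = (let \<kappa> = 2 * r2 * m / r1; K = sqrt (2 * r2 * (1 + \<kappa>))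
    in (1 + \<kappa>) * (exp (K\<^sup>2 / (2 * r1)) * (K powr n / n)))"

lemma integral_pos_if_bounded_below:
  fixes f :: "real \<Rightarrow> real"
  assumes "f integrable_on {a..b}" "a < b" "0 < c" "\<And>x. x \<in> {a..b} \<Longrightarrow> c \<le> f x"
  shows "0 < integral {a..b} f"
proof -
  have "0 < c * (b - a)" using assms by simp
  also have "\<dots> = integral {a..b} (\<lambda>x. c)" using assms(2) by simp
  also have "\<dots> \<le> integral {a..b} f" by (rule integral_le) (use assms in auto)
  finally show ?thesis .
qed

context radial
begin

text \<open>The weight need not be continuous. A positive lower bound is obtained from the minimum
  of the continuous function \<open>P * g\<close> on a compact interval away from 0, divided by
  \<open>r2\<close>.\<close>

lemma wg_integral_pos:
  assumes g: "continuous_on {0..} g" and "0 < x" and "0 < g 0"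
    and nn: "\<And>t. 0 \<le> t \<Longrightarrow> t \<le> x \<Longrightarrow> 0 \<le> g t"
  shows "0 < integral {0..x} (\<lambda>t. w t * g t)"
proof -
  have "continuous (at 0 within {0..}) g" using g by (simp add: continuous_on_eq_continuous_within)
  then have "(g \<longlongrightarrow> g 0) (at 0 within {0..})" by (simp add: continuous_within)
  then have "eventually (\<lambda>t. 0 < g t) (at 0 within {0..})" using order_tendstoD(1) \<open>0 < g 0\<close> by blast
  then obtain d where d: "d > 0" "\<forall>t\<in>{0..}. t \<noteq> 0 \<and> dist t 0 < d \<longrightarrow> 0 < g t"
    unfolding eventually_at by blast
  define e where "e = min (d / 2) x"
  have e: "0 < e" "e \<le> x" "e < d" using d(1) \<open>0 < x\<close> by (auto simp: e_def)
  have gp: "0 < g t" if "0 < t" "t \<le> e" for t using d(2)[rule_format, of t] that e by (simp add: dist_real_def)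
  have "continuous_on {e/2..e} (\<lambda>t. P t * g t)"
    by (intro continuous_intros continuous_on_subset[OF P_continuous] continuous_on_subset[OF g]) (use e in auto)
  then obtain m where m: "m \<in> {e/2..e}" "\<And>t. t \<in> {e/2..e} \<Longrightarrow> P m * g m \<le> P t * g t"
    using continuous_attains_inf[of "{e/2..e}" "\<lambda>t. P t * g t"] e by auto
  have wi: "(\<lambda>t. w t * g t) integrable_on {0..x}" by (rule wg_integrable_cont[OF g]) simp
  have "0 < integral {e/2..e} (\<lambda>t. w t * g t)"
  proof (rule integral_pos_if_bounded_below)
    show "(\<lambda>t. w t * g t) integrable_on {e/2..e}" by (rule integrable_on_subinterval[OF wi]) (use e in auto)
    show "0 < P m * g m / r2" using m(1) e gp[of m] P_pos[of m] r2_pos by simp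
    fix t assume t: "t \<in> {e/2..e}"
    then have t0: "0 < t" using e by auto
    have "P m * g m / r2 \<le> P t * g t / r2" using m(2)[OF t] r2_pos by (simp add: divide_right_mono)
    also have "\<dots> \<le> P t * g t / R t"
      using R_upper[OF t0] R_pos[OF t0] r2_pos P_pos[OF t0] gp[of t] t t0 by (intro divide_left_mono) auto
    finally show "P m * g m / r2 \<le> w t * g t" by (simp add: weight_eq)
  qed (use e in auto)
  also have "\<dots> \<le> integral {0..x} (\<lambda>t. w t * g t)"
  proof (rule integral_subset_le[OF _ _ wi])
    show "(\<lambda>t. w t * g t) integrable_on {e/2..e}" by (rule integrable_on_subinterval[OF wi]) (use e in auto)
    have "0 \<le> w t * g t" if "t \<in> {0..x}" for t
      using nn[of t] w_pos[of t] that by (cases "t = 0") auto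
    then show "\<forall>t\<in>{0..x}. 0 \<le> w t * g t" by blast
  qed (use e in auto)
  finally show ?thesis .
qed

lemma M_nonneg:
  assumes g: "continuous_on {0..} g" and "\<And>t. 0 \<le> t \<Longrightarrow> t \<le> x \<Longrightarrow> 0 \<le> g t" "0 \<le> x"
  shows "0 \<le> M g x"
proof (cases "x = 0")
  case False
  then have "0 < x" using assms by simp
  have "0 \<le> integral {0..x} (\<lambda>t. w t * g t)"
  proof (rule integral_nonneg)
    show "0 \<le> w t * g t" if "t \<in> {0..x}" for t
      using assms(2)[of t] w_pos[of t] that by (cases "t = 0") auto
  qed (rule wg_integrable_cont[OF g], simp)
  then show ?thesis using P_pos[OF \<open>0 < x\<close>] by (simp add: M_def)
qed simp

text \<open>While \<open>y (-\<mu>)\<close> is nonnegative, so is its image under \<open>T\<close>,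
  and this is subtracted from the initial value 1.\<close>

lemma y_le_1:
  assumes "0 \<le> \<mu>" "0 \<le> x" "\<And>t. 0 \<le> t \<Longrightarrow> t \<le> x \<Longrightarrow> 0 \<le> y (-\<mu>) t"
  shows "y (-\<mu>) x \<le> 1"
proof -
  have "0 \<le> T (y (-\<mu>)) x" unfolding T_def
  proof (rule integral_nonneg)
    show "M (y (-\<mu>)) integrable_on {0..x}"
      by (intro integrable_continuous_interval continuous_on_subset[OF M_continuous[OF y_continuous]]) auto
    show "0 \<le> M (y (-\<mu>)) t" if "t \<in> {0..x}" for t
      by (rule M_nonneg[OF y_continuous]) (use assms that in auto)
  qed
  then show ?thesis using y_eq[OF assms(2), of "-\<mu>"] assms(1) by simp
qed

lemma dy_neg:
  assumes "0 < \<mu>" "0 < x" "\<And>t. 0 \<le> t \<Longrightarrow> t \<le> x \<Longrightarrow> 0 \<le> y (-\<mu>) t"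
  shows "dy (-\<mu>) x < 0"
proof -
  have "0 < integral {0..x} (\<lambda>t. w t * y (-\<mu>) t)"
    by (rule wg_integral_pos[OF y_continuous assms(2)]) (use assms in auto)
  then show ?thesis using assms P_pos[OF assms(2)] by (simp add: dy_def M_def)
qed

text \<open>A nonnegative solution would have strictly negative derivative at its zero, so it
  crosses the axis instead of touching it. Consequently a nonnegative limit of solutions is
  positive.\<close>

lemma y_zero_imp_negative:
  assumes "0 < \<mu>" "0 < b" "y (-\<mu>) b = 0"
  shows "\<exists>x>0. y (-\<mu>) x < 0"
proof (rule ccontr)
  assume "\<not> ?thesis"
  then have "0 \<le> y (-\<mu>) t" if "0 < t" for t using that by (meson not_le)
  then have nn: "0 \<le> y (-\<mu>) t" if "0 \<le> t" for t using that by (cases "t = 0") auto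
  have "dy (-\<mu>) b < 0" by (rule dy_neg) (use assms nn in auto)
  from DERIV_neg_dec_right[OF y_deriv[OF assms(2)] this]
  obtain d where d: "d > 0" "\<forall>h>0. h < d \<longrightarrow> y (-\<mu>) (b + h) < y (-\<mu>) b" by blast
  have "y (-\<mu>) (b + d / 2) < y (-\<mu>) b" using d(2)[rule_format, of "d / 2"] d(1) by simp
  then show False using nn[of "b + d / 2"] assms d(1) by simp
qed

lemma first_zero:
  assumes "0 < x" "y s x \<le> 0"
  obtains b where "0 < b" "b \<le> x" "y s b = 0" "\<And>t. 0 \<le> t \<Longrightarrow> t < b \<Longrightarrow> 0 < y s t"
proof -
  define Z where "Z = {t \<in> {0..x}. y s t \<le> 0}"
  have cx: "continuous_on {0..x} (y s)" by (rule continuous_on_subset[OF y_continuous]) auto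
  have "closed ({0..x} \<inter> y s -` {..0})" by (rule continuous_closed_preimage[OF cx]) auto
  moreover have "{0..x} \<inter> y s -` {..0} = Z" by (auto simp: Z_def)
  moreover have "bounded Z" by (rule bounded_subset[of "{0..x}"]) (auto simp: Z_def)
  ultimately have cZ: "compact Z" by (simp add: compact_eq_bounded_closed)
  have "Z \<noteq> {}" using assms by (auto simp: Z_def)
  from compact_attains_inf[OF cZ this] obtain b where b: "b \<in> Z" "\<And>t. t \<in> Z \<Longrightarrow> b \<le> t" by blast
  have bx: "0 \<le> b" "b \<le> x" "y s b \<le> 0" using b(1) by (auto simp: Z_def)
  have pos: "0 < y s t" if "0 \<le> t" "t < b" for t
    using b(2)[of t] that bx by (force simp: Z_def)
  have "continuous_on {0..b} (y s)" by (rule continuous_on_subset[OF cx]) (use bx in auto)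
  then obtain t where t: "0 \<le> t" "t \<le> b" "y s t = 0"
    using IVT2'[of "y s" b 0 0] bx by auto
  then have "t = b" using pos[of t] by (cases "t = b") auto
  moreover have "b \<noteq> 0" using t \<open>t = b\<close> by auto
  ultimately show ?thesis using that[of b] bx pos t by auto
qed

lemma Pg_integrable:
  assumes g: "continuous_on {0..} g" and "0 \<le> a"
  shows "(\<lambda>t. P t * g t) absolutely_integrable_on {a..x}" "(\<lambda>t. P t * g t) integrable_on {a..x}"
proof -
  show "(\<lambda>t. P t * g t) absolutely_integrable_on {a..x}"
  proof (cases "0 \<le> x")
    case True
    obtain C where C: "0 \<le> C" "\<And>s. 0 \<le> s \<Longrightarrow> s \<le> x \<Longrightarrow> \<bar>g s\<bar> \<le> C"
      using continuous_on_Icc_bound[OF g] by blast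
    have int: "(\<lambda>s. C * exp (E x) * s powr (n - 1)) integrable_on {0..x}"
      using has_integral_mult_right[OF has_integral_powr_n[OF True]] by blast
    show ?thesis
    proof (rule absolutely_integrable_dominated[OF _ \<open>0 \<le> a\<close>])
      show "(\<lambda>t. P t * g t) \<in> borel_measurable (lebesgue_on {0<..})"
        by (intro borel_measurable_times P_measurable continuous_measurable_0 g)
      show "(\<lambda>s. C * exp (E x) * s powr (n - 1)) integrable_on {a..x}"
        by (rule integrable_on_subinterval[OF int]) (use \<open>0 \<le> a\<close> in auto)
      fix t assume "a < t" "t \<le> x"
      then have t: "0 < t" "t \<le> x" using \<open>0 \<le> a\<close> by auto
      have "\<bar>P t * g t\<bar> \<le> (t powr (n - 1) * exp (E x)) * C"
        unfolding abs_mult using P_le[OF t] P_pos[OF t(1)] C(2)[of t] t by (intro mult_mono) auto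
      then show "\<bar>P t * g t\<bar> \<le> C * exp (E x) * t powr (n - 1)" by (simp add: algebra_simps)
    qed
  next
    case False
    then show ?thesis using \<open>0 \<le> a\<close> by (simp add: set_integrable_def)
  qed
  then show "(\<lambda>t. P t * g t) integrable_on {a..x}" by (simp add: absolutely_integrable_on_def)
qed

text \<open>For n > 0 and x \<ge> 1 the power is at least 1 / x, and the exponential is at least x^2
  / (2 r2). This crude constant suffices to see that functions bounded away from 0 have infinite
  mass.\<close>

lemma P_lower: "1 \<le> x \<Longrightarrow> 1 / (2 * r2) \<le> P x"
proof -
  assume x: "1 \<le> x"
  have "1 / (2 * r2) \<le> x / (2 * r2)" using x r2_pos by (simp add: divide_right_mono)
  also have "\<dots> = x powr (-1) * (x\<^sup>2 / (2 * r2))" using x by (simp add: powr_minus power2_eq_square field_simps)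
  also have "\<dots> \<le> x powr (n - 1) * exp (E x)"
  proof (rule mult_mono)
    show "x powr (-1) \<le> x powr (n - 1)" using x n_pos by (intro powr_mono) auto
    have "x\<^sup>2 / (2 * r2) \<le> E x" using E_lower[of 0 x] x by simp
    then show "x\<^sup>2 / (2 * r2) \<le> exp (E x)" using exp_ge_add_one_self[of "E x"] by linarith
  qed (use r2_pos in auto)
  finally show ?thesis by (simp add: P_def)
qed

text \<open>The coefficient \<open>2 * r2\<close> is the one for which the mixed term and the term
  with \<open>(dy s x)\<^sup>2\<close> are completed to a square by
  \<open>x\<^sup>2 / (2 * r2) * (y s x)\<^sup>2\<close>. As R \<le> r2, this consumes at most half
  of the term with \<open>x\<^sup>2 / R x\<close>; the other half is left to control the
  mass.\<close>

lemma ac_deriv_energy: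
  "ac_deriv (\<lambda>x. x powr n * exp (E x) * (y s x)\<^sup>2 + 2 * r2 * (P x * dy s x * y s x))
    (\<lambda>x. P x * ((n + x\<^sup>2 / R x) * (y s x)\<^sup>2 + 2 * x * y s x * dy s x + 2 * r2 * (dy s x)\<^sup>2)
      + 2 * r2 * s * (w x * (y s x)\<^sup>2))"
proof (rule ac_deriv_cong)
  show "ac_deriv (\<lambda>x. (x powr n * exp (1 * E x)) * (y s x * y s x) + (2 * r2) * ((P x * dy s x) * y s x))
     (\<lambda>x. ((x powr n * exp (1 * E x) * (n / x + 1 * x / R x)) * (y s x * y s x)
          + (x powr n * exp (1 * E x)) * (dy s x * y s x + y s x * dy s x))
        + (2 * r2) * ((s * (w x * y s x)) * y s x + (P x * dy s x) * dy s x))"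
    by (intro ac_deriv_add ac_deriv_mult ac_deriv_cmult ac_deriv_powr_exp_E ac_deriv_y ac_deriv_P_dy)
  have "P x * ((n + x\<^sup>2 / R x) * (y s x)\<^sup>2 + 2 * x * y s x * dy s x + 2 * r2 * (dy s x)\<^sup>2)
      + 2 * r2 * s * (w x * (y s x)\<^sup>2)
     = ((x powr n * exp (1 * E x) * (n / x + 1 * x / R x)) * (y s x * y s x)
          + (x powr n * exp (1 * E x)) * (dy s x * y s x + y s x * dy s x))
        + (2 * r2) * ((s * (w x * y s x)) * y s x + (P x * dy s x) * dy s x)" if x: "0 < x" for x
  proof -
    have eq: "x powr n * exp (1 * E x) = x * P x" using x by (simp add: P_def powr_diff)
    show ?thesis unfolding eq using x R_pos[OF x] by (simp add: field_simps power2_eq_square)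
  qed
  then show "AE x in lebesgue. 0 < x \<longrightarrow>
     P x * ((n + x\<^sup>2 / R x) * (y s x)\<^sup>2 + 2 * x * y s x * dy s x + 2 * r2 * (dy s x)\<^sup>2)
      + 2 * r2 * s * (w x * (y s x)\<^sup>2)
     = ((x powr n * exp (1 * E x) * (n / x + 1 * x / R x)) * (y s x * y s x)
          + (x powr n * exp (1 * E x)) * (dy s x * y s x + y s x * dy s x))
        + (2 * r2) * ((s * (w x * y s x)) * y s x + (P x * dy s x) * dy s x)" by simp
qed (simp add: power2_eq_square)

text \<open>The energy vanishes at the zero \<open>b\<close>, and near 0 it is at least a quantity
  that tends to 0. Its derivative dominates \<open>P x * (f x)\<^sup>2\<close> minus
  \<open>(1 + \<kappa>) * h x\<close>, and the integral of \<open>h\<close> depends only on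
  \<open>K\<close>. Hence the bound is the same for all positions of \<open>b\<close>.\<close>

lemma mass_bound_before_zero:
  assumes \<mu>: "0 < \<mu>" "\<mu> \<le> m" and b: "0 < b" "y (-\<mu>) b = 0" and pos: "\<And>t. 0 \<le> t \<Longrightarrow> t < b \<Longrightarrow> 0 < y (-\<mu>) t"
    and X: "0 \<le> X" "X \<le> b"
  shows "integral {0..X} (\<lambda>t. P t * (y (-\<mu>) t)\<^sup>2) \<le> mass_bound n r1 r2 m"
proof -
  define \<kappa> where "\<kappa> = 2 * r2 * m / r1"
  define K where "K = sqrt (2 * r2 * (1 + \<kappa>))"
  define f where "f = y (-\<mu>)"
  define f' where "f' = dy (-\<mu>)"
  define \<Phi> where "\<Phi> x = x powr n * exp (E x) * (f x)\<^sup>2 + 2 * r2 * (P x * f' x * f x)" for x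
  have \<kappa>: "0 < \<kappa>" using \<mu> r1_pos r2_pos by (simp add: \<kappa>_def)
  have K2: "K\<^sup>2 = 2 * r2 * (1 + \<kappa>)" "0 < K" using \<kappa> r2_pos by (auto simp: K_def)
  have nn: "0 \<le> f t" if "0 \<le> t" "t \<le> b" for t
    using pos[of t] b that by (cases "t = b") (auto simp: f_def)
  have le1: "f t \<le> 1" if "0 \<le> t" "t \<le> b" for t
    unfolding f_def by (rule y_le_1) (use \<mu> nn that in \<open>auto simp: f_def\<close>)
  \<comment> \<open>On \<open>{0..K}\<close> the solution is at most 1, so \<open>h\<close>
    majorises \<open>P x * (f x)\<^sup>2\<close> there.\<close>
  define h where "h x = (if x \<in> {0..K} then exp (K\<^sup>2 / (2 * r1)) * x powr (n - 1) else 0)" for x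
  have hU: "(h has_integral (exp (K\<^sup>2 / (2 * r1)) * (K powr n / n))) UNIV"
    unfolding h_def has_integral_restrict_UNIV
    by (intro has_integral_mult_right has_integral_powr_n) (use K2 in auto)
  have hnn: "0 \<le> h x" for x by (simp add: h_def)
  have hi: "h integrable_on {a..c}" for a c using has_integral_integrable[OF hU] by (rule integrable_on_subinterval) auto
  have hle: "integral {a..c} h \<le> exp (K\<^sup>2 / (2 * r1)) * (K powr n / n)" for a c
    using integral_subset_le[of "{a..c}" UNIV h] hi hU hnn by (auto simp: integral_unique[OF hU])
  have Pf: "(\<lambda>t. P t * (f t)\<^sup>2) integrable_on {a..c}" if "0 \<le> a" for a c
    unfolding f_def by (rule Pg_integrable(2)[OF _ that]) (intro continuous_intros y_continuous)
  have wf: "(\<lambda>t. w t * f t) integrable_on {0..c}" for c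
    unfolding f_def by (rule wg_integrable_cont[OF y_continuous]) simp
  have main: "integral {0..b} (\<lambda>t. P t * (f t)\<^sup>2)
     \<le> (1 + \<kappa>) * (exp (K\<^sup>2 / (2 * r1)) * (K powr n / n))
      + (integral {0..a} (\<lambda>t. P t * (f t)\<^sup>2) + 2 * r2 * \<mu> * integral {0..a} (\<lambda>t. w t * f t))"
    if a: "0 < a" "a < b" for a
  proof -
    have "integral {a..b} (\<lambda>x. P x * (f x)\<^sup>2 - (1 + \<kappa>) * h x) \<le> \<Phi> b - \<Phi> a"
    proof (rule has_integral_le_AE)
      show "((\<lambda>x. P x * (f x)\<^sup>2 - (1 + \<kappa>) * h x) has_integral integral {a..b} (\<lambda>x. P x * (f x)\<^sup>2 - (1 + \<kappa>) * h x)) {a..b}"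
        by (intro integrable_integral integrable_diff Pf integrable_on_mult_right hi) (use a in auto)
      show "((\<lambda>x. P x * ((n + x\<^sup>2 / R x) * (f x)\<^sup>2 + 2 * x * f x * f' x + 2 * r2 * (f' x)\<^sup>2)
          + 2 * r2 * (-\<mu>) * (w x * (f x)\<^sup>2)) has_integral (\<Phi> b - \<Phi> a)) {a..b}"
        unfolding \<Phi>_def f_def f'_def by (rule ac_deriv_has_integral[OF ac_deriv_energy]) (use a in auto)
      have "P x * (f x)\<^sup>2 - (1 + \<kappa>) * h x \<le> P x * ((n + x\<^sup>2 / R x) * (f x)\<^sup>2 + 2 * x * f x * f' x + 2 * r2 * (f' x)\<^sup>2)
          + 2 * r2 * (-\<mu>) * (w x * (f x)\<^sup>2)" if x: "x \<in> {a..b}" for x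
      proof -
        have x0: "0 < x" using x a by auto
        note Pp = P_pos[OF x0]
        have e1: "x\<^sup>2 / r2 * (f x)\<^sup>2 \<le> x\<^sup>2 / R x * (f x)\<^sup>2"
          using R_upper[OF x0] R_pos[OF x0] r2_pos by (intro mult_right_mono divide_left_mono) auto
        have "0 \<le> (x * f x / sqrt (2 * r2) + sqrt (2 * r2) * f' x)\<^sup>2" by simp
        also have "\<dots> = x\<^sup>2 / (2 * r2) * (f x)\<^sup>2 + 2 * x * f x * f' x + 2 * r2 * (f' x)\<^sup>2"
          using r2_pos by (simp add: power2_sum power_mult_distrib power_divide)
        finally have e2: "0 \<le> x\<^sup>2 / (2 * r2) * (f x)\<^sup>2 + 2 * x * f x * f' x + 2 * r2 * (f' x)\<^sup>2" .
        \<comment> \<open>The eigenvalue term carries the factor 2 r2 \<mu> / R, of which \<kappa> =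
          2 r2 m / r1 is the uniform bound.\<close>
        have e3: "2 * r2 * \<mu> * (w x * (f x)\<^sup>2) \<le> P x * (\<kappa> * (f x)\<^sup>2)"
        proof -
          have "\<mu> / R x \<le> m / r1" using \<mu> R_lower[OF x0] r1_pos by (intro frac_le) auto
          then have "(2 * r2 * P x * (f x)\<^sup>2) * (\<mu> / R x) \<le> (2 * r2 * P x * (f x)\<^sup>2) * (m / r1)"
            using Pp r2_pos by (intro mult_left_mono) auto
          then show ?thesis by (simp add: weight_eq \<kappa>_def field_simps)
        qed
        have e4: "P x * (f x)\<^sup>2 - (1 + \<kappa>) * h x \<le> P x * ((x\<^sup>2 / (2 * r2) - \<kappa>) * (f x)\<^sup>2)"
        proof (cases "x \<le> K")
          case True
          have "(f x)\<^sup>2 \<le> 1" using nn[of x] le1[of x] x a by (simp add: power_le_one)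
          then have "P x * (f x)\<^sup>2 \<le> P x * 1" using Pp by (intro mult_left_mono) auto
          also have "P x \<le> x powr (n - 1) * exp (K\<^sup>2 / (2 * r1))"
          proof -
            have "E x \<le> x\<^sup>2 / (2 * r1)" using E_upper[of 0 x] x0 by simp
            also have "\<dots> \<le> K\<^sup>2 / (2 * r1)" using True x0 r1_pos by (intro divide_right_mono power_mono) auto
            finally show ?thesis unfolding P_def by (intro mult_left_mono) auto
          qed
          then have "P x * 1 \<le> h x" using True x0 by (simp add: h_def mult.commute)
          finally have "(1 + \<kappa>) * (P x * (f x)\<^sup>2) \<le> (1 + \<kappa>) * h x" using \<kappa> by (intro mult_left_mono) auto
          moreover have "0 \<le> P x * (x\<^sup>2 / (2 * r2) * (f x)\<^sup>2)" using Pp r2_pos by simp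
          ultimately show ?thesis by (simp add: algebra_simps)
        next
          case False
          have "K\<^sup>2 \<le> x\<^sup>2" using False K2(2) by (intro power_mono) auto
          \<comment> \<open>This is what fixes \<open>K\<close>: its square is 2 r2 (1 +
            \<kappa>).\<close>
          then have "1 \<le> x\<^sup>2 / (2 * r2) - \<kappa>" using K2(1) r2_pos by (simp add: field_simps)
          then have "P x * (1 * (f x)\<^sup>2) \<le> P x * ((x\<^sup>2 / (2 * r2) - \<kappa>) * (f x)\<^sup>2)"
            using Pp by (intro mult_left_mono mult_right_mono) auto
          then show ?thesis using False by (simp add: h_def)
        qed
        have "P x * ((x\<^sup>2 / (2 * r2) - \<kappa>) * (f x)\<^sup>2)
          \<le> P x * ((n + x\<^sup>2 / R x) * (f x)\<^sup>2 + 2 * x * f x * f' x + 2 * r2 * (f' x)\<^sup>2 - \<kappa> * (f x)\<^sup>2)"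
        proof (rule mult_left_mono)
          have "x\<^sup>2 / (2 * r2) * (f x)\<^sup>2 + x\<^sup>2 / (2 * r2) * (f x)\<^sup>2 = x\<^sup>2 / r2 * (f x)\<^sup>2" by (simp add: field_simps)
          moreover have "0 \<le> n * (f x)\<^sup>2" using n_pos by simp
          ultimately show "(x\<^sup>2 / (2 * r2) - \<kappa>) * (f x)\<^sup>2
            \<le> (n + x\<^sup>2 / R x) * (f x)\<^sup>2 + 2 * x * f x * f' x + 2 * r2 * (f' x)\<^sup>2 - \<kappa> * (f x)\<^sup>2"
            using e1 e2 unfolding distrib_right left_diff_distrib by linarith
        qed (use Pp in simp)
        then show ?thesis using e3 e4 by (simp add: algebra_simps)
      qed
      then show "AE x in lebesgue. x \<in> {a..b} \<longrightarrow> P x * (f x)\<^sup>2 - (1 + \<kappa>) * h x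
        \<le> P x * ((n + x\<^sup>2 / R x) * (f x)\<^sup>2 + 2 * x * f x * f' x + 2 * r2 * (f' x)\<^sup>2) + 2 * r2 * (-\<mu>) * (w x * (f x)\<^sup>2)"
        by simp
    qed
    moreover have "\<Phi> b = 0" using b by (simp add: \<Phi>_def f_def)
    moreover have "- \<Phi> a \<le> 2 * r2 * \<mu> * integral {0..a} (\<lambda>t. w t * f t)"
    proof -
      have I: "0 \<le> integral {0..a} (\<lambda>t. w t * f t)"
      proof (rule integral_nonneg[OF wf])
        show "0 \<le> w t * f t" if "t \<in> {0..a}" for t
          using nn[of t] w_pos[of t] that a by (cases "t = 0") auto
      qed
      have "P a * f' a = -\<mu> * integral {0..a} (\<lambda>t. w t * f t)"
        using P_dy[of a "-\<mu>"] a by (simp add: f_def f'_def)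
      then have "- \<Phi> a = - (a powr n * exp (E a) * (f a)\<^sup>2) + 2 * r2 * \<mu> * integral {0..a} (\<lambda>t. w t * f t) * f a"
        by (simp add: \<Phi>_def)
      also have "\<dots> \<le> 0 + 2 * r2 * \<mu> * integral {0..a} (\<lambda>t. w t * f t) * 1"
        using le1[of a] a I \<mu> r2_pos by (intro add_mono mult_left_mono) auto
      finally show ?thesis by simp
    qed
    moreover have "integral {a..b} (\<lambda>x. P x * (f x)\<^sup>2 - (1 + \<kappa>) * h x)
      = integral {a..b} (\<lambda>x. P x * (f x)\<^sup>2) - (1 + \<kappa>) * integral {a..b} h"
      using a by (subst integral_diff[OF Pf]) (auto intro!: integrable_on_mult_right hi)
    moreover have "(1 + \<kappa>) * integral {a..b} h \<le> (1 + \<kappa>) * (exp (K\<^sup>2 / (2 * r1)) * (K powr n / n))"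
      using hle \<kappa> by (intro mult_left_mono) auto
    moreover have "integral {0..b} (\<lambda>x. P x * (f x)\<^sup>2) = integral {0..a} (\<lambda>x. P x * (f x)\<^sup>2) + integral {a..b} (\<lambda>x. P x * (f x)\<^sup>2)"
      using Henstock_Kurzweil_Integration.integral_combine[of 0 a b "\<lambda>x. P x * (f x)\<^sup>2"] Pf a by simp
    ultimately show ?thesis by linarith
  qed
  \<comment> \<open>Contribution of \<open>{0..a}\<close>, which the energy argument on
    \<open>{a..b}\<close> does not see; it vanishes as \<open>a\<close> tends to 0.\<close>
  define r where "r a = integral {0..a} (\<lambda>t. P t * (f t)\<^sup>2) + 2 * r2 * \<mu> * integral {0..a} (\<lambda>t. w t * f t)" for a
  have "continuous_on {0..b} r"
    unfolding r_def by (intro continuous_intros indefinite_integral_continuous_1 Pf wf) auto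
  then have "(r \<longlongrightarrow> r 0) (at 0 within {0..b})"
    using b by (simp add: continuous_on_eq_continuous_within continuous_within)
  then have "(r \<longlongrightarrow> 0) (at 0 within {0..b})" by (simp add: r_def)
  then have lim: "((\<lambda>a. (1 + \<kappa>) * (exp (K\<^sup>2 / (2 * r1)) * (K powr n / n)) + r a)
      \<longlongrightarrow> (1 + \<kappa>) * (exp (K\<^sup>2 / (2 * r1)) * (K powr n / n)) + 0) (at 0 within {0..b})"
    by (intro tendsto_intros)
  have "integral {0..b} (\<lambda>t. P t * (f t)\<^sup>2) \<le> (1 + \<kappa>) * (exp (K\<^sup>2 / (2 * r1)) * (K powr n / n)) + 0"
  proof (rule tendsto_lowerbound[OF lim])
    show "eventually (\<lambda>a. integral {0..b} (\<lambda>t. P t * (f t)\<^sup>2)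
        \<le> (1 + \<kappa>) * (exp (K\<^sup>2 / (2 * r1)) * (K powr n / n)) + r a) (at 0 within {0..b})"
      unfolding eventually_at
      by (intro exI[of _ b] conjI ballI impI b(1)) (use main in \<open>auto simp: r_def dist_real_def\<close>)
    show "at 0 within {0..b} \<noteq> bot" using b by (simp add: at_within_Icc_at_right)
  qed
  moreover have "integral {0..X} (\<lambda>t. P t * (f t)\<^sup>2) \<le> integral {0..b} (\<lambda>t. P t * (f t)\<^sup>2)"
  proof (rule integral_subset_le)
    have "0 \<le> P t * (f t)\<^sup>2" if "t \<in> {0..b}" for t using P_pos[of t] that by (cases "t = 0") auto
    then show "\<forall>t\<in>{0..b}. 0 \<le> P t * (f t)\<^sup>2" by blast
  qed (use X Pf in auto)
  ultimately show ?thesis by (simp add: f_def mass_bound_def Let_def \<kappa>_def K_def)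
qed

end

section \<open>Boundary behaviour at 0\<close>

lemma indefinite_integral_tendsto_0:
  fixes g :: "real \<Rightarrow> real"
  assumes "g integrable_on {0..x}" "0 < x"
  shows "((\<lambda>a. integral {0..a} g) \<longlongrightarrow> 0) (at_right 0)"
proof -
  have "continuous (at 0 within {0..x}) (\<lambda>a. integral {0..a} g)"
    using indefinite_integral_continuous_1[OF assms(1)] assms(2) by (simp add: continuous_on_eq_continuous_within)
  then have "((\<lambda>a. integral {0..a} g) \<longlongrightarrow> integral {0..0} g) (at 0 within {0..x})"
    by (simp only: continuous_within)
  then show ?thesis using assms(2) by (simp add: at_within_Icc_at_right)
qed

text \<open>Local absolute continuity gives increments between positive points only; the limit at 0
  supplies the missing initial value.\<close>

lemma ac_deriv_integral_from_0:
  assumes f: "ac_deriv f g" and lim: "(f \<longlongrightarrow> 0) (at_right 0)" and g: "g integrable_on {0..x}" and x: "0 < x"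
  shows "f x = integral {0..x} g"
proof -
  have "((\<lambda>a. integral {0..a} g) \<longlongrightarrow> 0) (at_right 0)" by (rule indefinite_integral_tendsto_0[OF g x])
  from tendsto_add[OF tendsto_diff[OF lim this] tendsto_const[of "integral {0..x} g"]]
  have "((\<lambda>a. f a - integral {0..a} g + integral {0..x} g) \<longlongrightarrow> integral {0..x} g) (at_right 0)" by simp
  moreover have "eventually (\<lambda>a. f a - integral {0..a} g + integral {0..x} g = f x) (at_right 0)"
    using eventually_at_right_real[OF x]
  proof eventually_elim
    case (elim a)
    have "integral {a..x} g = f x - f a"
      by (rule integral_unique[OF ac_deriv_has_integral[OF f]]) (use elim in auto)
    moreover have "integral {0..a} g + integral {a..x} g = integral {0..x} g"
      by (rule Henstock_Kurzweil_Integration.integral_combine[OF _ _ g]) (use elim in auto)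
    ultimately show ?case by simp
  qed
  ultimately have "((\<lambda>a::real. f x) \<longlongrightarrow> integral {0..x} g) (at_right 0)"
    by (rule Lim_transform_eventually)
  then show ?thesis by (simp add: tendsto_const_iff)
qed

lemma ac_deriv_nonneg_from_0:
  assumes f: "ac_deriv f g" and lim: "(f \<longlongrightarrow> c) (at_right 0)"
    and nn: "AE x in lebesgue. 0 < x \<longrightarrow> 0 \<le> g x" and x: "0 < x"
  shows "c \<le> f x"
proof (rule tendsto_upperbound[OF lim])
  show "eventually (\<lambda>a. f a \<le> f x) (at_right 0)"
    using eventually_at_right_real[OF x] by eventually_elim (rule ac_deriv_mono[OF f nn], auto)
qed simp

context radial
begin

lemma at_right_0_tendsto:
  fixes g :: "real \<Rightarrow> real"
  assumes "continuous_on {0..} g"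
  shows "(g \<longlongrightarrow> g 0) (at_right 0)"
proof -
  have "(g \<longlongrightarrow> g 0) (at 0 within {0..})"
    using assms by (simp add: continuous_on_eq_continuous_within continuous_within)
  then show ?thesis by (rule tendsto_within_subset) auto
qed

lemma y_tendsto_0: "(y s \<longlongrightarrow> 1) (at_right 0)"
  using at_right_0_tendsto[OF y_continuous[of s]] by simp

lemma dy_tendsto_0: "(dy s \<longlongrightarrow> 0) (at_right 0)"
  using at_right_0_tendsto[OF dy_continuous[of s]] by (simp add: dy_def)

lemma E_tendsto_0: "(E \<longlongrightarrow> 0) (at_right 0)"
proof (rule tendsto_sandwich)
  show "eventually (\<lambda>x. 0 \<le> E x) (at_right 0)"
    using eventually_at_right_less[of 0] by eventually_elim (simp add: E_nonneg)
  show "eventually (\<lambda>x. E x \<le> x\<^sup>2 / (2 * r1)) (at_right 0)"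
    using eventually_at_right_less[of 0] by eventually_elim (use E_upper[of 0] in simp)
  have "((\<lambda>x. x\<^sup>2 / (2 * r1)) \<longlongrightarrow> 0\<^sup>2 / (2 * r1)) (at_right (0::real))"
    using r1_pos by (intro tendsto_intros) auto
  then show "((\<lambda>x. x\<^sup>2 / (2 * r1)) \<longlongrightarrow> 0) (at_right (0::real))" by simp
qed simp

lemma integral_wg_tendsto_0:
  assumes "continuous_on {0..} g"
  shows "((\<lambda>x. integral {0..x} (\<lambda>t. w t * g t)) \<longlongrightarrow> 0) (at_right 0)"
  by (rule indefinite_integral_tendsto_0[OF wg_integrable_cont(2)[OF assms, of 0 1]]) simp_all

lemma P_dy_tendsto_0: "((\<lambda>x. P x * dy s x) \<longlongrightarrow> 0) (at_right 0)"
proof -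
  have "((\<lambda>x. s * integral {0..x} (\<lambda>t. w t * y s t)) \<longlongrightarrow> s * 0) (at_right 0)"
    by (intro tendsto_intros integral_wg_tendsto_0 y_continuous)
  moreover have "eventually (\<lambda>x. s * integral {0..x} (\<lambda>t. w t * y s t) = P x * dy s x) (at_right 0)"
    using eventually_at_right_less[of 0] by eventually_elim (simp add: P_dy)
  ultimately show ?thesis using Lim_transform_eventually by fastforce
qed

lemma y_param_0: "0 \<le> x \<Longrightarrow> y 0 x = 1"
  using y_eq[of x 0] by simp

text \<open>Lagrange's identity: the products of first derivatives cancel when the left side is
  differentiated, and the boundary term at 0 vanishes with the fluxes.\<close>

lemma wronskian:
  assumes "0 < x"
  shows "P x * (dy s x * y t x - y s x * dy t x) = (s - t) * integral {0..x} (\<lambda>r. w r * (y s r * y t r))"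
proof -
  have c: "continuous_on {0..} (\<lambda>r. y s r * y t r)" by (intro continuous_intros y_continuous)
  have "ac_deriv (\<lambda>x. P x * (dy s x * y t x - y s x * dy t x)) (\<lambda>x. (s - t) * (w x * (y s x * y t x)))"
  proof (rule ac_deriv_cong)
    show "ac_deriv (\<lambda>x. (P x * dy s x) * y t x - y s x * (P x * dy t x))
      (\<lambda>x. ((s * (w x * y s x)) * y t x + (P x * dy s x) * dy t x)
        - (dy s x * (P x * dy t x) + y s x * (t * (w x * y t x))))"
      by (intro ac_deriv_diff ac_deriv_mult ac_deriv_P_dy ac_deriv_y)
  qed (auto simp: algebra_simps)
  moreover have "((\<lambda>x. P x * (dy s x * y t x - y s x * dy t x)) \<longlongrightarrow> 0) (at_right 0)"
  proof -
    have "((\<lambda>x. (P x * dy s x) * y t x - y s x * (P x * dy t x)) \<longlongrightarrow> 0 * 1 - 1 * 0) (at_right 0)"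
      by (intro tendsto_intros P_dy_tendsto_0 y_tendsto_0)
    then show ?thesis by (simp add: algebra_simps)
  qed
  moreover have "(\<lambda>x. (s - t) * (w x * (y s x * y t x))) integrable_on {0..x}"
    by (intro integrable_on_mult_right wg_integrable_cont(2)[OF c]) simp
  ultimately have "P x * (dy s x * y t x - y s x * dy t x) = integral {0..x} (\<lambda>x. (s - t) * (w x * (y s x * y t x)))"
    using ac_deriv_integral_from_0 assms by blast
  then show ?thesis by simp
qed

text \<open>The mass is measured with \<open>P\<close>, which differs from the weight by the factor
  \<open>R\<close>, bounded between \<open>r1\<close> and \<open>r2\<close>. It carries an explicit
  bound \<open>B\<close> because mere finiteness would not survive a limit.\<close>

definition ground :: "real \<Rightarrow> real \<Rightarrow> bool" where
  "ground \<mu> B \<longleftrightarrow> 0 \<le> \<mu> \<and> (\<forall>x\<ge>0. 0 < y (-\<mu>) x) \<and>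
    (\<forall>X\<ge>0. integral {0..X} (\<lambda>t. P t * (y (-\<mu>) t)\<^sup>2) \<le> B)"

lemma groundD:
  assumes "ground \<mu> B"
  shows "0 \<le> \<mu>" "\<And>x. 0 \<le> x \<Longrightarrow> 0 < y (-\<mu>) x"
    "\<And>X. 0 \<le> X \<Longrightarrow> integral {0..X} (\<lambda>t. P t * (y (-\<mu>) t)\<^sup>2) \<le> B"
  using assms by (auto simp: ground_def)

lemma P_y2_integrable: "0 \<le> a \<Longrightarrow> (\<lambda>t. P t * (y s t)\<^sup>2) integrable_on {a..x}"
  by (rule Pg_integrable(2)) (intro continuous_intros y_continuous)

lemma not_bounded_mass:
  assumes g: "continuous_on {0..} g" and B: "\<And>X. 0 \<le> X \<Longrightarrow> integral {0..X} (\<lambda>t. P t * (g t)\<^sup>2) \<le> B"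
    and "0 \<le> X0" "0 < c" and low: "\<And>t. X0 \<le> t \<Longrightarrow> c \<le> P t * (g t)\<^sup>2"
  shows False
proof -
  have i: "(\<lambda>t. P t * (g t)\<^sup>2) integrable_on {a..x}" if "0 \<le> a" for a x
    by (rule Pg_integrable(2)[OF _ that]) (intro continuous_intros g)
  define X where "X = X0 + (\<bar>B\<bar> + 1) / c"
  have X: "X0 \<le> X" "0 \<le> X" using assms by (auto simp: X_def)
  have "c * (X - X0) = integral {X0..X} (\<lambda>t. c)" using X by simp
  also have "\<dots> \<le> integral {X0..X} (\<lambda>t. P t * (g t)\<^sup>2)"
    by (rule integral_le) (use low i \<open>0 \<le> X0\<close> in auto)
  also have "\<dots> \<le> integral {0..X} (\<lambda>t. P t * (g t)\<^sup>2)"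
  proof (rule integral_subset_le)
    have "0 \<le> P t * (g t)\<^sup>2" if "t \<in> {0..X}" for t using P_pos[of t] that by (cases "t = 0") auto
    then show "\<forall>t\<in>{0..X}. 0 \<le> P t * (g t)\<^sup>2" by blast
  qed (use i \<open>0 \<le> X0\<close> in auto)
  also have "\<dots> \<le> B" by (rule B[OF X(2)])
  finally show False using \<open>0 < c\<close> by (simp add: X_def)
qed

text \<open>For \<mu> = 0 the solution is constant, and \<open>P\<close> is bounded below on
  \<open>{1..}\<close>, so the mass would be infinite.\<close>

lemma ground_pos:
  assumes g: "ground \<mu> B"
  shows "0 < \<mu>"
proof (rule ccontr)
  assume "\<not> 0 < \<mu>"
  then have "\<mu> = 0" using groundD(1)[OF g] by simp
  show False
  proof (rule not_bounded_mass[OF y_continuous groundD(3)[OF g]])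
    show "1 / (2 * r2) \<le> P t * (y (-\<mu>) t)\<^sup>2" if "1 \<le> t" for t
      using P_lower[OF that] that \<open>\<mu> = 0\<close> by (simp add: y_param_0)
  qed (use r2_pos in auto)
qed

text \<open>Sturm comparison with the ground state: at a first zero of \<open>y s\<close> the
  Wronskian is positive, so \<open>y s\<close> would have to increase there although it comes down
  from positive values.\<close>

lemma y_pos_above_ground:
  assumes g: "ground \<mu> B" and "-\<mu> < s" "0 \<le> x"
  shows "0 < y s x"
proof (rule ccontr)
  assume "\<not> 0 < y s x"
  then have "0 < x" "y s x \<le> 0" using \<open>0 \<le> x\<close> by (cases "x = 0"; simp)+
  then obtain b where b: "0 < b" "y s b = 0" "\<And>t. 0 \<le> t \<Longrightarrow> t < b \<Longrightarrow> 0 < y s t"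
    using first_zero by blast
  have "0 < integral {0..b} (\<lambda>r. w r * (y s r * y (-\<mu>) r))"
  proof (rule wg_integral_pos)
    show "continuous_on {0..} (\<lambda>r. y s r * y (-\<mu>) r)" by (intro continuous_intros y_continuous)
    show "0 \<le> y s t * y (-\<mu>) t" if "0 \<le> t" "t \<le> b" for t
      using b(2) b(3)[of t] groundD(2)[OF g that(1)] that by (cases "t = b") auto
  qed (use b in auto)
  then have "0 < P b * (dy s b * y (-\<mu>) b - y s b * dy (-\<mu>) b)"
    unfolding wronskian[OF b(1)] using assms(2) by simp
  then have "0 < dy s b" using b(2) P_pos[OF b(1)] groundD(2)[OF g, of b] b(1) by (simp add: zero_less_mult_iff)
  from DERIV_pos_inc_left[OF y_deriv[OF b(1)] this]
  obtain d where d: "d > 0" "\<forall>h>0. h < d \<longrightarrow> y s (b - h) < y s b" by blast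
  define h where "h = min (d / 2) (b / 2)"
  have "0 < h" "h < d" "h < b" using d(1) b(1) by (auto simp: h_def)
  then show False using d(2) b(2) b(3)[of "b - h"] by force
qed

section \<open>The inflection point of a ground state\<close>

definition ddy :: "real \<Rightarrow> real \<Rightarrow> real" where
  "ddy s x = (s * y s x - x * dy s x) / R x - (n - 1) / x * dy s x"

text \<open>The flux is already known to be absolutely continuous. Multiplying it by the reciprocal
  of \<open>P\<close>, written \<open>x powr (1 - n) * exp (-1 * E x)\<close>, transfers this to
  \<open>dy s\<close>.\<close>

lemma ac_deriv_dy: "ac_deriv (dy s) (ddy s)"
proof (rule ac_deriv_cong)
  show "ac_deriv (\<lambda>x. (P x * dy s x) * (x powr (1 - n) * exp (-1 * E x)))
    (\<lambda>x. (s * (w x * y s x)) * (x powr (1 - n) * exp (-1 * E x))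
      + (P x * dy s x) * (x powr (1 - n) * exp (-1 * E x) * ((1 - n) / x + -1 * x / R x)))"
    by (intro ac_deriv_mult ac_deriv_P_dy ac_deriv_powr_exp_E)
  have eq: "P x * (x powr (1 - n) * exp (-1 * E x)) = 1" if "0 < x" for x
    using that by (simp add: P_def exp_minus field_simps flip: powr_add)
  then show "dy s x = (P x * dy s x) * (x powr (1 - n) * exp (-1 * E x))" if "0 < x" for x
    using that by (simp add: mult.commute mult.left_commute)
  have "ddy s x = (s * (w x * y s x)) * (x powr (1 - n) * exp (-1 * E x))
      + (P x * dy s x) * (x powr (1 - n) * exp (-1 * E x) * ((1 - n) / x + -1 * x / R x))" if x: "0 < x" for x
  proof -
    let ?q = "x powr (1 - n) * exp (-1 * E x)"
    have "(s * (w x * y s x)) * ?q + (P x * dy s x) * (?q * ((1 - n) / x + -1 * x / R x))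
      = (P x * ?q) * (s * y s x / R x + dy s x * ((1 - n) / x + -1 * x / R x))"
      by (simp add: weight_eq algebra_simps)
    also have "\<dots> = ddy s x" unfolding eq[OF x] using x R_pos[OF x] by (simp add: ddy_def field_simps)
    finally show ?thesis by simp
  qed
  then show "AE x in lebesgue. 0 < x \<longrightarrow> ddy s x = (s * (w x * y s x)) * (x powr (1 - n) * exp (-1 * E x))
      + (P x * dy s x) * (x powr (1 - n) * exp (-1 * E x) * ((1 - n) / x + -1 * x / R x))" by simp
qed

text \<open>By the eigenvalue equation, the radial Laplacian of \<^term>\<open>y (-\<mu>)\<close> is the negative of the
  following function divided by \<^term>\<open>R\<close>.\<close>

definition F :: "real \<Rightarrow> real \<Rightarrow> real" where
  "F \<mu> x = x * dy (-\<mu>) x + \<mu> * y (-\<mu>) x"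

text \<open>The eigenvalue equation reads x y'' = -(n - 1) y' - (x / R) F, whence F' = (2 - n +
  \<mu>) y' - (x / R) F. The integrating factor for the last term is
  \<open>exp (E x)\<close>.\<close>

lemma ac_deriv_exp_F: "ac_deriv (\<lambda>x. exp (E x) * F \<mu> x) (\<lambda>x. (2 - n + \<mu>) * (exp (E x) * dy (-\<mu>) x))"
proof (rule ac_deriv_cong)
  show "ac_deriv (\<lambda>x. exp (1 * E x) * (x * dy (-\<mu>) x + \<mu> * y (-\<mu>) x))
    (\<lambda>x. (exp (1 * E x) * (1 * (x / R x))) * (x * dy (-\<mu>) x + \<mu> * y (-\<mu>) x)
      + exp (1 * E x) * ((1 * dy (-\<mu>) x + x * ddy (-\<mu>) x) + \<mu> * dy (-\<mu>) x))"
    by (intro ac_deriv_mult ac_deriv_exp_E ac_deriv_add ac_deriv_cmult ac_deriv_dy ac_deriv_y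
        ac_deriv_C1[of "\<lambda>x. x"]) (auto intro!: derivative_eq_intros continuous_intros)
  have "(2 - n + \<mu>) * (exp (E x) * dy (-\<mu>) x) = (exp (1 * E x) * (1 * (x / R x))) * (x * dy (-\<mu>) x + \<mu> * y (-\<mu>) x)
      + exp (1 * E x) * ((1 * dy (-\<mu>) x + x * ddy (-\<mu>) x) + \<mu> * dy (-\<mu>) x)" if x: "0 < x" for x
    using x R_pos[OF x] unfolding ddy_def by (simp add: field_simps)
  then show "AE x in lebesgue. 0 < x \<longrightarrow> (2 - n + \<mu>) * (exp (E x) * dy (-\<mu>) x)
    = (exp (1 * E x) * (1 * (x / R x))) * (x * dy (-\<mu>) x + \<mu> * y (-\<mu>) x)
      + exp (1 * E x) * ((1 * dy (-\<mu>) x + x * ddy (-\<mu>) x) + \<mu> * dy (-\<mu>) x)" by simp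
qed (simp add: F_def)

lemma ground_dy_neg: "ground \<mu> B \<Longrightarrow> 0 < x \<Longrightarrow> dy (-\<mu>) x < 0"
  by (rule dy_neg) (auto intro: ground_pos less_imp_le groundD)

lemma exp_F_decreasing:
  assumes g: "ground \<mu> B" and ab: "0 < a" "a < b"
  shows "exp (E b) * F \<mu> b < exp (E a) * F \<mu> a"
proof -
  let ?h = "\<lambda>x. (2 - n + \<mu>) * (exp (E x) * dy (-\<mu>) x)"
  have hi: "(?h has_integral (exp (E b) * F \<mu> b - exp (E a) * F \<mu> a)) {a..b}"
    by (rule ac_deriv_has_integral[OF ac_deriv_exp_F]) (use ab in auto)
  have neg: "?h x < 0" if "0 < x" for x
    using ground_dy_neg[OF g that] n_less groundD(1)[OF g] by (intro mult_pos_neg) auto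
  have "continuous_on {a..b} (\<lambda>x. - ?h x)"
    by (intro continuous_intros continuous_on_subset[OF dy_continuous]
        continuous_on_subset[OF ac_deriv_continuous_on[OF ac_deriv_E]]) (use ab in auto)
  then obtain m where m: "m \<in> {a..b}" "\<And>x. x \<in> {a..b} \<Longrightarrow> - ?h m \<le> - ?h x"
    using continuous_attains_inf[of "{a..b}" "\<lambda>x. - ?h x"] ab by auto
  have "0 < integral {a..b} (\<lambda>x. - ?h x)"
  proof (rule integral_pos_if_bounded_below[OF _ ab(2), of _ "- ?h m"])
    show "(\<lambda>x. - ?h x) integrable_on {a..b}" using has_integral_neg[OF hi] by blast
    show "0 < - ?h m" using neg[of m] m(1) ab by simp
    show "- ?h m \<le> - ?h x" if "x \<in> {a..b}" for x using m(2)[OF that] .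
  qed
  also have "\<dots> = - (exp (E b) * F \<mu> b - exp (E a) * F \<mu> a)"
    by (rule integral_unique[OF has_integral_neg[OF hi]])
  finally show ?thesis by simp
qed

text \<open>The derivative of \<open>x powr \<mu> * y (-\<mu>) x\<close> is
  \<open>x powr (\<mu> - 1) * F \<mu> x\<close>. If \<open>F\<close> were nonnegative, this product
  would be nondecreasing and the ground state would decay at most polynomially, against a density
  \<open>P\<close> of Gaussian growth.\<close>

lemma ground_F_negative_somewhere:
  assumes g: "ground \<mu> B"
  shows "\<exists>x>0. F \<mu> x < 0"
proof (rule ccontr)
  assume "\<not> ?thesis"
  then have nn: "0 \<le> F \<mu> x" if "0 < x" for x using that by (meson not_le)
  let ?f = "y (-\<mu>)"
  have "ac_deriv (\<lambda>x. x powr \<mu> * ?f x) (\<lambda>x. (\<mu> * x powr (\<mu> - 1)) * ?f x + x powr \<mu> * dy (-\<mu>) x)"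
    by (intro ac_deriv_mult ac_deriv_powr ac_deriv_y)
  moreover have "0 \<le> (\<mu> * x powr (\<mu> - 1)) * ?f x + x powr \<mu> * dy (-\<mu>) x" if x: "0 < x" for x
  proof -
    have "(\<mu> * x powr (\<mu> - 1)) * ?f x + x powr \<mu> * dy (-\<mu>) x = x powr (\<mu> - 1) * F \<mu> x"
      using x by (simp add: F_def powr_diff field_simps)
    then show ?thesis using nn[OF x] by simp
  qed
  ultimately have mono: "1 powr \<mu> * ?f 1 \<le> x powr \<mu> * ?f x" if "1 \<le> x" for x
    using ac_deriv_mono[of "\<lambda>x. x powr \<mu> * ?f x" _ 1 x] that by auto
  define c where "c = ?f 1"
  have c: "0 < c" using groundD(2)[OF g, of 1] by (simp add: c_def)
  define d where "d = 1 / (2 * r2)"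
  have "0 < d" using r2_pos by (simp add: d_def)
  define q where "q = \<bar>n - 1 - 2 * \<mu>\<bar>"
  \<comment> \<open>Past \<open>X1\<close> the exponent d x^2 beats q ln x, because ln x <
    x.\<close>
  define X1 where "X1 = q / d"
  have X1: "1 \<le> x powr (n - 1 - 2 * \<mu>) * exp (d * x\<^sup>2)" if x: "max 1 X1 \<le> x" for x
  proof -
    have "- ((n - 1 - 2 * \<mu>) * ln x) \<le> q * ln x"
      unfolding q_def using x by (simp add: abs_if mult_right_mono flip: mult_minus_left)
    also have "\<dots> \<le> q * x" using less_imp_le[OF ln_less_self[of x]] x by (intro mult_left_mono) (auto simp: q_def)
    also have "\<dots> \<le> (d * x) * x" using x \<open>0 < d\<close> by (intro mult_right_mono) (auto simp: X1_def field_simps)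
    finally have "0 \<le> (n - 1 - 2 * \<mu>) * ln x + d * x\<^sup>2" by (simp add: power2_eq_square)
    then have "1 \<le> exp ((n - 1 - 2 * \<mu>) * ln x + d * x\<^sup>2)" by simp
    then show ?thesis using x by (simp add: powr_def exp_add)
  qed
  show False
  proof (rule not_bounded_mass[OF y_continuous groundD(3)[OF g]])
    fix t assume t: "max 1 X1 \<le> t"
    have "c\<^sup>2 * 1 \<le> c\<^sup>2 * (t powr (n - 1 - 2 * \<mu>) * exp (d * t\<^sup>2))"
      using X1[OF t] by (intro mult_left_mono) auto
    also have "\<dots> = t powr (n - 1) * exp (d * t\<^sup>2) * (c * t powr (-\<mu>))\<^sup>2"
    proof -
      have "(t powr (-\<mu>))\<^sup>2 = t powr (-2 * \<mu>)" using t by (simp add: power2_eq_square flip: powr_add)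
      then show ?thesis by (simp add: power_mult_distrib flip: powr_add)
    qed
    also have "\<dots> \<le> P t * (?f t)\<^sup>2"
    proof (rule mult_mono)
      have "d * t\<^sup>2 \<le> E t" using E_lower[of 0 t] t by (simp add: d_def)
      then show "t powr (n - 1) * exp (d * t\<^sup>2) \<le> P t" unfolding P_def by (intro mult_left_mono) auto
      have "c * t powr (-\<mu>) \<le> (t powr \<mu> * ?f t) * t powr (-\<mu>)"
        using mono[of t] t by (intro mult_right_mono) (auto simp: c_def)
      also have "\<dots> = ?f t" using t by (simp add: powr_minus)
      finally show "(c * t powr (-\<mu>))\<^sup>2 \<le> (?f t)\<^sup>2" using c by (intro power_mono) auto
    qed (use P_pos[of t] t in auto)
    finally show "c\<^sup>2 \<le> P t * (?f t)\<^sup>2" by simp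
  qed (use c in auto)
qed

text \<open>\<open>exp (E x) * F \<mu> x\<close> tends to \<mu> > 0 at 0, is strictly decreasing and
  becomes negative; \<open>p\<close> is its only zero.\<close>

lemma ground_inflection:
  assumes g: "ground \<mu> B"
  obtains p where "0 < p" "\<And>x. 0 < x \<Longrightarrow> x < p \<Longrightarrow> 0 < F \<mu> x" "\<And>x. p < x \<Longrightarrow> F \<mu> x < 0"
proof -
  let ?G = "\<lambda>x. exp (E x) * F \<mu> x"
  obtain b where b: "0 < b" "F \<mu> b < 0" using ground_F_negative_somewhere[OF g] by blast
  have "((\<lambda>x. exp (E x) * (x * dy (-\<mu>) x + \<mu> * y (-\<mu>) x)) \<longlongrightarrow> exp 0 * (0 * 0 + \<mu> * 1)) (at_right 0)"
    by (intro tendsto_intros E_tendsto_0 dy_tendsto_0 y_tendsto_0)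
  then have "(?G \<longlongrightarrow> \<mu>) (at_right 0)" by (simp add: F_def)
  from order_tendstoD(1)[OF this ground_pos[OF g]]
  have "eventually (\<lambda>x. 0 < ?G x) (at_right 0)" .
  then have "eventually (\<lambda>x. 0 < ?G x \<and> x \<in> {0<..<b}) (at_right 0)"
    using eventually_at_right_real[OF b(1)] by (rule eventually_conj)
  then obtain a where a: "0 < ?G a" "a \<in> {0<..<b}" using eventually_happens trivial_limit_at_right_real by blast
  have "continuous_on {a..b} ?G"
    by (rule continuous_on_subset[OF ac_deriv_continuous_on[OF ac_deriv_exp_F]]) (use a in auto)
  moreover have "?G b \<le> 0" using b(2) by (simp add: mult_le_0_iff)
  ultimately obtain p where p: "a \<le> p" "p \<le> b" "?G p = 0"
    using IVT2'[of ?G b 0 a] a by auto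
  have p0: "0 < p" using p(1) a(2) by auto
  show ?thesis
  proof (rule that[OF p0])
    fix x assume "0 < x" "x < p"
    then have "0 < ?G x" using exp_F_decreasing[OF g, of x p] p(3) by simp
    then show "0 < F \<mu> x" by (simp add: zero_less_mult_iff)
  next
    fix x assume "p < x"
    then have "?G x < 0" using exp_F_decreasing[OF g p0, of x] p(3) by simp
    then show "F \<mu> x < 0" by (simp add: mult_less_0_iff)
  qed
qed

end

text \<open>Nonnegativity and the mass bound are asked for on \<open>{0..Xs k}\<close> only, with
  \<open>Xs k\<close> tending to infinity. The sequence may thus consist of solutions observed up to
  their first zero as well as of genuine ground states. The limit is nonnegative, hence positive,
  and keeps the mass bound by dominated convergence on compact intervals.\<close>

lemma ground_limit:
  fixes Rs :: "nat \<Rightarrow> real \<Rightarrow> real"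
  assumes rk: "\<And>k. radial n r1 r2 (Rs k)" and r: "radial n r1 r2 R"
    and lim: "\<And>x. 0 < x \<Longrightarrow> (\<lambda>k. Rs k x) \<longlonglongrightarrow> R x"
    and \<mu>: "\<mu>s \<longlonglongrightarrow> \<mu>" "\<And>k. 0 \<le> \<mu>s k"
    and Xs: "filterlim Xs at_top sequentially"
    and nn: "\<And>k t. 0 \<le> t \<Longrightarrow> t \<le> Xs k \<Longrightarrow> 0 \<le> radial.y n (Rs k) (- \<mu>s k) t"
    and bd: "\<And>k X. 0 \<le> X \<Longrightarrow> X \<le> Xs k \<Longrightarrow>
      integral {0..X} (\<lambda>t. radial.P n (Rs k) t * (radial.y n (Rs k) (- \<mu>s k) t)\<^sup>2) \<le> B"
  shows "radial.ground n R \<mu> B"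
proof -
  interpret r: radial n r1 r2 R by (rule r)
  interpret rk: radial n r1 r2 "Rs k" for k by (rule rk)
  have \<mu>0: "0 \<le> \<mu>" using \<mu> by (intro LIMSEQ_le_const) auto
  have ylim: "(\<lambda>k. rk.y k (- \<mu>s k) t) \<longlonglongrightarrow> r.y (-\<mu>) t" if "0 \<le> t" for t
    by (rule radial_y_tendsto[OF rk r lim]) (use that \<mu>(1) in \<open>auto intro: tendsto_intros\<close>)
  have evX: "eventually (\<lambda>k. X \<le> Xs k) sequentially" for X
    using Xs by (simp add: filterlim_at_top)
  have ynn: "0 \<le> r.y (-\<mu>) t" if "0 \<le> t" for t
    by (rule tendsto_lowerbound[OF ylim[OF that]])
      (use evX[of t] nn that in \<open>auto elim!: eventually_mono\<close>)
  have ypos: "0 < r.y (-\<mu>) t" if t: "0 \<le> t" for t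
  proof (cases "\<mu> = 0")
    case True
    then show ?thesis using r.y_param_0[OF t] by simp
  next
    case False
    have "r.y (-\<mu>) t \<noteq> 0"
    proof
      assume z: "r.y (-\<mu>) t = 0"
      then have "0 < t" using t by (cases "t = 0") auto
      then obtain x where "0 < x" "r.y (-\<mu>) x < 0"
        using r.y_zero_imp_negative[of \<mu> t] z False \<mu>0 by auto
      then show False using ynn[of x] by simp
    qed
    then show ?thesis using ynn[OF t] by simp
  qed
  obtain m where m: "\<And>k. \<bar>- \<mu>s k\<bar> \<le> m"
    using convergent_imp_Bseq[OF convergentI[OF \<mu>(1)]] by (auto simp: Bseq_def)
  have m0: "0 \<le> m" using m[of 0] by linarith
  have "integral {0..X} (\<lambda>t. r.P t * (r.y (-\<mu>) t)\<^sup>2) \<le> B" if X: "0 \<le> X" for X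
  proof -
    define C where "C = exp (X\<^sup>2 / (2 * r1)) * (exp (m * X\<^sup>2 / (2 * n * r1)))\<^sup>2"
    have "(\<lambda>k. integral {0..X} (\<lambda>t. rk.P k t * (rk.y k (- \<mu>s k) t)\<^sup>2)) \<longlonglongrightarrow> integral {0..X} (\<lambda>t. r.P t * (r.y (-\<mu>) t)\<^sup>2)"
    proof (rule dominated_convergence(2)[where h = "\<lambda>t. C * t powr (n - 1)"])
      show "(\<lambda>t. rk.P k t * (rk.y k (- \<mu>s k) t)\<^sup>2) integrable_on {0..X}" for k
        by (rule rk.P_y2_integrable) simp
      show "(\<lambda>t. C * t powr (n - 1)) integrable_on {0..X}"
        using has_integral_mult_right[OF r.has_integral_powr_n[OF X]] by blast
      show "(\<lambda>k. rk.P k t * (rk.y k (- \<mu>s k) t)\<^sup>2) \<longlonglongrightarrow> r.P t * (r.y (-\<mu>) t)\<^sup>2" if "t \<in> {0..X}" for t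
        using that by (intro tendsto_intros ylim radial_P_tendsto[OF rk r lim]) auto
      show "norm (rk.P k t * (rk.y k (- \<mu>s k) t)\<^sup>2) \<le> C * t powr (n - 1)" if t: "t \<in> {0..X}" for k t
      proof (cases "t = 0")
        case False
        then have t': "0 < t" "t \<le> X" using t by auto
        have p: "rk.P k t \<le> t powr (n - 1) * exp (X\<^sup>2 / (2 * r1))"
        proof -
          have "rk.P k t \<le> t powr (n - 1) * exp (rk.E k X)" by (rule rk.P_le[OF t'])
          also have "\<dots> \<le> t powr (n - 1) * exp (X\<^sup>2 / (2 * r1))"
            using rk.E_upper[of 0 X k] X by (intro mult_left_mono) auto
          finally show ?thesis .
        qed
        have "\<bar>rk.y k (- \<mu>s k) t\<bar> \<le> exp (m * t\<^sup>2 / (2 * n * r1))" using rk.y_bound[OF _ m] t' by simp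
        also have "\<dots> \<le> exp (m * X\<^sup>2 / (2 * n * r1))"
          using t' m0 r.n_pos r.r1_pos
          by (subst exp_le_cancel_iff) (intro divide_right_mono mult_left_mono power_mono, auto)
        finally have "\<bar>rk.y k (- \<mu>s k) t\<bar>\<^sup>2 \<le> (exp (m * X\<^sup>2 / (2 * n * r1)))\<^sup>2"
          by (intro power_mono) auto
        then have "rk.P k t * (rk.y k (- \<mu>s k) t)\<^sup>2
          \<le> (t powr (n - 1) * exp (X\<^sup>2 / (2 * r1))) * (exp (m * X\<^sup>2 / (2 * n * r1)))\<^sup>2"
          using p rk.P_pos[OF t'(1), of k] by (intro mult_mono) auto
        then show ?thesis using rk.P_pos[OF t'(1), of k] by (simp add: C_def mult_ac)
      qed simp
    qed
    then show ?thesis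
      by (rule tendsto_upperbound) (use evX[of X] bd[OF X] in \<open>auto elim!: eventually_mono\<close>)
  qed
  then show ?thesis using \<mu>0 ypos by (simp add: r.ground_def)
qed

section \<open>Existence and comparison of ground states\<close>

context radial
begin

lemma mean_value:
  assumes "0 \<le> a" "a < b"
  obtains z where "a < z" "z < b" "y s b - y s a = dy s z * (b - a)"
proof -
  have "continuous_on {a..b} (y s)" by (rule continuous_on_subset[OF y_continuous]) (use assms in auto)
  moreover have "(y s has_derivative (\<lambda>h. dy s z * h)) (at z)" if "a < z" "z < b" for z
    using y_deriv[of z s] that assms(1) by (simp add: has_field_derivative_def)
  ultimately obtain z where "a < z" "z < b" "y s b - y s a = dy s z * (b - a)"
    using mvt[OF \<open>a < b\<close>, of "y s" "\<lambda>z h. dy s z * h"] by blast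
  then show ?thesis by (rule that)
qed

text \<open>A positive solution decreases on \<open>{0..1}\<close>, so beyond 1 its flux is in
  absolute value at least \<mu> y(1) times the weight of \<open>{0..1}\<close>. For large \<mu> the
  resulting slope brings the solution below 0 at 2.\<close>

lemma oscillating_parameter_exists: "\<exists>\<mu>>0. \<exists>x>0. y (-\<mu>) x < 0"
proof -
  define c where "c = integral {0..1} (\<lambda>t. w t * 1)"
  have c: "0 < c" unfolding c_def by (rule wg_integral_pos) auto
  have "continuous_on {1..2} P" by (rule continuous_on_subset[OF P_continuous]) auto
  then obtain B where B: "\<And>x. x \<in> {1..2} \<Longrightarrow> \<bar>P x\<bar> \<le> B" using continuous_on_interval_bounded by blast
  have B0: "0 < B" using B[of 1] P_pos[of 1] by simp
  \<comment> \<open>With this value the mean slope between 1 and 2 is at most -2 y(1).\<close>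
  define \<mu> where "\<mu> = 2 * B / c"
  have \<mu>: "0 < \<mu>" using B0 c by (simp add: \<mu>_def)
  have "\<exists>x>0. y (-\<mu>) x < 0"
  proof (rule ccontr)
    assume no: "\<not> ?thesis"
    then have pos: "0 < y (-\<mu>) t" if "0 \<le> t" for t
    proof (cases "t = 0")
      case False
      then have "0 < t" using that by simp
      moreover have "y (-\<mu>) t \<noteq> 0" using y_zero_imp_negative[OF \<mu> \<open>0 < t\<close>] no by blast
      ultimately show ?thesis using no by (meson linorder_neqE_linordered_idom)
    qed simp
    have dneg: "dy (-\<mu>) t < 0" if "0 < t" for t
      by (rule dy_neg[OF \<mu> that]) (use pos in \<open>auto intro: less_imp_le\<close>)
    have dec: "y (-\<mu>) 1 \<le> y (-\<mu>) t" if "0 \<le> t" "t \<le> 1" for t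
    proof (cases "t = 1")
      case False
      then have "t < 1" using that by simp
      from mean_value[OF that(1) \<open>t < 1\<close>]
      obtain z where z: "t < z" "z < 1" "y (-\<mu>) 1 - y (-\<mu>) t = dy (-\<mu>) z * (1 - t)" by blast
      have "dy (-\<mu>) z * (1 - t) \<le> 0" using dneg[of z] z that by (simp add: mult_nonpos_nonneg)
      then show ?thesis using z(3) by simp
    qed simp
    obtain z where z: "1 < z" "z < 2" "y (-\<mu>) 2 - y (-\<mu>) 1 = dy (-\<mu>) z"
      using mean_value[of 1 2 "-\<mu>"] by auto
    note wi = wg_integrable_cont(2)[OF y_continuous[of "-\<mu>"]]
    have c1: "continuous_on {0..} (\<lambda>t. 1 :: real)" by (rule continuous_on_const)
    have wnn: "0 \<le> w t" if "0 \<le> t" for t using w_pos[of t] that by (cases "t = 0") auto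
    have "y (-\<mu>) 1 * c = integral {0..1} (\<lambda>t. w t * 1 * y (-\<mu>) 1)"
      by (simp add: c_def mult.commute)
    also have "\<dots> \<le> integral {0..1} (\<lambda>t. w t * y (-\<mu>) t)"
    proof (rule integral_le)
      show "(\<lambda>t. w t * 1 * y (-\<mu>) 1) integrable_on {0..1}"
        by (intro integrable_on_mult_left wg_integrable_cont(2)[OF c1]) simp
      show "w t * 1 * y (-\<mu>) 1 \<le> w t * y (-\<mu>) t" if "t \<in> {0..1}" for t
        using that dec[of t] wnn[of t] by (simp add: mult_left_mono)
    qed (simp add: wi)
    also have "\<dots> \<le> integral {0..z} (\<lambda>t. w t * y (-\<mu>) t)"
    proof (rule integral_subset_le)
      have "0 \<le> w t * y (-\<mu>) t" if "t \<in> {0..z}" for t using wnn[of t] pos[of t] that by simp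
      then show "\<forall>t\<in>{0..z}. 0 \<le> w t * y (-\<mu>) t" by blast
    qed (use z wi in auto)
    finally have "\<mu> * (y (-\<mu>) 1 * c) \<le> \<mu> * integral {0..z} (\<lambda>t. w t * y (-\<mu>) t)"
      using \<mu> by (intro mult_left_mono) auto
    also have "\<dots> = P z * (- dy (-\<mu>) z)" using P_dy[of z "-\<mu>"] z by simp
    also have "\<dots> \<le> B * (- dy (-\<mu>) z)"
      using B[of z] dneg[of z] z P_pos[of z] by (intro mult_right_mono) auto
    finally have "2 * B * y (-\<mu>) 1 \<le> B * (- dy (-\<mu>) z)" using c by (simp add: \<mu>_def)
    then have "B * (2 * y (-\<mu>) 1) \<le> B * (- dy (-\<mu>) z)" by (simp add: mult_ac)
    then have "2 * y (-\<mu>) 1 \<le> - dy (-\<mu>) z" using B0 by (rule mult_left_le_imp_le)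
    then show False using z(3) pos[of 1] pos[of 2] by simp
  qed
  then show ?thesis using \<mu> by blast
qed

text \<open>\<mu> is the infimum of the parameters whose solution becomes negative. For such
  parameters \<open>ms k\<close> converging to \<mu> the first zeros escape to infinity, so the mass
  bound before a zero turns into one on the whole half-line. Since \<open>ms k\<close> is at most
  \<open>\<mu> + 1\<close>, one bound serves for all \<open>k\<close>.\<close>

theorem ground_exists: "\<exists>\<mu>. ground \<mu> (mass_bound n r1 r2 (\<mu> + 1))"
proof -
  define N where "N = {\<mu>. 0 < \<mu> \<and> (\<exists>x>0. y (-\<mu>) x < 0)}"
  define \<mu> where "\<mu> = Inf N"
  have Nne: "N \<noteq> {}" using oscillating_parameter_exists by (auto simp: N_def)
  have Nbd: "bdd_below N" by (rule bdd_belowI[of _ 0]) (auto simp: N_def)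
  have \<mu>0: "0 \<le> \<mu>" unfolding \<mu>_def by (rule cInf_greatest[OF Nne]) (auto simp: N_def)
  have self: "radial n r1 r2 R" by unfold_locales
  have notin: "0 \<le> y (-\<mu>) x" if "0 \<le> x" for x
  proof (rule ccontr)
    assume "\<not> 0 \<le> y (-\<mu>) x"
    then have neg: "y (-\<mu>) x < 0" by simp
    then have x: "0 < x" using that by (cases "x = 0") auto
    have \<mu>p: "0 < \<mu>" using neg \<mu>0 that by (cases "\<mu> = 0") (auto simp: y_param_0)
    \<comment> \<open>If the solution at \<mu> were negative somewhere, continuity in the parameter
      would put values below the infimum into \<open>N\<close>.\<close>
    define ms where "ms k = \<mu> - inverse (real (Suc k))" for k
    have ms: "ms \<longlonglongrightarrow> \<mu>" unfolding ms_def
      using tendsto_diff[OF tendsto_const[of \<mu>] LIMSEQ_inverse_real_of_nat] by simp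
    have "(\<lambda>k. y (- ms k) x) \<longlonglongrightarrow> y (-\<mu>) x"
      by (rule radial_y_tendsto[OF self self]) (use ms that in \<open>auto intro: tendsto_intros\<close>)
    then have "eventually (\<lambda>k. y (- ms k) x < 0) sequentially" using neg by (intro order_tendstoD(2))
    moreover have "eventually (\<lambda>k. 0 < ms k) sequentially" using ms \<mu>p by (rule order_tendstoD(1))
    ultimately have "eventually (\<lambda>k. y (- ms k) x < 0 \<and> 0 < ms k) sequentially" by (rule eventually_conj)
    then obtain k where "y (- ms k) x < 0" "0 < ms k" using eventually_happens'[OF sequentially_bot] by blast
    then have "ms k \<in> N" using x by (auto simp: N_def)
    then have "\<mu> \<le> ms k" unfolding \<mu>_def by (rule cInf_lower[OF _ Nbd])
    then show False by (simp add: ms_def)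
  qed
  have nozero: "y (-\<mu>) x \<noteq> 0" if "0 \<le> x" for x
  proof (cases "\<mu> = 0 \<or> x = 0")
    case True
    then show ?thesis using that by (auto simp: y_param_0)
  next
    case False
    then have "0 < \<mu>" "0 < x" using \<mu>0 that by auto
    show ?thesis
    proof
      assume "y (-\<mu>) x = 0"
      from y_zero_imp_negative[OF \<open>0 < \<mu>\<close> \<open>0 < x\<close> this] obtain z where "0 < z" "y (-\<mu>) z < 0" by blast
      then show False using notin[of z] by simp
    qed
  qed
  have "\<exists>m. m \<in> N \<and> m < \<mu> + inverse (real (Suc k))" for k
  proof -
    have "Inf N < \<mu> + inverse (real (Suc k))" unfolding \<mu>_def by simp
    then show ?thesis using cInf_lessD[OF Nne] by blast
  qed
  then obtain ms where ms: "\<And>k. ms k \<in> N" "\<And>k. ms k < \<mu> + inverse (real (Suc k))" by metis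
  have ms_ge: "\<mu> \<le> ms k" for k unfolding \<mu>_def by (rule cInf_lower[OF ms(1) Nbd])
  have mslim: "ms \<longlonglongrightarrow> \<mu>"
  proof (rule tendsto_sandwich[of "\<lambda>k. \<mu>" _ _ "\<lambda>k. \<mu> + inverse (real (Suc k))"])
    show "(\<lambda>k. \<mu> + inverse (real (Suc k))) \<longlonglongrightarrow> \<mu>"
      using tendsto_add[OF tendsto_const[of \<mu>] LIMSEQ_inverse_real_of_nat] by simp
  qed (use ms_ge ms(2) in \<open>auto intro!: always_eventually less_imp_le\<close>)
  have "\<exists>b. 0 < b \<and> y (- ms k) b = 0 \<and> (\<forall>t. 0 \<le> t \<and> t < b \<longrightarrow> 0 < y (- ms k) t)" for k
  proof -
    obtain x where "0 < x" "y (- ms k) x < 0" using ms(1)[of k] by (auto simp: N_def)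
    then obtain b where "0 < b" "y (- ms k) b = 0" "\<And>t. 0 \<le> t \<Longrightarrow> t < b \<Longrightarrow> 0 < y (- ms k) t"
      using first_zero[of x "- ms k"] by auto
    then show ?thesis by blast
  qed
  then obtain b where b: "\<And>k. 0 < b k \<and> y (- ms k) (b k) = 0 \<and> (\<forall>t. 0 \<le> t \<and> t < b k \<longrightarrow> 0 < y (- ms k) t)"
    by metis
  \<comment> \<open>Otherwise a subsequence of the zeros would converge to a zero of the solution at
    \<mu>.\<close>
  have blim: "filterlim b at_top sequentially"
  proof (rule ccontr)
    assume "\<not> ?thesis"
    then obtain X where "\<not> eventually (\<lambda>k. X \<le> b k) sequentially" by (auto simp: filterlim_at_top)
    then have inf: "infinite {k. b k < X}"
      by (simp add: eventually_sequentially INFM_nat_le[symmetric] frequently_cofinite not_le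
          flip: infinite_nat_iff_unbounded_le)
    define f where "f = enumerate {k. b k < X}"
    have sf: "strict_mono f" unfolding f_def using inf by (rule strict_mono_enumerate)
    have fX: "b (f k) < X" for k using enumerate_in_set[OF inf, of k] by (simp add: f_def)
    have "compact {0..X}" by simp
    moreover have "\<forall>k. b (f k) \<in> {0..X}" using fX b by (auto intro: less_imp_le)
    ultimately obtain l g where g: "l \<in> {0..X}" "strict_mono g" "((b \<circ> f) \<circ> g) \<longlonglongrightarrow> l"
      unfolding compact_def by (metis comp_apply)
    have "(\<lambda>k. y (- ms (f (g k))) (b (f (g k)))) \<longlonglongrightarrow> y (-\<mu>) l"
    proof (rule radial_y_tendsto[OF self self])
      have "(\<lambda>k. ms (f (g k))) \<longlonglongrightarrow> \<mu>"
        using LIMSEQ_subseq_LIMSEQ[OF mslim strict_mono_o[OF sf g(2)]] by (simp add: o_def)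
      then show "(\<lambda>k. - ms (f (g k))) \<longlonglongrightarrow> - \<mu>" by (rule tendsto_minus)
      show "(\<lambda>k. b (f (g k))) \<longlonglongrightarrow> l" using g(3) by (simp add: o_def)
      show "0 \<le> b (f (g k))" for k using b by (simp add: less_imp_le)
    qed auto
    then have "y (-\<mu>) l = 0" using b by (simp add: LIMSEQ_const_iff)
    then show False using nozero[of l] g(1) by simp
  qed
  have "ground \<mu> (mass_bound n r1 r2 (\<mu> + 1))"
  proof (rule ground_limit[OF self self _ mslim _ blim])
    show "0 \<le> ms k" for k using ms_ge[of k] \<mu>0 by simp
    show "0 \<le> y (- ms k) t" if "0 \<le> t" "t \<le> b k" for k t
      using b[of k] that by (cases "t = b k") (auto intro: less_imp_le)
    fix k X assume X: "0 \<le> X" "X \<le> b k"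
    have "inverse (real (Suc k)) \<le> 1" by (simp add: inverse_eq_divide)
    then have "ms k \<le> \<mu> + 1" using ms(2)[of k] by simp
    moreover have "0 < ms k" using ms(1)[of k] by (simp add: N_def)
    ultimately show "integral {0..X} (\<lambda>t. P t * (y (- ms k) t)\<^sup>2) \<le> mass_bound n r1 r2 (\<mu> + 1)"
      using b[of k] X by (intro mass_bound_before_zero[where b = "b k"]) auto
  qed simp
  then show ?thesis by blast
qed

end

section \<open>Comparison with the step at the inflection point\<close>

lemma radial_step:
  assumes "radial n r1 r2 R" "r1 \<le> r2"
  shows "radial n r1 r2 (step_fun r1 r2 p)"
proof -
  interpret r: radial n r1 r2 R by fact
  have "step_fun r1 r2 p \<in> borel_measurable borel" unfolding step_fun_def[abs_def] by measurable
  then have "step_fun r1 r2 p \<in> borel_measurable (restrict_space borel {0<..})"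
    by (rule measurable_restrict_space1)
  then show ?thesis
    using r.n_pos r.n_less r.r1_pos assms(2) by unfold_locales (auto simp: step_fun_def)
qed

text \<open>\<open>W\<close>, the Wronskian of the two ground states taken with the \<open>P\<close>
  of the step, is nondecreasing and starts at 0. If it were positive somewhere, the quotient
  \<open>g / f\<close> would fall from there on at a rate of at least a constant over P f^2; finite
  mass of \<open>f\<close> makes the integral of that rate diverge and the quotient negative. So
  \<open>W\<close> vanishes identically, which forces equal eigenvalues and a constant
  quotient.\<close>

theorem ground_comparison:
  assumes "radial n r1 r2 R" "radial.ground n R \<mu> B" "0 < p"
    and F1: "\<And>x. 0 < x \<Longrightarrow> x < p \<Longrightarrow> 0 < radial.F n R \<mu> x" and F2: "\<And>x. p < x \<Longrightarrow> radial.F n R \<mu> x < 0"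
    and "radial n r1 r2 (step_fun r1 r2 p)" "radial.ground n (step_fun r1 r2 p) \<mu>' B'"
    and le: "\<mu> \<le> \<mu>'"
  shows "\<mu>' = \<mu> \<and> (\<forall>x\<ge>0. radial.y n (step_fun r1 r2 p) (-\<mu>') x = radial.y n R (-\<mu>) x)"
proof -
  let ?S = "step_fun r1 r2 p"
  interpret r: radial n r1 r2 R by fact
  interpret s: radial n r1 r2 ?S by fact
  note gr = assms(2) and gs = assms(7)
  define f where "f = r.y (-\<mu>)"
  define f' where "f' = r.dy (-\<mu>)"
  define g where "g = s.y (-\<mu>')"
  define g' where "g' = s.dy (-\<mu>')"
  define W where "W x = s.P x * (f' x * g x - f x * g' x)" for x
  have fpos: "0 < f x" if "0 \<le> x" for x using r.groundD(2)[OF gr that] by (simp add: f_def)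
  have gpos: "0 < g x" if "0 \<le> x" for x using s.groundD(2)[OF gs that] by (simp add: g_def)
  have fcont: "continuous_on {0..} f" and gcont: "continuous_on {0..} g"
    by (simp_all add: f_def g_def r.y_continuous s.y_continuous)
  \<comment> \<open>With \<open>?S\<close> in place of \<open>R\<close> the operator sends
    \<open>f\<close> to F - \<mu> f - S F / R, because - F / R is the radial Laplacian of
    \<open>f\<close>. The term with \<mu>' comes from the equation for \<open>g\<close>.\<close>
  define W' where "W' x = s.w x * ((r.F \<mu> x - ?S x * r.F \<mu> x / R x) + (\<mu>' - \<mu>) * f x) * g x" for x
  have acW: "ac_deriv W W'"
  proof (rule ac_deriv_cong)
    show "ac_deriv (\<lambda>x. (s.P x * f' x) * g x - f x * (s.P x * g' x))
      (\<lambda>x. (((s.P x * ((n - 1) / x + x / ?S x)) * f' x + s.P x * r.ddy (-\<mu>) x) * g x + (s.P x * f' x) * g' x)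
        - (f' x * (s.P x * g' x) + f x * ((-\<mu>') * (s.w x * g x))))"
      unfolding f_def f'_def g_def g'_def
      by (intro ac_deriv_diff ac_deriv_mult s.ac_deriv_P r.ac_deriv_dy s.ac_deriv_y r.ac_deriv_y s.ac_deriv_P_dy)
    have "W' x = (((s.P x * ((n - 1) / x + x / ?S x)) * f' x + s.P x * r.ddy (-\<mu>) x) * g x + (s.P x * f' x) * g' x)
        - (f' x * (s.P x * g' x) + f x * ((-\<mu>') * (s.w x * g x)))" if x: "0 < x" for x
    proof -
      \<comment> \<open>Naming the reciprocals makes the identity polynomial up to the relations
        \<open>uv\<close>.\<close>
      define u where "u = 1 / R x"
      define v where "v = 1 / ?S x"
      have uv: "R x * u = 1" "?S x * v = 1" using r.R_pos[OF x] s.R_pos[OF x] by (auto simp: u_def v_def)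
      have eq1: "(s.P x * ((n - 1) / x + x / ?S x)) * f' x + s.P x * r.ddy (-\<mu>) x
          = s.P x * (x * v * f' x - u * r.F \<mu> x)"
        by (simp add: r.ddy_def r.F_def f_def f'_def u_def v_def diff_divide_distrib add_divide_distrib algebra_simps)
      have eq2: "s.w x = s.P x * v" by (simp add: s.weight_eq v_def)
      have eq3: "?S x * r.F \<mu> x / R x = ?S x * r.F \<mu> x * u" by (simp add: u_def)
      have F: "r.F \<mu> x = x * f' x + \<mu> * f x" by (simp add: r.F_def f_def f'_def)
      have "W' x = s.P x * g x * (v * (x * f' x + \<mu>' * f x) - (?S x * v) * r.F \<mu> x * u)"
        unfolding W'_def eq2 eq3 by (simp add: F algebra_simps)
      also have "\<dots> = s.P x * g x * (v * (x * f' x + \<mu>' * f x) - r.F \<mu> x * u)" by (simp add: uv)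
      finally show ?thesis unfolding eq1 eq2 by (simp add: algebra_simps)
    qed
    then show "AE x in lebesgue. 0 < x \<longrightarrow> W' x = (((s.P x * ((n - 1) / x + x / ?S x)) * f' x + s.P x * r.ddy (-\<mu>) x) * g x + (s.P x * f' x) * g' x)
        - (f' x * (s.P x * g' x) + f x * ((-\<mu>') * (s.w x * g x)))" by simp
  qed (simp add: W_def algebra_simps)
  \<comment> \<open>The step takes the least admissible value where \<open>F\<close> is positive and
    the largest where \<open>F\<close> is negative, so F (R - S) is nonnegative.\<close>
  have key: "0 \<le> r.F \<mu> x - ?S x * r.F \<mu> x / R x" if x: "0 < x" "x \<noteq> p" for x
  proof -
    have "r.F \<mu> x - ?S x * r.F \<mu> x / R x = r.F \<mu> x * (R x - ?S x) / R x"
      using r.R_pos[OF x(1)] by (simp add: field_simps)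
    also have "0 \<le> \<dots>"
    proof (cases "x < p")
      case True
      then show ?thesis using F1[OF x(1) True] r.R_lower[OF x(1)] r.R_pos[OF x(1)] by (simp add: step_fun_def)
    next
      case False
      then have "r.F \<mu> x < 0" "?S x = r2" using F2[of x] x by (auto simp: step_fun_def)
      then show ?thesis using r.R_upper[OF x(1)] r.R_pos[OF x(1)] by (simp add: mult_nonpos_nonpos)
    qed
    finally show ?thesis .
  qed
  have Wlim: "(W \<longlongrightarrow> 0) (at_right 0)"
  proof -
    \<comment> \<open>The flux of \<open>f\<close> is known to vanish with the \<open>P\<close> of
      \<open>R\<close>; the ratio of the two densities is \<open>exp (s.E x - r.E x)\<close>, which
      tends to 1.\<close>
    have "((\<lambda>x. exp (s.E x - r.E x) * (r.P x * f' x) * g x - f x * (s.P x * g' x))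
        \<longlongrightarrow> exp (0 - 0) * 0 * 1 - 1 * 0) (at_right 0)"
      unfolding f_def f'_def g_def g'_def
      by (intro tendsto_intros r.E_tendsto_0 s.E_tendsto_0 r.P_dy_tendsto_0 s.P_dy_tendsto_0
          r.y_tendsto_0 s.y_tendsto_0)
    moreover have "exp (s.E x - r.E x) * (r.P x * f' x) * g x - f x * (s.P x * g' x) = W x" for x
      by (simp add: W_def r.P_def s.P_def exp_diff algebra_simps)
    ultimately show ?thesis by simp
  qed
  have AEp: "AE x in lebesgue. x \<noteq> p" by (simp add: AE_lebesgue_iff_negligible)
  have fgcont: "continuous_on {0..} (\<lambda>t. f t * g t)" by (intro continuous_intros fcont gcont)
  have Wlow: "(\<mu>' - \<mu>) * integral {0..x} (\<lambda>t. s.w t * (f t * g t)) \<le> W x" if x: "0 < x" for x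
  proof -
    let ?I = "\<lambda>x. integral {0..x} (\<lambda>t. s.w t * (f t * g t))"
    have "0 \<le> W x - (\<mu>' - \<mu>) * ?I x"
    proof (rule ac_deriv_nonneg_from_0[OF _ _ _ x])
      show "ac_deriv (\<lambda>x. W x - (\<mu>' - \<mu>) * ?I x) (\<lambda>x. W' x - (\<mu>' - \<mu>) * (s.w x * (f x * g x)))"
        by (intro ac_deriv_diff acW ac_deriv_cmult ac_deriv_indefinite_integral s.integral_wg_diff
            s.wg_integrable_cont[OF fgcont]) auto
      have "((\<lambda>x. W x - (\<mu>' - \<mu>) * ?I x) \<longlongrightarrow> 0 - (\<mu>' - \<mu>) * 0) (at_right 0)"
        by (intro tendsto_intros Wlim s.integral_wg_tendsto_0 fgcont)
      then show "((\<lambda>x. W x - (\<mu>' - \<mu>) * ?I x) \<longlongrightarrow> 0) (at_right 0)" by simp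
      show "AE x in lebesgue. 0 < x \<longrightarrow> 0 \<le> W' x - (\<mu>' - \<mu>) * (s.w x * (f x * g x))"
        using AEp
      proof eventually_elim
        case (elim x)
        show ?case
        proof
          assume x: "0 < x"
          have "W' x - (\<mu>' - \<mu>) * (s.w x * (f x * g x)) = s.w x * (r.F \<mu> x - ?S x * r.F \<mu> x / R x) * g x"
            by (simp add: W'_def algebra_simps)
          then show "0 \<le> W' x - (\<mu>' - \<mu>) * (s.w x * (f x * g x))"
            using key[OF x elim] s.w_pos[OF x] gpos[of x] x by simp
        qed
      qed
    qed
    then show ?thesis by simp
  qed
  have W'nn: "AE x in lebesgue. 0 < x \<longrightarrow> 0 \<le> W' x"
    using AEp
  proof eventually_elim
    case (elim x)
    show ?case
      using key[of x] elim s.w_pos[of x] gpos[of x] fpos[of x] le by (auto simp: W'_def intro!: mult_nonneg_nonneg add_nonneg_nonneg)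
  qed
  have Wnn: "0 \<le> W x" if "0 < x" for x
    by (rule ac_deriv_nonneg_from_0[OF acW Wlim W'nn that])
  define q where "q x = g x / f x" for x
  have qd: "(q has_real_derivative - (W x / (s.P x * (f x)\<^sup>2))) (at x)" if x: "0 < x" for x
  proof -
    have "(q has_real_derivative (g' x * f x - g x * f' x) / (f x * f x)) (at x)"
      unfolding q_def[abs_def] g_def f_def g'_def f'_def
      by (rule DERIV_divide[OF s.y_deriv[OF x] r.y_deriv[OF x]]) (use fpos[of x] x in \<open>auto simp: f_def\<close>)
    moreover have "(g' x * f x - g x * f' x) / (f x * f x) = - (W x / (s.P x * (f x)\<^sup>2))"
      using s.P_pos[OF x] fpos[of x] x by (simp add: W_def power2_eq_square field_simps)
    ultimately show ?thesis by simp
  qed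
  have W0: "W x = 0" if x0: "0 < x" for x
  proof (rule ccontr)
    assume "W x \<noteq> 0"
    then have Wx: "0 < W x" using Wnn[OF x0] by simp
    define a where "a = max x p"
    have a: "0 < a" "x \<le> a" "p \<le> a" using x0 by (auto simp: a_def)
    \<comment> \<open>Beyond \<open>p\<close> the step has the smallest possible drift v / r2, so on
      that range the ratio of the two densities is largest at \<open>p\<close>.\<close>
    define C where "C = exp (s.E p - r.E p)"
    have C: "0 < C" by (simp add: C_def)
    have PC: "s.P t \<le> C * r.P t" if "p \<le> t" for t
    proof -
      have "s.E t - s.E p = integral {p..t} (\<lambda>v. v / ?S v)"
        by (rule s.E_diff) (use \<open>0 < p\<close> that in auto)
      also have "\<dots> = integral {p..t} (\<lambda>v. v / r2)"
        by (rule integral_spike[of "{p}"]) (auto simp: step_fun_def)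
      also have "\<dots> = (t\<^sup>2 - p\<^sup>2) / (2 * r2)" by (rule r.integral_id[OF that r.r2_pos])
      also have "\<dots> \<le> r.E t - r.E p" by (rule r.E_lower) (use \<open>0 < p\<close> that in auto)
      finally have "s.E t \<le> (s.E p - r.E p) + r.E t" by simp
      then have "exp (s.E t) \<le> C * exp (r.E t)" by (simp add: C_def flip: exp_add)
      then have "t powr (n - 1) * exp (s.E t) \<le> t powr (n - 1) * (C * exp (r.E t))" by (intro mult_left_mono) auto
      then show ?thesis by (simp add: s.P_def r.P_def mult_ac)
    qed
    define K where "K = W x / C"
    have K: "0 < K" using Wx C by (simp add: K_def)
    \<comment> \<open>The inequality 2 - z \<le> 1 / z for z > 0 turns the upper bound
      \<open>B\<close> on the mass of \<open>f\<close> into a lower bound, linear in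
      \<open>X\<close>, for the integral of 1 / (P f^2).\<close>
    have step: "q X \<le> q a - K * (2 * (X - a) - B)" if X: "a \<le> X" for X
    proof -
      have i: "(\<lambda>t. r.P t * (f t)\<^sup>2) integrable_on {c..X}" if "0 \<le> c" for c
        unfolding f_def by (rule r.P_y2_integrable[OF that])
      have "((\<lambda>t. - (W t / (s.P t * (f t)\<^sup>2))) has_integral (q X - q a)) {a..X}"
      proof (rule fundamental_theorem_of_calculus[OF X])
        fix t assume "t \<in> {a..X}"
        then have "0 < t" using a by simp
        from has_field_derivative_at_within[OF qd[OF this]]
        show "(q has_vector_derivative - (W t / (s.P t * (f t)\<^sup>2))) (at t within {a..X})"
          by (simp add: has_real_derivative_iff_has_vector_derivative)
      qed
      moreover have "((\<lambda>t. - (K * (2 - r.P t * (f t)\<^sup>2))) has_integral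
          - (K * (2 * (X - a) - integral {a..X} (\<lambda>t. r.P t * (f t)\<^sup>2)))) {a..X}"
      proof (intro has_integral_neg has_integral_mult_right has_integral_diff integrable_integral i)
        show "((\<lambda>t. 2) has_integral 2 * (X - a)) {a..X}"
          using has_integral_const_real[of "2::real" a X] X by (simp add: mult.commute)
      qed (use a in auto)
      ultimately have "q X - q a \<le> - (K * (2 * (X - a) - integral {a..X} (\<lambda>t. r.P t * (f t)\<^sup>2)))"
      proof (rule has_integral_le)
        fix t assume t: "t \<in> {a..X}"
        then have t0: "0 < t" "p \<le> t" using a by auto
        define z where "z = r.P t * (f t)\<^sup>2"
        have z: "0 < z" using r.P_pos[OF t0(1)] fpos[of t] t0 by (simp add: z_def)
        have "W x \<le> W t" by (rule ac_deriv_mono[OF acW W'nn]) (use x0 t a in auto)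
        have "2 - z \<le> 1 / z"
        proof -
          have "0 \<le> (z - 1)\<^sup>2 / z" using z by simp
          also have "\<dots> = z - 2 + 1 / z" using z by (simp add: power2_eq_square field_simps)
          finally show ?thesis by simp
        qed
        then have "K * (2 - z) \<le> K * (1 / z)" using K by (intro mult_left_mono) auto
        also have "\<dots> = W x / (C * z)" by (simp add: K_def)
        also have "\<dots> \<le> W t / (s.P t * (f t)\<^sup>2)"
        proof (rule frac_le)
          show "s.P t * (f t)\<^sup>2 \<le> C * z"
            using PC[OF t0(2)] by (simp add: z_def mult_right_mono flip: mult.assoc)
          show "0 < s.P t * (f t)\<^sup>2" using s.P_pos[OF t0(1)] fpos[of t] t0 by simp
        qed (use \<open>W x \<le> W t\<close> Wnn[OF t0(1)] in auto)
        finally show "- (W t / (s.P t * (f t)\<^sup>2)) \<le> - (K * (2 - r.P t * (f t)\<^sup>2))" by (simp add: z_def)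
      qed
      moreover have "integral {a..X} (\<lambda>t. r.P t * (f t)\<^sup>2) \<le> B"
      proof -
        have "integral {a..X} (\<lambda>t. r.P t * (f t)\<^sup>2) \<le> integral {0..X} (\<lambda>t. r.P t * (f t)\<^sup>2)"
        proof (rule integral_subset_le)
          have "0 \<le> r.P t * (f t)\<^sup>2" if "t \<in> {0..X}" for t using r.P_pos[of t] that by (cases "t = 0") auto
          then show "\<forall>t\<in>{0..X}. 0 \<le> r.P t * (f t)\<^sup>2" by blast
        qed (use a i in auto)
        also have "\<dots> \<le> B" unfolding f_def by (rule r.groundD(3)[OF gr]) (use a X in auto)
        finally show ?thesis .
      qed
      then have "K * (2 * (X - a) - B) \<le> K * (2 * (X - a) - integral {a..X} (\<lambda>t. r.P t * (f t)\<^sup>2))"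
        using K by (intro mult_left_mono) auto
      ultimately show ?thesis by linarith
    qed
    \<comment> \<open>Solves \<open>K * (2 * (X - a) - \<bar>B\<bar>) = q a\<close>, which makes the
      right-hand side of \<open>step\<close> nonpositive.\<close>
    define X where "X = a + (q a / K + \<bar>B\<bar>) / 2"
    have qa: "0 < q a" using fpos[of a] gpos[of a] a by (simp add: q_def)
    have "a \<le> X" using qa K by (simp add: X_def)
    moreover have "2 * (X - a) = q a / K + \<bar>B\<bar>" by (simp add: X_def)
    ultimately have "q X \<le> q a - K * (q a / K + \<bar>B\<bar> - B)" using step[of X] by simp
    also have "\<dots> = - (K * (\<bar>B\<bar> - B))" using K by (simp add: algebra_simps)
    also have "\<dots> \<le> 0" using K by simp
    finally have "q X \<le> 0" .
    moreover have "a \<le> X" using qa K by (simp add: X_def)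
    ultimately show False using fpos[of X] gpos[of X] a by (simp add: q_def divide_le_0_iff)
  qed
  have "\<mu>' = \<mu>"
  proof (rule ccontr)
    assume "\<mu>' \<noteq> \<mu>"
    then have "0 < \<mu>' - \<mu>" using le by simp
    moreover have "0 < integral {0..1} (\<lambda>t. s.w t * (f t * g t))"
    proof (rule s.wg_integral_pos[OF fgcont])
      show "0 < f 0 * g 0" using fpos[of 0] gpos[of 0] by simp
      show "0 \<le> f t * g t" if "0 \<le> t" for t using fpos[OF that] gpos[OF that] by simp
    qed simp
    ultimately have "0 < (\<mu>' - \<mu>) * integral {0..1} (\<lambda>t. s.w t * (f t * g t))" by (rule mult_pos_pos)
    then have "0 < W 1" using Wlow[of 1] by simp
    then show False using W0[of 1] by simp
  qed
  moreover have "g x = f x" if "0 \<le> x" for x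
  proof (cases "x = 0")
    case True
    then show ?thesis by (simp add: f_def g_def)
  next
    case False
    have qc: "continuous_on {0..x} q"
      unfolding q_def[abs_def] by (intro continuous_intros continuous_on_subset[OF fcont] continuous_on_subset[OF gcont])
        (use fpos in fastforce)+
    have "q x = q 0"
    proof (rule DERIV_isconst2[of 0 x q x])
      show "(q has_real_derivative 0) (at z)" if "0 < z" "z < x" for z
        using qd[OF that(1)] W0[OF that(1)] by simp
    qed (use False that qc in auto)
    then show ?thesis using fpos[OF that] by (simp add: q_def f_def g_def)
  qed
  ultimately show ?thesis by (simp add: f_def g_def)
qed

section \<open>The weighted Hilbert space and the operator domain\<close>

lemma borel_measurable_positive_AE:
  fixes f g :: "real \<Rightarrow> real"
  assumes f: "f \<in> borel_measurable (lebesgue_on {0<..})" and ae: "AE x in lebesgue. 0 < x \<longrightarrow> f x = g x"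
  shows "g \<in> borel_measurable (lebesgue_on {0<..})"
proof -
  have "(\<lambda>x. if x \<in> {0<..} then f x else 0) \<in> borel_measurable lebesgue"
    using f by (subst borel_measurable_if) auto
  moreover have "AE x in lebesgue. (if x \<in> {0<..} then f x else 0) = (if x \<in> {0<..} then g x else 0)"
    using ae by eventually_elim auto
  ultimately have "(\<lambda>x. if x \<in> {0<..} then g x else 0) \<in> borel_measurable lebesgue"
    by (rule borel_measurable_AE)
  then show ?thesis by (subst (asm) borel_measurable_if) auto
qed

context radial
begin

abbreviation mW :: "real measure" where "mW \<equiv> weighted_measure n R"

lemma weight_ennreal_measurable: "(\<lambda>x. ennreal (w x)) \<in> borel_measurable (lebesgue_on {0<..})"
  using w_measurable by (rule measurable_compose) simp

lemma borel_measurable_mW: "borel_measurable mW = borel_measurable (lebesgue_on {0<..})"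
  unfolding weighted_measure_def by (rule measurable_density_eq1 measurable_cong_sets; simp)

text \<open>The density is positive on the half-line, so it creates no new null sets there.\<close>

lemma AE_mW: "(AE x in mW. Q x) \<longleftrightarrow> (AE x in lebesgue. 0 < x \<longrightarrow> Q x)"
proof -
  have "(AE x in mW. Q x) \<longleftrightarrow> (AE x in lebesgue_on {0<..}. 0 < ennreal (w x) \<longrightarrow> Q x)"
    unfolding weighted_measure_def by (rule AE_density[OF weight_ennreal_measurable])
  also have "\<dots> \<longleftrightarrow> (AE x in lebesgue. x \<in> {0<..} \<longrightarrow> 0 < ennreal (w x) \<longrightarrow> Q x)"
    by (rule AE_restrict_space_iff) simp
  also have "\<dots> \<longleftrightarrow> (AE x in lebesgue. 0 < x \<longrightarrow> Q x)"
    by (rule arg_cong[where f = "\<lambda>P. almost_everywhere lebesgue P"]) (use w_pos in \<open>auto simp: fun_eq_iff\<close>)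
  finally show ?thesis .
qed

lemma integrable_mW:
  fixes f :: "real \<Rightarrow> real"
  assumes f: "f \<in> borel_measurable (lebesgue_on {0<..})"
  shows "integrable mW f \<longleftrightarrow> (\<lambda>x. w x * f x) absolutely_integrable_on {0<..}"
    and "integral\<^sup>L mW f = (LINT x:{0<..}|lebesgue. w x * f x)"
proof -
  have nn: "AE x in lebesgue_on {0<..}. 0 \<le> w x"
    using w_pos by (subst AE_restrict_space_iff) (auto intro!: AE_I2 less_imp_le)
  have "integrable mW f \<longleftrightarrow> integrable (lebesgue_on {0<..}) (\<lambda>x. w x *\<^sub>R f x)"
    unfolding weighted_measure_def by (rule integrable_density[OF f w_measurable nn])
  also have "\<dots> \<longleftrightarrow> (\<lambda>x. w x * f x) absolutely_integrable_on {0<..}"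
    by (simp add: integrable_restrict_space set_integrable_def)
  finally show "integrable mW f \<longleftrightarrow> (\<lambda>x. w x * f x) absolutely_integrable_on {0<..}" .
  have "integral\<^sup>L mW f = integral\<^sup>L (lebesgue_on {0<..}) (\<lambda>x. w x *\<^sub>R f x)"
    unfolding weighted_measure_def by (rule integral_density[OF f w_measurable nn])
  also have "\<dots> = (LINT x:{0<..}|lebesgue. w x * f x)"
    by (simp add: integral_restrict_space set_lebesgue_integral_def)
  finally show "integral\<^sup>L mW f = (LINT x:{0<..}|lebesgue. w x * f x)" .
qed

definition L2 :: "(real \<Rightarrow> real) set" where "L2 = L2_space mW"

lemma L2_measurable: "f \<in> L2 \<Longrightarrow> f \<in> borel_measurable (lebesgue_on {0<..})"
  by (simp add: L2_def L2_space_def borel_measurable_mW)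

lemma L2_iff:
  "f \<in> L2 \<longleftrightarrow> f \<in> borel_measurable (lebesgue_on {0<..}) \<and> (\<lambda>x. w x * (f x)\<^sup>2) absolutely_integrable_on {0<..}"
proof -
  have "(\<lambda>x. (f x)\<^sup>2) \<in> borel_measurable (lebesgue_on {0<..})" if "f \<in> borel_measurable (lebesgue_on {0<..})"
    using that by (rule borel_measurable_power)
  then show ?thesis using integrable_mW(1)[of "\<lambda>x. (f x)\<^sup>2"]
    unfolding L2_def L2_space_def borel_measurable_mW by blast
qed

text \<open>The squared norm as a gauge integral, so that bounds obtained by integrating derivatives
  over compact intervals apply directly.\<close>

definition N2 :: "(real \<Rightarrow> real) \<Rightarrow> real" where "N2 f = integral {0<..} (\<lambda>x. w x * (f x)\<^sup>2)"

lemma L2_norm_eq: "f \<in> L2 \<Longrightarrow> L2_norm mW f = sqrt (N2 f)"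
proof -
  assume f: "f \<in> L2"
  then have m: "(\<lambda>x. (f x)\<^sup>2) \<in> borel_measurable (lebesgue_on {0<..})"
    by (intro borel_measurable_power L2_measurable)
  have ai: "(\<lambda>x. w x * (f x)\<^sup>2) absolutely_integrable_on {0<..}" using f by (simp add: L2_iff)
  show ?thesis
    unfolding L2_norm_def N2_def integrable_mW(2)[OF m] set_lebesgue_integral_eq_integral(2)[OF ai] ..
qed

lemma w_sq_nonneg: "0 \<le> x \<Longrightarrow> 0 \<le> w x * (c :: real)\<^sup>2"
  using w_pos[of x] by (cases "x = 0") auto

lemma N2_nonneg: "0 \<le> N2 f"
proof (cases "(\<lambda>x. w x * (f x)\<^sup>2) integrable_on {0<..}")
  case True
  then show ?thesis unfolding N2_def by (rule integral_nonneg) (use w_sq_nonneg in auto)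
next
  case False
  then show ?thesis by (simp add: N2_def not_integrable_integral)
qed

lemma L2_integrable:
  assumes "f \<in> L2" "0 \<le> a"
  shows "(\<lambda>x. w x * (f x)\<^sup>2) integrable_on {a..b}" "integral {a..b} (\<lambda>x. w x * (f x)\<^sup>2) \<le> N2 f"
proof -
  have ai: "(\<lambda>x. w x * (f x)\<^sup>2) absolutely_integrable_on {0<..}" using assms(1) by (simp add: L2_iff)
  have "(\<lambda>x. w x * (f x)\<^sup>2) absolutely_integrable_on {a<..b}"
    by (rule set_integrable_subset[OF ai]) (use assms(2) in auto)
  then have i: "(\<lambda>x. w x * (f x)\<^sup>2) integrable_on {a<..b}" by (simp add: absolutely_integrable_on_def)
  have neg: "negligible ({a..b} - {a<..b})" "negligible ({a<..b} - {a..b})"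
    by (rule negligible_subset[of "{a}"]; auto)+
  then have sym: "negligible (({a..b} - {a<..b}) \<union> ({a<..b} - {a..b}))" by (rule negligible_Un)
  show "(\<lambda>x. w x * (f x)\<^sup>2) integrable_on {a..b}"
    using i integrable_spike_set_eq[OF sym] by blast
  have "integral {a..b} (\<lambda>x. w x * (f x)\<^sup>2) = integral {a<..b} (\<lambda>x. w x * (f x)\<^sup>2)"
    by (rule integral_spike_set) (auto intro: negligible_subset[OF neg(1)] negligible_subset[OF neg(2)])
  also have "\<dots> \<le> N2 f" unfolding N2_def
    by (rule integral_subset_le[OF _ i]) (use assms(2) ai w_sq_nonneg in \<open>auto simp: absolutely_integrable_on_def\<close>)
  finally show "integral {a..b} (\<lambda>x. w x * (f x)\<^sup>2) \<le> N2 f" .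
qed

text \<open>Monotone convergence along the intervals from 1 / (k + 1) to k + 1 reduces square
  integrability to uniform bounds on compact subintervals of the open half-line, which is where the
  calculus is available.\<close>

lemma L2_intro:
  assumes f: "f \<in> borel_measurable (lebesgue_on {0<..})"
    and i: "\<And>a b. 0 < a \<Longrightarrow> a \<le> b \<Longrightarrow> (\<lambda>x. w x * (f x)\<^sup>2) integrable_on {a..b}"
    and bd: "\<And>a b. 0 < a \<Longrightarrow> a \<le> b \<Longrightarrow> integral {a..b} (\<lambda>x. w x * (f x)\<^sup>2) \<le> B"
  shows "f \<in> L2" "N2 f \<le> B"
proof -
  let ?g = "\<lambda>x. w x * (f x)\<^sup>2"
  define c where "c k = inverse (real k + 1)" for k
  define d where "d k = real k + 1" for k
  define h where "h k x = (if x \<in> {c k..d k} then ?g x else 0)" for k x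
  have cd: "0 < c k" "c k \<le> d k" "c (Suc k) \<le> c k" "d k \<le> d (Suc k)" for k
    by (auto simp: c_def d_def field_simps) 
  have sub: "{c k..d k} \<subseteq> {0<..}" for k using cd(1)[of k] by auto
  have hi: "(h k has_integral integral {c k..d k} ?g) {0<..}" for k
    unfolding h_def by (subst has_integral_restrict[OF sub]) (rule integrable_integral[OF i[OF cd(1,2)]])
  have "?g integrable_on {0<..} \<and> (\<lambda>k. integral {0<..} (h k)) \<longlonglongrightarrow> integral {0<..} ?g"
  proof (rule monotone_convergence_increasing)
    show "h k integrable_on {0<..}" for k using hi by blast
    show "h k x \<le> h (Suc k) x" if "x \<in> {0<..}" for k x
      using cd(3,4)[of k] w_sq_nonneg[of x "f x"] that by (auto simp: h_def)
    show "(\<lambda>k. h k x) \<longlonglongrightarrow> ?g x" if x: "x \<in> {0<..}" for x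
    proof (rule tendsto_eventually)
      show "eventually (\<lambda>k. h k x = ?g x) sequentially"
        using eventually_ge_at_top[of "nat \<lceil>max x (inverse x)\<rceil>"]
      proof eventually_elim
        case (elim k)
        have k: "x \<le> real k + 1" "inverse x \<le> real k + 1" using elim by linarith+
        have "inverse (real k + 1) \<le> inverse (inverse x)" using k(2) x by (intro le_imp_inverse_le) auto
        then show ?case using k(1) by (simp add: h_def c_def d_def)
      qed
    qed
    have "0 \<le> integral {c k..d k} ?g" for k
      by (rule integral_nonneg[OF i[OF cd(1,2)]]) (use cd(1)[of k] w_sq_nonneg in auto)
    then have "\<bar>integral {0<..} (h k)\<bar> \<le> B" for k
      using bd[OF cd(1,2), of k] integral_unique[OF hi[of k]] by (simp add: abs_of_nonneg)
    then show "bounded (range (\<lambda>k. integral {0<..} (h k)))" by (auto simp: bounded_iff)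
  qed
  then have gi: "?g integrable_on {0<..}" and glim: "(\<lambda>k. integral {0<..} (h k)) \<longlonglongrightarrow> integral {0<..} ?g" by auto
  have "?g absolutely_integrable_on {0<..}"
    by (rule nonnegative_absolutely_integrable_1[OF gi]) (use w_sq_nonneg in auto)
  then show "f \<in> L2" using f by (simp add: L2_iff)
  show "N2 f \<le> B" unfolding N2_def
    by (rule LIMSEQ_le_const2[OF glim]) (use bd[OF cd(1,2)] integral_unique[OF hi] in auto)
qed

lemma wg_integrable_away:
  assumes "continuous_on {0<..} g" "0 < a"
  shows "(\<lambda>x. w x * g x) absolutely_integrable_on {a..b}" "(\<lambda>x. w x * g x) integrable_on {a..b}"
proof -
  have "continuous_on {a..b} (\<lambda>x. P x * g x)"
    by (intro continuous_intros continuous_on_subset[OF P_continuous] continuous_on_subset[OF assms(1)])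
      (use assms(2) in auto)
  then obtain C where C: "0 \<le> C" "\<And>x. x \<in> {a..b} \<Longrightarrow> \<bar>P x * g x\<bar> \<le> C"
    using continuous_on_interval_bounded by blast
  show "(\<lambda>x. w x * g x) absolutely_integrable_on {a..b}"
  proof (rule absolutely_integrable_dominated[where h = "\<lambda>x. C / r1"])
    show "(\<lambda>x. w x * g x) \<in> borel_measurable (lebesgue_on {0<..})"
      by (intro borel_measurable_times w_measurable continuous_measurable assms(1))
    fix x assume x: "a < x" "x \<le> b"
    then have x0: "0 < x" using assms(2) by simp
    have "\<bar>w x * g x\<bar> = \<bar>P x * g x\<bar> / R x" using R_pos[OF x0] by (simp add: weight_eq abs_mult)
    also have "\<dots> \<le> C / r1" using C(2)[of x] R_lower[OF x0] r1_pos x C(1) by (intro frac_le) auto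
    finally show "\<bar>w x * g x\<bar> \<le> C / r1" .
  qed (use assms(2) in auto)
  then show "(\<lambda>x. w x * g x) integrable_on {a..b}" by (simp add: absolutely_integrable_on_def)
qed

lemma L2_dominated:
  assumes f: "f \<in> L2" and g: "g \<in> L2" and h: "h \<in> borel_measurable (lebesgue_on {0<..})"
    and le: "\<And>x. 0 < x \<Longrightarrow> (h x)\<^sup>2 \<le> C * ((f x)\<^sup>2 + (g x)\<^sup>2)"
  shows "h \<in> L2"
  unfolding L2_iff
proof (intro conjI h measurable_bounded_by_integrable_imp_absolutely_integrable)
  show "(\<lambda>x. w x * (h x)\<^sup>2) \<in> borel_measurable (lebesgue_on {0<..})"
    by (intro borel_measurable_times w_measurable borel_measurable_power h)
  have "(\<lambda>x. w x * (f x)\<^sup>2) integrable_on {0<..}" "(\<lambda>x. w x * (g x)\<^sup>2) integrable_on {0<..}"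
    using f g by (auto simp: L2_iff absolutely_integrable_on_def)
  then show "(\<lambda>x. C * (w x * (f x)\<^sup>2 + w x * (g x)\<^sup>2)) integrable_on {0<..}"
    by (intro integrable_on_mult_right integrable_add)
  fix x :: real assume "x \<in> {0<..}"
  then have x: "0 < x" by simp
  have "w x * (h x)\<^sup>2 \<le> w x * (C * ((f x)\<^sup>2 + (g x)\<^sup>2))"
    using le[OF x] w_pos[OF x] by (intro mult_left_mono) auto
  then show "norm (w x * (h x)\<^sup>2) \<le> C * (w x * (f x)\<^sup>2 + w x * (g x)\<^sup>2)"
    using w_pos[OF x] by (simp add: algebra_simps)
qed auto

lemma L2_lincomb:
  assumes f: "f \<in> L2" and g: "g \<in> L2"
  shows "(\<lambda>x. a * f x + b * g x) \<in> L2"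
proof (rule L2_dominated[OF f g, where C = "2 * (a\<^sup>2 + b\<^sup>2)"])
  show "(\<lambda>x. a * f x + b * g x) \<in> borel_measurable (lebesgue_on {0<..})"
    by (intro borel_measurable_add borel_measurable_times borel_measurable_const L2_measurable f g)
  show "(a * f x + b * g x)\<^sup>2 \<le> 2 * (a\<^sup>2 + b\<^sup>2) * ((f x)\<^sup>2 + (g x)\<^sup>2)" for x
  proof -
    have "(a * f x + b * g x)\<^sup>2 + (a * g x - b * f x)\<^sup>2 = (a\<^sup>2 + b\<^sup>2) * ((f x)\<^sup>2 + (g x)\<^sup>2)"
      by (simp add: power2_eq_square algebra_simps)
    moreover have "0 \<le> (a * g x - b * f x)\<^sup>2" "0 \<le> (a\<^sup>2 + b\<^sup>2) * ((f x)\<^sup>2 + (g x)\<^sup>2)" by auto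
    ultimately show ?thesis by linarith
  qed
qed

lemma L2_div_R:
  assumes f: "f \<in> L2"
  shows "(\<lambda>x. f x / R x) \<in> L2"
proof (rule L2_dominated[OF f f, where C = "1 / r1\<^sup>2"])
  show "(\<lambda>x. f x / R x) \<in> borel_measurable (lebesgue_on {0<..})"
    by (intro borel_measurable_divide R_measurable L2_measurable f)
  show "(f x / R x)\<^sup>2 \<le> 1 / r1\<^sup>2 * ((f x)\<^sup>2 + (f x)\<^sup>2)" if x: "0 < x" for x
  proof -
    have "(f x / R x)\<^sup>2 = (f x)\<^sup>2 / (R x)\<^sup>2" by (simp add: power_divide)
    also have "\<dots> \<le> (f x)\<^sup>2 / r1\<^sup>2"
      using R_lower[OF x] r1_pos R_pos[OF x] by (intro divide_left_mono power_mono mult_pos_pos zero_less_power) auto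
    also have "\<dots> \<le> 1 / r1\<^sup>2 * ((f x)\<^sup>2 + (f x)\<^sup>2)" using r1_pos by (simp add: field_simps)
    finally show ?thesis .
  qed
qed

lemma L2_times_R:
  assumes f: "f \<in> L2"
  shows "(\<lambda>x. R x * f x) \<in> L2"
proof (rule L2_dominated[OF f f, where C = "r2\<^sup>2"])
  show "(\<lambda>x. R x * f x) \<in> borel_measurable (lebesgue_on {0<..})"
    by (intro borel_measurable_times R_measurable L2_measurable f)
  show "(R x * f x)\<^sup>2 \<le> r2\<^sup>2 * ((f x)\<^sup>2 + (f x)\<^sup>2)" if x: "0 < x" for x
  proof -
    have "(R x)\<^sup>2 * (f x)\<^sup>2 \<le> r2\<^sup>2 * (f x)\<^sup>2"
      using R_upper[OF x] R_pos[OF x] by (intro mult_right_mono power_mono) auto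
    also have "\<dots> \<le> r2\<^sup>2 * ((f x)\<^sup>2 + (f x)\<^sup>2)" by (intro mult_left_mono) auto
    finally show ?thesis by (simp add: power_mult_distrib)
  qed
qed

lemma L2_AE_cong:
  assumes f: "f \<in> L2" and ae: "AE x in lebesgue. 0 < x \<longrightarrow> f x = g x"
  shows "g \<in> L2" "N2 g = N2 f"
proof -
  have gm: "g \<in> borel_measurable (lebesgue_on {0<..})"
    by (rule borel_measurable_positive_AE[OF L2_measurable[OF f] ae])
  have hi: "((\<lambda>x. w x * (f x)\<^sup>2) has_integral N2 f) {0<..}"
    unfolding N2_def by (rule integrable_integral) (use f in \<open>simp add: L2_iff absolutely_integrable_on_def\<close>)
  have hg: "((\<lambda>x. w x * (g x)\<^sup>2) has_integral N2 f) {0<..}"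
    by (rule has_integral_spike_AE[OF _ hi]) (use ae in \<open>auto elim!: eventually_mono\<close>)
  have "(\<lambda>x. w x * (g x)\<^sup>2) absolutely_integrable_on {0<..}"
    by (rule nonnegative_absolutely_integrable_1) (use hg w_sq_nonneg in auto)
  then show "g \<in> L2" using gm by (simp add: L2_iff)
  show "N2 g = N2 f" unfolding N2_def[of g] by (rule integral_unique[OF hg])
qed

lemma L2_local_integrable:
  assumes f: "f \<in> L2" and g: "continuous_on {0..} g" and "0 \<le> a"
  shows "(\<lambda>x. w x * (g x * f x)) absolutely_integrable_on {a..b}"
proof (rule absolutely_integrable_dominated[OF _ assms(3)])
  show "(\<lambda>x. w x * (g x * f x)) \<in> borel_measurable (lebesgue_on {0<..})"
    by (intro borel_measurable_times w_measurable continuous_measurable_0 g L2_measurable f)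
  have "continuous_on {0..} (\<lambda>x. (g x)\<^sup>2)" by (intro continuous_intros g)
  then show "(\<lambda>x. w x * (g x)\<^sup>2 + w x * (f x)\<^sup>2) integrable_on {a..b}"
    by (intro integrable_add wg_integrable_cont(2) L2_integrable f assms(3))
  fix x assume "a < x" "x \<le> b"
  then have x: "0 < x" using assms(3) by simp
  have "\<bar>g x * f x\<bar> \<le> (g x)\<^sup>2 + (f x)\<^sup>2"
  proof -
    have "2 * \<bar>g x\<bar> * \<bar>f x\<bar> \<le> (g x)\<^sup>2 + (f x)\<^sup>2" using sum_squares_bound[of "\<bar>g x\<bar>" "\<bar>f x\<bar>"] by simp
    moreover have "0 \<le> \<bar>g x\<bar> * \<bar>f x\<bar>" by simp
    ultimately show ?thesis unfolding abs_mult by linarith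
  qed
  then have "w x * \<bar>g x * f x\<bar> \<le> w x * ((g x)\<^sup>2 + (f x)\<^sup>2)" using w_pos[OF x] by (intro mult_left_mono) auto
  then show "\<bar>w x * (g x * f x)\<bar> \<le> w x * (g x)\<^sup>2 + w x * (f x)\<^sup>2"
    using w_pos[OF x] by (simp add: abs_mult algebra_simps)
qed

text \<open>Integrating the derivative of \<^term>\<open>\<lambda>x. x * (f' x)\<^sup>2 * P x\<close> bounds the drift term, because
  the drift dominates the dispersion for large arguments.\<close>

lemma drift_term_L2:
  assumes f': "continuous_on {0<..} f'" and flux: "ac_deriv (\<lambda>x. P x * f' x) (\<lambda>x. w x * G x)"
    and lim: "((\<lambda>x. P x * f' x) \<longlongrightarrow> 0) (at_right 0)" and G: "G \<in> L2"
  shows "(\<lambda>x. x * f' x) \<in> L2"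
proof -
  \<comment> \<open>Beyond \<open>K\<close> the number 2 - n is at most x^2 / (4 R), a quarter of
    the drift contribution. The summand 1 keeps \<open>K\<close> at least 1.\<close>
  define K where "K = 2 * sqrt (r2 * (2 - n)) + 1"
  have K0: "1 \<le> K" using r2_pos n_less by (simp add: K_def)
  have K2: "4 * (r2 * (2 - n)) \<le> K\<^sup>2"
  proof -
    have "4 * (r2 * (2 - n)) = (2 * sqrt (r2 * (2 - n)))\<^sup>2" using r2_pos n_less by (simp add: power_mult_distrib)
    also have "\<dots> \<le> K\<^sup>2" unfolding K_def using r2_pos n_less by (intro power_mono) auto
    finally show ?thesis .
  qed
  define \<Gamma> where "\<Gamma> x = x * (f' x)\<^sup>2 * P x" for x
  have cont: "continuous_on {0<..} (\<lambda>x. (x * f' x)\<^sup>2)" by (intro continuous_intros f')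
  have wi: "(\<lambda>x. w x * (x * f' x)\<^sup>2) integrable_on {a..b}" if "0 < a" for a b
    by (rule wg_integrable_away(2)[OF cont that])
  have ac\<Gamma>: "ac_deriv \<Gamma> (\<lambda>x. 2 * x * f' x * w x * G x + P x * (f' x)\<^sup>2 * (2 - n - x\<^sup>2 / R x))"
  proof (rule ac_deriv_cong)
    show "ac_deriv (\<lambda>x. ((P x * f' x) * (P x * f' x)) * (x powr (2 - n) * exp (-1 * E x)))
      (\<lambda>x. ((w x * G x) * (P x * f' x) + (P x * f' x) * (w x * G x)) * (x powr (2 - n) * exp (-1 * E x))
       + ((P x * f' x) * (P x * f' x)) * (x powr (2 - n) * exp (-1 * E x) * ((2 - n) / x + -1 * x / R x)))"
      by (intro ac_deriv_mult flux ac_deriv_powr_exp_E)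
    have eq: "P x * (x powr (2 - n) * exp (-1 * E x)) = x" if "0 < x" for x
      using that by (simp add: P_def exp_minus field_simps flip: powr_add)
    show "\<Gamma> x = ((P x * f' x) * (P x * f' x)) * (x powr (2 - n) * exp (-1 * E x))" if x: "0 < x" for x
    proof -
      have re: "((P x * f' x) * (P x * f' x)) * (x powr (2 - n) * exp (-1 * E x))
        = P x * (f' x)\<^sup>2 * (P x * (x powr (2 - n) * exp (-1 * E x)))" by (simp add: power2_eq_square mult_ac)
      show ?thesis unfolding re eq[OF x] by (simp add: \<Gamma>_def)
    qed
    have "2 * x * f' x * w x * G x + P x * (f' x)\<^sup>2 * (2 - n - x\<^sup>2 / R x)
      = ((w x * G x) * (P x * f' x) + (P x * f' x) * (w x * G x)) * (x powr (2 - n) * exp (-1 * E x))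
       + ((P x * f' x) * (P x * f' x)) * (x powr (2 - n) * exp (-1 * E x) * ((2 - n) / x + -1 * x / R x))"
      if x: "0 < x" for x
    proof -
      let ?q = "x powr (2 - n) * exp (-1 * E x)"
      have "((w x * G x) * (P x * f' x) + (P x * f' x) * (w x * G x)) * ?q
       + ((P x * f' x) * (P x * f' x)) * (?q * ((2 - n) / x + -1 * x / R x))
       = (P x * ?q) * (2 * f' x * w x * G x + P x * (f' x)\<^sup>2 * ((2 - n) / x + -1 * x / R x))"
        by (simp add: power2_eq_square algebra_simps)
      also have "\<dots> = 2 * x * f' x * w x * G x + P x * (f' x)\<^sup>2 * (2 - n - x\<^sup>2 / R x)"
        unfolding eq[OF x] using x R_pos[OF x] by (simp add: power2_eq_square field_simps)
      finally show ?thesis by simp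
    qed
    then show "AE x in lebesgue. 0 < x \<longrightarrow> 2 * x * f' x * w x * G x + P x * (f' x)\<^sup>2 * (2 - n - x\<^sup>2 / R x)
      = ((w x * G x) * (P x * f' x) + (P x * f' x) * (w x * G x)) * (x powr (2 - n) * exp (-1 * E x))
       + ((P x * f' x) * (P x * f' x)) * (x powr (2 - n) * exp (-1 * E x) * ((2 - n) / x + -1 * x / R x))"
      by simp
  qed
  \<comment> \<open>Of the drift contribution a quarter absorbs the term with 2 - n and a half the
    mixed term with \<open>G\<close>; the remaining quarter is the one estimated.\<close>
  have far: "integral {K..X} (\<lambda>x. w x * (x * f' x)\<^sup>2) \<le> 4 * (\<Gamma> K + 2 * N2 G)" if X: "K \<le> X" for X
  proof -
    have GI: "(\<lambda>x. w x * (G x)\<^sup>2) integrable_on {K..X}" by (rule L2_integrable[OF G]) (use K0 in simp)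
    have "\<Gamma> X - \<Gamma> K \<le> - (1/4) * integral {K..X} (\<lambda>x. w x * (x * f' x)\<^sup>2) + 2 * integral {K..X} (\<lambda>x. w x * (G x)\<^sup>2)"
    proof (rule has_integral_le_AE)
      show "((\<lambda>x. 2 * x * f' x * w x * G x + P x * (f' x)\<^sup>2 * (2 - n - x\<^sup>2 / R x)) has_integral \<Gamma> X - \<Gamma> K) {K..X}"
        by (rule ac_deriv_has_integral[OF ac\<Gamma>]) (use K0 X in auto)
      show "((\<lambda>x. - (1/4) * (w x * (x * f' x)\<^sup>2) + 2 * (w x * (G x)\<^sup>2)) has_integral
        - (1/4) * integral {K..X} (\<lambda>x. w x * (x * f' x)\<^sup>2) + 2 * integral {K..X} (\<lambda>x. w x * (G x)\<^sup>2)) {K..X}"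
        using K0 by (intro has_integral_add has_integral_mult_right integrable_integral wi GI) auto
      have "2 * x * f' x * w x * G x + P x * (f' x)\<^sup>2 * (2 - n - x\<^sup>2 / R x)
          \<le> - (1/4) * (w x * (x * f' x)\<^sup>2) + 2 * (w x * (G x)\<^sup>2)" if x: "K \<le> x" for x
      proof -
        have x0: "0 < x" using x K0 by simp
        define z where "z = (x * f' x)\<^sup>2"
        have z: "0 \<le> z" by (simp add: z_def)
        have e1: "P x * (f' x)\<^sup>2 * (x\<^sup>2 / R x) = w x * z"
          by (simp add: weight_eq z_def power_mult_distrib)
        have e2: "P x * (f' x)\<^sup>2 * (2 - n) \<le> w x * z / 4"
        proof -
          have "4 * ((2 - n) * R x) \<le> 4 * ((2 - n) * r2)" using R_upper[OF x0] n_less by (intro mult_left_mono) auto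
          also have "\<dots> \<le> K\<^sup>2" using K2 by (simp add: mult.commute)
          also have "\<dots> \<le> x\<^sup>2" using x K0 by (intro power_mono) auto
          finally have "2 - n \<le> x\<^sup>2 / R x / 4" using R_pos[OF x0] by (simp add: field_simps)
          then have "P x * (f' x)\<^sup>2 * (2 - n) \<le> P x * (f' x)\<^sup>2 * (x\<^sup>2 / R x / 4)"
            using P_pos[OF x0] by (intro mult_left_mono) auto
          then show ?thesis using e1 by simp
        qed
        have "0 \<le> (x * f' x / 2 - G x)\<^sup>2 * 2" by simp
        also have "\<dots> = z / 2 + 2 * (G x)\<^sup>2 - 2 * (x * f' x) * G x"
          by (simp add: z_def power2_eq_square field_simps)
        finally have "w x * (2 * (x * f' x) * G x) \<le> w x * (z / 2 + 2 * (G x)\<^sup>2)"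
          using w_pos[OF x0] by (intro mult_left_mono) auto
        then have e3: "2 * x * f' x * w x * G x \<le> w x * z / 2 + 2 * (w x * (G x)\<^sup>2)"
          by (simp add: algebra_simps)
        have "P x * (f' x)\<^sup>2 * (2 - n - x\<^sup>2 / R x) = P x * (f' x)\<^sup>2 * (2 - n) - w x * z"
          using e1 by (simp add: right_diff_distrib)
        then show ?thesis using e2 e3 unfolding z_def[symmetric] by linarith
      qed
      then show "AE x in lebesgue. x \<in> {K..X} \<longrightarrow> 2 * x * f' x * w x * G x + P x * (f' x)\<^sup>2 * (2 - n - x\<^sup>2 / R x)
          \<le> - (1/4) * (w x * (x * f' x)\<^sup>2) + 2 * (w x * (G x)\<^sup>2)" by simp
    qed
    moreover have "0 \<le> \<Gamma> X" unfolding \<Gamma>_def using X K0 P_pos[of X] by simp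
    moreover have "integral {K..X} (\<lambda>x. w x * (G x)\<^sup>2) \<le> N2 G" by (rule L2_integrable[OF G]) (use K0 in simp)
    moreover have "i \<le> 4 * (g0 + 2 * m)" if "g1 - g0 \<le> - (1/4) * i + 2 * j" "0 \<le> g1" "j \<le> m" for g0 g1 i j m :: real
      using that by (simp add: field_simps)
    ultimately show ?thesis by blast
  qed
  have "\<exists>C\<ge>0. \<forall>x. 0 < x \<and> x \<le> K \<longrightarrow> \<bar>P x * f' x\<bar> \<le> C"
  proof -
    have "eventually (\<lambda>x. \<bar>P x * f' x\<bar> < 1) (at_right 0)"
      using tendstoD[OF lim, of 1] by (simp add: dist_real_def)
    then obtain d where d: "0 < d" "\<And>x. 0 < x \<Longrightarrow> x < d \<Longrightarrow> \<bar>P x * f' x\<bar> < 1"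
      by (auto simp: eventually_at_right_field)
    have "continuous_on {d/2..K} (\<lambda>x. P x * f' x)"
      by (intro continuous_intros continuous_on_subset[OF P_continuous] continuous_on_subset[OF f']) (use d in auto)
    then obtain C where C: "0 \<le> C" "\<And>x. x \<in> {d/2..K} \<Longrightarrow> \<bar>P x * f' x\<bar> \<le> C"
      using continuous_on_interval_bounded by blast
    have "\<bar>P x * f' x\<bar> \<le> C + 1" if "0 < x" "x \<le> K" for x
    proof (cases "x < d / 2")
      case True
      then show ?thesis using d(2)[of x] that d(1) C(1) by simp
    next
      case False
      then show ?thesis using C(2)[of x] that by simp
    qed
    then show ?thesis using C(1) by (intro exI[of _ "C + 1"]) auto
  qed
  then obtain C where C: "0 \<le> C" "\<And>x. 0 < x \<Longrightarrow> x \<le> K \<Longrightarrow> \<bar>P x * f' x\<bar> \<le> C" by blast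
  define C' where "C' = C\<^sup>2 * (K powr (3 - n) / r1)"
  have C'0: "0 \<le> C'" using r1_pos by (simp add: C'_def)
  \<comment> \<open>Near 0 the zero flux bounds P f', and x^2 / (P R) is at most x^(3 - n) / r1 with
    a positive exponent.\<close>
  have near: "w x * (x * f' x)\<^sup>2 \<le> C'" if x: "0 < x" "x \<le> K" for x
  proof -
    have "w x * (x * f' x)\<^sup>2 = (P x * f' x)\<^sup>2 * (x\<^sup>2 / (P x * R x))"
      using P_pos[OF x(1)] by (simp add: weight_eq power2_eq_square field_simps)
    also have "\<dots> \<le> C\<^sup>2 * (K powr (3 - n) / r1)"
    proof (rule mult_mono)
      show "(P x * f' x)\<^sup>2 \<le> C\<^sup>2" using C(2)[OF x] C(1) abs_le_square_iff[of "P x * f' x" C] by simp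
      have "x\<^sup>2 / (P x * R x) = x\<^sup>2 / P x / R x" by simp
      also have "\<dots> \<le> K powr (3 - n) / r1"
      proof (rule frac_le)
        have "x\<^sup>2 / P x = x powr (3 - n) * exp (- E x)"
          using x by (simp add: P_def exp_minus field_simps powr_diff power2_eq_square power3_eq_cube)
        also have "\<dots> \<le> x powr (3 - n) * 1" using E_nonneg[of x] x by (intro mult_left_mono) auto
        also have "\<dots> \<le> K powr (3 - n)" using x n_less by (auto intro!: powr_mono2)
        finally show "x\<^sup>2 / P x \<le> K powr (3 - n)" .
      qed (use R_lower[OF x(1)] r1_pos in auto)
      finally show "x\<^sup>2 / (P x * R x) \<le> K powr (3 - n) / r1" .
    qed (use P_pos[OF x(1)] R_pos[OF x(1)] in auto)
    finally show ?thesis by (simp add: C'_def)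
  qed
  show ?thesis
  proof (rule L2_intro(1)[where B = "C' * K + 4 * (\<Gamma> K + 2 * N2 G)"])
    show "(\<lambda>x. x * f' x) \<in> borel_measurable (lebesgue_on {0<..})"
      by (intro continuous_measurable continuous_intros f')
    fix a b :: real assume ab: "0 < a" "a \<le> b"
    show "(\<lambda>x. w x * (x * f' x)\<^sup>2) integrable_on {a..b}" by (rule wi[OF ab(1)])
    define a' where "a' = min a K"
    define b' where "b' = max b K"
    have a'b': "0 < a'" "a' \<le> K" "K \<le> b'" "{a..b} \<subseteq> {a'..b'}" using ab K0 by (auto simp: a'_def b'_def)
    have "integral {a..b} (\<lambda>x. w x * (x * f' x)\<^sup>2) \<le> integral {a'..b'} (\<lambda>x. w x * (x * f' x)\<^sup>2)"
      by (rule integral_subset_le[OF a'b'(4) wi[OF ab(1)] wi[OF a'b'(1)]]) (use a'b'(1) w_sq_nonneg in auto)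
    also have "\<dots> = integral {a'..K} (\<lambda>x. w x * (x * f' x)\<^sup>2) + integral {K..b'} (\<lambda>x. w x * (x * f' x)\<^sup>2)"
      by (rule Henstock_Kurzweil_Integration.integral_combine[OF a'b'(2,3) wi[OF a'b'(1)], symmetric])
    also have "\<dots> \<le> C' * K + 4 * (\<Gamma> K + 2 * N2 G)"
    proof (rule add_mono[OF _ far[OF a'b'(3)]])
      have "integral {a'..K} (\<lambda>x. w x * (x * f' x)\<^sup>2) \<le> integral {a'..K} (\<lambda>x. C')"
        by (rule integral_le[OF wi[OF a'b'(1)]]) (use near a'b' in auto)
      also have "\<dots> = C' * (K - a')" using a'b'(2) by simp
      also have "\<dots> \<le> C' * K" using C'0 a'b'(1) by (intro mult_left_mono) auto
      finally show "integral {a'..K} (\<lambda>x. w x * (x * f' x)\<^sup>2) \<le> C' * K" .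
    qed
    finally show "integral {a..b} (\<lambda>x. w x * (x * f' x)\<^sup>2) \<le> C' * K + 4 * (\<Gamma> K + 2 * N2 G)" .
  qed
qed

section \<open>Square integrability of the drift term from that of the Laplacian\<close>

lemma not_L2_if_bounded_below:
  assumes f: "f \<in> L2" and low: "\<And>x. X0 \<le> x \<Longrightarrow> 1 \<le> \<bar>f x\<bar>"
  shows False
proof -
  define c where "c = 1 / (2 * r2) / r2"
  have c: "0 < c" using r2_pos by (simp add: c_def)
  define a where "a = max 1 X0"
  define b where "b = a + (N2 f + 1) / c"
  have ab: "1 \<le> a" "X0 \<le> a" "a \<le> b" using N2_nonneg[of f] c by (auto simp: a_def b_def)
  have "c * (b - a) = integral {a..b} (\<lambda>x. c)" using ab by simp
  also have "\<dots> \<le> integral {a..b} (\<lambda>x. w x * (f x)\<^sup>2)"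
  proof (rule integral_le)
    show "(\<lambda>x. w x * (f x)\<^sup>2) integrable_on {a..b}" by (rule L2_integrable[OF f]) (use ab in simp)
    fix x assume x: "x \<in> {a..b}"
    have "c \<le> w x"
      unfolding c_def weight_eq using P_lower[of x] P_pos[of x] R_upper[of x] R_pos[of x] x ab r2_pos by (intro frac_le) auto
    moreover have "1 \<le> (f x)\<^sup>2" using low[of x] x ab by (metis abs_le_square_iff abs_one atLeastAtMost_iff order_trans power2_eq_1_iff power_one)
    ultimately show "c \<le> w x * (f x)\<^sup>2" using mult_mono[of c "w x" 1 "(f x)\<^sup>2"] c by simp
  qed auto
  also have "\<dots> \<le> N2 f" by (rule L2_integrable[OF f]) (use ab in simp)
  finally show False using c by (simp add: b_def)
qed

text \<open>A flux that stays away from 0 keeps its sign. Then f' is in absolute value at least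
  \<eta> x^(1 - n), hence at least \<eta> / x for x \<ge> 1 because n < 2, and \<open>f\<close>
  grows logarithmically, which square integrability excludes.\<close>

lemma flux_small_somewhere:
  assumes f: "f \<in> L2" and d: "\<And>x. 0 < x \<Longrightarrow> (f has_real_derivative f' x) (at x)" and c: "continuous_on {0<..} f'"
    and "0 < \<eta>" "0 < x"
  shows "\<exists>Y\<ge>x. \<bar>Y powr (n - 1) * f' Y\<bar> < \<eta>"
proof (rule ccontr)
  assume no: "\<not> ?thesis"
  define a where "a = max x 1"
  have big: "\<eta> \<le> \<bar>Y powr (n - 1) * f' Y\<bar>" if "a \<le> Y" for Y
    using no that by (auto simp: a_def not_less)
  have Vc: "continuous_on {a..b} (\<lambda>Y. Y powr (n - 1) * f' Y)" for b
    by (intro continuous_intros continuous_on_subset[OF c]) (auto simp: a_def)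
  define e where "e = sgn (a powr (n - 1) * f' a)"
  have e: "e = 1 \<or> e = -1" using big[of a] \<open>0 < \<eta>\<close> by (auto simp: e_def sgn_real_def)
  have sign: "\<eta> \<le> e * (Y powr (n - 1) * f' Y)" if Y: "a \<le> Y" for Y
  proof (rule ccontr)
    assume neg: "\<not> \<eta> \<le> e * (Y powr (n - 1) * f' Y)"
    have "e * (Y powr (n - 1) * f' Y) \<le> 0" using neg big[OF Y] e by (auto simp: abs_if split: if_splits)
    moreover have "0 \<le> sgn z * z" for z :: real by (simp add: sgn_real_def)
    then have "0 \<le> e * (a powr (n - 1) * f' a)" unfolding e_def by blast
    moreover have "continuous_on {a..Y} (\<lambda>Y. e * (Y powr (n - 1) * f' Y))" by (intro continuous_intros Vc)
    ultimately obtain z where "a \<le> z" "z \<le> Y" "e * (z powr (n - 1) * f' z) = 0"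
      using IVT2'[of "\<lambda>Y. e * (Y powr (n - 1) * f' Y)" Y 0 a] Y by auto
    then show False using big[of z] e \<open>0 < \<eta>\<close> by auto
  qed
  have low: "\<eta> * (ln X - ln a) \<le> e * f X - e * f a" if X: "a \<le> X" for X
  proof -
    have "e * f a - \<eta> * ln a \<le> e * f X - \<eta> * ln X"
    proof (rule DERIV_nonneg_imp_nondecreasing[OF X])
      fix t assume t: "a \<le> t" "t \<le> X"
      then have t1: "1 \<le> t" by (simp add: a_def)
      have "\<eta> / t \<le> \<eta> * t powr (1 - n)"
      proof -
        have "t powr (-1) \<le> t powr (1 - n)" using t1 n_less by (intro powr_mono) auto
        then have "\<eta> * t powr (-1) \<le> \<eta> * t powr (1 - n)" using \<open>0 < \<eta>\<close> by (intro mult_left_mono) auto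
        then show ?thesis using t1 by (simp add: powr_minus divide_inverse)
      qed
      also have "\<dots> \<le> (e * (t powr (n - 1) * f' t)) * t powr (1 - n)"
        using sign[OF t(1)] by (intro mult_right_mono) auto
      also have "\<dots> = e * f' t" using t1 by (simp flip: powr_add)
      finally have "0 \<le> e * f' t - \<eta> / t" by simp
      moreover have "((\<lambda>t. e * f t - \<eta> * ln t) has_real_derivative (e * f' t - \<eta> / t)) (at t)"
        using t1 by (auto intro!: derivative_eq_intros d)
      ultimately show "\<exists>y. ((\<lambda>t. e * f t - \<eta> * ln t) has_real_derivative y) (at t) \<and> 0 \<le> y" by blast
    qed
    then show ?thesis by (simp add: algebra_simps)
  qed
  \<comment> \<open>\<open>ln X0\<close> exceeds \<open>ln a\<close> by
    \<open>(1 + \<bar>f a\<bar>) / \<eta>\<close>, so that the growth of \<open>f\<close> outweighs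
    its value at \<open>a\<close> by 1.\<close>
  define X0 where "X0 = a * exp ((1 + \<bar>f a\<bar>) / \<eta>)"
  have a1: "1 \<le> a" by (simp add: a_def)
  have X0a: "a \<le> X0" using a1 \<open>0 < \<eta>\<close> by (simp add: X0_def)
  show False
  proof (rule not_L2_if_bounded_below[OF f])
    fix X assume X: "X0 \<le> X"
    have "ln X0 \<le> ln X" using X X0a a1 by simp
    moreover have "ln X0 = ln a + (1 + \<bar>f a\<bar>) / \<eta>" using a1 by (simp add: X0_def ln_mult)
    ultimately have "(1 + \<bar>f a\<bar>) / \<eta> \<le> ln X - ln a" by simp
    then have "1 + \<bar>f a\<bar> \<le> \<eta> * (ln X - ln a)" using \<open>0 < \<eta>\<close> by (simp add: pos_divide_le_eq mult.commute)
    also have "\<dots> \<le> e * f X - e * f a" by (rule low) (use X X0a in simp)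
    also have "\<dots> \<le> \<bar>f X\<bar> + \<bar>f a\<bar>" using e by auto
    finally show "1 \<le> \<bar>f X\<bar>" by simp
  qed
qed

text \<open>\<open>(- r2) * (s powr (n - 2) * exp (-1 * E s))\<close> is almost an antiderivative:
  its derivative dominates the integrand because R \<le> r2 and n < 2.\<close>

lemma integral_gaussian_tail:
  assumes "0 < x" "x \<le> Y"
  shows "integral {x..Y} (\<lambda>s. s powr (n - 1) * exp (-1 * E s)) \<le> r2 * (x powr (n - 2) * exp (-1 * E x))"
proof -
  let ?\<Psi> = "\<lambda>s. (- r2) * (s powr (n - 2) * exp (-1 * E s))"
  have cont: "continuous_on {x..Y} (\<lambda>s. s powr (n - 1) * exp (-1 * E s))"
    by (intro continuous_intros continuous_on_subset[OF ac_deriv_continuous_on[OF ac_deriv_E]]) (use assms in auto)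
  have "integral {x..Y} (\<lambda>s. s powr (n - 1) * exp (-1 * E s)) \<le> ?\<Psi> Y - ?\<Psi> x"
  proof (rule has_integral_le_AE)
    show "((\<lambda>s. s powr (n - 1) * exp (-1 * E s)) has_integral integral {x..Y} (\<lambda>s. s powr (n - 1) * exp (-1 * E s))) {x..Y}"
      by (rule integrable_integral[OF integrable_continuous_interval[OF cont]])
    show "((\<lambda>s. (- r2) * (s powr (n - 2) * exp (-1 * E s) * ((n - 2) / s + -1 * s / R s))) has_integral ?\<Psi> Y - ?\<Psi> x) {x..Y}"
      by (rule ac_deriv_has_integral[OF ac_deriv_cmult[OF ac_deriv_powr_exp_E]]) (use assms in auto)
    have "s powr (n - 1) * exp (-1 * E s) \<le> (- r2) * (s powr (n - 2) * exp (-1 * E s) * ((n - 2) / s + -1 * s / R s))"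
      if s: "0 < s" for s
    proof -
      have "s \<le> r2 * (s / R s)" using R_upper[OF s] R_pos[OF s] s by (simp add: field_simps)
      moreover have "0 \<le> r2 * ((2 - n) / s)" using n_less r2_pos s by simp
      ultimately have "s \<le> r2 * ((2 - n) / s + s / R s)" by (simp add: distrib_left)
      then have "s powr (n - 2) * exp (-1 * E s) * s \<le> s powr (n - 2) * exp (-1 * E s) * (r2 * ((2 - n) / s + s / R s))"
        by (intro mult_left_mono) auto
      moreover have "s powr (n - 1) = s powr (n - 2) * s" using s by (simp add: powr_diff power2_eq_square)
      moreover have "(n - 2) / s + -1 * s / R s = - ((2 - n) / s + s / R s)"
        by (simp add: diff_divide_distrib)
      ultimately show ?thesis by (simp add: algebra_simps)
    qed
    then show "AE s in lebesgue. s \<in> {x..Y} \<longrightarrow> s powr (n - 1) * exp (-1 * E s)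
        \<le> (- r2) * (s powr (n - 2) * exp (-1 * E s) * ((n - 2) / s + -1 * s / R s))" using assms by simp
  qed
  moreover have "0 \<le> r2 * (Y powr (n - 2) * exp (-1 * E Y))" using r2_pos by simp
  ultimately show ?thesis by simp
qed

text \<open>The domain controls the Laplacian rather than the operator itself, and then the drift
  enters the derivative of \<open>\<Gamma>\<close> with positive sign. Integrating that derivative
  requires an upper bound for \<open>\<Gamma>\<close> at the right end. It comes from estimating
  \<open>V\<close> by a tail integral of \<open>g\<close>, which is legitimate because
  \<open>V\<close> becomes arbitrarily small far out.\<close>

lemma drift_term_L2_of_Laplacian:
  assumes f: "f \<in> L2" and d: "\<And>x. 0 < x \<Longrightarrow> (f has_real_derivative f' x) (at x)" and c: "continuous_on {0<..} f'"
    and acV: "ac_deriv (\<lambda>x. x powr (n - 1) * f' x) (\<lambda>x. x powr (n - 1) * g x)" and g: "g \<in> L2"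
  shows "(\<lambda>x. x * f' x) \<in> L2"
proof -
  define V where "V x = x powr (n - 1) * f' x" for x
  define \<Gamma> where "\<Gamma> x = x * (f' x)\<^sup>2 * P x" for x
  have gi: "(\<lambda>x. w x * (g x)\<^sup>2) integrable_on {a..b}" if "0 < a" for a b
    by (rule L2_integrable[OF g]) (use that in simp)
  \<comment> \<open>\<alpha> is the parameter of Young's inequality in the tail integral. This
    choice balances the two terms at order 1 / \<alpha>, and \<open>\<Gamma> x\<close> is the square
    of \<open>V x * \<alpha>\<close>.\<close>
  have V_bound: "\<bar>V x\<bar> \<le> r2 / 2 * (1 + N2 g) / \<alpha>" if x: "0 < x" and \<alpha>: "\<alpha> = sqrt (x powr (2 - n) * exp (E x))" for x \<alpha>
  proof -
    have \<alpha>0: "0 < \<alpha>" using x \<alpha> by simp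
    have \<alpha>2: "\<alpha> * (x powr (n - 2) * exp (-1 * E x)) = 1 / \<alpha>"
    proof -
      have "\<alpha>\<^sup>2 = x powr (2 - n) * exp (E x)" using x \<alpha> by simp
      then have "\<alpha>\<^sup>2 * (x powr (n - 2) * exp (-1 * E x)) = 1"
        using x by (simp add: exp_minus field_simps flip: powr_add)
      then show ?thesis using \<alpha>0 by (simp add: power2_eq_square field_simps)
    qed
    have step: "\<bar>V x\<bar> \<le> \<bar>V Y\<bar> + r2 / 2 * (1 + N2 g) / \<alpha>" if Y: "x \<le> Y" for Y
    proof -
      define b where "b s = (1/2) * (\<alpha> * (s powr (n - 1) * exp (-1 * E s)) + (r2 / \<alpha>) * (w s * (g s)\<^sup>2))" for s
      have cont: "continuous_on {x..Y} (\<lambda>s. s powr (n - 1) * exp (-1 * E s))"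
        by (intro continuous_intros continuous_on_subset[OF ac_deriv_continuous_on[OF ac_deriv_E]]) (use x in auto)
      note ci = integrable_continuous_interval[OF cont]
      have hi: "((\<lambda>s. s powr (n - 1) * g s) has_integral V Y - V x) {x..Y}"
        unfolding V_def by (rule ac_deriv_has_integral[OF acV x Y])
      have hb: "(b has_integral (1/2) * (\<alpha> * integral {x..Y} (\<lambda>s. s powr (n - 1) * exp (-1 * E s))
          + (r2 / \<alpha>) * integral {x..Y} (\<lambda>s. w s * (g s)\<^sup>2))) {x..Y}"
        unfolding b_def by (intro has_integral_mult_right has_integral_add integrable_integral ci gi x)
      have "\<bar>V Y - V x\<bar> = norm (integral {x..Y} (\<lambda>s. s powr (n - 1) * g s))" using integral_unique[OF hi] by simp
      also have "\<dots> \<le> integral {x..Y} b"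
      proof (rule integral_norm_bound_integral)
        show "norm (s powr (n - 1) * g s) \<le> b s" if "s \<in> {x..Y}" for s
        proof -
          have s: "0 < s" using that x by simp
          define p where "p = s powr (n - 1)"
          have p: "0 < p" using s by (simp add: p_def)
          have "P s * (g s)\<^sup>2 \<le> r2 * (w s * (g s)\<^sup>2)"
            using R_upper[OF s] R_pos[OF s] P_pos[OF s] by (simp add: weight_eq field_simps mult_right_mono)
          then have e1: "(1 / \<alpha>) * (P s * (g s)\<^sup>2) \<le> (1 / \<alpha>) * (r2 * (w s * (g s)\<^sup>2))"
            using \<alpha>0 by (intro mult_left_mono) auto
          have "0 \<le> (sqrt \<alpha> * exp (- E s / 2) - \<bar>g s\<bar> * exp (E s / 2) / sqrt \<alpha>)\<^sup>2" by simp
          also have "\<dots> = \<alpha> * exp (- E s) - 2 * \<bar>g s\<bar> + (g s)\<^sup>2 * exp (E s) / \<alpha>"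
          proof -
            have "exp (- E s / 2) * exp (E s / 2) = 1" by (simp flip: exp_add)
            moreover have "(exp (- E s / 2))\<^sup>2 = exp (- E s)" "(exp (E s / 2))\<^sup>2 = exp (E s)"
              by (simp_all add: power2_eq_square flip: exp_add)
            moreover have "(sqrt \<alpha> * exp (- E s / 2)) * (\<bar>g s\<bar> * exp (E s / 2) / sqrt \<alpha>)
               = \<bar>g s\<bar> * (exp (- E s / 2) * exp (E s / 2))" using \<alpha>0 by simp
            ultimately show ?thesis using \<alpha>0 by (simp add: power2_diff power_mult_distrib power_divide)
          qed
          finally have "2 * \<bar>g s\<bar> \<le> \<alpha> * exp (- E s) + (g s)\<^sup>2 * exp (E s) / \<alpha>" by simp
          then have "p * (2 * \<bar>g s\<bar>) \<le> p * (\<alpha> * exp (- E s) + (g s)\<^sup>2 * exp (E s) / \<alpha>)"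
            using p by (intro mult_left_mono) auto
          also have "\<dots> = \<alpha> * (p * exp (- E s)) + (1 / \<alpha>) * (P s * (g s)\<^sup>2)"
            by (simp add: P_def p_def algebra_simps)
          finally have "p * \<bar>g s\<bar> \<le> b s" using e1 by (simp add: b_def p_def)
          then show ?thesis by (simp add: p_def abs_mult)
        qed
      qed (use hi hb in auto)
      also have "integral {x..Y} b = (1/2) * (\<alpha> * integral {x..Y} (\<lambda>s. s powr (n - 1) * exp (-1 * E s))
          + (r2 / \<alpha>) * integral {x..Y} (\<lambda>s. w s * (g s)\<^sup>2))" by (rule integral_unique[OF hb])
      also have "\<dots> \<le> (1/2) * (\<alpha> * (r2 * (x powr (n - 2) * exp (-1 * E x))) + (r2 / \<alpha>) * N2 g)"
        using integral_gaussian_tail[OF x Y] L2_integrable(2)[OF g, of x Y] \<alpha>0 r2_pos x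
        by (intro mult_left_mono add_mono) auto
      also have "\<dots> = (1/2) * (r2 * (\<alpha> * (x powr (n - 2) * exp (-1 * E x))) + (r2 / \<alpha>) * N2 g)" by (simp add: mult_ac)
      also have "\<dots> = r2 / 2 * (1 + N2 g) / \<alpha>" unfolding \<alpha>2 by (simp add: algebra_simps add_divide_distrib)
      finally show ?thesis by linarith
    qed
    show ?thesis
    proof (rule field_le_epsilon)
      fix \<eta> :: real assume "0 < \<eta>"
      obtain Y where Y: "Y \<ge> x" "\<bar>V Y\<bar> < \<eta>"
        using flux_small_somewhere[OF f d c \<open>0 < \<eta>\<close> x] unfolding V_def by blast
      show "\<bar>V x\<bar> \<le> r2 / 2 * (1 + N2 g) / \<alpha> + \<eta>" using step[OF Y(1)] Y(2) by linarith
    qed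
  qed
  define G0 where "G0 = (r2 / 2 * (1 + N2 g))\<^sup>2"
  have \<Gamma>V: "\<Gamma> x = (V x)\<^sup>2 * (x powr (2 - n) * exp (E x))" if x: "0 < x" for x
  proof -
    have "(x powr (n - 1))\<^sup>2 * x powr (2 - n) = x * x powr (n - 1)"
      using x by (simp add: powr_diff powr_add[symmetric] power2_eq_square field_simps)
    then show ?thesis by (simp add: \<Gamma>_def V_def P_def power_mult_distrib mult_ac)
  qed
  have \<Gamma>_bound: "\<Gamma> x \<le> G0" if x: "0 < x" for x
  proof -
    define \<alpha> where "\<alpha> = sqrt (x powr (2 - n) * exp (E x))"
    have \<alpha>: "0 < \<alpha>" "\<alpha>\<^sup>2 = x powr (2 - n) * exp (E x)" using x by (auto simp: \<alpha>_def)
    have "\<bar>V x\<bar> * \<alpha> \<le> r2 / 2 * (1 + N2 g)" using V_bound[OF x \<alpha>_def] \<alpha>(1) by (simp add: pos_le_divide_eq)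
    then have "(\<bar>V x\<bar> * \<alpha>)\<^sup>2 \<le> G0" unfolding G0_def using \<alpha>(1) by (intro power_mono) auto
    then show ?thesis unfolding \<Gamma>V[OF x] \<alpha>(2)[symmetric] by (simp add: power_mult_distrib)
  qed
  have ac\<Gamma>: "ac_deriv \<Gamma> (\<lambda>x. 2 * x * f' x * (P x * g x) + P x * (f' x)\<^sup>2 * (2 - n + x\<^sup>2 / R x))"
  proof (rule ac_deriv_cong)
    show "ac_deriv (\<lambda>x. (V x * V x) * (x powr (2 - n) * exp (1 * E x)))
      (\<lambda>x. ((x powr (n - 1) * g x) * V x + V x * (x powr (n - 1) * g x)) * (x powr (2 - n) * exp (1 * E x))
       + (V x * V x) * (x powr (2 - n) * exp (1 * E x) * ((2 - n) / x + 1 * x / R x)))"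
      unfolding V_def by (intro ac_deriv_mult acV ac_deriv_powr_exp_E)
    show "\<Gamma> x = (V x * V x) * (x powr (2 - n) * exp (1 * E x))" if "0 < x" for x
      using \<Gamma>V[OF that] by (simp add: power2_eq_square)
    have "2 * x * f' x * (P x * g x) + P x * (f' x)\<^sup>2 * (2 - n + x\<^sup>2 / R x)
      = ((x powr (n - 1) * g x) * V x + V x * (x powr (n - 1) * g x)) * (x powr (2 - n) * exp (1 * E x))
       + (V x * V x) * (x powr (2 - n) * exp (1 * E x) * ((2 - n) / x + 1 * x / R x))" if x: "0 < x" for x
    proof -
      have q: "x powr (n - 1) * x powr (2 - n) = x" using x by (simp flip: powr_add)
      have "((x powr (n - 1) * g x) * V x + V x * (x powr (n - 1) * g x)) * (x powr (2 - n) * exp (1 * E x))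
       + (V x * V x) * (x powr (2 - n) * exp (1 * E x) * ((2 - n) / x + 1 * x / R x))
       = (x powr (n - 1) * x powr (2 - n)) * (2 * f' x * (P x * g x) + P x * (f' x)\<^sup>2 * ((2 - n) / x + x / R x))"
        by (simp add: V_def P_def power2_eq_square algebra_simps)
      also have "\<dots> = 2 * x * f' x * (P x * g x) + P x * (f' x)\<^sup>2 * (2 - n + x\<^sup>2 / R x)"
        unfolding q using x R_pos[OF x] by (simp add: power2_eq_square field_simps)
      finally show ?thesis by simp
    qed
    then show "AE x in lebesgue. 0 < x \<longrightarrow> 2 * x * f' x * (P x * g x) + P x * (f' x)\<^sup>2 * (2 - n + x\<^sup>2 / R x)
      = ((x powr (n - 1) * g x) * V x + V x * (x powr (n - 1) * g x)) * (x powr (2 - n) * exp (1 * E x))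
       + (V x * V x) * (x powr (2 - n) * exp (1 * E x) * ((2 - n) / x + 1 * x / R x))" by simp
  qed
  have cont: "continuous_on {0<..} (\<lambda>x. (x * f' x)\<^sup>2)" by (intro continuous_intros c)
  have wi: "(\<lambda>x. w x * (x * f' x)\<^sup>2) integrable_on {a..b}" if "0 < a" for a b
    by (rule wg_integrable_away(2)[OF cont that])
  show ?thesis
  proof (rule L2_intro(1)[where B = "2 * (G0 + 2 * r2\<^sup>2 * N2 g)"])
    show "(\<lambda>x. x * f' x) \<in> borel_measurable (lebesgue_on {0<..})"
      by (intro continuous_measurable continuous_intros c)
    fix a b :: real assume ab: "0 < a" "a \<le> b"
    show "(\<lambda>x. w x * (x * f' x)\<^sup>2) integrable_on {a..b}" by (rule wi[OF ab(1)])
    have "(1/2) * integral {a..b} (\<lambda>x. w x * (x * f' x)\<^sup>2) + (- (2 * r2\<^sup>2)) * integral {a..b} (\<lambda>x. w x * (g x)\<^sup>2) \<le> \<Gamma> b - \<Gamma> a"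
    proof (rule has_integral_le_AE)
      show "((\<lambda>x. (1/2) * (w x * (x * f' x)\<^sup>2) + (- (2 * r2\<^sup>2)) * (w x * (g x)\<^sup>2)) has_integral
        (1/2) * integral {a..b} (\<lambda>x. w x * (x * f' x)\<^sup>2) + (- (2 * r2\<^sup>2)) * integral {a..b} (\<lambda>x. w x * (g x)\<^sup>2)) {a..b}"
        by (intro has_integral_add has_integral_mult_right integrable_integral wi gi ab)
      show "((\<lambda>x. 2 * x * f' x * (P x * g x) + P x * (f' x)\<^sup>2 * (2 - n + x\<^sup>2 / R x)) has_integral \<Gamma> b - \<Gamma> a) {a..b}"
        by (rule ac_deriv_has_integral[OF ac\<Gamma> ab])
      have "(1/2) * (w x * (x * f' x)\<^sup>2) + (- (2 * r2\<^sup>2)) * (w x * (g x)\<^sup>2)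
        \<le> 2 * x * f' x * (P x * g x) + P x * (f' x)\<^sup>2 * (2 - n + x\<^sup>2 / R x)" if x: "0 < x" for x
      proof -
        define z where "z = (x * f' x)\<^sup>2"
        have e1: "P x * (f' x)\<^sup>2 * (x\<^sup>2 / R x) = w x * z" by (simp add: weight_eq z_def power_mult_distrib)
        have e2: "0 \<le> P x * (f' x)\<^sup>2 * (2 - n)" using P_pos[OF x] n_less by simp
        have PR: "P x = R x * w x" using R_pos[OF x] by (simp add: weight_eq)
        have "(R x)\<^sup>2 * (g x)\<^sup>2 \<le> r2\<^sup>2 * (g x)\<^sup>2"
          using R_upper[OF x] R_pos[OF x] by (intro mult_right_mono power_mono) auto
        moreover have "0 \<le> 2 * (x * f' x / 2 + R x * g x)\<^sup>2" by simp
        moreover have "2 * (x * f' x / 2 + R x * g x)\<^sup>2 = z / 2 + 2 * (R x)\<^sup>2 * (g x)\<^sup>2 + 2 * (x * f' x) * (R x * g x)"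
          by (simp add: z_def power2_eq_square field_simps)
        ultimately have "0 \<le> z / 2 + 2 * (r2\<^sup>2 * (g x)\<^sup>2) + 2 * (x * f' x) * (R x * g x)" by simp
        then have "0 \<le> w x * (z / 2 + 2 * (r2\<^sup>2 * (g x)\<^sup>2) + 2 * (x * f' x) * (R x * g x))"
          using w_pos[OF x] by (intro mult_nonneg_nonneg) auto
        then have e3: "0 \<le> w x * z / 2 + 2 * r2\<^sup>2 * (w x * (g x)\<^sup>2) + 2 * x * f' x * (P x * g x)"
          unfolding PR by (simp add: algebra_simps)
        have e4: "P x * (f' x)\<^sup>2 * (2 - n + x\<^sup>2 / R x) = P x * (f' x)\<^sup>2 * (2 - n) + w x * z"
          unfolding distrib_left e1 ..
        show ?thesis unfolding e4 z_def[symmetric] using e2 e3 by simp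
      qed
      then show "AE x in lebesgue. x \<in> {a..b} \<longrightarrow> (1/2) * (w x * (x * f' x)\<^sup>2) + (- (2 * r2\<^sup>2)) * (w x * (g x)\<^sup>2)
        \<le> 2 * x * f' x * (P x * g x) + P x * (f' x)\<^sup>2 * (2 - n + x\<^sup>2 / R x)" using ab by simp
    qed
    moreover have "0 \<le> \<Gamma> a" unfolding \<Gamma>_def using ab P_pos[of a] by simp
    moreover have "\<Gamma> b \<le> G0" by (rule \<Gamma>_bound) (use ab in simp)
    moreover have "2 * r2\<^sup>2 * integral {a..b} (\<lambda>x. w x * (g x)\<^sup>2) \<le> 2 * r2\<^sup>2 * N2 g"
      using L2_integrable(2)[OF g, of a b] ab by (intro mult_left_mono) auto
    ultimately show "integral {a..b} (\<lambda>x. w x * (x * f' x)\<^sup>2) \<le> 2 * (G0 + 2 * r2\<^sup>2 * N2 g)" by simp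
  qed
qed

section \<open>Membership in the operator domain\<close>

lemma op_domainD:
  assumes "f \<in> op_domain n R"
  shows "f \<in> L2" "\<And>x. 0 < x \<Longrightarrow> (f has_real_derivative deriv f x) (at x)" "continuous_on {0<..} (deriv f)"
    "ac_deriv (deriv f) (deriv (deriv f))" "radial_Laplacian n f \<in> L2"
    "((\<lambda>x. x powr (n - 1) * deriv f x) \<longlongrightarrow> 0) (at_right 0)"
proof -
  show "f \<in> L2" "radial_Laplacian n f \<in> L2" "((\<lambda>x. x powr (n - 1) * deriv f x) \<longlongrightarrow> 0) (at_right 0)"
    using assms by (auto simp: op_domain_def L2_def)
  show "(f has_real_derivative deriv f x) (at x)" if "0 < x" for x
    using assms that by (auto simp: op_domain_def DERIV_deriv_iff_real_differentiable)
  show ac: "ac_deriv (deriv f) (deriv (deriv f))"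
    using assms by (auto simp: op_domain_def intro: locally_abs_continuous_ac_deriv)
  show "continuous_on {0<..} (deriv f)" by (rule ac_deriv_continuous_on[OF ac])
qed

text \<open>In particular \<open>L_op\<close> maps the domain into \<open>L2\<close>, although the
  domain is defined through the Laplacian alone.\<close>

lemma op_domain_flux:
  assumes "f \<in> op_domain n R"
  shows "ac_deriv (\<lambda>x. P x * deriv f x) (\<lambda>x. w x * L_op n R f x)"
    "((\<lambda>x. P x * deriv f x) \<longlongrightarrow> 0) (at_right 0)" "(\<lambda>x. x * deriv f x) \<in> L2" "L_op n R f \<in> L2"
proof -
  note D = op_domainD[OF assms]
  show "ac_deriv (\<lambda>x. P x * deriv f x) (\<lambda>x. w x * L_op n R f x)"
  proof (rule ac_deriv_cong[OF ac_deriv_mult[OF ac_deriv_P D(4)]])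
    have "w x * L_op n R f x = P x * ((n - 1) / x + x / R x) * deriv f x + P x * deriv (deriv f) x" if x: "0 < x" for x
      using R_pos[OF x] by (simp add: weight_eq L_op_def radial_Laplacian_def field_simps)
    then show "AE x in lebesgue. 0 < x \<longrightarrow> w x * L_op n R f x
      = P x * ((n - 1) / x + x / R x) * deriv f x + P x * deriv (deriv f) x" by simp
  qed simp
  have "((\<lambda>x. exp (E x) * (x powr (n - 1) * deriv f x)) \<longlongrightarrow> exp 0 * 0) (at_right 0)"
    by (intro tendsto_intros E_tendsto_0 D(6))
  then show "((\<lambda>x. P x * deriv f x) \<longlongrightarrow> 0) (at_right 0)" by (simp add: P_def mult_ac)
  show xf: "(\<lambda>x. x * deriv f x) \<in> L2"
  proof (rule drift_term_L2_of_Laplacian[OF D(1,2,3) _ D(5)])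
    show "ac_deriv (\<lambda>x. x powr (n - 1) * deriv f x) (\<lambda>x. x powr (n - 1) * radial_Laplacian n f x)"
    proof (rule ac_deriv_cong[OF ac_deriv_mult[OF ac_deriv_powr D(4)]])
      have "x powr (n - 1) * radial_Laplacian n f x
        = (n - 1) * x powr (n - 1 - 1) * deriv f x + x powr (n - 1) * deriv (deriv f) x" if x: "0 < x" for x
      proof -
        have "x powr (n - 1 - 1) = x powr (n - 1) / x" using x powr_diff[of x "n - 1" 1] by simp
        then show ?thesis by (simp add: radial_Laplacian_def algebra_simps)
      qed
      then show "AE x in lebesgue. 0 < x \<longrightarrow> x powr (n - 1) * radial_Laplacian n f x
        = (n - 1) * x powr (n - 1 - 1) * deriv f x + x powr (n - 1) * deriv (deriv f) x" by simp
    qed simp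
  qed auto
  show "L_op n R f \<in> L2"
    using L2_lincomb[OF xf L2_times_R[OF D(5)], of 1 1] by (simp add: L_op_def[abs_def])
qed

text \<open>Square integrability of \<open>G\<close> makes the drift term square integrable, and the
  Laplacian is then recovered as (G - x f') / R. The factor \<open>exp (- E x)\<close> converts the
  limit of P f' into the boundary condition of the domain.\<close>

lemma op_domainI:
  assumes f: "f \<in> L2" and d: "\<And>x. 0 < x \<Longrightarrow> (f has_real_derivative f' x) (at x)" and f'': "ac_deriv f' f''"
    and lim: "((\<lambda>x. P x * f' x) \<longlongrightarrow> 0) (at_right 0)" and G: "G \<in> L2"
    and eq: "AE x in lebesgue. 0 < x \<longrightarrow> x * f' x + R x * ((n - 1) / x * f' x + f'' x) = G x"
  shows "f \<in> op_domain n R" "AE x in lebesgue. 0 < x \<longrightarrow> L_op n R f x = G x"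
    "AE x in lebesgue. 0 < x \<longrightarrow> radial_Laplacian n f x = (n - 1) / x * f' x + f'' x"
proof -
  have c: "continuous_on {0<..} f'" by (rule ac_deriv_continuous_on[OF f''])
  have df: "deriv f x = f' x" if "0 < x" for x using d[OF that] by (rule DERIV_imp_deriv)
  have ac1: "ac_deriv f f'" by (rule ac_deriv_C1[OF d c])
  have ac2: "ac_deriv (deriv f) f''" by (rule ac_deriv_cong[OF f'']) (auto simp: df)
  have ddf: "AE x in lebesgue. 0 < x \<longrightarrow> deriv (deriv f) x = f'' x"
    using ac_deriv_AE[OF ac2] by eventually_elim (auto intro: DERIV_imp_deriv)
  show lap: "AE x in lebesgue. 0 < x \<longrightarrow> radial_Laplacian n f x = (n - 1) / x * f' x + f'' x"
    using ddf by eventually_elim (auto simp: radial_Laplacian_def df)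
  show L: "AE x in lebesgue. 0 < x \<longrightarrow> L_op n R f x = G x"
    using lap eq by eventually_elim (auto simp: L_op_def df)
  have xf: "(\<lambda>x. x * f' x) \<in> L2"
  proof (rule drift_term_L2[OF c _ lim G])
    show "ac_deriv (\<lambda>x. P x * f' x) (\<lambda>x. w x * G x)"
    proof (rule ac_deriv_cong[OF ac_deriv_mult[OF ac_deriv_P f'']])
      show "AE x in lebesgue. 0 < x \<longrightarrow> w x * G x = P x * ((n - 1) / x + x / R x) * f' x + P x * f'' x"
        using eq
      proof eventually_elim
        case (elim x)
        show ?case
        proof
          assume x: "0 < x"
          then have G: "G x = x * f' x + R x * ((n - 1) / x * f' x + f'' x)" using elim by simp
          show "w x * G x = P x * ((n - 1) / x + x / R x) * f' x + P x * f'' x"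
            unfolding G using x R_pos[OF x] by (simp add: weight_eq field_simps)
        qed
      qed
    qed simp
  qed
  have "(\<lambda>x. (1 * G x + (-1) * (x * f' x)) / R x) \<in> L2" by (rule L2_div_R[OF L2_lincomb[OF G xf]])
  moreover have "AE x in lebesgue. 0 < x \<longrightarrow> (1 * G x + (-1) * (x * f' x)) / R x = radial_Laplacian n f x"
    using lap eq
  proof eventually_elim
    case (elim x)
    show ?case
    proof
      assume x: "0 < x"
      have "R x * radial_Laplacian n f x = G x - x * f' x" using elim x by simp
      then show "(1 * G x + (-1) * (x * f' x)) / R x = radial_Laplacian n f x"
        using R_pos[OF x] by (simp add: field_simps)
    qed
  qed
  ultimately have lapL2: "radial_Laplacian n f \<in> L2" by (rule L2_AE_cong(1))
  have "((\<lambda>x. exp (- E x) * (P x * f' x)) \<longlongrightarrow> exp (- 0) * 0) (at_right 0)"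
    by (intro tendsto_intros E_tendsto_0 lim)
  then have "((\<lambda>x. exp (- E x) * (P x * f' x)) \<longlongrightarrow> 0) (at_right 0)" by simp
  moreover have "eventually (\<lambda>x. exp (- E x) * (P x * f' x) = x powr (n - 1) * deriv f x) (at_right 0)"
    using eventually_at_right_less[of 0] by eventually_elim (simp add: P_def df exp_minus)
  ultimately have lim0: "((\<lambda>x. x powr (n - 1) * deriv f x) \<longlongrightarrow> 0) (at_right 0)"
    by (rule Lim_transform_eventually)
  have "f differentiable (at x)" if "0 < x" for x
    using d[OF that] by (auto simp: real_differentiable_def)
  then show "f \<in> op_domain n R"
    using f lapL2 lim0 ac1 ac2 by (auto simp: op_domain_def L2_def ac_deriv_def)
qed

end

section \<open>Eigenfunctions\<close>

lemma antiderivative_positive: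
  fixes q :: "real \<Rightarrow> real"
  assumes "continuous_on {0<..} q"
  obtains Q where "\<And>x. 0 < x \<Longrightarrow> (Q has_real_derivative q x) (at x)"
proof -
  \<comment> \<open>An integral over a reversed interval is over the empty set and hence 0, so each
    term takes care of one side of 1.\<close>
  define Q where "Q x = integral {1..x} q - integral {x..1} q" for x
  have i: "q integrable_on {a..b}" if "0 < a" for a b
    by (intro integrable_continuous_interval continuous_on_subset[OF assms]) (use that in auto)
  have "(Q has_real_derivative q x) (at x)" if x: "0 < x" for x
  proof -
    define a where "a = min 1 x / 2"
    define b where "b = max 1 x + 1"
    have ab: "0 < a" "a < 1" "a < x" "x < b" "1 < b" using x by (auto simp: a_def b_def)
    have "((\<lambda>u. integral {a..u} q) has_real_derivative q x) (at x within {a..b})"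
      by (rule integral_has_real_derivative) (use ab in \<open>auto intro: continuous_on_subset[OF assms]\<close>)
    then have "((\<lambda>u. integral {a..u} q) has_real_derivative q x) (at x)"
      using at_within_interior[of x "{a..b}"] ab by (simp add: interior_atLeastAtMost_real)
    then have "((\<lambda>u. integral {a..u} q - integral {a..1} q) has_real_derivative q x) (at x)"
      by (auto intro!: derivative_eq_intros)
    then show ?thesis
    proof (rule has_field_derivative_transform_within_open[of _ _ _ "{a<..<b}"])
      fix u assume u: "u \<in> {a<..<b}"
      show "integral {a..u} q - integral {a..1} q = Q u"
      proof (cases "u \<le> 1")
        case True
        have "integral {a..u} q + integral {u..1} q = integral {a..1} q"
          by (rule Henstock_Kurzweil_Integration.integral_combine[OF _ True i[OF ab(1)]]) (use u in simp)
        moreover have "integral {1..u} q = 0" using True by (cases "u = 1") auto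
        ultimately show ?thesis by (simp add: Q_def)
      next
        case False
        then have "integral {a..1} q + integral {1..u} q = integral {a..u} q"
          by (intro Henstock_Kurzweil_Integration.integral_combine i ab) (use ab in auto)
        then show ?thesis using False by (simp add: Q_def)
      qed
    qed (use ab in auto)
  qed
  then show ?thesis by (rule that)
qed

context radial
begin

lemma ground_L2: "ground \<mu> B \<Longrightarrow> y (-\<mu>) \<in> L2"
proof (rule L2_intro(1)[where B = "B / r1"])
  assume g: "ground \<mu> B"
  have c: "continuous_on {0..} (\<lambda>x. (y (-\<mu>) x)\<^sup>2)" by (intro continuous_intros y_continuous)
  show "y (-\<mu>) \<in> borel_measurable (lebesgue_on {0<..})" by (rule continuous_measurable_0[OF y_continuous])
  fix a b :: real assume ab: "0 < a" "a \<le> b"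
  show i: "(\<lambda>x. w x * (y (-\<mu>) x)\<^sup>2) integrable_on {a..b}" by (rule wg_integrable_cont[OF c]) (use ab in simp)
  have Pi: "(\<lambda>t. P t * (y (-\<mu>) t)\<^sup>2) integrable_on {c..b}" if "0 \<le> c" for c by (rule P_y2_integrable[OF that])
  have "integral {a..b} (\<lambda>x. w x * (y (-\<mu>) x)\<^sup>2) \<le> integral {a..b} (\<lambda>x. (1 / r1) * (P x * (y (-\<mu>) x)\<^sup>2))"
  proof (rule integral_le[OF i])
    show "(\<lambda>x. (1 / r1) * (P x * (y (-\<mu>) x)\<^sup>2)) integrable_on {a..b}"
      by (intro integrable_on_mult_right Pi) (use ab in simp)
    fix x assume "x \<in> {a..b}"
    then have x: "0 < x" using ab by simp
    have "P x * (y (-\<mu>) x)\<^sup>2 / R x \<le> P x * (y (-\<mu>) x)\<^sup>2 / r1"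
      using R_lower[OF x] R_pos[OF x] r1_pos P_pos[OF x] by (intro divide_left_mono) auto
    then show "w x * (y (-\<mu>) x)\<^sup>2 \<le> (1 / r1) * (P x * (y (-\<mu>) x)\<^sup>2)" by (simp add: weight_eq)
  qed
  also have "\<dots> = integral {a..b} (\<lambda>x. P x * (y (-\<mu>) x)\<^sup>2) / r1" by simp
  also have "\<dots> \<le> B / r1"
  proof (rule divide_right_mono)
    have "integral {a..b} (\<lambda>x. P x * (y (-\<mu>) x)\<^sup>2) \<le> integral {0..b} (\<lambda>x. P x * (y (-\<mu>) x)\<^sup>2)"
    proof (rule integral_subset_le)
      have "0 \<le> P t * (y (-\<mu>) t)\<^sup>2" if "t \<in> {0..b}" for t using P_pos[of t] that by (cases "t = 0") auto
      then show "\<forall>t\<in>{0..b}. 0 \<le> P t * (y (-\<mu>) t)\<^sup>2" by blast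
    qed (use ab Pi in auto)
    also have "\<dots> \<le> B" by (rule groundD(3)[OF g]) (use ab in simp)
    finally show "integral {a..b} (\<lambda>x. P x * (y (-\<mu>) x)\<^sup>2) \<le> B" .
  qed (use r1_pos in simp)
  finally show "integral {a..b} (\<lambda>x. w x * (y (-\<mu>) x)\<^sup>2) \<le> B / r1" .
qed

lemma y_equation: "0 < x \<Longrightarrow> x * dy s x + R x * ((n - 1) / x * dy s x + ddy s x) = s * y s x"
  using R_pos[of x] by (simp add: ddy_def algebra_simps diff_divide_distrib)

lemma y_op_domain:
  assumes "y s \<in> L2"
  shows "y s \<in> op_domain n R" "AE x in lebesgue. 0 < x \<longrightarrow> L_op n R (y s) x = s * y s x"
    "AE x in lebesgue. 0 < x \<longrightarrow> radial_Laplacian n (y s) x = (n - 1) / x * dy s x + ddy s x"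
proof -
  have G: "(\<lambda>x. s * y s x) \<in> L2" using L2_lincomb[OF assms assms, of s 0] by simp
  have e: "AE x in lebesgue. 0 < x \<longrightarrow> x * dy s x + R x * ((n - 1) / x * dy s x + ddy s x) = s * y s x"
    using y_equation by simp
  show "y s \<in> op_domain n R" "AE x in lebesgue. 0 < x \<longrightarrow> L_op n R (y s) x = s * y s x"
    "AE x in lebesgue. 0 < x \<longrightarrow> radial_Laplacian n (y s) x = (n - 1) / x * dy s x + ddy s x"
    using op_domainI[OF assms y_deriv ac_deriv_dy P_dy_tendsto_0 G e] by auto
qed

text \<open>Zero flux makes \<open>P x * deriv f x\<close> the integral of s w f from 0, hence
  bounded near 0. So \<open>deriv f\<close> is of order x^(1 - n) there, integrable because n < 2,
  and \<open>f\<close> extends continuously to 0 with value \<open>c\<close>. The extension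
  satisfies the same integral equation as \<open>c * y s x\<close>, and the difference is a fixed
  point to which \<open>T_fixed_point_zero\<close> applies.\<close>

lemma eigenfunction_unique:
  assumes f: "f \<in> op_domain n R" and eig: "AE x in lebesgue. 0 < x \<longrightarrow> L_op n R f x = s * f x"
  obtains c where "\<And>x. 0 < x \<Longrightarrow> f x = c * y s x"
proof -
  note D = op_domainD[OF f] and Fl = op_domain_flux[OF f]
  define V where "V x = P x * deriv f x" for x
  have c1: "continuous_on {0..} (\<lambda>x. 1 :: real)" by simp
  have wfa: "(\<lambda>t. w t * f t) absolutely_integrable_on {a..b}" if "0 \<le> a" for a b
    using L2_local_integrable[OF D(1) c1 that] by simp
  then have wf: "(\<lambda>t. w t * f t) integrable_on {a..b}" if "0 \<le> a" for a b
    using that by (simp add: absolutely_integrable_on_def)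
  have acV: "ac_deriv V (\<lambda>x. s * (w x * f x))"
    unfolding V_def by (rule ac_deriv_cong[OF Fl(1)]) (use eig in \<open>auto elim!: eventually_mono\<close>)
  have V_eq: "V x = s * integral {0..x} (\<lambda>t. w t * f t)" if x: "0 < x" for x
  proof -
    have "V x = integral {0..x} (\<lambda>t. s * (w t * f t))"
      by (rule ac_deriv_integral_from_0[OF acV _ _ x])
        (use Fl(2) wf in \<open>auto simp: V_def[abs_def] intro: integrable_on_mult_right\<close>)
    then show ?thesis by simp
  qed
  define J where "J = integral {0..1} (\<lambda>t. w t * \<bar>f t\<bar>)"
  have V_bd: "\<bar>V x\<bar> \<le> \<bar>s\<bar> * J" if x: "0 < x" "x \<le> 1" for x
  proof -
    have wabs: "(\<lambda>t. w t * \<bar>f t\<bar>) integrable_on {0..b}" for b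
    proof -
      have "(\<lambda>t. norm (w t * f t)) integrable_on {0..b}" using wfa[of 0 b] by (simp add: absolutely_integrable_on_def)
      moreover have "norm (w t * f t) = w t * \<bar>f t\<bar>" if "t \<in> {0..b}" for t
        using w_pos[of t] that by (cases "t = 0") (auto simp: abs_mult)
      ultimately show ?thesis by (rule integrable_eq)
    qed
    have wnn: "0 \<le> w t * \<bar>f t\<bar>" if "0 \<le> t" for t using w_pos[of t] that by (cases "t = 0") auto
    have "norm (integral {0..x} (\<lambda>t. w t * f t)) \<le> integral {0..x} (\<lambda>t. w t * \<bar>f t\<bar>)"
    proof (rule integral_norm_bound_integral[OF wf wabs])
      show "norm (w t * f t) \<le> w t * \<bar>f t\<bar>" if "t \<in> {0..x}" for t
        using w_pos[of t] that by (cases "t = 0") (auto simp: abs_mult)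
    qed simp
    also have "\<dots> \<le> J" unfolding J_def by (rule integral_subset_le[OF _ wabs wabs]) (use x wnn in auto)
    finally show ?thesis unfolding V_eq[OF x(1)] abs_mult by (intro mult_left_mono) auto
  qed
  have f'_bd: "\<bar>deriv f x\<bar> \<le> \<bar>s\<bar> * J * x powr (1 - n)" if x: "0 < x" "x \<le> 1" for x
  proof -
    have "deriv f x = V x * (x powr (1 - n) * exp (- E x))"
      using x by (simp add: V_def P_def exp_minus field_simps flip: powr_add)
    also have "\<bar>\<dots>\<bar> \<le> (\<bar>s\<bar> * J) * (x powr (1 - n) * 1)"
      unfolding abs_mult using V_bd[OF x] E_nonneg[of x] x by (intro mult_mono) auto
    finally show ?thesis by simp
  qed
  have pw: "(\<lambda>x. \<bar>s\<bar> * J * x powr (1 - n)) integrable_on {0..1}"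
    using has_integral_mult_right[OF has_integral_powr_from_0[of "1 - n" 1]] n_less by fastforce
  have f'm: "deriv f \<in> borel_measurable (lebesgue_on {0<..})" by (rule continuous_measurable[OF D(3)])
  have f'i: "deriv f integrable_on {0..x}" if "0 < x" for x
  proof -
    have "deriv f absolutely_integrable_on {0..1}"
      by (rule absolutely_integrable_dominated[OF f'm _ pw]) (use f'_bd in auto)
    then have 1: "deriv f integrable_on {0..1}" by (simp add: absolutely_integrable_on_def)
    have 2: "deriv f integrable_on {1..x}"
      by (intro integrable_continuous_interval continuous_on_subset[OF D(3)]) auto
    show ?thesis
    proof (cases "x \<le> 1")
      case True then show ?thesis using integrable_on_subinterval[OF 1, of 0 x] by auto
    next
      case False then show ?thesis using Henstock_Kurzweil_Integration.integrable_combine[OF _ _ 1 2] by auto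
    qed
  qed
  have acf: "ac_deriv f (deriv f)" by (rule ac_deriv_C1[OF D(2,3)])
  define c where "c = f 1 - integral {0..1} (deriv f)"
  have f_eq: "f x = c + integral {0..x} (deriv f)" if x: "0 < x" for x
  proof (cases "x \<le> 1")
    case True
    have "integral {x..1} (deriv f) = f 1 - f x"
      by (rule integral_unique[OF ac_deriv_has_integral[OF acf x True]])
    moreover have "integral {0..x} (deriv f) + integral {x..1} (deriv f) = integral {0..1} (deriv f)"
      by (rule Henstock_Kurzweil_Integration.integral_combine[OF _ True f'i]) (use x in auto)
    ultimately show ?thesis by (simp add: c_def)
  next
    case False
    have "integral {1..x} (deriv f) = f x - f 1"
      by (rule integral_unique[OF ac_deriv_has_integral[OF acf]]) (use False in auto)
    moreover have "integral {0..1} (deriv f) + integral {1..x} (deriv f) = integral {0..x} (deriv f)"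
      by (rule Henstock_Kurzweil_Integration.integral_combine[OF _ _ f'i[OF x]]) (use False in auto)
    ultimately show ?thesis by (simp add: c_def)
  qed
  define F0 where "F0 x = (if x \<le> 0 then c else f x)" for x
  have F0_eq: "F0 x = c + integral {0..x} (deriv f)" if "0 \<le> x" for x
    using f_eq[of x] that by (cases "x = 0") (auto simp: F0_def)
  have F0_cont: "continuous_on {0..} F0"
    unfolding continuous_on_eq_continuous_within
  proof
    fix x :: real assume x: "x \<in> {0..}"
    have "continuous_on {0..x+1} (\<lambda>u. c + integral {0..u} (deriv f))"
      by (intro continuous_intros indefinite_integral_continuous_1 f'i) (use x in auto)
    then have "continuous_on {0..x+1} F0" by (rule continuous_on_eq) (simp add: F0_eq)
    then have "continuous (at x within {0..x+1}) F0" using x by (simp add: continuous_on_eq_continuous_within)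
    moreover have "at x within {0..x+1} = at x within {0..}"
      by (rule at_within_nhd[of _ "{..<x+1}"]) auto
    ultimately show "continuous (at x within {0..}) F0" by (simp add: continuous_within)
  qed
  have F0_T: "F0 x = c + s * T F0 x" if x: "0 \<le> x" for x
  proof -
    have "deriv f t = s * M F0 t" if t: "0 < t" for t
    proof -
      have "integral {0..t} (\<lambda>u. w u * F0 u) = integral {0..t} (\<lambda>u. w u * f u)"
        by (rule integral_cong) (auto simp: F0_def)
      then show ?thesis using V_eq[OF t] P_pos[OF t] by (simp add: V_def M_def field_simps)
    qed
    then have "integral {0..x} (deriv f) = integral {0..x} (\<lambda>t. s * M F0 t)"
      by (intro integral_spike[of "{0}"]) auto
    then show ?thesis using F0_eq[OF x] by (simp add: T_def)
  qed
  have zero: "F0 x - c * y s x = 0" if x: "0 \<le> x" for x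
  proof -
    let ?g = "\<lambda>x. 1 * F0 x + (- c) * y s x"
    have "?g x = 0"
    proof (rule T_fixed_point_zero[OF _ _ x])
      show "continuous_on {0..} ?g" by (intro continuous_intros F0_cont y_continuous)
      show "?g x = s * T ?g x" if "0 \<le> x" for x
        unfolding T_linear[OF F0_cont y_continuous] using F0_T[OF that] y_eq[OF that, of s]
        by (simp add: algebra_simps)
    qed
    then show ?thesis by simp
  qed
  have "f x = c * y s x" if "0 < x" for x
    using zero[of x] that by (simp add: F0_def)
  then show ?thesis by (rule that)
qed

text \<open>Beyond 1 the flux Wronskian with the ground state is at least \<delta> > 0. If
  \<open>y s\<close> were square integrable, so would be \<open>x * dy s x\<close>, and x / R times
  the flux Wronskian would have bounded integrals; but that integrand is at least \<delta> /
  r2.\<close>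

lemma y_not_L2_above_ground:
  assumes g: "ground \<mu> B" and s: "-\<mu> < s"
  shows "y s \<notin> L2"
proof
  assume y: "y s \<in> L2"
  let ?f = "y (-\<mu>)" and ?f' = "dy (-\<mu>)"
  have fL: "?f \<in> L2" by (rule ground_L2[OF g])
  have drift: "(\<lambda>x. x * dy t x) \<in> L2" if "y t \<in> L2" for t
  proof (rule drift_term_L2[OF _ _ P_dy_tendsto_0])
    show "continuous_on {0<..} (dy t)" by (rule continuous_on_subset[OF dy_continuous]) auto
    show "ac_deriv (\<lambda>x. P x * dy t x) (\<lambda>x. w x * (t * y t x))"
      using ac_deriv_P_dy[of t] by (simp add: mult.left_commute)
    show "(\<lambda>x. t * y t x) \<in> L2" using L2_lincomb[OF that that, of t 0] by simp
  qed
  define I where "I x = integral {0..x} (\<lambda>r. w r * (y s r * ?f r))" for x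
  have prodc: "continuous_on {0..} (\<lambda>r. y s r * ?f r)" by (intro continuous_intros y_continuous)
  have prodnn: "0 \<le> y s r * ?f r" if "0 \<le> r" for r
    using y_pos_above_ground[OF g s that] groundD(2)[OF g that] by simp
  have wi: "(\<lambda>r. w r * (y s r * ?f r)) integrable_on {0..x}" for x by (rule wg_integrable_cont[OF prodc]) simp
  have I1: "0 < I 1" unfolding I_def by (rule wg_integral_pos[OF prodc]) (use prodnn in auto)
  define \<delta> where "\<delta> = (s + \<mu>) * I 1"
  have \<delta>: "0 < \<delta>" using I1 s by (simp add: \<delta>_def)
  have Wlow: "\<delta> \<le> P x * (dy s x * ?f x - y s x * ?f' x)" if x: "1 \<le> x" for x
  proof -
    have "I 1 \<le> I x" unfolding I_def
    proof (rule integral_subset_le[OF _ wi wi])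
      have "0 \<le> w r * (y s r * ?f r)" if "r \<in> {0..x}" for r
        using prodnn[of r] w_pos[of r] that by (cases "r = 0") auto
      then show "\<forall>r\<in>{0..x}. 0 \<le> w r * (y s r * ?f r)" by blast
    qed (use x in auto)
    then have "\<delta> \<le> (s - (-\<mu>)) * I x" unfolding \<delta>_def using s by (simp add: mult_left_mono)
    then show ?thesis using wronskian[of x s "-\<mu>"] x by (simp add: I_def)
  qed
  define q where "q x = ((x * dy s x)\<^sup>2 + (?f x)\<^sup>2) + ((y s x)\<^sup>2 + (x * ?f' x)\<^sup>2)" for x
  define C where "C = N2 (\<lambda>x. x * dy s x) + N2 ?f + N2 (y s) + N2 (\<lambda>x. x * ?f' x)"
  have bound: "integral {1..X} (\<lambda>x. w x * q x) \<le> C" if "1 \<le> X" for X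
  proof -
    have "(\<lambda>x. w x * q x) = (\<lambda>x. (w x * (x * dy s x)\<^sup>2 + w x * (?f x)\<^sup>2) + (w x * (y s x)\<^sup>2 + w x * (x * ?f' x)\<^sup>2))"
      by (simp add: q_def distrib_left)
    then have "integral {1..X} (\<lambda>x. w x * q x)
      = (integral {1..X} (\<lambda>x. w x * (x * dy s x)\<^sup>2) + integral {1..X} (\<lambda>x. w x * (?f x)\<^sup>2))
        + (integral {1..X} (\<lambda>x. w x * (y s x)\<^sup>2) + integral {1..X} (\<lambda>x. w x * (x * ?f' x)\<^sup>2))"
      by (simp add: integral_add integrable_add L2_integrable(1) drift y fL)
    also have "\<dots> \<le> C"
      unfolding C_def using L2_integrable(2)[OF drift[OF y], of 1 X] L2_integrable(2)[OF fL, of 1 X]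
        L2_integrable(2)[OF y, of 1 X] L2_integrable(2)[OF drift[OF fL], of 1 X] by linarith
    finally show ?thesis .
  qed
  have qi: "(\<lambda>x. w x * q x) integrable_on {1..X}" for X
  proof (rule wg_integrable_away(2))
    have "continuous_on {0<..} (dy t)" "continuous_on {0<..} (y t)" for t
      by (rule continuous_on_subset[OF dy_continuous] continuous_on_subset[OF y_continuous]; auto)+
    then show "continuous_on {0<..} q" unfolding q_def[abs_def] by (intro continuous_intros)
  qed simp
  have low: "\<delta> / r2 \<le> w x * q x" if x: "1 \<le> x" for x
  proof -
    have x0: "0 < x" using x by simp
    have "\<delta> / r2 \<le> \<delta> * (x / R x)"
    proof -
      have "1 / r2 \<le> x / R x" using R_upper[OF x0] R_pos[OF x0] x by (intro frac_le) auto
      then show ?thesis using \<delta> mult_left_mono[of "1 / r2" "x / R x" \<delta>] by simp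
    qed
    also have "\<dots> \<le> P x * (dy s x * ?f x - y s x * ?f' x) * (x / R x)"
      using Wlow[OF x] x0 R_pos[OF x0] by (intro mult_right_mono) auto
    also have "\<dots> = w x * ((x * dy s x) * ?f x - y s x * (x * ?f' x))" by (simp add: weight_eq algebra_simps)
    also have "\<dots> \<le> w x * q x"
    proof (rule mult_left_mono)
      have "0 \<le> (x * dy s x - ?f x)\<^sup>2" "0 \<le> (y s x + x * ?f' x)\<^sup>2" "0 \<le> q x" by (auto simp: q_def)
      then show "(x * dy s x) * ?f x - y s x * (x * ?f' x) \<le> q x"
        unfolding q_def power2_diff power2_sum by linarith
    qed (use w_pos[OF x0] in simp)
    finally show ?thesis .
  qed
  define X where "X = 1 + (\<bar>C\<bar> + 1) * r2 / \<delta>"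
  have X: "1 \<le> X" using \<delta> r2_pos by (simp add: X_def)
  have "\<delta> / r2 * (X - 1) = integral {1..X} (\<lambda>x. \<delta> / r2)" using X by simp
  also have "\<dots> \<le> integral {1..X} (\<lambda>x. w x * q x)" by (rule integral_le) (use qi low in auto)
  also have "\<dots> \<le> C" by (rule bound[OF X])
  finally show False using \<delta> r2_pos by (simp add: X_def)
qed

end

section \<open>The resolvent above the ground state\<close>

text \<open>Reduction of order: with \<open>Q' = q\<close>, the functions \<open>y (c - Q)\<close> are exactly the solutions of
  \<open>s f - L f = h\<close> with zero flux at \<open>0\<close>; the resolvent is the limit of those vanishing at \<open>b\<close>
  as \<open>b\<close> tends to infinity.\<close>

locale resolvent_problem = radial +
  fixes \<mu> B s :: real and h :: "real \<Rightarrow> real"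
  assumes ground: "ground \<mu> B" and above: "-\<mu> < s" and h: "h \<in> L2"
begin

abbreviation \<phi> :: "real \<Rightarrow> real" where "\<phi> \<equiv> y (-\<mu>)"

definition \<sigma> :: real where "\<sigma> = s + \<mu>"

definition H :: "real \<Rightarrow> real" where "H x = integral {0..x} (\<lambda>t. w t * (y s t * h t))"

definition q :: "real \<Rightarrow> real" where "q x = H x / (P x * (y s x)\<^sup>2)"

lemma \<sigma>_pos: "0 < \<sigma>"
  using above by (simp add: \<sigma>_def)

lemma ys_pos: "0 \<le> x \<Longrightarrow> 0 < y s x"
  by (rule y_pos_above_ground[OF ground above])

lemma phi_pos: "0 \<le> x \<Longrightarrow> 0 < \<phi> x"
  by (rule groundD(2)[OF ground])

lemma wyh_integrable: "0 \<le> a \<Longrightarrow> (\<lambda>t. w t * (y s t * h t)) absolutely_integrable_on {a..b}"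
  by (rule L2_local_integrable[OF h y_continuous])

lemma wyh_integrable_on: "0 \<le> a \<Longrightarrow> (\<lambda>t. w t * (y s t * h t)) integrable_on {a..b}"
  using wyh_integrable[of a b] by (simp add: absolutely_integrable_on_def)

lemma ac_deriv_H: "ac_deriv H (\<lambda>x. w x * (y s x * h x))"
proof (rule ac_deriv_indefinite_integral)
  show "(\<lambda>x. w x * (y s x * h x)) absolutely_integrable_on {a..b}" if "0 < a" for a b
    using wyh_integrable[of a b] that by simp
  show "H b - H a = integral {a..b} (\<lambda>x. w x * (y s x * h x))" if "0 < a" "a \<le> b" for a b
    unfolding H_def by (rule integral_wg_diff[OF wyh_integrable_on]) (use that in auto)
qed

lemma H_tendsto_0: "(H \<longlongrightarrow> 0) (at_right 0)"
  unfolding H_def[abs_def] by (rule indefinite_integral_tendsto_0[OF wyh_integrable_on[of 0 1]]) auto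

lemma q_continuous: "continuous_on {0<..} q"
proof -
  have "continuous_on {0<..} (y s)" by (rule continuous_on_subset[OF y_continuous]) auto
  moreover have "P x * (y s x)\<^sup>2 \<noteq> 0" if "x \<in> {0<..}" for x using P_pos[of x] ys_pos[of x] that by simp
  ultimately show ?thesis
    unfolding q_def[abs_def]
    by (intro continuous_intros ac_deriv_continuous_on[OF ac_deriv_H] P_continuous) blast+
qed

text \<open>Any antiderivative serves, since the constant of integration is absorbed by the
  parameter \<open>c\<close> of \<open>sol\<close>.\<close>

definition Q :: "real \<Rightarrow> real" where
  "Q = (SOME Q. \<forall>x>0. (Q has_real_derivative q x) (at x))"

lemma Q_deriv: "0 < x \<Longrightarrow> (Q has_real_derivative q x) (at x)"
proof -
  have "\<exists>Q. \<forall>x>0. (Q has_real_derivative q x) (at x)"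
    using antiderivative_positive[OF q_continuous] by blast
  from someI_ex[OF this] show "0 < x \<Longrightarrow> ?thesis" by (simp add: Q_def)
qed

lemma ac_deriv_Q: "ac_deriv Q q"
  by (rule ac_deriv_C1[OF Q_deriv q_continuous])

lemma Q_continuous: "continuous_on {0<..} Q"
  by (rule ac_deriv_continuous_on[OF ac_deriv_Q])

definition sol :: "real \<Rightarrow> real \<Rightarrow> real" where "sol c x = y s x * (c - Q x)"

text \<open>Equals \<open>P x * dsol c x\<close> with the \<open>P\<close> inside \<open>q\<close>
  cancelled; in this form absolute continuity and the limit at 0 can be read off.\<close>

definition flux :: "real \<Rightarrow> real \<Rightarrow> real" where "flux c x = (P x * dy s x) * (c - Q x) - H x / y s x"

definition dsol :: "real \<Rightarrow> real \<Rightarrow> real" where "dsol c x = dy s x * (c - Q x) - y s x * q x"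

lemma P_dsol: "0 < x \<Longrightarrow> P x * dsol c x = flux c x"
  using P_pos[of x] ys_pos[of x] by (simp add: dsol_def flux_def q_def power2_eq_square field_simps)

lemma sol_deriv: "0 < x \<Longrightarrow> (sol c has_real_derivative dsol c x) (at x)"
  unfolding sol_def[abs_def] dsol_def by (auto intro!: derivative_eq_intros y_deriv Q_deriv)

lemma ac_deriv_inverse_y: "ac_deriv (\<lambda>x. 1 / y s x) (\<lambda>x. - dy s x / (y s x)\<^sup>2)"
proof (rule ac_deriv_C1)
  show "((\<lambda>x. 1 / y s x) has_real_derivative - dy s x / (y s x)\<^sup>2) (at x)" if "0 < x" for x
    using ys_pos[of x] that by (auto intro!: derivative_eq_intros y_deriv simp: power2_eq_square)
  have "continuous_on {0<..} (dy s)" "continuous_on {0<..} (y s)"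
    by (rule continuous_on_subset[OF dy_continuous] continuous_on_subset[OF y_continuous]; auto)+
  moreover have "(y s x)\<^sup>2 \<noteq> 0" if "x \<in> {0<..}" for x using ys_pos[of x] that by simp
  ultimately show "continuous_on {0<..} (\<lambda>x. - dy s x / (y s x)\<^sup>2)"
    by (intro continuous_intros) blast+
qed

lemma ac_deriv_flux: "ac_deriv (flux c) (\<lambda>x. w x * (s * sol c x - h x))"
proof (rule ac_deriv_cong)
  show "ac_deriv (\<lambda>x. (P x * dy s x) * (c - Q x) - H x * (1 / y s x))
    (\<lambda>x. ((s * (w x * y s x)) * (c - Q x) + (P x * dy s x) * (0 - q x))
       - ((w x * (y s x * h x)) * (1 / y s x) + H x * (- dy s x / (y s x)\<^sup>2)))"
    by (intro ac_deriv_diff ac_deriv_mult ac_deriv_P_dy ac_deriv_const ac_deriv_Q ac_deriv_H ac_deriv_inverse_y)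
  have "w x * (s * sol c x - h x) = ((s * (w x * y s x)) * (c - Q x) + (P x * dy s x) * (0 - q x))
       - ((w x * (y s x * h x)) * (1 / y s x) + H x * (- dy s x / (y s x)\<^sup>2))" if x: "0 < x" for x
    using P_pos[OF x] ys_pos[of x] x by (simp add: sol_def q_def power2_eq_square field_simps)
  then show "AE x in lebesgue. 0 < x \<longrightarrow> w x * (s * sol c x - h x)
    = ((s * (w x * y s x)) * (c - Q x) + (P x * dy s x) * (0 - q x))
       - ((w x * (y s x * h x)) * (1 / y s x) + H x * (- dy s x / (y s x)\<^sup>2))" by simp
qed (simp add: flux_def)

text \<open>Near 0 the function \<open>q\<close> is of order x^(1 - n), so both combinations of
  \<open>Q\<close> with a multiple of x^(2 - n) are monotone, and that power is bounded on
  \<open>{0..1}\<close> because n < 2.\<close>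

lemma Q_bounded_near_0: "\<exists>C\<ge>0. \<forall>x. 0 < x \<and> x \<le> 1 \<longrightarrow> \<bar>Q x\<bar> \<le> C"
proof -
  have "continuous_on {0..1} H"
    unfolding H_def[abs_def] by (rule indefinite_integral_continuous_1[OF wyh_integrable_on]) simp
  then obtain C1 where C1: "0 \<le> C1" "\<And>x. x \<in> {0..1} \<Longrightarrow> \<bar>H x\<bar> \<le> C1" using continuous_on_interval_bounded by blast
  have "continuous_on {0..1} (\<lambda>x. 1 / (y s x)\<^sup>2)"
    by (intro continuous_intros continuous_on_subset[OF y_continuous]) (use ys_pos in fastforce)+
  then obtain C2 where C2: "0 \<le> C2" "\<And>x. x \<in> {0..1} \<Longrightarrow> \<bar>1 / (y s x)\<^sup>2\<bar> \<le> C2" using continuous_on_interval_bounded by blast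
  define K where "K = C1 * C2 / (2 - n)"
  have K: "0 \<le> K" using C1 C2 n_less by (simp add: K_def)
  have qb: "\<bar>q x\<bar> \<le> K * ((2 - n) * x powr (1 - n))" if x: "0 < x" "x \<le> 1" for x
  proof -
    have "q x = H x * (1 / (y s x)\<^sup>2) * (x powr (1 - n) * exp (- E x))"
      using x ys_pos[of x] by (simp add: q_def P_def exp_minus field_simps flip: powr_add)
    also have "\<bar>\<dots>\<bar> \<le> (C1 * C2) * (x powr (1 - n) * 1)"
      unfolding abs_mult using C1 C2 x E_nonneg[of x] by (intro mult_mono) auto
    finally show ?thesis using n_less by (simp add: K_def)
  qed
  have pd: "((\<lambda>x. K * x powr (2 - n)) has_real_derivative K * ((2 - n) * x powr (1 - n))) (at x)" if "0 < x" for x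
    using that by (auto intro!: derivative_eq_intros)
  have "\<bar>Q x\<bar> \<le> \<bar>Q 1\<bar> + K" if x: "0 < x" "x \<le> 1" for x
  proof -
    have "Q x + K * x powr (2 - n) \<le> Q 1 + K * 1 powr (2 - n)"
    proof (rule DERIV_nonneg_imp_nondecreasing[OF x(2)])
      fix t assume t: "x \<le> t" "t \<le> 1"
      show "\<exists>d. ((\<lambda>x. Q x + K * x powr (2 - n)) has_real_derivative d) (at t) \<and> 0 \<le> d"
        using qb[of t] t x by (intro exI[of _ "q t + K * ((2 - n) * t powr (1 - n))"] conjI DERIV_add Q_deriv pd) auto
    qed
    moreover have "K * 1 powr (2 - n) - Q 1 \<ge> K * x powr (2 - n) - Q x"
    proof (rule DERIV_nonneg_imp_nondecreasing[OF x(2)])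
      fix t assume t: "x \<le> t" "t \<le> 1"
      show "\<exists>d. ((\<lambda>x. K * x powr (2 - n) - Q x) has_real_derivative d) (at t) \<and> 0 \<le> d"
        using qb[of t] t x by (intro exI[of _ "K * ((2 - n) * t powr (1 - n)) - q t"] conjI DERIV_diff Q_deriv pd) auto
    qed
    moreover have "0 \<le> K * x powr (2 - n)" using K by simp
    ultimately show ?thesis by simp
  qed
  then show ?thesis using K by (intro exI[of _ "\<bar>Q 1\<bar> + K"]) auto
qed

lemma bounded_times_tendsto_0:
  fixes g :: "real \<Rightarrow> real"
  assumes "(g \<longlongrightarrow> 0) (at_right 0)"
  shows "((\<lambda>x. (c - Q x) * g x) \<longlongrightarrow> 0) (at_right 0)"
proof -
  obtain C where C: "0 \<le> C" "\<And>x. 0 < x \<Longrightarrow> x \<le> 1 \<Longrightarrow> \<bar>Q x\<bar> \<le> C" using Q_bounded_near_0 by blast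
  show ?thesis
  proof (rule Lim_null_comparison)
    show "eventually (\<lambda>x. norm ((c - Q x) * g x) \<le> (\<bar>c\<bar> + C) * \<bar>g x\<bar>) (at_right 0)"
      using eventually_at_right_real[OF zero_less_one]
    proof eventually_elim
      case (elim x)
      have "\<bar>c - Q x\<bar> \<le> \<bar>c\<bar> + C" using C(2)[of x] elim by simp
      then show ?case by (simp add: abs_mult mult_right_mono)
    qed
    have "((\<lambda>x. (\<bar>c\<bar> + C) * \<bar>g x\<bar>) \<longlongrightarrow> (\<bar>c\<bar> + C) * \<bar>0\<bar>) (at_right 0)" by (intro tendsto_intros assms)
    then show "((\<lambda>x. (\<bar>c\<bar> + C) * \<bar>g x\<bar>) \<longlongrightarrow> 0) (at_right 0)" by simp
  qed
qed

lemma flux_tendsto_0: "(flux c \<longlongrightarrow> 0) (at_right 0)"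
proof -
  have "((\<lambda>x. (c - Q x) * (P x * dy s x) - H x / y s x) \<longlongrightarrow> 0 - 0 / 1) (at_right 0)"
    by (intro tendsto_intros bounded_times_tendsto_0 P_dy_tendsto_0 H_tendsto_0 y_tendsto_0) simp
  then show ?thesis by (simp add: flux_def[abs_def] mult.commute)
qed

lemma sol_continuous: "continuous_on {0<..} (sol c)"
  unfolding sol_def[abs_def]
  by (intro continuous_intros Q_continuous continuous_on_subset[OF y_continuous]) auto

lemma wsol_integrable: "0 < a \<Longrightarrow> (\<lambda>x. w x * (sol c x)\<^sup>2) integrable_on {a..b}"
  by (rule wg_integrable_away(2)) (intro continuous_intros sol_continuous)

text \<open>Picone's identity with the ground state bounds the solution that vanishes at \<^term>\<open>b\<close>.\<close>

lemma dirichlet_bound: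
  assumes a: "0 < a" "a < b"
  shows "\<sigma>\<^sup>2 * integral {a..b} (\<lambda>x. w x * (sol (Q b) x)\<^sup>2) \<le> N2 h"
proof -
  define f where "f = sol (Q b)"
  define v where "v = flux (Q b)"
  \<comment> \<open>\<open>Z\<close> is the flux Wronskian with the ground state, and \<rho>' = Z /
    (P \<phi>^2). So the derivative of \<rho> Z is a nonnegative square plus w f (\<sigma> f - h),
    while \<rho> Z vanishes at \<open>b\<close> and in the limit at 0.\<close>
  define Z where "Z x = v x * \<phi> x - f x * (P x * dy (-\<mu>) x)" for x
  define \<rho> where "\<rho> x = f x / \<phi> x" for x
  have fb: "f b = 0" by (simp add: f_def sol_def)
  have acZ: "ac_deriv Z (\<lambda>x. w x * \<phi> x * (\<sigma> * f x - h x))"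
  proof (rule ac_deriv_cong)
    have acf: "ac_deriv f (dsol (Q b))"
      unfolding f_def
    proof (rule ac_deriv_C1[OF sol_deriv])
      have "continuous_on {0<..} (dy s)" "continuous_on {0<..} (y s)"
        by (rule continuous_on_subset[OF dy_continuous] continuous_on_subset[OF y_continuous]; auto)+
      then show "continuous_on {0<..} (dsol (Q b))"
        unfolding dsol_def[abs_def] by (intro continuous_intros Q_continuous q_continuous)
    qed
    show "ac_deriv (\<lambda>x. v x * \<phi> x - f x * (P x * dy (-\<mu>) x))
      (\<lambda>x. ((w x * (s * f x - h x)) * \<phi> x + v x * dy (-\<mu>) x)
         - (dsol (Q b) x * (P x * dy (-\<mu>) x) + f x * ((-\<mu>) * (w x * \<phi> x))))"
      unfolding v_def f_def using acf
      by (intro ac_deriv_diff ac_deriv_mult ac_deriv_flux ac_deriv_y ac_deriv_P_dy) (simp add: f_def)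
    have "w x * \<phi> x * (\<sigma> * f x - h x) = ((w x * (s * f x - h x)) * \<phi> x + v x * dy (-\<mu>) x)
         - (dsol (Q b) x * (P x * dy (-\<mu>) x) + f x * ((-\<mu>) * (w x * \<phi> x)))" if x: "0 < x" for x
      unfolding v_def P_dsol[OF x, symmetric] by (simp add: \<sigma>_def algebra_simps)
    then show "AE x in lebesgue. 0 < x \<longrightarrow> w x * \<phi> x * (\<sigma> * f x - h x)
      = ((w x * (s * f x - h x)) * \<phi> x + v x * dy (-\<mu>) x)
         - (dsol (Q b) x * (P x * dy (-\<mu>) x) + f x * ((-\<mu>) * (w x * \<phi> x)))" by simp
  qed (simp add: Z_def)
  have \<rho>d: "(\<rho> has_real_derivative Z x / (P x * (\<phi> x)\<^sup>2)) (at x)" if x: "0 < x" for x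
  proof -
    have "(\<rho> has_real_derivative (dsol (Q b) x * \<phi> x - f x * dy (-\<mu>) x) / (\<phi> x * \<phi> x)) (at x)"
      unfolding \<rho>_def[abs_def] f_def
      by (rule DERIV_divide[OF sol_deriv[OF x] y_deriv[OF x]]) (use phi_pos[of x] x in auto)
    moreover have "(dsol (Q b) x * \<phi> x - f x * dy (-\<mu>) x) / (\<phi> x * \<phi> x) = Z x / (P x * (\<phi> x)\<^sup>2)"
      using P_pos[OF x] phi_pos[of x] x
      by (simp add: Z_def v_def P_dsol[OF x, symmetric] power2_eq_square field_simps)
    ultimately show ?thesis by simp
  qed
  have phic: "continuous_on {0<..} \<phi>" by (rule continuous_on_subset[OF y_continuous]) auto
  have ac\<rho>: "ac_deriv \<rho> (\<lambda>x. Z x / (P x * (\<phi> x)\<^sup>2))"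
  proof (rule ac_deriv_C1[OF \<rho>d])
    have "P x * (\<phi> x)\<^sup>2 \<noteq> 0" if "x \<in> {0<..}" for x using P_pos[of x] phi_pos[of x] that by simp
    then show "continuous_on {0<..} (\<lambda>x. Z x / (P x * (\<phi> x)\<^sup>2))"
      by (intro continuous_intros ac_deriv_continuous_on[OF acZ] P_continuous phic) blast+
  qed
  have ac\<rho>Z: "ac_deriv (\<lambda>x. \<rho> x * Z x) (\<lambda>x. Z x / (P x * (\<phi> x)\<^sup>2) * Z x + \<rho> x * (w x * \<phi> x * (\<sigma> * f x - h x)))"
    by (rule ac_deriv_mult[OF ac\<rho> acZ])
  have lim: "((\<lambda>x. \<rho> x * Z x) \<longlongrightarrow> 0) (at_right 0)"
  proof -
    \<comment> \<open>\<open>Q\<close> is only known to be bounded near 0. The product \<rho> Z is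
      therefore regrouped into factors \<open>Q b - Q x\<close> and quantities that tend to
      0.\<close>
    define A where "A x = (y s x / \<phi> x) * ((P x * dy s x) * \<phi> x - y s x * (P x * dy (-\<mu>) x))" for x
    have "(A \<longlongrightarrow> (1 / 1) * (0 * 1 - 1 * 0)) (at_right 0)"
      unfolding A_def by (intro tendsto_intros y_tendsto_0 P_dy_tendsto_0) auto
    then have A: "(A \<longlongrightarrow> 0) (at_right 0)" by simp
    have "((\<lambda>x. (Q b - Q x) * ((Q b - Q x) * A x) - (Q b - Q x) * H x) \<longlongrightarrow> 0 - 0) (at_right 0)"
      by (intro tendsto_diff bounded_times_tendsto_0 A H_tendsto_0)
    moreover have "eventually (\<lambda>x. (Q b - Q x) * ((Q b - Q x) * A x) - (Q b - Q x) * H x = \<rho> x * Z x) (at_right 0)"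
      using eventually_at_right_less[of 0]
    proof eventually_elim
      case (elim x)
      then show ?case using phi_pos[of x] ys_pos[of x]
        by (simp add: A_def \<rho>_def Z_def v_def f_def sol_def flux_def field_simps)
    qed
    ultimately show ?thesis using Lim_transform_eventually by fastforce
  qed
  define C where "C = \<sigma> / 2 * integral {a..b} (\<lambda>x. w x * (f x)\<^sup>2)"
  have wf: "(\<lambda>x. w x * (f x)\<^sup>2) integrable_on {c..b}" if "0 < c" for c
    unfolding f_def by (rule wsol_integrable[OF that])
  have wh: "(\<lambda>x. w x * (h x)\<^sup>2) integrable_on {c..b}" if "0 < c" for c
    by (rule L2_integrable[OF h]) (use that in simp)
  have main: "C - N2 h / (2 * \<sigma>) \<le> - (\<rho> c * Z c)" if c: "0 < c" "c < a" for c
  proof -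
    have "\<sigma> / 2 * integral {c..b} (\<lambda>x. w x * (f x)\<^sup>2) - 1 / (2 * \<sigma>) * integral {c..b} (\<lambda>x. w x * (h x)\<^sup>2)
      \<le> \<rho> b * Z b - \<rho> c * Z c"
    proof (rule has_integral_le_AE)
      show "((\<lambda>x. \<sigma> / 2 * (w x * (f x)\<^sup>2) - 1 / (2 * \<sigma>) * (w x * (h x)\<^sup>2)) has_integral
        \<sigma> / 2 * integral {c..b} (\<lambda>x. w x * (f x)\<^sup>2) - 1 / (2 * \<sigma>) * integral {c..b} (\<lambda>x. w x * (h x)\<^sup>2)) {c..b}"
        by (intro has_integral_diff has_integral_mult_right integrable_integral wf wh c)
      show "((\<lambda>x. Z x / (P x * (\<phi> x)\<^sup>2) * Z x + \<rho> x * (w x * \<phi> x * (\<sigma> * f x - h x))) has_integral \<rho> b * Z b - \<rho> c * Z c) {c..b}"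
        by (rule ac_deriv_has_integral[OF ac\<rho>Z]) (use c a in auto)
      have "\<sigma> / 2 * (w x * (f x)\<^sup>2) - 1 / (2 * \<sigma>) * (w x * (h x)\<^sup>2)
        \<le> Z x / (P x * (\<phi> x)\<^sup>2) * Z x + \<rho> x * (w x * \<phi> x * (\<sigma> * f x - h x))" if x: "0 < x" for x
      proof -
        have "0 \<le> Z x / (P x * (\<phi> x)\<^sup>2) * Z x" using P_pos[OF x] by simp
        moreover have "\<rho> x * (w x * \<phi> x * (\<sigma> * f x - h x)) = w x * (\<sigma> * (f x)\<^sup>2 - f x * h x)"
          using phi_pos[of x] x by (simp add: \<rho>_def power2_eq_square algebra_simps)
        moreover have "w x * (\<sigma> / 2 * (f x)\<^sup>2 - 1 / (2 * \<sigma>) * (h x)\<^sup>2) \<le> w x * (\<sigma> * (f x)\<^sup>2 - f x * h x)"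
        proof (rule mult_left_mono)
          \<comment> \<open>Half of \<sigma> f^2 absorbs the mixed term f h, at the price of h^2 /
            (2 \<sigma>).\<close>
          have "0 \<le> (\<sigma> * f x - h x)\<^sup>2 / (2 * \<sigma>)" using \<sigma>_pos by simp
          also have "\<dots> = \<sigma> / 2 * (f x)\<^sup>2 - f x * h x + 1 / (2 * \<sigma>) * (h x)\<^sup>2"
            using \<sigma>_pos by (simp add: power2_eq_square field_simps)
          finally show "\<sigma> / 2 * (f x)\<^sup>2 - 1 / (2 * \<sigma>) * (h x)\<^sup>2 \<le> \<sigma> * (f x)\<^sup>2 - f x * h x" by simp
        qed (use w_pos[OF x] in simp)
        moreover have "w x * (\<sigma> / 2 * (f x)\<^sup>2 - 1 / (2 * \<sigma>) * (h x)\<^sup>2)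
          = \<sigma> / 2 * (w x * (f x)\<^sup>2) - 1 / (2 * \<sigma>) * (w x * (h x)\<^sup>2)" by (simp add: right_diff_distrib mult_ac)
        ultimately show ?thesis by linarith
      qed
      then show "AE x in lebesgue. x \<in> {c..b} \<longrightarrow> \<sigma> / 2 * (w x * (f x)\<^sup>2) - 1 / (2 * \<sigma>) * (w x * (h x)\<^sup>2)
        \<le> Z x / (P x * (\<phi> x)\<^sup>2) * Z x + \<rho> x * (w x * \<phi> x * (\<sigma> * f x - h x))" using c by simp
    qed
    moreover have "\<rho> b = 0" by (simp add: \<rho>_def fb)
    moreover have "C \<le> \<sigma> / 2 * integral {c..b} (\<lambda>x. w x * (f x)\<^sup>2)"
      unfolding C_def
    proof (rule mult_left_mono[OF integral_subset_le[OF _ wf[OF a(1)] wf[OF c(1)]]])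
      show "\<forall>x\<in>{c..b}. 0 \<le> w x * (f x)\<^sup>2" using w_sq_nonneg c by auto
    qed (use c \<sigma>_pos in auto)
    moreover have "1 / (2 * \<sigma>) * integral {c..b} (\<lambda>x. w x * (h x)\<^sup>2) \<le> 1 / (2 * \<sigma>) * N2 h"
      using L2_integrable(2)[OF h, of c b] c \<sigma>_pos by (intro mult_left_mono) auto
    ultimately show ?thesis by simp
  qed
  have "C - N2 h / (2 * \<sigma>) \<le> - 0"
  proof (rule tendsto_lowerbound[OF tendsto_minus[OF lim]])
    show "eventually (\<lambda>c. C - N2 h / (2 * \<sigma>) \<le> - (\<rho> c * Z c)) (at_right 0)"
      using eventually_at_right_real[OF a(1)] by eventually_elim (use main in auto)
  qed simp
  then have "2 * \<sigma> * C \<le> 2 * \<sigma> * (N2 h / (2 * \<sigma>))" using \<sigma>_pos by (intro mult_left_mono) auto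
  moreover have "2 * \<sigma> * C = \<sigma>\<^sup>2 * integral {a..b} (\<lambda>x. w x * (f x)\<^sup>2)" by (simp add: C_def power2_eq_square)
  ultimately show ?thesis using \<sigma>_pos by (simp add: f_def)
qed

text \<open>As \<open>Q\<close> is monotone, the solution vanishing at \<open>b\<close> is at least
  (Q b - Q 1) y on \<open>{1/2..1}\<close>, and its norm is bounded uniformly in
  \<open>b\<close>.\<close>

lemma Q_increment_bound:
  assumes mono: "\<And>x. 0 < x \<Longrightarrow> 0 \<le> q x"
  obtains K where "\<And>b. 1 \<le> b \<Longrightarrow> Q b - Q 1 \<le> K"
proof -
  have Qm: "Q u \<le> Q v" if "0 < u" "u \<le> v" for u v
    by (rule ac_deriv_mono[OF ac_deriv_Q _ that]) (use mono in simp)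
  have yc: "continuous_on {0..} (\<lambda>x. (y s x)\<^sup>2)" by (intro continuous_intros y_continuous)
  define c where "c = integral {1/2..1} (\<lambda>x. w x * (y s x)\<^sup>2)"
  have wy: "(\<lambda>x. w x * (y s x)\<^sup>2) integrable_on {a..b}" if "0 \<le> a" for a b
    by (rule wg_integrable_cont(2)[OF yc that])
  have c0: "0 \<le> c" unfolding c_def by (rule integral_nonneg[OF wy]) (use w_sq_nonneg in auto)
  have cpos: "0 < c"
  proof -
    have "continuous_on {1/2..1} (\<lambda>x. P x * (y s x)\<^sup>2)"
      by (intro continuous_intros continuous_on_subset[OF P_continuous] continuous_on_subset[OF y_continuous]) auto
    then obtain m where m: "m \<in> {1/2..1}" "\<And>x. x \<in> {1/2..1} \<Longrightarrow> P m * (y s m)\<^sup>2 \<le> P x * (y s x)\<^sup>2"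
      using continuous_attains_inf[of "{1/2..1::real}" "\<lambda>x. P x * (y s x)\<^sup>2"] by auto
    show ?thesis unfolding c_def
    proof (rule integral_pos_if_bounded_below[OF wy])
      show "0 < P m * (y s m)\<^sup>2 / r2" using m(1) P_pos[of m] ys_pos[of m] r2_pos by simp
      fix x :: real assume x: "x \<in> {1/2..1}"
      then have x0: "0 < x" by simp
      have "P m * (y s m)\<^sup>2 / r2 \<le> P x * (y s x)\<^sup>2 / R x"
        using m(2)[OF x] R_upper[OF x0] R_pos[OF x0] P_pos[OF x0] by (intro frac_le) auto
      then show "P m * (y s m)\<^sup>2 / r2 \<le> w x * (y s x)\<^sup>2" by (simp add: weight_eq)
    qed auto
  qed
  have "Q b - Q 1 \<le> sqrt (N2 h / (\<sigma>\<^sup>2 * c))" if b: "1 \<le> b" for b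
  proof -
    have "c * (Q b - Q 1)\<^sup>2 = integral {1/2..1} (\<lambda>x. w x * (y s x)\<^sup>2 * (Q b - Q 1)\<^sup>2)" by (simp add: c_def)
    also have "\<dots> \<le> integral {1/2..1} (\<lambda>x. w x * (sol (Q b) x)\<^sup>2)"
    proof (rule integral_le)
      show "(\<lambda>x. w x * (y s x)\<^sup>2 * (Q b - Q 1)\<^sup>2) integrable_on {1/2..1}" by (intro integrable_on_mult_left wy) simp
      show "(\<lambda>x. w x * (sol (Q b) x)\<^sup>2) integrable_on {1/2..1}" by (rule wsol_integrable) simp
      fix x :: real assume x: "x \<in> {1/2..1}"
      have "Q b - Q 1 \<le> Q b - Q x" "0 \<le> Q b - Q 1" using Qm[of x 1] Qm[of 1 b] x b by auto
      then have "(Q b - Q 1)\<^sup>2 \<le> (Q b - Q x)\<^sup>2" by (rule power_mono)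
      then show "w x * (y s x)\<^sup>2 * (Q b - Q 1)\<^sup>2 \<le> w x * (sol (Q b) x)\<^sup>2"
        using w_pos[of x] x by (simp add: sol_def power_mult_distrib mult_left_mono flip: mult.assoc)
    qed
    also have "\<dots> \<le> integral {1/2..b} (\<lambda>x. w x * (sol (Q b) x)\<^sup>2)"
      by (rule integral_subset_le[OF _ wsol_integrable wsol_integrable]) (use b w_sq_nonneg in auto)
    finally have "\<sigma>\<^sup>2 * (c * (Q b - Q 1)\<^sup>2) \<le> \<sigma>\<^sup>2 * integral {1/2..b} (\<lambda>x. w x * (sol (Q b) x)\<^sup>2)"
      by (intro mult_left_mono) auto
    also have "\<dots> \<le> N2 h" by (rule dirichlet_bound) (use b in auto)
    finally have "(Q b - Q 1)\<^sup>2 \<le> N2 h / (\<sigma>\<^sup>2 * c)" using \<sigma>_pos cpos by (simp add: field_simps)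
    then show ?thesis by (rule real_le_rsqrt)
  qed
  then show ?thesis by (rule that)
qed

end

context radial
begin

text \<open>For \<open>h\<close> of changing sign \<open>Q\<close> need not be monotone. The problem
  for the absolute value of \<open>h\<close> majorises it: there \<open>Q\<close> is increasing and
  bounded, so the \<open>Q\<close> of \<open>h\<close>, a difference of monotone bounded functions,
  converges too. Its limit \<open>L\<close> selects the solution, and the bound for the solutions
  vanishing at \<open>b\<close> survives the passage to the limit.\<close>

lemma resolvent_exists:
  assumes g: "ground \<mu> B" and s: "-\<mu> < s" and h: "h \<in> L2"
  shows "\<exists>f\<in>op_domain n R. (AE x in lebesgue. 0 < x \<longrightarrow> s * f x - L_op n R f x = h x) \<and> (s + \<mu>)\<^sup>2 * N2 f \<le> N2 h"
proof -
  have hm: "(\<lambda>x. \<bar>h x\<bar>) \<in> L2"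
    by (rule L2_dominated[OF h h, where C = 1]) (auto intro: borel_measurable_abs L2_measurable[OF h])
  interpret a: resolvent_problem n r1 r2 R \<mu> B s h by unfold_locales (use g s h in auto)
  interpret b: resolvent_problem n r1 r2 R \<mu> B s "\<lambda>x. \<bar>h x\<bar>" by unfold_locales (use g s hm in auto)
  have Hle: "\<bar>a.H x\<bar> \<le> b.H x" if "0 < x" for x
  proof -
    have "norm (integral {0..x} (\<lambda>t. w t * (y s t * h t))) \<le> integral {0..x} (\<lambda>t. w t * (y s t * \<bar>h t\<bar>))"
    proof (rule integral_norm_bound_integral[OF a.wyh_integrable_on b.wyh_integrable_on])
      show "norm (w t * (y s t * h t)) \<le> w t * (y s t * \<bar>h t\<bar>)" if "t \<in> {0..x}" for t
        using w_pos[of t] a.ys_pos[of t] that by (cases "t = 0") (auto simp: abs_mult)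
    qed auto
    then show ?thesis by (simp add: a.H_def b.H_def)
  qed
  have qle: "\<bar>a.q x\<bar> \<le> b.q x" if x: "0 < x" for x
    using Hle[OF x] P_pos[OF x] by (simp add: a.q_def b.q_def abs_mult divide_right_mono)
  obtain K where K: "\<And>b. 1 \<le> b \<Longrightarrow> b.Q b - b.Q 1 \<le> K"
    using b.Q_increment_bound qle abs_ge_zero order_trans by metis
  have mono1: "b.Q u \<le> b.Q v" if "0 < u" "u \<le> v" for u v
    by (rule ac_deriv_mono[OF b.ac_deriv_Q _ that]) (use qle order_trans[OF abs_ge_zero] in auto)
  have mono2: "a.Q u + b.Q u \<le> a.Q v + b.Q v" if "0 < u" "u \<le> v" for u v
    by (rule ac_deriv_mono[OF ac_deriv_add[OF a.ac_deriv_Q b.ac_deriv_Q] _ that]) (use qle in \<open>auto simp: abs_le_iff\<close>, fastforce)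
  have mono3: "b.Q u - a.Q u \<le> b.Q v - a.Q v" if "0 < u" "u \<le> v" for u v
    by (rule ac_deriv_mono[OF ac_deriv_diff[OF b.ac_deriv_Q a.ac_deriv_Q] _ that]) (use qle in \<open>auto simp: abs_le_iff\<close>)
  have "convergent (\<lambda>k. b.Q (real (Suc k)))"
  proof (rule Bseq_mono_convergent)
    show "Bseq (\<lambda>k. b.Q (real (Suc k)))"
    proof (rule BseqI')
      show "norm (b.Q (real (Suc k))) \<le> \<bar>b.Q 1\<bar> + \<bar>K\<bar>" for k
        using K[of "real (Suc k)"] mono1[of 1 "real (Suc k)"] by simp
    qed
  qed (use mono1 in auto)
  moreover have "convergent (\<lambda>k. a.Q (real (Suc k)) + b.Q (real (Suc k)))"
  proof (rule Bseq_mono_convergent)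
    show "Bseq (\<lambda>k. a.Q (real (Suc k)) + b.Q (real (Suc k)))"
    proof (rule BseqI')
      show "norm (a.Q (real (Suc k)) + b.Q (real (Suc k))) \<le> \<bar>a.Q 1 + b.Q 1\<bar> + 2 * \<bar>K\<bar>" for k
        using K[of "real (Suc k)"] mono2[of 1 "real (Suc k)"] mono3[of 1 "real (Suc k)"] by simp
    qed
  qed (use mono2 in auto)
  ultimately have "convergent (\<lambda>k. a.Q (real (Suc k)))"
    using convergent_diff[of "\<lambda>k. a.Q (real (Suc k)) + b.Q (real (Suc k))" "\<lambda>k. b.Q (real (Suc k))"] by simp
  then obtain L where L: "(\<lambda>k. a.Q (real (Suc k))) \<longlonglongrightarrow> L" by (auto simp: convergent_def)
  define f where "f = a.sol L"
  have fc: "continuous_on {0<..} f" unfolding f_def by (rule a.sol_continuous)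
  have yc: "continuous_on {0<..} (y s)" by (rule continuous_on_subset[OF y_continuous]) auto
  have bound: "integral {c..d} (\<lambda>x. w x * (f x)\<^sup>2) \<le> N2 h / a.\<sigma>\<^sup>2" if cd: "0 < c" "c \<le> d" for c d
  proof -
    \<comment> \<open>The solution that vanishes at \<open>Suc k\<close> is
      \<open>f + e k * y s\<close>, so its squared norm on a compact interval is a quadratic
      polynomial in \<open>e k\<close>.\<close>
    define e where "e k = a.Q (real (Suc k)) - L" for k
    have e0: "e \<longlonglongrightarrow> 0" unfolding e_def using tendsto_diff[OF L tendsto_const[of L]] by simp
    have i1: "(\<lambda>x. w x * (f x)\<^sup>2) integrable_on {c..d}"
      by (rule wg_integrable_away(2)[OF _ cd(1)]) (intro continuous_intros fc)
    have i2: "(\<lambda>x. w x * (f x * y s x)) integrable_on {c..d}"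
      by (rule wg_integrable_away(2)[OF _ cd(1)]) (intro continuous_intros fc yc)
    have i3: "(\<lambda>x. w x * (y s x)\<^sup>2) integrable_on {c..d}"
      by (rule wg_integrable_away(2)[OF _ cd(1)]) (intro continuous_intros yc)
    have ex: "integral {c..d} (\<lambda>x. w x * (a.sol (a.Q (real (Suc k))) x)\<^sup>2)
      = integral {c..d} (\<lambda>x. w x * (f x)\<^sup>2) + 2 * e k * integral {c..d} (\<lambda>x. w x * (f x * y s x))
        + (e k)\<^sup>2 * integral {c..d} (\<lambda>x. w x * (y s x)\<^sup>2)" for k
    proof (rule integral_unique)
      have "((\<lambda>x. w x * (f x)\<^sup>2 + 2 * e k * (w x * (f x * y s x)) + (e k)\<^sup>2 * (w x * (y s x)\<^sup>2)) has_integral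
        integral {c..d} (\<lambda>x. w x * (f x)\<^sup>2) + 2 * e k * integral {c..d} (\<lambda>x. w x * (f x * y s x))
        + (e k)\<^sup>2 * integral {c..d} (\<lambda>x. w x * (y s x)\<^sup>2)) {c..d}"
        by (intro has_integral_add has_integral_mult_right integrable_integral i1 i2 i3)
      moreover have "w x * (f x)\<^sup>2 + 2 * e k * (w x * (f x * y s x)) + (e k)\<^sup>2 * (w x * (y s x)\<^sup>2)
        = w x * (a.sol (a.Q (real (Suc k))) x)\<^sup>2" for x
        by (simp add: f_def a.sol_def e_def power2_eq_square algebra_simps)
      ultimately show "((\<lambda>x. w x * (a.sol (a.Q (real (Suc k))) x)\<^sup>2) has_integral
        integral {c..d} (\<lambda>x. w x * (f x)\<^sup>2) + 2 * e k * integral {c..d} (\<lambda>x. w x * (f x * y s x))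
        + (e k)\<^sup>2 * integral {c..d} (\<lambda>x. w x * (y s x)\<^sup>2)) {c..d}" by simp
    qed
    have lim: "(\<lambda>k. integral {c..d} (\<lambda>x. w x * (f x)\<^sup>2) + 2 * e k * integral {c..d} (\<lambda>x. w x * (f x * y s x))
        + (e k)\<^sup>2 * integral {c..d} (\<lambda>x. w x * (y s x)\<^sup>2)) \<longlonglongrightarrow>
        integral {c..d} (\<lambda>x. w x * (f x)\<^sup>2) + 2 * 0 * integral {c..d} (\<lambda>x. w x * (f x * y s x))
        + 0\<^sup>2 * integral {c..d} (\<lambda>x. w x * (y s x)\<^sup>2)"
      by (intro tendsto_intros e0)
    have "integral {c..d} (\<lambda>x. w x * (f x)\<^sup>2) + 2 * 0 * integral {c..d} (\<lambda>x. w x * (f x * y s x))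
        + 0\<^sup>2 * integral {c..d} (\<lambda>x. w x * (y s x)\<^sup>2) \<le> N2 h / a.\<sigma>\<^sup>2"
    proof (rule tendsto_upperbound[OF lim])
      show "eventually (\<lambda>k. integral {c..d} (\<lambda>x. w x * (f x)\<^sup>2) + 2 * e k * integral {c..d} (\<lambda>x. w x * (f x * y s x))
        + (e k)\<^sup>2 * integral {c..d} (\<lambda>x. w x * (y s x)\<^sup>2) \<le> N2 h / a.\<sigma>\<^sup>2) sequentially"
        using eventually_gt_at_top[of "nat \<lceil>d\<rceil>"]
      proof eventually_elim
        case (elim k)
        define b where "b = real (Suc k)"
        have db: "d \<le> b" "c < b" using elim cd by (auto simp: b_def) linarith+
        have "integral {c..d} (\<lambda>x. w x * (a.sol (a.Q b) x)\<^sup>2) \<le> integral {c..b} (\<lambda>x. w x * (a.sol (a.Q b) x)\<^sup>2)"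
          by (rule integral_subset_le[OF _ a.wsol_integrable[OF cd(1)] a.wsol_integrable[OF cd(1)]])
            (use db cd w_sq_nonneg in auto)
        also have "\<dots> \<le> N2 h / a.\<sigma>\<^sup>2"
          using a.dirichlet_bound[OF cd(1) db(2)] a.\<sigma>_pos by (simp add: field_simps)
        finally show ?case using ex[of k] by (simp add: b_def)
      qed
    qed simp
    then show ?thesis by simp
  qed
  have fL2: "f \<in> L2" "N2 f \<le> N2 h / a.\<sigma>\<^sup>2"
    using L2_intro[OF continuous_measurable[OF fc] _ bound] wg_integrable_away(2)[of "\<lambda>x. (f x)\<^sup>2"] fc
    by (auto intro!: continuous_intros)
  define G where "G x = s * f x + (-1) * h x" for x
  have G: "G \<in> L2" unfolding G_def[abs_def] by (rule L2_lincomb[OF fL2(1) h])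
  define f'' where "f'' x = G x / R x - (n - 1) / x * a.dsol L x - x / R x * a.dsol L x" for x
  have acd: "ac_deriv (a.dsol L) f''"
  proof (rule ac_deriv_cong)
    show "ac_deriv (\<lambda>x. a.flux L x * (x powr (1 - n) * exp (-1 * E x)))
      (\<lambda>x. (w x * (s * a.sol L x - h x)) * (x powr (1 - n) * exp (-1 * E x))
        + a.flux L x * (x powr (1 - n) * exp (-1 * E x) * ((1 - n) / x + -1 * x / R x)))"
      by (intro ac_deriv_mult a.ac_deriv_flux ac_deriv_powr_exp_E)
    have eq: "P x * (x powr (1 - n) * exp (-1 * E x)) = 1" if "0 < x" for x
      using that by (simp add: P_def exp_minus field_simps flip: powr_add)
    show "a.dsol L x = a.flux L x * (x powr (1 - n) * exp (-1 * E x))" if x: "0 < x" for x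
    proof -
      have "a.flux L x * (x powr (1 - n) * exp (-1 * E x)) = a.dsol L x * (P x * (x powr (1 - n) * exp (-1 * E x)))"
        unfolding a.P_dsol[OF x, symmetric] by (simp add: mult_ac)
      then show ?thesis unfolding eq[OF x] by simp
    qed
    have "f'' x = (w x * (s * a.sol L x - h x)) * (x powr (1 - n) * exp (-1 * E x))
        + a.flux L x * (x powr (1 - n) * exp (-1 * E x) * ((1 - n) / x + -1 * x / R x))" if x: "0 < x" for x
    proof -
      let ?q = "x powr (1 - n) * exp (-1 * E x)"
      have "(w x * (s * a.sol L x - h x)) * ?q + a.flux L x * (?q * ((1 - n) / x + -1 * x / R x))
        = (P x * ?q) * ((s * a.sol L x - h x) / R x + a.dsol L x * ((1 - n) / x + -1 * x / R x))"
        unfolding a.P_dsol[OF x, symmetric] by (simp add: weight_eq diff_divide_distrib algebra_simps)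
      also have "\<dots> = f'' x"
        unfolding eq[OF x] using x R_pos[OF x] by (simp add: f''_def G_def f_def field_simps)
      finally show ?thesis by simp
    qed
    then show "AE x in lebesgue. 0 < x \<longrightarrow> f'' x = (w x * (s * a.sol L x - h x)) * (x powr (1 - n) * exp (-1 * E x))
        + a.flux L x * (x powr (1 - n) * exp (-1 * E x) * ((1 - n) / x + -1 * x / R x))" by simp
  qed
  have lim: "((\<lambda>x. P x * a.dsol L x) \<longlongrightarrow> 0) (at_right 0)"
  proof (rule Lim_transform_eventually[OF a.flux_tendsto_0[of L]])
    show "eventually (\<lambda>x. a.flux L x = P x * a.dsol L x) (at_right 0)"
      using eventually_at_right_less[of 0] by eventually_elim (simp add: a.P_dsol)
  qed
  have e: "AE x in lebesgue. 0 < x \<longrightarrow> x * a.dsol L x + R x * ((n - 1) / x * a.dsol L x + f'' x) = G x"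
  proof -
    have "x * a.dsol L x + R x * ((n - 1) / x * a.dsol L x + f'' x) = G x" if "0 < x" for x
      using that R_pos[OF that] by (simp add: f''_def algebra_simps)
    then show ?thesis by simp
  qed
  have d: "(f has_real_derivative a.dsol L x) (at x)" if "0 < x" for x
    using a.sol_deriv[OF that, of L] unfolding f_def .
  have D: "f \<in> op_domain n R" "AE x in lebesgue. 0 < x \<longrightarrow> L_op n R f x = G x"
    by (rule op_domainI[OF fL2(1) d acd lim G e]; assumption)+
  have "AE x in lebesgue. 0 < x \<longrightarrow> s * f x - L_op n R f x = h x"
    using D(2) by eventually_elim (simp add: G_def)
  moreover have "(s + \<mu>)\<^sup>2 * N2 f \<le> N2 h"
    using fL2(2) a.\<sigma>_pos by (simp add: a.\<sigma>_def field_simps)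
  ultimately show ?thesis using D(1) by blast
qed

end

section \<open>The top of the spectrum\<close>

lemma AE_lebesgue_False_interval:
  assumes ae: "AE x in lebesgue. \<not> (a < x \<and> x < (b::real))"
  shows "b \<le> a"
proof (rule ccontr)
  assume "\<not> b \<le> a"
  then have ne: "{a<..<b} \<noteq> {}" by simp
  have "AE x in lebesgue. \<not> x \<in> {a<..<b}" using ae by eventually_elim simp
  then have "negligible {a<..<b}" by (simp only: AE_lebesgue_iff_negligible not_not Collect_mem_eq)
  then show False using open_not_negligible[OF open_greaterThanLessThan ne] by simp
qed

context radial
begin

lemma op_domain_diff:
  assumes f: "f \<in> op_domain n R" and g: "g \<in> op_domain n R"
  shows "(\<lambda>x. f x - g x) \<in> op_domain n R"
    "AE x in lebesgue. 0 < x \<longrightarrow> L_op n R (\<lambda>x. f x - g x) x = L_op n R f x - L_op n R g x"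
proof -
  note Df = op_domainD[OF f] and Dg = op_domainD[OF g]
  have d: "(\<lambda>x. f x - g x) \<in> L2" using L2_lincomb[OF Df(1) Dg(1), of 1 "-1"] by simp
  have dd: "((\<lambda>x. f x - g x) has_real_derivative deriv f x - deriv g x) (at x)" if "0 < x" for x
    by (rule DERIV_diff[OF Df(2)[OF that] Dg(2)[OF that]])
  have lim: "((\<lambda>x. P x * (deriv f x - deriv g x)) \<longlongrightarrow> 0) (at_right 0)"
    using tendsto_diff[OF op_domain_flux(2)[OF f] op_domain_flux(2)[OF g]] by (simp add: right_diff_distrib)
  have G: "(\<lambda>x. L_op n R f x - L_op n R g x) \<in> L2"
    using L2_lincomb[OF op_domain_flux(4)[OF f] op_domain_flux(4)[OF g], of 1 "-1"] by simp
  have e: "AE x in lebesgue. 0 < x \<longrightarrow> x * (deriv f x - deriv g x)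
    + R x * ((n - 1) / x * (deriv f x - deriv g x) + (deriv (deriv f) x - deriv (deriv g) x))
    = L_op n R f x - L_op n R g x"
    by (simp add: L_op_def radial_Laplacian_def algebra_simps)
  show "(\<lambda>x. f x - g x) \<in> op_domain n R"
    by (rule op_domainI(1)[OF d dd ac_deriv_diff[OF Df(4) Dg(4)] lim G e])
  show "AE x in lebesgue. 0 < x \<longrightarrow> L_op n R (\<lambda>x. f x - g x) x = L_op n R f x - L_op n R g x"
    by (rule op_domainI(2)[OF d dd ac_deriv_diff[OF Df(4) Dg(4)] lim G e])
qed

text \<open>The difference solves the eigenvalue equation, hence is a multiple of
  \<open>y s\<close>; a nonzero multiple would make \<open>y s\<close> square integrable.\<close>

lemma no_eigenfunction_above_ground:
  assumes g: "ground \<mu> B" and s: "-\<mu> < s" and f: "f \<in> op_domain n R" and h: "h \<in> op_domain n R"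
    and eq: "AE x in lebesgue. 0 < x \<longrightarrow> s * f x - L_op n R f x = s * h x - L_op n R h x"
    and x: "0 < x"
  shows "f x = h x"
proof -
  have "AE x in lebesgue. 0 < x \<longrightarrow> L_op n R (\<lambda>x. f x - h x) x = s * (f x - h x)"
    using op_domain_diff(2)[OF f h] eq by eventually_elim (auto simp: algebra_simps)
  from eigenfunction_unique[OF op_domain_diff(1)[OF f h] this]
  obtain c where c: "\<And>x. 0 < x \<Longrightarrow> f x - h x = c * y s x" by blast
  have "c = 0"
  proof (rule ccontr)
    assume c0: "c \<noteq> 0"
    have "(\<lambda>x. (1 / c) * (f x - h x) + 0 * (f x - h x)) \<in> L2"
      by (intro L2_lincomb op_domainD(1)[OF op_domain_diff(1)[OF f h]])
    moreover have "AE x in lebesgue. 0 < x \<longrightarrow> (1 / c) * (f x - h x) + 0 * (f x - h x) = y s x"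
      using c c0 by simp
    ultimately have "y s \<in> L2" by (rule L2_AE_cong(1))
    then show False using y_not_L2_above_ground[OF g s] by simp
  qed
  then show ?thesis using c[OF x] by simp
qed

text \<open>The constructed solution comes with a norm bound; by injectivity this is a bound for
  every element of the domain.\<close>

lemma above_ground_in_resolvent_set:
  assumes g: "ground \<mu> B" and s: "-\<mu> < s"
  shows "s \<in> resolvent_set mW (op_domain n R) (L_op n R)"
proof -
  have bound: "L2_norm mW f \<le> 1 / (s + \<mu>) * L2_norm mW (\<lambda>x. s * f x - L_op n R f x)"
    if f: "f \<in> op_domain n R" for f
  proof -
    define h where "h x = s * f x - L_op n R f x" for x
    have fL2: "f \<in> L2" by (rule op_domainD(1)[OF f])
    have h: "h \<in> L2"
      using L2_lincomb[OF fL2 op_domain_flux(4)[OF f], of s "-1"] by (simp add: h_def[abs_def])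
    obtain f1 where f1: "f1 \<in> op_domain n R" "AE x in lebesgue. 0 < x \<longrightarrow> s * f1 x - L_op n R f1 x = h x"
      "(s + \<mu>)\<^sup>2 * N2 f1 \<le> N2 h"
      using resolvent_exists[OF g s h] by blast
    have "f1 x = f x" if "0 < x" for x
      by (rule no_eigenfunction_above_ground[OF g s f1(1) f _ that]) (use f1(2) in \<open>simp add: h_def\<close>)
    then have "N2 f = N2 f1" using L2_AE_cong(2)[OF op_domainD(1)[OF f1(1)], of f] by simp
    then have "(s + \<mu>)\<^sup>2 * N2 f \<le> N2 h" using f1(3) by simp
    then have "sqrt ((s + \<mu>)\<^sup>2 * N2 f) \<le> sqrt (N2 h)" by simp
    then have "(s + \<mu>) * sqrt (N2 f) \<le> sqrt (N2 h)" using s by (simp add: real_sqrt_mult)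
    then have "(s + \<mu>) * L2_norm mW f \<le> L2_norm mW h" by (simp add: L2_norm_eq[OF fL2] L2_norm_eq[OF h])
    then show ?thesis using s by (simp add: h_def[abs_def] field_simps)
  qed
  show ?thesis
    unfolding resolvent_set_def mem_Collect_eq
  proof (intro conjI ballI impI)
    fix f h assume *: "f \<in> op_domain n R" "h \<in> op_domain n R"
      "AE x in mW. s * f x - L_op n R f x = s * h x - L_op n R h x"
    have "f x = h x" if "0 < x" for x
      by (rule no_eigenfunction_above_ground[OF g s *(1,2) _ that]) (use *(3) in \<open>simp add: AE_mW\<close>)
    then show "AE x in mW. f x = h x" by (simp add: AE_mW)
  next
    fix h assume "h \<in> L2_space mW"
    then have "h \<in> L2" by (simp add: L2_def)
    from resolvent_exists[OF g s this]
    show "\<exists>f\<in>op_domain n R. AE x in mW. s * f x - L_op n R f x = h x" unfolding AE_mW by blast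
  next
    show "\<exists>C. \<forall>f\<in>op_domain n R. L2_norm mW f \<le> C * L2_norm mW (\<lambda>x. s * f x - L_op n R f x)"
      using bound by blast
  qed
qed

lemma not_AE_ground_zero:
  assumes g: "ground \<mu> B" and c: "c \<noteq> 0"
  shows "\<not> (AE x in mW. c * y (-\<mu>) x = 0)"
proof
  assume "AE x in mW. c * y (-\<mu>) x = 0"
  then have "AE x in lebesgue. 0 < x \<longrightarrow> c * y (-\<mu>) x = 0" unfolding AE_mW .
  then have "AE x in lebesgue. \<not> (0 < x \<and> x < (1::real))"
  proof eventually_elim
    case (elim x)
    then show ?case using groundD(2)[OF g, of x] c by auto
  qed
  then show False using AE_lebesgue_False_interval[of 0 1] by simp
qed

lemma ground_in_spectrum:
  assumes g: "ground \<mu> B"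
  shows "-\<mu> \<in> spectrum mW (op_domain n R) (L_op n R)"
proof -
  define f where "f = y (-\<mu>)"
  note Y = y_op_domain[OF ground_L2[OF g], folded f_def]
  note Z = op_domain_diff[OF Y(1) Y(1)]
  \<comment> \<open>Injectivity fails for the pair of the ground state and the zero function. The
    latter appears as \<open>f x - f x\<close>, for which membership in the domain is at
    hand.\<close>
  have "AE x in mW. - \<mu> * f x - L_op n R f x = - \<mu> * (f x - f x) - L_op n R (\<lambda>x. f x - f x) x"
    unfolding AE_mW using Y(2) Z(2) by eventually_elim auto
  moreover have "\<not> (AE x in mW. f x = f x - f x)"
    using not_AE_ground_zero[OF g, of 1] by (simp add: f_def)
  ultimately have "\<not> (\<forall>f\<in>op_domain n R. \<forall>h\<in>op_domain n R.
    (AE x in mW. - \<mu> * f x - L_op n R f x = - \<mu> * h x - L_op n R h x) \<longrightarrow> (AE x in mW. f x = h x))"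
    using Y(1) Z(1) by (intro notI) (drule (1) bspec, drule (1) bspec, simp)
  then have "-\<mu> \<notin> resolvent_set mW (op_domain n R) (L_op n R)"
    by (simp add: resolvent_set_def)
  then show ?thesis by (simp add: spectrum_def)
qed

lemma max_spectrum_ground:
  assumes "ground \<mu> B"
  shows "max_spectrum n R = -\<mu>"
  unfolding max_spectrum_def
proof (rule Greatest_equality)
  show "-\<mu> \<in> spectrum mW (op_domain n R) (L_op n R)" by (rule ground_in_spectrum[OF assms])
  fix s assume "s \<in> spectrum mW (op_domain n R) (L_op n R)"
  then show "s \<le> -\<mu>" using above_ground_in_resolvent_set[OF assms, of s] by (force simp: spectrum_def)
qed

lemma ground_is_eigenfunction:
  assumes g: "ground \<mu> B"
  shows "is_eigenfunction n R (-\<mu>) (y (-\<mu>))"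
  using y_op_domain[OF ground_L2[OF g]] not_AE_ground_zero[OF g, of 1]
  by (simp add: is_eigenfunction_def AE_mW)

text \<open>The eigenvalue equation is solved for the Laplacian. \<open>f\<close> is prescribed on
  the half-line only, since this is all that is known of an eigenfunction.\<close>

lemma radial_Laplacian_multiple_ground:
  assumes g: "ground \<mu> B" and f: "\<And>x. 0 < x \<Longrightarrow> f x = c * y (-\<mu>) x"
  shows "AE x in lebesgue. 0 < x \<longrightarrow> radial_Laplacian n f x = - c * F \<mu> x / R x"
proof -
  have G: "(\<lambda>x. (-\<mu>) * (c * y (-\<mu>) x)) \<in> L2"
    using L2_lincomb[OF ground_L2[OF g] ground_L2[OF g], of "-\<mu> * c" 0] by (simp add: mult.assoc)
  have "(\<lambda>x. c * y (-\<mu>) x) \<in> L2"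
    using L2_lincomb[OF ground_L2[OF g] ground_L2[OF g], of c 0] by simp
  then have fL2: "f \<in> L2" by (rule L2_AE_cong(1)) (use f in simp)
  have fd: "(f has_real_derivative c * dy (-\<mu>) x) (at x)" if x: "0 < x" for x
  proof (rule has_field_derivative_transform_within_open[OF DERIV_cmult[OF y_deriv[OF x]]])
    show "open {0::real<..}" "x \<in> {0<..}" using x by auto
  qed (use f in auto)
  have eqn: "x * (c * dy (-\<mu>) x) + R x * ((n - 1) / x * (c * dy (-\<mu>) x) + c * ddy (-\<mu>) x)
    = (-\<mu>) * (c * y (-\<mu>) x)" if x: "0 < x" for x
  proof -
    have "x * (c * dy (-\<mu>) x) + R x * ((n - 1) / x * (c * dy (-\<mu>) x) + c * ddy (-\<mu>) x)
      = c * (x * dy (-\<mu>) x + R x * ((n - 1) / x * dy (-\<mu>) x + ddy (-\<mu>) x))" by (simp add: algebra_simps)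
    then show ?thesis unfolding y_equation[OF x] by simp
  qed
  have lim: "((\<lambda>x. P x * (c * dy (-\<mu>) x)) \<longlongrightarrow> 0) (at_right 0)"
    using tendsto_mult_left[OF P_dy_tendsto_0, of c "-\<mu>"] by (simp add: mult_ac)
  have eqA: "AE x in lebesgue. 0 < x \<longrightarrow> x * (c * dy (-\<mu>) x) + R x * ((n - 1) / x * (c * dy (-\<mu>) x) + c * ddy (-\<mu>) x)
    = (-\<mu>) * (c * y (-\<mu>) x)" using eqn by simp
  have "AE x in lebesgue. 0 < x \<longrightarrow> radial_Laplacian n f x = (n - 1) / x * (c * dy (-\<mu>) x) + c * ddy (-\<mu>) x"
    by (rule op_domainI(3)[OF fL2 fd ac_deriv_cmult[OF ac_deriv_dy] lim G eqA])
  then show ?thesis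
  proof eventually_elim
    case (elim x)
    show ?case
    proof
      assume x: "0 < x"
      have "R x * radial_Laplacian n f x = - c * F \<mu> x"
        using elim x eqn[OF x] by (simp add: F_def algebra_simps)
      then show "radial_Laplacian n f x = - c * F \<mu> x / R x" using R_pos[OF x] by (simp add: field_simps)
    qed
  qed
qed

end

text \<open>Near a point \<open>q\<close> different from \<open>p\<close> the sign of
  \<open>h\<close> is almost everywhere the same on both sides. A sign change at \<open>q\<close>
  would give this one sign two values, each on a nonempty open interval.\<close>

lemma sign_change_unique:
  assumes p: "0 < (p::real)" and k: "k \<noteq> 0"
    and h: "AE x in lebesgue. 0 < x \<longrightarrow> h x = k * g x"
    and g: "\<And>x. 0 < x \<Longrightarrow> x < p \<Longrightarrow> 0 < g x" "\<And>x. p < x \<Longrightarrow> g x < (0::real)"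
  shows "{q. 0 < q \<and> changes_sign_at h q} = {p}"
proof -
  have "changes_sign_at h p"
  proof (cases "0 < k")
    case True
    have "AE x in lebesgue. (p - p < x \<and> x < p \<longrightarrow> h x > 0) \<and> (p < x \<and> x < p + p \<longrightarrow> h x < 0)"
      using h by eventually_elim (use g p True in \<open>auto simp: mult_pos_neg\<close>)
    then show ?thesis unfolding changes_sign_at_def using p by blast
  next
    case False
    then have "k < 0" using k by simp
    have "AE x in lebesgue. (p - p < x \<and> x < p \<longrightarrow> h x < 0) \<and> (p < x \<and> x < p + p \<longrightarrow> h x > 0)"
      using h by eventually_elim (use g p \<open>k < 0\<close> in \<open>auto simp: mult_neg_pos mult_neg_neg\<close>)
    then show ?thesis unfolding changes_sign_at_def using p by blast
  qed
  moreover have "q = p" if q: "0 < q" and c: "changes_sign_at h q" for q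
  proof (rule ccontr)
    assume "q \<noteq> p"
    obtain e where e: "0 < e" and ch:
      "(AE x in lebesgue. (q - e < x \<and> x < q \<longrightarrow> h x < 0) \<and> (q < x \<and> x < q + e \<longrightarrow> h x > 0)) \<or>
       (AE x in lebesgue. (q - e < x \<and> x < q \<longrightarrow> h x > 0) \<and> (q < x \<and> x < q + e \<longrightarrow> h x < 0))"
      using c unfolding changes_sign_at_def by blast
    \<comment> \<open>Keeps the neighbourhood of \<open>q\<close> positive, inside the range of the
      sign change, and away from \<open>p\<close>.\<close>
    obtain d where d: "0 < d" "d \<le> e" "d \<le> q" "p \<notin> {q - d<..<q + d}"
    proof
      show "0 < min e (min q \<bar>q - p\<bar>)" using e q \<open>q \<noteq> p\<close> by simp
    qed auto
    have sg: "sgn (h x) = sgn k * sgn (q - p) * (-1)" if "q - d < x" "x < q + d" "h x = k * g x" for x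
    proof (cases "q < p")
      case True
      then have "0 < g x" using g(1)[of x] that d by auto
      then show ?thesis using True that by (simp add: sgn_mult)
    next
      case False
      then have "g x < 0" using g(2)[of x] that d \<open>q \<noteq> p\<close> by auto
      then show ?thesis using False that \<open>q \<noteq> p\<close> by (simp add: sgn_mult)
    qed
    define \<tau> where "\<tau> = sgn k * sgn (q - p) * (-1)"
    have "AE x in lebesgue. q - d < x \<and> x < q + d \<longrightarrow> sgn (h x) = \<tau>"
      using h by eventually_elim (use sg d in \<open>auto simp: \<tau>_def\<close>)
    from ch show False
    proof
      assume "AE x in lebesgue. (q - e < x \<and> x < q \<longrightarrow> h x < 0) \<and> (q < x \<and> x < q + e \<longrightarrow> h x > 0)"
      with \<open>AE x in lebesgue. q - d < x \<and> x < q + d \<longrightarrow> sgn (h x) = \<tau>\<close>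
      have ae: "AE x in lebesgue. (q - d < x \<and> x < q \<longrightarrow> \<tau> = -1) \<and> (q < x \<and> x < q + d \<longrightarrow> \<tau> = 1)"
        by eventually_elim (use d in auto)
      have "\<tau> = -1"
      proof (rule ccontr)
        assume "\<tau> \<noteq> -1"
        with ae have "AE x in lebesgue. \<not> (q - d < x \<and> x < q)" by simp
        then show False using AE_lebesgue_False_interval[of "q - d" q] d(1) by simp
      qed
      moreover have "\<tau> = 1"
      proof (rule ccontr)
        assume "\<tau> \<noteq> 1"
        with ae have "AE x in lebesgue. \<not> (q < x \<and> x < q + d)" by simp
        then show False using AE_lebesgue_False_interval[of q "q + d"] d(1) by simp
      qed
      ultimately show False by simp
    next
      assume "AE x in lebesgue. (q - e < x \<and> x < q \<longrightarrow> h x > 0) \<and> (q < x \<and> x < q + e \<longrightarrow> h x < 0)"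
      with \<open>AE x in lebesgue. q - d < x \<and> x < q + d \<longrightarrow> sgn (h x) = \<tau>\<close>
      have ae: "AE x in lebesgue. (q - d < x \<and> x < q \<longrightarrow> \<tau> = 1) \<and> (q < x \<and> x < q + d \<longrightarrow> \<tau> = -1)"
        by eventually_elim (use d in auto)
      have "\<tau> = 1"
      proof (rule ccontr)
        assume "\<tau> \<noteq> 1"
        with ae have "AE x in lebesgue. \<not> (q - d < x \<and> x < q)" by simp
        then show False using AE_lebesgue_False_interval[of "q - d" q] d(1) by simp
      qed
      moreover have "\<tau> = -1"
      proof (rule ccontr)
        assume "\<tau> \<noteq> -1"
        with ae have "AE x in lebesgue. \<not> (q < x \<and> x < q + d)" by simp
        then show False using AE_lebesgue_False_interval[of q "q + d"] d(1) by simp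
      qed
      ultimately show False by simp
    qed
  qed
  ultimately show ?thesis using p by blast
qed

section \<open>Compactness of the step functions\<close>

lemma mass_bound_mono:
  assumes "0 < n" "0 < r1" "0 < r2" "0 \<le> a" "a \<le> b"
  shows "mass_bound n r1 r2 a \<le> mass_bound n r1 r2 b"
proof -
  define \<kappa> where "\<kappa> m = 2 * r2 * m / r1" for m
  define K where "K m = sqrt (2 * r2 * (1 + \<kappa> m))" for m
  have k: "0 \<le> \<kappa> a" "\<kappa> a \<le> \<kappa> b"
    unfolding \<kappa>_def using assms by (auto intro!: divide_right_mono mult_left_mono)
  have K: "0 \<le> K a" "K a \<le> K b"
    unfolding K_def using assms k by auto
  have "(1 + \<kappa> a) * (exp ((K a)\<^sup>2 / (2 * r1)) * (K a powr n / n)) \<le> (1 + \<kappa> b) * (exp ((K b)\<^sup>2 / (2 * r1)) * (K b powr n / n))"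
    using assms k K by (intro mult_mono divide_right_mono powr_mono2) (auto intro!: divide_right_mono power_mono)
  then show ?thesis by (simp add: mass_bound_def Let_def K_def \<kappa>_def)
qed

text \<open>Along a monotone subsequence of the switching points the truth of
  \<open>x \<le> cs k\<close> is eventually constant for every \<open>x\<close>. This includes
  switching points that tend to 0 or to infinity, where the limit is constant on the
  half-line.\<close>

lemma step_fun_subsequence_limit:
  fixes cs :: "nat \<Rightarrow> real"
  obtains \<rho> :: "nat \<Rightarrow> nat" and R where "strict_mono \<rho>" "\<And>x. (\<lambda>k. step_fun r1 r2 (cs (\<rho> k)) x) \<longlonglongrightarrow> R x"
proof -
  obtain \<rho> :: "nat \<Rightarrow> nat" where \<rho>: "strict_mono \<rho>" "monoseq (\<lambda>k. cs (\<rho> k))"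
    using seq_monosub[of cs] by blast
  have "\<exists>l. (\<lambda>k. step_fun r1 r2 (cs (\<rho> k)) x) \<longlonglongrightarrow> l" for x
  proof (cases "eventually (\<lambda>k. x \<le> cs (\<rho> k)) sequentially")
    case True
    then have "eventually (\<lambda>k. step_fun r1 r2 (cs (\<rho> k)) x = r1) sequentially"
      by eventually_elim (simp add: step_fun_def)
    then show ?thesis by (intro exI[of _ r1] tendsto_eventually)
  next
    case False
    have ev: "eventually (\<lambda>k. \<not> x \<le> cs (\<rho> k)) sequentially"
    proof (cases "\<exists>k. x \<le> cs (\<rho> k)")
      case ex: True
      then obtain k0 where k0: "x \<le> cs (\<rho> k0)" by blast
      have "\<not> incseq (\<lambda>k. cs (\<rho> k))"
      proof
        assume "incseq (\<lambda>k. cs (\<rho> k))"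
        then have "x \<le> cs (\<rho> k)" if "k0 \<le> k" for k using k0 incseqD[of "\<lambda>k. cs (\<rho> k)" k0 k] that by simp
        then show False using False unfolding eventually_sequentially by blast
      qed
      then have dec: "decseq (\<lambda>k. cs (\<rho> k))" using \<rho>(2) by (simp add: monoseq_iff)
      obtain k1 where k1: "\<not> x \<le> cs (\<rho> k1)" using False by (auto simp: not_eventually dest: frequently_ex)
      have "\<not> x \<le> cs (\<rho> k)" if "k1 \<le> k" for k using k1 decseqD[OF dec that] by simp
      then show ?thesis unfolding eventually_sequentially by blast
    qed auto
    have "eventually (\<lambda>k. step_fun r1 r2 (cs (\<rho> k)) x = r2) sequentially"
      using ev by eventually_elim (simp add: step_fun_def)
    then show ?thesis by (intro exI[of _ r2] tendsto_eventually)
  qed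
  then obtain R where "\<And>x. (\<lambda>k. step_fun r1 r2 (cs (\<rho> k)) x) \<longlonglongrightarrow> R x" by metis
  with \<rho>(1) show thesis by (rule that)
qed

section \<open>Optimality of step functions\<close>

lemma radial_max_spectrum:
  assumes "radial n r1 r2 R"
  obtains \<mu> where "radial.ground n R \<mu> (mass_bound n r1 r2 (\<mu> + 1))" "0 \<le> \<mu>" "max_spectrum n R = -\<mu>"
proof -
  interpret radial n r1 r2 R by fact
  from ground_exists obtain \<mu> where "ground \<mu> (mass_bound n r1 r2 (\<mu> + 1))" by blast
  with groundD(1)[OF this] max_spectrum_ground[OF this] show thesis by (intro that)
qed

text \<open>The point \<open>p\<close> is the inflection point of the ground state for
  \<open>R\<close>. In the case of equality both ground states coincide, and as the radial Laplacian
  involves no coefficient, its sign may be read off from the equation with \<open>R\<close>, where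
  it changes at \<open>p\<close>.\<close>

lemma max_spectrum_le_step:
  assumes R: "radial n r1 r2 R" and g: "radial.ground n R \<mu> B"
  obtains p where "0 < p" "-\<mu> \<le> max_spectrum n (step_fun r1 r2 p)"
    "\<And>f. max_spectrum n (step_fun r1 r2 p) = -\<mu> \<Longrightarrow>
       is_eigenfunction n (step_fun r1 r2 p) (-\<mu>) f \<Longrightarrow> radial_inflection_points n f = {p}"
proof -
  interpret r: radial n r1 r2 R by fact
  from r.ground_inflection[OF g] obtain p where p: "0 < p"
    and F: "\<And>x. 0 < x \<Longrightarrow> x < p \<Longrightarrow> 0 < r.F \<mu> x" "\<And>x. p < x \<Longrightarrow> r.F \<mu> x < 0" by blast
  have "r1 \<le> r2" using r.R_lower[of 1] r.R_upper[of 1] by simp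
  then have S: "radial n r1 r2 (step_fun r1 r2 p)" by (rule radial_step[OF R])
  interpret s: radial n r1 r2 "step_fun r1 r2 p" by (rule S)
  obtain \<mu>' where g': "s.ground \<mu>' (mass_bound n r1 r2 (\<mu>' + 1))"
    and ms: "max_spectrum n (step_fun r1 r2 p) = -\<mu>'" using radial_max_spectrum[OF S] by blast
  note cmp = ground_comparison[OF R g p F S g']
  have "-\<mu> \<le> max_spectrum n (step_fun r1 r2 p)"
    using cmp ms by (cases "\<mu> \<le> \<mu>'") auto
  moreover have "radial_inflection_points n f = {p}"
    if "max_spectrum n (step_fun r1 r2 p) = -\<mu>" and f: "is_eigenfunction n (step_fun r1 r2 p) (-\<mu>) f" for f
  proof -
    have \<mu>': "\<mu>' = \<mu>" using ms that(1) by simp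
    have ys: "s.y (-\<mu>) x = r.y (-\<mu>) x" if "0 \<le> x" for x using cmp that by (simp add: \<mu>')
    have D: "f \<in> op_domain n (step_fun r1 r2 p)" and nz: "\<not> (AE x in s.mW. f x = 0)"
      and L: "AE x in lebesgue. 0 < x \<longrightarrow> L_op n (step_fun r1 r2 p) f x = (-\<mu>) * f x"
      using f by (auto simp: is_eigenfunction_def s.AE_mW)
    obtain c where c: "\<And>x. 0 < x \<Longrightarrow> f x = c * s.y (-\<mu>) x" using s.eigenfunction_unique[OF D L] by blast
    have c0: "c \<noteq> 0" using nz c by (auto simp: s.AE_mW)
    have "f x = c * r.y (-\<mu>) x" if "0 < x" for x using c[OF that] ys[of x] that by simp
    then have "AE x in lebesgue. 0 < x \<longrightarrow> radial_Laplacian n f x = - c * r.F \<mu> x / R x"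
      by (rule r.radial_Laplacian_multiple_ground[OF g])
    then have lap: "AE x in lebesgue. 0 < x \<longrightarrow> radial_Laplacian n f x = - c * (r.F \<mu> x / R x)"
      by eventually_elim simp
    show ?thesis
      unfolding radial_inflection_points_def
    proof (rule sign_change_unique[OF p _ lap])
      show "0 < r.F \<mu> x / R x" if "0 < x" "x < p" for x using F(1)[OF that] r.R_pos[of x] that by simp
      show "r.F \<mu> x / R x < 0" if "p < x" for x
        using F(2)[OF that] r.R_pos[of x] p that by (simp add: divide_neg_pos)
    qed (use c0 in simp)
  qed
  ultimately show thesis by (intro that[OF p])
qed

lemma minimal_ground_step:
  assumes S: "\<And>c. radial n r1 r2 (step_fun r1 r2 c)"
    and m: "m = (SUP c\<in>{0<..}. max_spectrum n (step_fun r1 r2 c))"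
  obtains R B where "radial n r1 r2 R" "radial.ground n R (-m) B" "\<And>c. 0 < c \<Longrightarrow> max_spectrum n (step_fun r1 r2 c) \<le> m"
proof -
  let ?s = "\<lambda>c. max_spectrum n (step_fun r1 r2 c)"
  interpret a: radial n r1 r2 "step_fun r1 r2 0" by (rule S)
  have r2: "0 < r2" using a.R_lower[of 1] a.R_upper[of 1] a.r1_pos by simp
  have nonpos: "?s c \<le> 0" for c by (rule radial_max_spectrum[OF S, of c]) simp
  have bdd: "bdd_above (?s ` {0<..})" by (rule bdd_aboveI2[OF nonpos])
  have le: "?s c \<le> m" if "0 < c" for c
    unfolding m by (rule cSUP_upper[OF _ bdd]) (use that in simp)
  have m0: "m \<le> 0"
    unfolding m by (rule cSUP_least) (simp_all add: nonpos)
  have "\<exists>c>0. m - inverse (real (Suc k)) < ?s c" for k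
  proof -
    have "m - inverse (real (Suc k)) < m" by simp
    then show ?thesis unfolding m by (subst (asm) less_cSUP_iff[OF _ bdd]) auto
  qed
  then obtain cs where cs: "\<And>k. 0 < cs k" "\<And>k. m - inverse (real (Suc k)) < ?s (cs k)" by metis
  obtain \<rho> :: "nat \<Rightarrow> nat" and R where \<rho>: "strict_mono \<rho>"
    and lim: "\<And>x. (\<lambda>k. step_fun r1 r2 (cs (\<rho> k)) x) \<longlonglongrightarrow> R x"
    using step_fun_subsequence_limit by blast
  have R: "radial n r1 r2 R"
  proof
    have "R \<in> borel_measurable borel"
    proof (rule borel_measurable_LIMSEQ_real[OF lim])
      show "step_fun r1 r2 (cs (\<rho> k)) \<in> borel_measurable borel" for k
        unfolding step_fun_def[abs_def] by measurable
    qed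
    then show "R \<in> borel_measurable (restrict_space borel {0<..})" by (rule measurable_restrict_space1)
    have st: "r1 \<le> step_fun r1 r2 c x" "step_fun r1 r2 c x \<le> r2" for c x
      using a.R_lower[of 1] a.R_upper[of 1] by (auto simp: step_fun_def)
    show "r1 \<le> R x" for x by (rule LIMSEQ_le_const[OF lim]) (use st in auto)
    show "R x \<le> r2" for x by (rule LIMSEQ_le_const2[OF lim]) (use st in auto)
  qed (rule a.n_pos a.n_less a.r1_pos)+
  define \<mu> where "\<mu> k = - ?s (cs (\<rho> k))" for k
  have gr: "radial.ground n (step_fun r1 r2 (cs (\<rho> k))) (\<mu> k) (mass_bound n r1 r2 (\<mu> k + 1))" "0 \<le> \<mu> k" for k
    unfolding \<mu>_def by (rule radial_max_spectrum[OF S, of "cs (\<rho> k)"]; simp)+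
  have \<mu>: "\<bar>\<mu> k - (- m)\<bar> \<le> inverse (real (Suc k))" for k
  proof -
    have "inverse (real (Suc (\<rho> k))) \<le> inverse (real (Suc k))"
      using seq_suble[OF \<rho>, of k] by (simp add: le_imp_inverse_le)
    then show ?thesis
      using le[OF cs(1), of "\<rho> k"] cs(2)[of "\<rho> k"] unfolding \<mu>_def by linarith
  qed
  have \<mu>lim: "\<mu> \<longlonglongrightarrow> - m"
    by (rule Lim_transform_bound[where g = "\<lambda>k. inverse (real (Suc k))", THEN LIM_zero_cancel])
      (use \<mu> LIMSEQ_inverse_real_of_nat in auto)
  \<comment> \<open>All \<open>\<mu> k\<close> are within 1 of \<open>- m\<close>, so the bound at
    \<open>- m + 2\<close> dominates those at \<open>\<mu> k + 1\<close>. The observation points are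
    simply \<open>real k\<close>, as each solution is positive on the whole half-line.\<close>
  have "radial.ground n R (- m) (mass_bound n r1 r2 (- m + 2))"
  proof (rule ground_limit[OF S R lim \<mu>lim gr(2) filterlim_real_sequentially])
    fix k and t :: real assume "0 \<le> t"
    then show "0 \<le> radial.y n (step_fun r1 r2 (cs (\<rho> k))) (- \<mu> k) t"
      using radial.groundD(2)[OF S gr(1), of t] by (simp add: less_imp_le)
  next
    fix k and X :: real assume "0 \<le> X"
    have "inverse (real (Suc k)) \<le> 1" by (simp add: inverse_eq_divide)
    then have "mass_bound n r1 r2 (\<mu> k + 1) \<le> mass_bound n r1 r2 (- m + 2)"
      using \<mu>[of k] gr(2)[of k] r2 by (intro mass_bound_mono a.n_pos a.r1_pos) auto
    with radial.groundD(3)[OF S gr(1) \<open>0 \<le> X\<close>, of k]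
    show "integral {0..X} (\<lambda>t. radial.P n (step_fun r1 r2 (cs (\<rho> k))) t
      * (radial.y n (step_fun r1 r2 (cs (\<rho> k))) (- \<mu> k) t)\<^sup>2) \<le> mass_bound n r1 r2 (- m + 2)" by simp
  qed
  with R le show thesis by (intro that)
qed

theorem lemma4p1:
  fixes n r\<^sub>1 r\<^sub>2 :: real
  assumes "0 < n" and "n < 2" and "0 < r\<^sub>1" and "r\<^sub>1 < r\<^sub>2"
  shows "(\<forall>R :: real \<Rightarrow> real.
            R \<in> borel_measurable (restrict_space borel {0<..}) \<and> (\<forall>x>0. r\<^sub>1 \<le> R x \<and> R x \<le> r\<^sub>2) \<longrightarrow>
            max_spectrum n R \<le> (SUP c\<in>{0<..}. max_spectrum n (step_fun r\<^sub>1 r\<^sub>2 c))) \<and>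
         (\<exists>c>0. max_spectrum n (step_fun r\<^sub>1 r\<^sub>2 c) =
                  (SUP c'\<in>{0<..}. max_spectrum n (step_fun r\<^sub>1 r\<^sub>2 c')) \<and>
                (\<exists>\<phi>. is_eigenfunction n (step_fun r\<^sub>1 r\<^sub>2 c) (max_spectrum n (step_fun r\<^sub>1 r\<^sub>2 c)) \<phi>) \<and>
                (\<forall>\<phi>. is_eigenfunction n (step_fun r\<^sub>1 r\<^sub>2 c) (max_spectrum n (step_fun r\<^sub>1 r\<^sub>2 c)) \<phi> \<longrightarrow>
                     radial_inflection_points n \<phi> = {c}))"
proof -
  have "radial n r\<^sub>1 r\<^sub>2 (\<lambda>x. r\<^sub>1)" using assms by unfold_locales auto
  then have S: "radial n r\<^sub>1 r\<^sub>2 (step_fun r\<^sub>1 r\<^sub>2 c)" for c using assms(4) by (intro radial_step) auto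
  define m where "m = (SUP c\<in>{0<..}. max_spectrum n (step_fun r\<^sub>1 r\<^sub>2 c))"
  obtain R\<^sub>0 B where R0: "radial n r\<^sub>1 r\<^sub>2 R\<^sub>0" "radial.ground n R\<^sub>0 (-m) B"
    and le: "\<And>c. 0 < c \<Longrightarrow> max_spectrum n (step_fun r\<^sub>1 r\<^sub>2 c) \<le> m"
    using minimal_ground_step[OF S m_def] by blast
  \<comment> \<open>The comparison is applied to the limit coefficient, whose top eigenvalue is
    \<open>m\<close>: it yields a step with at least this value. Optimality of \<open>m\<close>
    gives equality, and only then does the statement about inflection points become
    available.\<close>
  obtain c where c: "0 < c" "- (- m) \<le> max_spectrum n (step_fun r\<^sub>1 r\<^sub>2 c)"
    and infl: "\<And>f. max_spectrum n (step_fun r\<^sub>1 r\<^sub>2 c) = - (- m) \<Longrightarrow>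
      is_eigenfunction n (step_fun r\<^sub>1 r\<^sub>2 c) (- (- m)) f \<Longrightarrow> radial_inflection_points n f = {c}"
    using max_spectrum_le_step[OF R0] by blast
  have cm: "max_spectrum n (step_fun r\<^sub>1 r\<^sub>2 c) = m" using c(2) le[OF c(1)] by simp
  have "max_spectrum n R \<le> m"
    if "R \<in> borel_measurable (restrict_space borel {0<..})" "\<forall>x>0. r\<^sub>1 \<le> R x \<and> R x \<le> r\<^sub>2" for R
  proof -
    have R: "radial n r\<^sub>1 r\<^sub>2 R" using assms that by unfold_locales auto
    obtain \<mu> where \<mu>: "radial.ground n R \<mu> (mass_bound n r\<^sub>1 r\<^sub>2 (\<mu> + 1))" "max_spectrum n R = -\<mu>"
      using radial_max_spectrum[OF R] by blast
    show ?thesis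
    proof (rule max_spectrum_le_step[OF R \<mu>(1)])
      fix p assume "0 < p" "-\<mu> \<le> max_spectrum n (step_fun r\<^sub>1 r\<^sub>2 p)"
      with le[of p] \<mu>(2) show ?thesis by simp
    qed
  qed
  moreover have "\<exists>\<phi>. is_eigenfunction n (step_fun r\<^sub>1 r\<^sub>2 c) m \<phi>"
  proof -
    obtain \<mu> where \<mu>: "radial.ground n (step_fun r\<^sub>1 r\<^sub>2 c) \<mu> (mass_bound n r\<^sub>1 r\<^sub>2 (\<mu> + 1))"
      "max_spectrum n (step_fun r\<^sub>1 r\<^sub>2 c) = -\<mu>" using radial_max_spectrum[OF S] by blast
    show ?thesis using radial.ground_is_eigenfunction[OF S \<mu>(1)] \<mu>(2) cm by auto
  qed
  ultimately show ?thesis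
    unfolding m_def[symmetric] using c(1) cm infl by (intro conjI exI[of _ c]) auto
qed

end
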